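(* In the setting described in the context, let Assumption A1 hold. Then there exists $\delta>0$, independent of $\boldsymbol y$, such that $$\lambda_2(\boldsymbol y)-\lambda_1(\boldsymbol y)\;\ge\;\delta\qquad\text{for all }\boldsymbol y\in U.$$
   Context: Setting. Let $d\in\{1,2,3\}$, let $D\subset\mathbb R^d$ be a bounded convex domain with Lipschitz boundary, $V=H^1_0(D)$ (real-valued) with norm $\|v\|_V=\|\nabla v\|_{L^2(D)}$, and $U=[-\tfrac12,\tfrac12]^{\mathbb N}$. For $\boldsymbol x\in D$, $\boldsymbol y=(y_j)_{j\ge1}\in U$ let $a(\boldsymbol x,\boldsymbol y)=a_0(\boldsymbol x)+\sum_{j\ge1}y_ja_j(\boldsymbol x)$, $b(\boldsymbol x,\boldsymbol y)=b_0(\boldsymbol x)+\sum_{j\ge1}y_jb_j(\boldsymbol x)$, and let $c=c(\boldsymbol x)$. Assumption A1: (1) $a_j,b_j\in L^\infty(D)$ for all $j\ge0$ and $c\in L^\infty(D)$. (2) There is $a_{\min}>0$ with $a(\boldsymbol x,\boldsymbol y)\ge a_{\min}$, $b(\boldsymbol x,\boldsymbol y)\ge0$, $c(\boldsymbol x)\ge a_{\min}$ for all $\boldsymbol x\in D,\boldsymbol y\in U$. (3) For some $p\in(0,1)$, $\sum_{j\ge1}\|a_j\|_{L^\infty(D)}^p<\infty$ and $\sum_{j\ge1}\|b_j\|_{L^\infty(D)}^p<\infty$. (4) $a_j\in W^{1,\infty}(D)$ for $j\ge0$ and $\sum_{j\ge1}\|a_j\|_{W^{1,\infty}(D)}<\infty$,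 where $\|v\|_{W^{1,\infty}(D)}=\max\{\|v\|_{L^\infty(D)},\|\nabla v\|_{L^\infty(D)}\}$. Let $\mathcal A(\boldsymbol y;w,v)=\int_D a(\boldsymbol x,\boldsymbol y)\nabla w\cdot\nabla v\,d\boldsymbol x+\int_D b(\boldsymbol x,\boldsymbol y)wv\,d\boldsymbol x$ and $\mathcal M(w,v)=\int_D c\,wv\,d\boldsymbol x$ for $w,v\in V$. For each $\boldsymbol y\in U$ the eigenvalue problem is: find $\lambda(\boldsymbol y)\in\mathbb R$, $0\ne u(\boldsymbol y)\in V$ with $\mathcal A(\boldsymbol y;u(\boldsymbol y),v)=\lambda(\boldsymbol y)\mathcal M(u(\boldsymbol y),v)$ for all $v\in V$. Its eigenvalues, counted with multiplicity, are $0<\lambda_1(\boldsymbol y)\le\lambda_2(\boldsymbol y)\le\lambda_3(\boldsymbol y)\le\cdots$. *)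

theory Defs
  imports "HOL-Analysis.Analysis" "HOL-Probability.Essential_Supremum"
begin

section \<open>Domains\<close>

text \<open>Near each boundary point \<open>x\<close>, the set \<open>D\<close> is the region strictly above the graph of a
  Lipschitz function over a hyperplane. The unit vector \<open>e\<close> is the local vertical direction, and
  the projection of \<open>z\<close> to the hyperplane orthogonal to \<open>e\<close> is \<open>z - (z \<bullet> e) *\<^sub>R e\<close>.\<close>

definition lipschitz_boundary :: "'a::euclidean_space set \<Rightarrow> bool" where
  "lipschitz_boundary D \<longleftrightarrow>
    (\<forall>x\<in>frontier D. \<exists>r>0. \<exists>e L. \<exists>h :: 'a \<Rightarrow> real.
       norm e = 1 \<and> L-lipschitz_on {z. z \<bullet> e = 0} h \<and>
       D \<inter> ball x r = {z \<in> ball x r. z \<bullet> e > h (z - (z \<bullet> e) *\<^sub>R e)})"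


section \<open>Lebesgue spaces\<close>

text \<open>Elements of function spaces are represented by functions on the whole space, of which only
  the values on \<open>D\<close> up to Lebesgue null sets matter.\<close>

definition L2 :: "'a::euclidean_space set \<Rightarrow> ('a \<Rightarrow> 'b::euclidean_space) set" where
  "L2 D = {f. f \<in> borel_measurable (lebesgue_on D) \<and>
              integrable (lebesgue_on D) (\<lambda>x. (norm (f x))\<^sup>2)}"

definition Linf :: "'a::euclidean_space set \<Rightarrow> ('a \<Rightarrow> 'b::euclidean_space) set" where
  "Linf D = {f. f \<in> borel_measurable (lebesgue_on D) \<and>
                esssup (lebesgue_on D) (\<lambda>x. ereal (norm (f x))) < \<infinity>}"

definition Linf_norm :: "'a::euclidean_space set \<Rightarrow> ('a \<Rightarrow> 'b::euclidean_space) \<Rightarrow> real" where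
  "Linf_norm D f = real_of_ereal (esssup (lebesgue_on D) (\<lambda>x. ereal (norm (f x))))"


section \<open>Sobolev spaces\<close>

definition grad :: "(real ^ 'd \<Rightarrow> real) \<Rightarrow> real ^ 'd \<Rightarrow> real ^ 'd" where
  "grad f x = (\<chi> i. frechet_derivative f (at x) (axis i 1))"

primrec Ck :: "nat \<Rightarrow> (real ^ 'd \<Rightarrow> real) \<Rightarrow> bool" where
  "Ck 0 f \<longleftrightarrow> continuous_on UNIV f"
| "Ck (Suc k) f \<longleftrightarrow> (\<forall>x. f differentiable at x) \<and> (\<forall>i. Ck k (\<lambda>x. grad f x $ i))"

definition test_functions :: "(real ^ 'd) set \<Rightarrow> (real ^ 'd \<Rightarrow> real) set" where
  "test_functions D = {f. (\<forall>k. Ck k f) \<and>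
     compact (closure {x. f x \<noteq> 0}) \<and> closure {x. f x \<noteq> 0} \<subseteq> D}"

definition has_weak_gradient ::
    "(real ^ 'd) set \<Rightarrow> (real ^ 'd \<Rightarrow> real) \<Rightarrow> (real ^ 'd \<Rightarrow> real ^ 'd) \<Rightarrow> bool" where
  "has_weak_gradient D u g \<longleftrightarrow>
     (\<forall>K. compact K \<and> K \<subseteq> D \<longrightarrow> u absolutely_integrable_on K \<and> g absolutely_integrable_on K) \<and>
     (\<forall>f\<in>test_functions D. \<forall>i.
        (LINT x|lebesgue_on D. u x * grad f x $ i) = - (LINT x|lebesgue_on D. g x $ i * f x))"

text \<open>The weak gradient is unique only up to null sets, so \<open>wgrad\<close> chooses a representative.\<close>

definition wgrad :: "(real ^ 'd) set \<Rightarrow> (real ^ 'd \<Rightarrow> real) \<Rightarrow> real ^ 'd \<Rightarrow> real ^ 'd" where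
  "wgrad D u = (SOME g. has_weak_gradient D u g)"

definition W1inf :: "(real ^ 'd) set \<Rightarrow> (real ^ 'd \<Rightarrow> real) set" where
  "W1inf D = {v \<in> Linf D. (\<exists>g. has_weak_gradient D v g) \<and> wgrad D v \<in> Linf D}"

definition W1inf_norm :: "(real ^ 'd) set \<Rightarrow> (real ^ 'd \<Rightarrow> real) \<Rightarrow> real" where
  "W1inf_norm D v = max (Linf_norm D v) (Linf_norm D (wgrad D v))"

definition H1 :: "(real ^ 'd) set \<Rightarrow> (real ^ 'd \<Rightarrow> real) set" where
  "H1 D = {v \<in> L2 D. (\<exists>g. has_weak_gradient D v g) \<and> wgrad D v \<in> L2 D}"

definition H1_norm :: "(real ^ 'd) set \<Rightarrow> (real ^ 'd \<Rightarrow> real) \<Rightarrow> real" where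
  "H1_norm D v = sqrt ((LINT x|lebesgue_on D. (v x)\<^sup>2) +
                       (LINT x|lebesgue_on D. (norm (wgrad D v x))\<^sup>2))"

definition H10 :: "(real ^ 'd) set \<Rightarrow> (real ^ 'd \<Rightarrow> real) set" where
  "H10 D = {v \<in> H1 D. \<exists>f. (\<forall>n::nat. f n \<in> test_functions D) \<and>
              (\<lambda>n. H1_norm D (\<lambda>x. v x - f n x)) \<longlonglongrightarrow> 0}"


section \<open>Parametric coefficients\<close>

text \<open>Parameter sequences are indexed from 1.\<close>

definition params :: "(nat \<Rightarrow> real) set" where
  "params = (\<Pi>\<^sub>E j\<in>{1..}. {-1/2..1/2})"

definition affine_coeff ::
    "(nat \<Rightarrow> 'a \<Rightarrow> real) \<Rightarrow> (nat \<Rightarrow> real) \<Rightarrow> 'a \<Rightarrow> real" where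
  "affine_coeff a y x = a 0 x + (\<Sum>j. y (Suc j) * a (Suc j) x)"


section \<open>The eigenvalue problem\<close>

text \<open>Here \<open>\<alpha>\<close>, \<open>\<beta>\<close>, \<open>\<gamma>\<close> are the diffusion, reaction and weight coefficients
  at a fixed parameter value.\<close>

definition A_form :: "(real ^ 'd) set \<Rightarrow> (real ^ 'd \<Rightarrow> real) \<Rightarrow> (real ^ 'd \<Rightarrow> real) \<Rightarrow>
    (real ^ 'd \<Rightarrow> real) \<Rightarrow> (real ^ 'd \<Rightarrow> real) \<Rightarrow> real" where
  "A_form D \<alpha> \<beta> w v = (LINT x|lebesgue_on D. \<alpha> x * (wgrad D w x \<bullet> wgrad D v x)) +
                       (LINT x|lebesgue_on D. \<beta> x * w x * v x)"

definition M_form :: "(real ^ 'd) set \<Rightarrow> (real ^ 'd \<Rightarrow> real) \<Rightarrow>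
    (real ^ 'd \<Rightarrow> real) \<Rightarrow> (real ^ 'd \<Rightarrow> real) \<Rightarrow> real" where
  "M_form D \<gamma> w v = (LINT x|lebesgue_on D. \<gamma> x * w x * v x)"

definition eigenspace :: "(real ^ 'd) set \<Rightarrow> (real ^ 'd \<Rightarrow> real) \<Rightarrow> (real ^ 'd \<Rightarrow> real) \<Rightarrow>
    (real ^ 'd \<Rightarrow> real) \<Rightarrow> real \<Rightarrow> (real ^ 'd \<Rightarrow> real) set" where
  "eigenspace D \<alpha> \<beta> \<gamma> \<mu> =
     {u \<in> H10 D. \<forall>v\<in>H10 D. A_form D \<alpha> \<beta> u v = \<mu> * M_form D \<gamma> u v}"

definition is_eigenvalue :: "(real ^ 'd) set \<Rightarrow> (real ^ 'd \<Rightarrow> real) \<Rightarrow> (real ^ 'd \<Rightarrow> real) \<Rightarrow>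
    (real ^ 'd \<Rightarrow> real) \<Rightarrow> real \<Rightarrow> bool" where
  "is_eigenvalue D \<alpha> \<beta> \<gamma> \<mu> \<longleftrightarrow>
     (\<exists>u\<in>eigenspace D \<alpha> \<beta> \<gamma> \<mu>. \<not> (AE x in lebesgue_on D. u x = 0))"

definition ae_independent :: "'a::euclidean_space set \<Rightarrow> nat \<Rightarrow> (nat \<Rightarrow> 'a \<Rightarrow> real) \<Rightarrow> bool" where
  "ae_independent D n u \<longleftrightarrow>
     (\<forall>s. (AE x in lebesgue_on D. (\<Sum>i<n. s i * u i x) = 0) \<longrightarrow> (\<forall>i<n. s i = (0::real)))"

text \<open>The dimension of the eigenspace as a space of functions modulo equality almost everywhere.
  It is the supremum of the sizes of the linearly independent families.\<close>

definition multiplicity_of :: "(real ^ 'd) set \<Rightarrow> (real ^ 'd \<Rightarrow> real) \<Rightarrow> (real ^ 'd \<Rightarrow> real) \<Rightarrow>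
    (real ^ 'd \<Rightarrow> real) \<Rightarrow> real \<Rightarrow> enat" where
  "multiplicity_of D \<alpha> \<beta> \<gamma> \<mu> =
     Sup {enat n |n. \<exists>u. (\<forall>i<n. u i \<in> eigenspace D \<alpha> \<beta> \<gamma> \<mu>) \<and> ae_independent D n u}"

text \<open>The \<open>k\<close>-th entry, \<open>k \<ge> 1\<close>, of the nondecreasing list of the eigenvalues in which each one is
  repeated according to its multiplicity. It is the least \<open>t\<close> such that at least \<open>k\<close> eigenvalues,
  counted with multiplicity, lie in \<open>{..t}\<close>.\<close>

definition eigval :: "(real ^ 'd) set \<Rightarrow> (real ^ 'd \<Rightarrow> real) \<Rightarrow> (real ^ 'd \<Rightarrow> real) \<Rightarrow>
    (real ^ 'd \<Rightarrow> real) \<Rightarrow> nat \<Rightarrow> real" where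
  "eigval D \<alpha> \<beta> \<gamma> k =
     (LEAST t. \<exists>S. finite S \<and> (\<forall>\<mu>\<in>S. is_eigenvalue D \<alpha> \<beta> \<gamma> \<mu> \<and> \<mu> \<le> t) \<and>
        enat k \<le> (\<Sum>\<mu>\<in>S. multiplicity_of D \<alpha> \<beta> \<gamma> \<mu>))"

text \<open>If \<open>l 1 \<le> l 2 \<le> \<dots>\<close> enumerates the eigenvalues, each as often as its multiplicity,
  then \<open>eigval\<close> returns its entries.\<close>

lemma eigval_eq_enumeration:
  fixes l :: "nat \<Rightarrow> real"
  assumes mono: "\<And>i j. 1 \<le> i \<Longrightarrow> i \<le> j \<Longrightarrow> l i \<le> l j"
    and fin: "\<And>\<mu>. finite {j. 1 \<le> j \<and> l j = \<mu>}"
    and eig: "\<And>\<mu>. is_eigenvalue D \<alpha> \<beta> \<gamma> \<mu> \<longleftrightarrow> (\<exists>j\<ge>1. l j = \<mu>)"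
    and mult: "\<And>\<mu>. is_eigenvalue D \<alpha> \<beta> \<gamma> \<mu> \<Longrightarrow>
                 multiplicity_of D \<alpha> \<beta> \<gamma> \<mu> = enat (card {j. 1 \<le> j \<and> l j = \<mu>})"
    and k: "1 \<le> k"
  shows "eigval D \<alpha> \<beta> \<gamma> k = l k"
proof -
  have count: "(\<Sum>\<mu>\<in>S. multiplicity_of D \<alpha> \<beta> \<gamma> \<mu>) = enat (card {j. 1 \<le> j \<and> l j \<in> S})"
    and count_fin: "finite {j. 1 \<le> j \<and> l j \<in> S}"
    if S: "finite S" "\<forall>\<mu>\<in>S. is_eigenvalue D \<alpha> \<beta> \<gamma> \<mu>" for S
  proof -
    have U: "{j. 1 \<le> j \<and> l j \<in> S} = (\<Union>\<mu>\<in>S. {j. 1 \<le> j \<and> l j = \<mu>})" by auto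
    show "finite {j. 1 \<le> j \<and> l j \<in> S}" unfolding U using S(1) fin by blast
    have "card {j. 1 \<le> j \<and> l j \<in> S} = (\<Sum>\<mu>\<in>S. card {j. 1 \<le> j \<and> l j = \<mu>})"
      unfolding U by (rule card_UN_disjoint) (use S(1) fin in auto)
    moreover have "(\<Sum>\<mu>\<in>S. enat (card {j. 1 \<le> j \<and> l j = \<mu>})) =
        enat (\<Sum>\<mu>\<in>S. card {j. 1 \<le> j \<and> l j = \<mu>})"
      using S(1) by (induction S rule: finite_induct) (auto simp: zero_enat_def)
    ultimately show "(\<Sum>\<mu>\<in>S. multiplicity_of D \<alpha> \<beta> \<gamma> \<mu>) = enat (card {j. 1 \<le> j \<and> l j \<in> S})"
      using S(2) mult by simp
  qed
  show ?thesis unfolding eigval_def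
  proof (rule Least_equality)
    let ?S = "l ` {1..k}"
    have ev: "\<forall>\<mu>\<in>?S. is_eigenvalue D \<alpha> \<beta> \<gamma> \<mu>" unfolding eig by auto
    have "card {1..k} \<le> card {j. 1 \<le> j \<and> l j \<in> ?S}"
      by (rule card_mono) (use count_fin[of ?S] ev in auto)
    then have "enat k \<le> (\<Sum>\<mu>\<in>?S. multiplicity_of D \<alpha> \<beta> \<gamma> \<mu>)"
      using count[of ?S] ev by simp
    moreover have "\<forall>\<mu>\<in>?S. \<mu> \<le> l k" using mono by auto
    ultimately show "\<exists>S. finite S \<and> (\<forall>\<mu>\<in>S. is_eigenvalue D \<alpha> \<beta> \<gamma> \<mu> \<and> \<mu> \<le> l k) \<and>
        enat k \<le> (\<Sum>\<mu>\<in>S. multiplicity_of D \<alpha> \<beta> \<gamma> \<mu>)"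
      using ev by (intro exI[of _ ?S]) auto
  next
    fix t
    assume "\<exists>S. finite S \<and> (\<forall>\<mu>\<in>S. is_eigenvalue D \<alpha> \<beta> \<gamma> \<mu> \<and> \<mu> \<le> t) \<and>
        enat k \<le> (\<Sum>\<mu>\<in>S. multiplicity_of D \<alpha> \<beta> \<gamma> \<mu>)"
    then obtain S where S: "finite S" "\<forall>\<mu>\<in>S. is_eigenvalue D \<alpha> \<beta> \<gamma> \<mu> \<and> \<mu> \<le> t"
      "enat k \<le> (\<Sum>\<mu>\<in>S. multiplicity_of D \<alpha> \<beta> \<gamma> \<mu>)" by blast
    have "\<exists>j\<ge>k. l j \<in> S"
    proof (rule ccontr)
      assume "\<not> (\<exists>j\<ge>k. l j \<in> S)"
      then have "{j. 1 \<le> j \<and> l j \<in> S} \<subseteq> {1..<k}" by (auto simp: not_le[symmetric])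
      then have "card {j. 1 \<le> j \<and> l j \<in> S} \<le> card {1..<k}" by (intro card_mono) auto
      moreover have "k \<le> card {j. 1 \<le> j \<and> l j \<in> S}" using S count[of S] by simp
      ultimately show False using k by simp
    qed
    then obtain j where "k \<le> j" "l j \<in> S" by blast
    then show "l k \<le> t" using S(2) mono[OF k] by fastforce
  qed
qed

end

theory Submission
  imports Defs "HOL-Real_Asymp.Real_Asymp" "HOL-Complex_Analysis.Great_Picard"
begin

text \<open>If there were no uniform gap, some parameters \<open>y\<^sub>n\<close> would have gaps tending to \<open>0\<close>. The parameter
  set is sequentially compact and the coefficients depend on it continuously in \<open>L\<^sup>\<infinity>\<close>, so we may assume
  \<open>y\<^sub>n \<rightarrow> z\<close>. The two lowest orthonormal eigenfunctions for \<open>y\<^sub>n\<close> are then minimizing sequences of the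
  Rayleigh quotient for \<open>z\<close>. By Rellich's theorem and the parallelogram identity they converge in
  \<open>H\<^sup>1\<^sub>0\<close> to two orthonormal first eigenfunctions for \<open>z\<close>, which contradicts the simplicity of the first
  eigenvalue. For simplicity, \<open>\<bar>u\<bar>\<close> is a first eigenfunction whenever \<open>u\<close> is, hence so is the
  positive part of \<open>u\<close>; and a nonnegative eigenfunction that vanishes on a set of positive measure
  is zero, because testing the equation with \<open>\<phi>\<^sup>2 / (v + \<epsilon>)\<close> bounds the gradient of
  \<open>log (v + \<epsilon>)\<close> uniformly in \<open>\<epsilon>\<close>, while a Poincare inequality would make its \<open>L\<^sup>2\<close> norm
  bounded as well.

  To avoid mollification, \<open>H\<^sup>1\<^sub>0\<close> is handled as the \<open>L\<^sup>2\<close> closure of the pairs \<open>(f, \<nabla>f)\<close> with \<open>f\<close> a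
  test function. Poincare's inequality is only needed for continuously differentiable functions on
  compact convex sets; applied to the cells of a fine partition of a box it also yields Rellich's
  theorem.\<close>

section \<open>Smooth functions\<close>

text \<open>Two obstacles shape the details. The weak gradient \<open>wgrad\<close> is a choice of
  representative, so identities for it hold only almost everywhere. A pair in \<open>jets0 D\<close>
  carries its gradient as second component instead, so that sums, limits and chain rules are
  formulas for pairs, and only the translation to \<open>eigenspace\<close> passes through the
  choice. Further, chain rules are obtained by approximation with test functions, which may be
  negative even if the limit is not. Hence 1 / (v + \<epsilon>) is realized as (sqrt (v^2 +
  \<epsilon>^2) - v) / \<epsilon>^2 and the logarithm as arsinh (v / \<epsilon>): both are smooth
  with bounded derivative on the whole line. Convexity of \<open>D\<close> enters where the zeros of
  v are compared with the points where v is at least some \<delta> > 0: the convex hull of a compact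
  set of each kind stays inside \<open>D\<close>, so a single Poincare inequality links them. The
  numbers \<open>eigval\<close> 1 and 2, defined by counting multiplicities, are reached as minima
  of the Rayleigh quotient over all pairs and over the pairs orthogonal to the first
  minimizer.\<close>

lemma has_derivative_grad:
  assumes "f differentiable at x"
  shows "(f has_derivative (\<lambda>h. grad f x \<bullet> h)) (at x)"
proof -
  have d: "(f has_derivative frechet_derivative f (at x)) (at x)"
    using assms frechet_derivative_works by blast
  have lin: "linear (frechet_derivative f (at x))"
    using d has_derivative_linear by blast
  have "frechet_derivative f (at x) h = grad f x \<bullet> h" for h
  proof -
    have "frechet_derivative f (at x) h = frechet_derivative f (at x) (\<Sum>i\<in>UNIV. (h $ i) *s axis i 1)"
      by (simp add: basis_expansion)
    also have "\<dots> = (\<Sum>i\<in>UNIV. h $ i * frechet_derivative f (at x) (axis i 1))"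
      using lin by (simp add: linear_sum scalar_mult_eq_scaleR linear_cmul)
    also have "\<dots> = grad f x \<bullet> h"
      by (simp add: grad_def inner_vec_def mult.commute)
    finally show ?thesis .
  qed
  then have "frechet_derivative f (at x) = (\<lambda>h. grad f x \<bullet> h)" by blast
  then show ?thesis using d by simp
qed

lemma grad_eqI:
  assumes "(f has_derivative (\<lambda>h. g \<bullet> h)) (at x)"
  shows "grad f x = g"
proof -
  have "frechet_derivative f (at x) h = g \<bullet> h" for h
    using frechet_derivative_at[OF assms] by metis
  then show ?thesis by (simp add: grad_def vec_eq_iff inner_axis)
qed

lemma grad_chain:
  assumes "f differentiable at x" "(h has_real_derivative h') (at (f x))"
  shows "(\<lambda>x. h (f x)) differentiable at x" "grad (\<lambda>x. h (f x)) x = h' *\<^sub>R grad f x"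
proof -
  have "((\<lambda>x. h (f x)) has_derivative (\<lambda>v. (h' *\<^sub>R grad f x) \<bullet> v)) (at x)"
    using has_derivative_compose[OF has_derivative_grad[OF assms(1)] assms(2)[unfolded has_field_derivative_def]]
    by simp
  then show "(\<lambda>x. h (f x)) differentiable at x" "grad (\<lambda>x. h (f x)) x = h' *\<^sub>R grad f x"
    using differentiableI grad_eqI by blast+
qed

lemma grad_add:
  assumes "f differentiable at x" "g differentiable at x"
  shows "grad (\<lambda>x. f x + g x) x = grad f x + grad g x"
  by (intro grad_eqI has_derivative_eq_rhs[OF has_derivative_add[OF assms[THEN has_derivative_grad]]])
     (simp add: inner_add_left)

lemma grad_mult:
  assumes "f differentiable at x" "g differentiable at x"
  shows "grad (\<lambda>x. f x * g x) x = f x *\<^sub>R grad g x + g x *\<^sub>R grad f x"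
  by (intro grad_eqI has_derivative_eq_rhs[OF has_derivative_mult[OF assms[THEN has_derivative_grad]]])
     (simp add: inner_add_left mult.commute)

lemma grad_const [simp]: "grad (\<lambda>x. c) x = 0"
  by (rule grad_eqI) simp

lemma Ck_Suc_D: "Ck (Suc k) f \<Longrightarrow> Ck k f"
proof (induction k arbitrary: f)
  case 0
  then show ?case by (auto intro!: differentiable_imp_continuous_on simp: differentiable_on_def)
next
  case (Suc k)
  then show ?case by (metis Ck.simps(2))
qed

lemma Ck_const: "Ck k (\<lambda>x. c)"
  by (induction k arbitrary: c) auto

lemma Ck_add: "Ck k f \<Longrightarrow> Ck k g \<Longrightarrow> Ck k (\<lambda>x. f x + g x)"
  by (induction k arbitrary: f g) (auto intro: continuous_on_add simp: grad_add)

lemma Ck_mult: "Ck k f \<Longrightarrow> Ck k g \<Longrightarrow> Ck k (\<lambda>x. f x * g x)"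
proof (induction k arbitrary: f g)
  case 0
  then show ?case by (auto intro: continuous_on_mult)
next
  case (Suc k)
  have "Ck k f" "Ck k g" using Suc.prems by (auto dest!: Ck_Suc_D simp del: Ck.simps)
  then show ?case using Suc by (auto simp: grad_mult intro!: Ck_add Suc.IH)
qed

text \<open>One differentiation at a time: only \<open>h'\<close> composed with \<open>f\<close> is
  asked to be regular, so families that are closed under differentiation, such as real powers and
  \<open>flat\<close>, become smooth by induction on the order.\<close>

lemma Ck_chain:
  assumes "Ck (Suc k) f" "Ck k (\<lambda>x. h' (f x))"
    and "\<And>x. (h has_real_derivative h' (f x)) (at (f x))"
  shows "Ck (Suc k) (\<lambda>x. h (f x))"
proof -
  have d: "f differentiable at x" for x using assms(1) by simp
  have "grad (\<lambda>x. h (f x)) x $ i = h' (f x) * grad f x $ i" for x i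
    using grad_chain(2)[OF d assms(3)] by simp
  then show ?thesis using assms(1,2) grad_chain(1)[OF d assms(3)] by (auto intro!: Ck_mult)
qed

lemma Ck_component: "Ck k (\<lambda>x. x $ i)"
proof (cases k)
  case (Suc n)
  have *: "((\<lambda>x. x $ i) has_derivative (\<lambda>h. axis i 1 \<bullet> h)) (at x)" for x :: "real^'a"
  proof -
    have "(\<lambda>h. axis i 1 \<bullet> h) = (\<lambda>h::real^'a. h $ i)" by (simp add: inner_axis' fun_eq_iff)
    then show ?thesis using bounded_linear_imp_has_derivative[OF bounded_linear_vec_nth[of i]] by metis
  qed
  then have "grad (\<lambda>x. x $ i) = (\<lambda>x. axis i 1)" using grad_eqI by blast
  moreover have "(\<lambda>x. x $ i) differentiable at x" for x :: "real^'a" using * differentiableI by blast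
  ultimately show ?thesis by (simp add: Suc Ck_const)
qed (auto intro: continuous_intros)

definition smooth :: "(real ^ 'd \<Rightarrow> real) \<Rightarrow> bool" where
  "smooth f \<longleftrightarrow> (\<forall>k. Ck k f)"

lemma smooth_const: "smooth (\<lambda>x. c)"
  and smooth_add: "smooth f \<Longrightarrow> smooth g \<Longrightarrow> smooth (\<lambda>x. f x + g x)"
  and smooth_mult: "smooth f \<Longrightarrow> smooth g \<Longrightarrow> smooth (\<lambda>x. f x * g x)"
  and smooth_component: "smooth (\<lambda>x. x $ i)"
  by (auto simp: smooth_def Ck_const Ck_add Ck_mult Ck_component)

lemma smooth_cmult: "smooth f \<Longrightarrow> smooth (\<lambda>x. c * f x)"
  by (intro smooth_mult smooth_const)

lemma smooth_diff: "smooth f \<Longrightarrow> smooth g \<Longrightarrow> smooth (\<lambda>x. f x - g x)"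
  using smooth_add[of f "\<lambda>x. (-1) * g x"] smooth_cmult[of g "-1"] by simp

lemma smooth_prod:
  assumes "finite S" "\<And>i. i \<in> S \<Longrightarrow> smooth (f i)"
  shows "smooth (\<lambda>x. \<Prod>i\<in>S. f i x)"
  using assms by (induction S rule: finite_induct) (auto intro: smooth_const smooth_mult)

text \<open>The exponent varies in the induction because a derivative lowers it by one. Real powers
  serve at once for reciprocals (exponent -1) and for square roots (exponent 1/2).\<close>

lemma smooth_powr:
  assumes f: "smooth f" and pos: "\<And>x. f x > 0"
  shows "smooth (\<lambda>x. f x powr s)"
proof -
  have "Ck k (\<lambda>x. f x powr s)" for k
  proof (induction k arbitrary: s)
    case 0
    have "Ck 0 f" using f by (simp only: smooth_def)
    then show ?case using pos by (auto intro!: continuous_intros) (metis less_irrefl)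
  next
    case (Suc k)
    show ?case
    proof (rule Ck_chain[of k f "\<lambda>t. s * t powr (s - 1)"])
      show "Ck (Suc k) f" using f by (simp only: smooth_def)
      show "Ck k (\<lambda>x. s * f x powr (s - 1))" by (intro Ck_mult Ck_const Suc)
      show "((\<lambda>t. t powr s) has_real_derivative s * f x powr (s - 1)) (at (f x))" for x
        by (rule has_real_derivative_powr) (rule pos)
    qed
  qed
  then show ?thesis by (simp add: smooth_def)
qed

lemma smooth_sqrt: "smooth f \<Longrightarrow> (\<And>x. f x > 0) \<Longrightarrow> smooth (\<lambda>x. sqrt (f x))"
  using smooth_powr[of f "1/2"] by (simp add: powr_half_sqrt less_imp_le)

lemma smooth_divide:
  assumes "smooth f" "smooth g" "\<And>x. g x > 0"
  shows "smooth (\<lambda>x. f x / g x)"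
proof -
  have "smooth (\<lambda>x. f x * g x powr (-1))" by (intro smooth_mult assms smooth_powr)
  then show ?thesis using assms(3) by (simp add: powr_minus divide_inverse less_imp_le)
qed

lemma smooth_imp_differentiable: "smooth f \<Longrightarrow> f differentiable at x"
  unfolding smooth_def by (metis Ck.simps(2))

lemma smooth_imp_continuous: "smooth f \<Longrightarrow> continuous_on S f"
  unfolding smooth_def by (metis Ck.simps(1) continuous_on_subset subset_UNIV)

lemma smooth_imp_continuous_grad:
  assumes "smooth f" shows "continuous_on S (grad f)"
proof -
  have "Ck (Suc 0) f" using assms by (simp only: smooth_def)
  then have "continuous_on S (\<lambda>x. grad f x $ i)" for i by (auto intro: continuous_on_subset)
  then show ?thesis using continuous_on_vec_lambda[of S "\<lambda>i x. grad f x $ i"] by simp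
qed

text \<open>For \<open>k = 0\<close> this is the classical function exp (- 1 / t), extended by zero.
  The extra powers of 1 / t close the family under differentiation, up to linear
  combinations.\<close>

definition flat :: "nat \<Rightarrow> real \<Rightarrow> real" where
  "flat k t = (if t > 0 then (1/t)^k * exp (- (1/t)) else 0)"

lemma flat_tendsto: "(flat k \<longlongrightarrow> 0) (at 0)"
proof -
  have "filterlim (\<lambda>t::real. 1 / t) at_top (at_right 0)"
    using filterlim_inverse_at_top_right by (simp add: inverse_eq_divide)
  then have "((\<lambda>t. (1/t)^k / exp (1/t)) \<longlongrightarrow> (0::real)) (at_right 0)"
    by (rule filterlim_compose[OF tendsto_power_div_exp_0])
  moreover have "\<forall>\<^sub>F t in at_right 0. (1/t)^k / exp (1/t) = flat k t"
    by (auto simp: eventually_at_right_field flat_def exp_minus field_simps intro: exI[of _ 1])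
  ultimately have R: "(flat k \<longlongrightarrow> 0) (at_right 0)" by (rule Lim_transform_eventually)
  have "\<forall>\<^sub>F t in at_left 0. (0::real) = flat k t"
    by (auto simp: eventually_at_left_field flat_def intro: exI[of _ "-1"])
  then have L: "(flat k \<longlongrightarrow> 0) (at_left 0)" by (rule Lim_transform_eventually[OF tendsto_const])
  show ?thesis using L R by (simp add: filterlim_at_split)
qed

text \<open>At 0 the difference quotient of \<open>flat k\<close> is \<open>flat (k + 1)\<close>
  itself, which tends to 0. Elsewhere the formula is the product rule.\<close>

lemma flat_deriv:
  "(flat k has_real_derivative (flat (k+2) t - real k * flat (k+1) t)) (at t)"
proof -
  consider "t > 0" | "t < 0" | "t = 0" by linarith
  then show ?thesis
  proof cases
    case 1
    have "((\<lambda>t. (1/t)^k * exp (- (1/t))) has_real_derivative (flat (k+2) t - real k * flat (k+1) t)) (at t)"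
    proof (cases k)
      case 0
      then show ?thesis using 1
        by (auto intro!: derivative_eq_intros simp: flat_def field_simps power2_eq_square)
    next
      case (Suc n)
      have "((\<lambda>t. (1/t)^Suc n * exp (- (1/t))) has_real_derivative
        (real (Suc n) * (1/t)^n * (- 1 / t^2)) * exp (- (1/t)) + (1/t)^Suc n * (exp (- (1/t)) * (1/t^2))) (at t)"
        using 1 by (auto intro!: derivative_eq_intros simp: power2_eq_square simp del: of_nat_Suc power_Suc)
      moreover have "(real (Suc n) * (1/t)^n * (- 1 / t^2)) * exp (- (1/t)) + (1/t)^Suc n * (exp (- (1/t)) * (1/t^2))
        = (1/t)^(Suc n + 2) * exp (- (1/t)) - real (Suc n) * ((1/t)^(Suc n + 1) * exp (- (1/t)))"
        by (simp add: power2_eq_square algebra_simps add_divide_distrib)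
      ultimately show ?thesis using 1 by (simp only: Suc flat_def if_True)
    qed
    then show ?thesis
      by (rule DERIV_cong_ev[THEN iffD1, rotated -1])
         (auto simp: flat_def eventually_nhds intro!: exI[of _ "{0<..}"] 1)
  next
    case 2
    have "((\<lambda>t. 0) has_real_derivative (flat (k+2) t - real k * flat (k+1) t)) (at t)"
      using 2 by (auto simp: flat_def)
    then show ?thesis
      by (rule DERIV_cong_ev[THEN iffD1, rotated -1])
         (auto simp: flat_def eventually_nhds intro!: exI[of _ "{..<0}"] 2)
  next
    case 3
    have "(\<lambda>h. (flat k (0 + h) - flat k 0) / h) = flat (k+1)"
      by (auto simp: flat_def fun_eq_iff)
    then have "(flat k has_real_derivative 0) (at 0)"
      unfolding DERIV_def using flat_tendsto[of "k+1"] by simp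
    then show ?thesis using 3 by (simp add: flat_def)
  qed
qed

lemma smooth_flat:
  assumes "smooth f" shows "smooth (\<lambda>x. flat k (f x))"
proof -
  have "Ck n (\<lambda>x. flat k (f x))" for n
  proof (induction n arbitrary: k)
    case 0
    have "isCont (flat k) t" for t using flat_deriv DERIV_isCont by blast
    then have "continuous_on UNIV (flat k)" by (simp add: continuous_at_imp_continuous_on)
    then have "continuous_on (range f) (flat k)" by (rule continuous_on_subset) simp
    then have "continuous_on UNIV (flat k \<circ> f)"
      by (intro continuous_on_compose smooth_imp_continuous[OF assms])
    then show ?case by (simp add: o_def)
  next
    case (Suc n)
    have "Ck n (\<lambda>x. flat (k+2) (f x) + (- real k) * flat (k+1) (f x))"
      by (intro Ck_add Ck_mult Ck_const Suc)
    then have "Ck n (\<lambda>x. flat (k+2) (f x) - real k * flat (k+1) (f x))" by simp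
    moreover have "Ck (Suc n) f" using assms by (simp only: smooth_def)
    ultimately show ?case
      using Ck_chain[where h' = "\<lambda>t. flat (k+2) t - real k * flat (k+1) t" and h = "flat k" and f = f and k = n] flat_deriv
      by blast
  qed
  then show ?thesis by (simp add: smooth_def)
qed

text \<open>A product of one-dimensional bumps, hence positive exactly on the open box. This
  exactness later lets functions of the bump converge to the indicator of the box.\<close>

lemma smooth_bump_box:
  fixes c d :: "real ^ 'd"
  obtains b :: "real ^ 'd \<Rightarrow> real" where "smooth b" "\<And>x. x \<in> box c d \<Longrightarrow> b x > 0"
    "\<And>x. x \<notin> box c d \<Longrightarrow> b x = 0" "\<And>x. b x \<ge> 0"
proof
  let ?b = "\<lambda>x. \<Prod>i\<in>UNIV. flat 0 (x $ i - c $ i) * flat 0 (d $ i - x $ i)"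
  have "smooth (\<lambda>x. flat 0 (x $ i - c $ i) * flat 0 (d $ i - x $ i))" for i
    by (rule smooth_mult; rule smooth_flat; rule smooth_diff; rule smooth_component smooth_const)
  then show "smooth ?b" by (rule smooth_prod[OF finite])
  show "?b x > 0" if "x \<in> box c d" for x
    using that by (intro prod_pos ballI mult_pos_pos) (simp_all add: mem_box_cart flat_def)
  show "?b x = 0" if "x \<notin> box c d" for x
  proof -
    have "\<exists>i. \<not> (c $ i < x $ i \<and> x $ i < d $ i)"
      using that by (simp add: mem_box_cart)
    then obtain i where "\<not> (c $ i < x $ i \<and> x $ i < d $ i)" by blast
    then have "flat 0 (x $ i - c $ i) * flat 0 (d $ i - x $ i) = 0" by (auto simp: flat_def)
    then show ?thesis by (intro prod_zero) auto
  qed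
  show "?b x \<ge> 0" for x by (intro prod_nonneg mult_nonneg_nonneg) (simp_all add: flat_def)
qed


section \<open>Test functions\<close>

lemma test_functionsI:
  assumes "smooth f" "compact K" "K \<subseteq> D" "\<And>x. x \<notin> K \<Longrightarrow> f x = 0"
  shows "f \<in> test_functions D"
proof -
  have "closure {x. f x \<noteq> 0} \<subseteq> K"
    using assms by (intro closure_minimal) (auto dest: compact_imp_closed)
  moreover from this have "compact (K \<inter> closure {x. f x \<noteq> 0})"
    using assms(2) by (intro compact_Int_closed) simp_all
  ultimately have "closure {x. f x \<noteq> 0} \<subseteq> D" "compact (closure {x. f x \<noteq> 0})"
    using assms(3) by (auto simp only: inf.absorb2)
  then show ?thesis using assms(1) by (simp add: test_functions_def smooth_def)
qed

lemma test_functionsE: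
  assumes "f \<in> test_functions D"
  obtains K where "smooth f" "compact K" "K \<subseteq> D" "\<And>x. x \<notin> K \<Longrightarrow> f x = 0" "\<And>x. x \<notin> K \<Longrightarrow> grad f x = 0"
proof (rule that[of "closure {x. f x \<noteq> 0}"])
  show "smooth f" "compact (closure {x. f x \<noteq> 0})" "closure {x. f x \<noteq> 0} \<subseteq> D"
    using assms by (auto simp: test_functions_def smooth_def)
  show "f x = 0" if "x \<notin> closure {x. f x \<noteq> 0}" for x
    using that closure_subset[of "{x. f x \<noteq> 0}"] by blast
  show "grad f x = 0" if x: "x \<notin> closure {x. f x \<noteq> 0}" for x
  proof (rule grad_eqI)
    have "(f has_derivative (\<lambda>h. 0)) (at x)"
    proof (rule has_derivative_transform_within_open[of "\<lambda>x. 0" _ _ _ "- closure {x. f x \<noteq> 0}"])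
      show "x \<in> - closure {x. f x \<noteq> 0}" using x by simp
      show "\<And>x. x \<in> - closure {x. f x \<noteq> 0} \<Longrightarrow> 0 = f x"
        using closure_subset[of "{x. f x \<noteq> 0}"] by (metis (mono_tags) ComplD mem_Collect_eq subsetD)
      show "open (- closure {x. f x \<noteq> 0})" by (rule open_Compl[OF closed_closure])
      show "((\<lambda>x. 0) has_derivative (\<lambda>h. 0)) (at x)" by simp
    qed
    then show "(f has_derivative (\<lambda>h. 0 \<bullet> h)) (at x)" by simp
  qed
qed

lemma test_smooth: "f \<in> test_functions D \<Longrightarrow> smooth f"
  by (simp add: test_functions_def smooth_def)

section \<open>Operations that preserve test functions\<close>

lemma test_zero: "(\<lambda>x. 0) \<in> test_functions D"
  by (rule test_functionsI[of _ "{}"]) (auto intro: smooth_const)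

lemma test_add:
  assumes "f \<in> test_functions D" "g \<in> test_functions D"
  shows "(\<lambda>x. f x + g x) \<in> test_functions D"
proof -
  obtain K where K: "smooth f" "compact K" "K \<subseteq> D" "\<And>x. x \<notin> K \<Longrightarrow> f x = 0"
    using assms(1) by (rule test_functionsE) blast
  obtain L where L: "smooth g" "compact L" "L \<subseteq> D" "\<And>x. x \<notin> L \<Longrightarrow> g x = 0"
    using assms(2) by (rule test_functionsE) blast
  show ?thesis by (rule test_functionsI[of _ "K \<union> L"]) (use K L in \<open>auto intro: smooth_add\<close>)
qed

lemma test_mult:
  assumes "f \<in> test_functions D" "smooth g"
  shows "(\<lambda>x. f x * g x) \<in> test_functions D"
proof -
  obtain K where K: "smooth f" "compact K" "K \<subseteq> D" "\<And>x. x \<notin> K \<Longrightarrow> f x = 0"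
    using assms(1) by (rule test_functionsE) blast
  show ?thesis by (rule test_functionsI[of _ K]) (use K assms in \<open>auto intro: smooth_mult\<close>)
qed

lemma test_cmult: "f \<in> test_functions D \<Longrightarrow> (\<lambda>x. c * f x) \<in> test_functions D"
  using test_mult[of f D "\<lambda>x. c"] by (simp add: smooth_const mult.commute)

lemma test_diff:
  assumes "f \<in> test_functions D" "g \<in> test_functions D"
  shows "(\<lambda>x. f x - g x) \<in> test_functions D"
  using test_add[OF assms(1) test_cmult[OF assms(2), of "-1"]] by simp

lemma test_comp:
  assumes "f \<in> test_functions D" "smooth (\<lambda>x. h (f x))" "h 0 = 0"
  shows "(\<lambda>x. h (f x)) \<in> test_functions D"
proof -
  obtain K where K: "smooth f" "compact K" "K \<subseteq> D" "\<And>x. x \<notin> K \<Longrightarrow> f x = 0"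
    using assms(1) by (rule test_functionsE) blast
  show ?thesis by (rule test_functionsI[of _ K]) (use K assms in auto)
qed

lemma test_sum:
  assumes "finite S" "\<And>i. i \<in> S \<Longrightarrow> f i \<in> test_functions D"
  shows "(\<lambda>x. \<Sum>i\<in>S. f i x) \<in> test_functions D"
  using assms by (induction S rule: finite_induct) (simp_all add: test_zero test_add)

lemma compactly_supported_bounded:
  fixes f :: "'a::euclidean_space \<Rightarrow> 'b::euclidean_space"
  assumes "continuous_on UNIV f" "compact K" "\<And>x. x \<notin> K \<Longrightarrow> f x = 0"
  obtains B where "B > 0" "\<And>x. norm (f x) \<le> B"
proof -
  have "bounded (f ` K)"
    by (intro compact_imp_bounded compact_continuous_image assms(2) continuous_on_subset[OF assms(1)] subset_UNIV)
  then obtain B where B: "B > 0" "\<And>x. x \<in> K \<Longrightarrow> norm (f x) \<le> B" by (auto simp: bounded_pos)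
  have "norm (f x) \<le> B" for x using B assms(3)[of x] by (cases "x \<in> K") auto
  then show ?thesis using that B(1) by blast
qed

lemma test_bounded:
  assumes "f \<in> test_functions D"
  obtains B where "B > 0" "\<And>x. \<bar>f x\<bar> \<le> B" "\<And>x. norm (grad f x) \<le> B"
proof -
  obtain K where K: "smooth f" "compact K" "\<And>x. x \<notin> K \<Longrightarrow> f x = 0" "\<And>x. x \<notin> K \<Longrightarrow> grad f x = 0"
    using assms by (rule test_functionsE) blast
  obtain B1 where 1: "B1 > 0" "\<And>x. norm (f x) \<le> B1"
    using compactly_supported_bounded[OF smooth_imp_continuous[OF K(1)] K(2,3)] by blast
  obtain B2 where 2: "B2 > 0" "\<And>x. norm (grad f x) \<le> B2"
    using compactly_supported_bounded[OF smooth_imp_continuous_grad[OF K(1)] K(2,4)] by blast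
  show ?thesis
    by (rule that[of "max B1 B2"]) (use 1 2 in \<open>auto intro: max.coboundedI1 max.coboundedI2\<close>)
qed

lemma test_bump_box:
  fixes c d :: "real ^ 'd"
  assumes "cbox c d \<subseteq> D"
  obtains b where "b \<in> test_functions D" "\<And>x. x \<in> box c d \<Longrightarrow> b x > 0"
    "\<And>x. x \<notin> box c d \<Longrightarrow> b x = 0" "\<And>x. b x \<ge> 0"
proof -
  obtain b :: "real ^ 'd \<Rightarrow> real" where b: "smooth b" "\<And>x. x \<in> box c d \<Longrightarrow> b x > 0"
    "\<And>x. x \<notin> box c d \<Longrightarrow> b x = 0" "\<And>x. b x \<ge> 0" by (rule smooth_bump_box[of c d]) blast
  have "b \<in> test_functions D"
    by (rule test_functionsI[of _ "cbox c d"]) (use b(1,3) assms box_subset_cbox[of c d] in auto)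
  then show ?thesis using that b by blast
qed

text \<open>Weak gradients only see test functions, so cut-offs are built from box bumps: finitely many of
  them have a sum that is bounded below on a compact set.\<close>

lemma test_cutoff:
  fixes K :: "(real ^ 'd) set"
  assumes "open D" "compact K" "K \<subseteq> D"
  obtains f m where "f \<in> test_functions D" "m > 0" "\<And>x. x \<in> K \<Longrightarrow> f x \<ge> m" "\<And>x. f x \<ge> 0"
proof -
  have "\<exists>b\<in>test_functions D. b z > 0 \<and> (\<forall>x. b x \<ge> 0)" if z: "z \<in> D" for z
  proof -
    obtain c d where cd: "z \<in> box c d" "cbox c d \<subseteq> D"
      by (rule open_contains_cbox[OF assms(1) z])
    obtain b where "b \<in> test_functions D" "\<And>x. x \<in> box c d \<Longrightarrow> b x > 0" "\<And>x. b x \<ge> 0"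
      by (rule test_bump_box[OF cd(2)]) blast
    then show ?thesis using cd(1) by blast
  qed
  then have "\<forall>z\<in>D. \<exists>b. b \<in> test_functions D \<and> b z > 0 \<and> (\<forall>x. b x \<ge> 0)" by blast
  then obtain b where b: "\<And>z. z \<in> D \<Longrightarrow> b z \<in> test_functions D" "\<And>z. z \<in> D \<Longrightarrow> b z z > 0"
     "\<And>z x. z \<in> D \<Longrightarrow> b z x \<ge> 0"
    by metis
  have op: "open {x. b z x > 0}" if "z \<in> K" for z
  proof -
    have "continuous_on UNIV (b z)"
      using that b(1) assms(3) by (intro smooth_imp_continuous test_smooth) blast
    then show ?thesis by (intro open_Collect_less continuous_on_const)
  qed
  have cov: "K \<subseteq> (\<Union>z\<in>K. {x. b z x > 0})"
  proof
    fix z assume "z \<in> K"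
    moreover have "b z z > 0" using b(2) assms(3) \<open>z \<in> K\<close> by (meson subsetD)
    ultimately show "z \<in> (\<Union>z\<in>K. {x. b z x > 0})" by (simp only: UN_iff mem_Collect_eq) (rule bexI)
  qed
  obtain S where S: "S \<subseteq> K" "finite S" "K \<subseteq> (\<Union>z\<in>S. {x. b z x > 0})"
    by (rule compactE_image[OF assms(2) op cov])
  let ?f = "\<lambda>x. \<Sum>z\<in>S. b z x"
  have SD: "z \<in> D" if "z \<in> S" for z using that S(1) assms(3) by blast
  have f: "?f \<in> test_functions D" using SD b(1) by (intro test_sum S(2)) blast
  have nn: "?f x \<ge> 0" for x using SD b(3) by (intro sum_nonneg) blast
  have pos: "?f x > 0" if x: "x \<in> K" for x
  proof -
    obtain z where z: "z \<in> S" "b z x > 0" using S(3) x by blast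
    show ?thesis by (rule sum_pos2[where f = "\<lambda>z. b z x", OF S(2) z]) (use SD b(3) in blast)
  qed
  show ?thesis
  proof (cases "K = {}")
    case True then show ?thesis using that[OF f, of 1] nn by auto
  next
    case False
    then obtain x0 where x0: "x0 \<in> K" "\<forall>x\<in>K. ?f x0 \<le> ?f x"
      using continuous_attains_inf[OF assms(2) False smooth_imp_continuous[OF test_smooth[OF f]]] by blast
    show ?thesis using x0 by (intro that[OF f pos[OF x0(1)] _ nn]) blast
  qed
qed


section \<open>Square integrable functions\<close>

text \<open>A version of \<open>L2\<close> for an arbitrary measure: the same estimates are needed
  on \<open>lebesgue_on D\<close> and on compact subsets of \<open>D\<close>.\<close>

definition square_integrable :: "'a measure \<Rightarrow> ('a \<Rightarrow> 'b::euclidean_space) \<Rightarrow> bool" where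
  "square_integrable M f \<longleftrightarrow> f \<in> borel_measurable M \<and> integrable M (\<lambda>x. (norm (f x))\<^sup>2)"

definition l2norm :: "'a measure \<Rightarrow> ('a \<Rightarrow> 'b::euclidean_space) \<Rightarrow> real" where
  "l2norm M f = sqrt (LINT x|M. (norm (f x))\<^sup>2)"

lemma square_integrableD [dest]:
  assumes "square_integrable M f"
  shows "f \<in> borel_measurable M" "integrable M (\<lambda>x. (norm (f x))\<^sup>2)"
  using assms by (auto simp: square_integrable_def)

lemma l2norm_nonneg [simp]: "0 \<le> l2norm M f"
  by (simp add: l2norm_def)

lemma l2norm_power2: "(l2norm M f)\<^sup>2 = (LINT x|M. (norm (f x))\<^sup>2)"
  by (simp add: l2norm_def)

lemma l2norm_nn_integral:
  assumes "square_integrable M f"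
  shows "(\<integral>\<^sup>+x. ennreal ((norm (f x))\<^sup>2) \<partial>M) = ennreal ((l2norm M f)\<^sup>2)"
  using assms by (subst nn_integral_eq_integral) (auto simp: l2norm_power2)

text \<open>With nonnegative integrals, square integrability and the norm bound follow from one
  inequality, which Fatou's lemma or a pointwise estimate can deliver.\<close>

lemma square_integrable_nn_integralI:
  assumes "f \<in> borel_measurable M" "(\<integral>\<^sup>+x. ennreal ((norm (f x))\<^sup>2) \<partial>M) \<le> ennreal (B\<^sup>2)" "B \<ge> 0"
  shows "square_integrable M f" "l2norm M f \<le> B"
proof -
  note [measurable] = assms(1)
  have fin: "(\<integral>\<^sup>+x. ennreal ((norm (f x))\<^sup>2) \<partial>M) < \<infinity>"
    using assms(2) by (rule order_le_less_trans) simp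
  show s: "square_integrable M f"
    using assms(1) fin by (auto simp: square_integrable_def integrable_iff_bounded)
  have "(l2norm M f)\<^sup>2 \<le> B\<^sup>2" using assms(2) l2norm_nn_integral[OF s] by simp
  then show "l2norm M f \<le> B" using assms(3) power2_le_imp_le by blast
qed

lemma square_integrable_cong_AE:
  assumes "f \<in> borel_measurable M" "g \<in> borel_measurable M" "AE x in M. f x = g x"
  shows "square_integrable M f \<longleftrightarrow> square_integrable M g"
proof -
  have "integrable M (\<lambda>x. (norm (f x))\<^sup>2) \<longleftrightarrow> integrable M (\<lambda>x. (norm (g x))\<^sup>2)"
    using assms by (intro integrable_cong_AE) auto
  then show ?thesis using assms by (simp add: square_integrable_def)
qed

lemma square_integrable_bound:
  fixes g :: "'a \<Rightarrow> 'c::euclidean_space"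
  assumes "square_integrable M f" "g \<in> borel_measurable M" "AE x in M. norm (g x) \<le> B * norm (f x)"
    and "B \<ge> 0"
  shows "square_integrable M g" "l2norm M g \<le> B * l2norm M f"
proof -
  have "(\<integral>\<^sup>+x. ennreal ((norm (g x))\<^sup>2) \<partial>M) \<le> (\<integral>\<^sup>+x. ennreal (B\<^sup>2) * ennreal ((norm (f x))\<^sup>2) \<partial>M)"
  proof (rule nn_integral_mono_AE, use assms(3) in eventually_elim)
    fix x assume "norm (g x) \<le> B * norm (f x)"
    then have "(norm (g x))\<^sup>2 \<le> (B * norm (f x))\<^sup>2" by (rule power_mono) simp
    then show "ennreal ((norm (g x))\<^sup>2) \<le> ennreal (B\<^sup>2) * ennreal ((norm (f x))\<^sup>2)"
      by (simp add: power_mult_distrib flip: ennreal_mult)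
  qed
  also have "\<dots> = ennreal ((B * l2norm M f)\<^sup>2)"
    using assms(1) by (subst nn_integral_cmult) (auto simp: l2norm_nn_integral power_mult_distrib ennreal_mult)
  finally have le: "(\<integral>\<^sup>+x. ennreal ((norm (g x))\<^sup>2) \<partial>M) \<le> ennreal ((B * l2norm M f)\<^sup>2)" .
  show "square_integrable M g" "l2norm M g \<le> B * l2norm M f"
    by (rule square_integrable_nn_integralI[OF assms(2) le]; simp add: assms(4))+
qed

lemma square_integrable_bounded_mult:
  assumes "square_integrable M f" "h \<in> borel_measurable M" "AE x in M. \<bar>h x\<bar> \<le> B" "B \<ge> 0"
  shows "square_integrable M (\<lambda>x. h x *\<^sub>R f x)" "l2norm M (\<lambda>x. h x *\<^sub>R f x) \<le> B * l2norm M f"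
proof -
  have m: "(\<lambda>x. h x *\<^sub>R f x) \<in> borel_measurable M" using assms by auto
  have "AE x in M. norm (h x *\<^sub>R f x) \<le> B * norm (f x)"
    using assms(3) by eventually_elim (auto intro: mult_right_mono)
  from square_integrable_bound[OF assms(1) m this assms(4)]
  show "square_integrable M (\<lambda>x. h x *\<^sub>R f x)" "l2norm M (\<lambda>x. h x *\<^sub>R f x) \<le> B * l2norm M f" .
qed

lemma square_integrable_scaleR:
  "square_integrable M f \<Longrightarrow> square_integrable M (\<lambda>x. c *\<^sub>R f x)"
  by (rule square_integrable_bounded_mult(1)[of _ _ _ "\<bar>c\<bar>"]) auto

lemma l2norm_scaleR: "l2norm M (\<lambda>x. c *\<^sub>R f x) = \<bar>c\<bar> * l2norm M f"
  by (simp add: l2norm_def power_mult_distrib real_sqrt_mult)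

lemma square_integrable_add:
  assumes "square_integrable M f" "square_integrable M g"
  shows "square_integrable M (\<lambda>x. f x + g x)"
proof -
  note sq = square_integrableD[OF assms(1)] square_integrableD[OF assms(2)]
  have m: "(\<lambda>x. f x + g x) \<in> borel_measurable M" using sq by auto
  have "integrable M (\<lambda>x. 2 * (norm (f x))\<^sup>2 + 2 * (norm (g x))\<^sup>2)" using sq by auto
  then have "integrable M (\<lambda>x. (norm (f x + g x))\<^sup>2)"
  proof (rule Bochner_Integration.integrable_bound)
    show "AE x in M. norm ((norm (f x + g x))\<^sup>2) \<le> norm (2 * (norm (f x))\<^sup>2 + 2 * (norm (g x))\<^sup>2)"
    proof (intro AE_I2)
      fix x
      have "(norm (f x + g x))\<^sup>2 \<le> (norm (f x) + norm (g x))\<^sup>2"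
        by (rule power_mono[OF norm_triangle_ineq]) simp
      also have "\<dots> \<le> 2 * (norm (f x))\<^sup>2 + 2 * (norm (g x))\<^sup>2"
        using zero_le_power2[of "norm (f x) - norm (g x)"] unfolding power2_eq_square by (simp add: algebra_simps)
      finally show "norm ((norm (f x + g x))\<^sup>2) \<le> norm (2 * (norm (f x))\<^sup>2 + 2 * (norm (g x))\<^sup>2)" by simp
    qed
  qed (use m in auto)
  then show ?thesis using m by (simp add: square_integrable_def)
qed

lemma square_integrable_diff:
  assumes "square_integrable M f" "square_integrable M g"
  shows "square_integrable M (\<lambda>x. f x - g x)"
  using square_integrable_add[OF assms(1) square_integrable_scaleR[OF assms(2), of "-1"]] by simp

lemma l2norm_minus_commute: "l2norm M (\<lambda>x. f x - g x) = l2norm M (\<lambda>x. g x - f x)"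
  by (simp add: l2norm_def norm_minus_commute)

lemma integrable_norm_mult:
  assumes "square_integrable M f" "square_integrable M g"
  shows "integrable M (\<lambda>x. norm (f x) * norm (g x))"
proof (rule Bochner_Integration.integrable_bound)
  show "integrable M (\<lambda>x. (norm (f x))\<^sup>2 + (norm (g x))\<^sup>2)" using assms by auto
  show "(\<lambda>x. norm (f x) * norm (g x)) \<in> borel_measurable M"
    using assms by (intro borel_measurable_times borel_measurable_norm) auto
  show "AE x in M. norm (norm (f x) * norm (g x)) \<le> norm ((norm (f x))\<^sup>2 + (norm (g x))\<^sup>2)"
  proof (intro AE_I2)
    fix x
    have "norm (f x) * norm (g x) \<le> (norm (f x))\<^sup>2 + (norm (g x))\<^sup>2"
      using sum_squares_bound[of "norm (f x)" "norm (g x)"] mult_nonneg_nonneg[OF norm_ge_zero norm_ge_zero, of "f x" "g x"]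
      by linarith
    then show "norm (norm (f x) * norm (g x)) \<le> norm ((norm (f x))\<^sup>2 + (norm (g x))\<^sup>2)" by simp
  qed
qed

lemma l2norm_Cauchy_Schwarz:
  assumes "square_integrable M f" "square_integrable M g"
  shows "(LINT x|M. norm (f x) * norm (g x)) \<le> l2norm M f * l2norm M g"
proof -
  let ?c = "LINT x|M. norm (f x) * norm (g x)"
  have c: "0 \<le> ?c" by (simp add: integral_nonneg_AE)
  have "(\<integral>\<^sup>+x. ennreal (norm (f x)) * ennreal (norm (g x)) \<partial>M) = ennreal ?c"
    using nn_integral_eq_integral[OF integrable_norm_mult[OF assms]] by (simp add: ennreal_mult)
  moreover have "(\<integral>\<^sup>+x. ennreal (norm (f x)) * ennreal (norm (g x)) \<partial>M)\<^sup>2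
    \<le> (\<integral>\<^sup>+x. (ennreal (norm (f x)))\<^sup>2 \<partial>M) * (\<integral>\<^sup>+x. (ennreal (norm (g x)))\<^sup>2 \<partial>M)"
    using assms by (intro Cauchy_Schwarz_nn_integral measurable_compose[OF _ measurable_ennreal] borel_measurable_norm) auto
  ultimately have "ennreal (?c\<^sup>2) \<le> ennreal ((l2norm M f)\<^sup>2 * (l2norm M g)\<^sup>2)"
    using l2norm_nn_integral[OF assms(1)] l2norm_nn_integral[OF assms(2)] c
    by (simp add: ennreal_power ennreal_mult)
  then have "?c\<^sup>2 \<le> (l2norm M f * l2norm M g)\<^sup>2" by (simp add: power_mult_distrib)
  then show ?thesis by (rule power2_le_imp_le) simp
qed

lemma l2norm_triangle:
  assumes "square_integrable M f" "square_integrable M g"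
  shows "l2norm M (\<lambda>x. f x + g x) \<le> l2norm M f + l2norm M g"
proof (rule power2_le_imp_le)
  have "(l2norm M (\<lambda>x. f x + g x))\<^sup>2 \<le> (LINT x|M. (norm (f x))\<^sup>2 + 2 * (norm (f x) * norm (g x)) + (norm (g x))\<^sup>2)"
    unfolding l2norm_power2
  proof (rule integral_mono)
    show "integrable M (\<lambda>x. (norm (f x + g x))\<^sup>2)" using square_integrable_add[OF assms] by auto
    show "integrable M (\<lambda>x. (norm (f x))\<^sup>2 + 2 * (norm (f x) * norm (g x)) + (norm (g x))\<^sup>2)"
      using square_integrableD(2)[OF assms(1)] square_integrableD(2)[OF assms(2)] integrable_norm_mult[OF assms] by auto
    show "(norm (f x + g x))\<^sup>2 \<le> (norm (f x))\<^sup>2 + 2 * (norm (f x) * norm (g x)) + (norm (g x))\<^sup>2" for x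
      using power_mono[OF norm_triangle_ineq[of "f x" "g x"] norm_ge_zero, of 2]
      by (simp add: power2_eq_square algebra_simps)
  qed
  also have "\<dots> = (l2norm M f)\<^sup>2 + 2 * (LINT x|M. norm (f x) * norm (g x)) + (l2norm M g)\<^sup>2"
    using assms integrable_norm_mult[OF assms] by (simp add: l2norm_power2 square_integrableD)
  also have "\<dots> \<le> (l2norm M f + l2norm M g)\<^sup>2"
    using l2norm_Cauchy_Schwarz[OF assms] by (simp add: power2_eq_square algebra_simps)
  finally show "(l2norm M (\<lambda>x. f x + g x))\<^sup>2 \<le> (l2norm M f + l2norm M g)\<^sup>2" .
qed simp

lemma l2norm_triangle_dist:
  assumes "square_integrable M f" "square_integrable M g" "square_integrable M h"
  shows "l2norm M (\<lambda>x. f x - h x) \<le> l2norm M (\<lambda>x. f x - g x) + l2norm M (\<lambda>x. g x - h x)"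
  using l2norm_triangle[OF square_integrable_diff[OF assms(1,2)] square_integrable_diff[OF assms(2,3)]]
  by simp

lemma l2norm_diff_abs_le:
  assumes "square_integrable M f" "square_integrable M g"
  shows "\<bar>l2norm M f - l2norm M g\<bar> \<le> l2norm M (\<lambda>x. f x - g x)"
  using l2norm_triangle[OF square_integrable_diff[OF assms] assms(2)]
    l2norm_triangle[OF square_integrable_diff[OF assms(2,1)] assms(1)]
    l2norm_minus_commute[of M f g] by simp

lemma l2norm_mono_AE:
  assumes "f \<in> borel_measurable M" "integrable M (\<lambda>x. (norm (g x))\<^sup>2)" "AE x in M. norm (f x) \<le> norm (g x)"
  shows "l2norm M f \<le> l2norm M g"
  unfolding l2norm_def
proof (intro real_sqrt_le_mono integral_mono_AE')
  show "AE x in M. (norm (f x))\<^sup>2 \<le> (norm (g x))\<^sup>2"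
    using assms(3) by eventually_elim (simp add: power_mono)
qed (use assms in auto)

section \<open>Convergence in mean square: subsequences, dominated convergence, completeness\<close>

lemma l2_conv_AE_subseq:
  assumes "\<And>n. square_integrable M (F n)" "square_integrable M f"
    and "(\<lambda>n. l2norm M (\<lambda>x. F n x - f x)) \<longlonglongrightarrow> 0"
  obtains r :: "nat \<Rightarrow> nat" where "strict_mono r" "AE x in M. (\<lambda>n. F (r n) x) \<longlonglongrightarrow> f x"
proof -
  have "(\<lambda>n. (l2norm M (\<lambda>x. F n x - f x))\<^sup>2) \<longlonglongrightarrow> 0\<^sup>2" by (intro tendsto_intros assms)
  then have "(\<lambda>n. LINT x|M. norm ((norm (F n x - f x))\<^sup>2)) \<longlonglongrightarrow> 0" by (simp add: l2norm_power2)
  moreover have "integrable M (\<lambda>x. (norm (F n x - f x))\<^sup>2)" for n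
    using square_integrable_diff[OF assms(1,2)] by blast
  ultimately obtain r :: "nat \<Rightarrow> nat" where r: "strict_mono r" "AE x in M. (\<lambda>n. (norm (F (r n) x - f x))\<^sup>2) \<longlonglongrightarrow> 0"
    using tendsto_L1_AE_subseq[of M "\<lambda>n x. (norm (F n x - f x))\<^sup>2"] by blast
  from r(2) have "AE x in M. (\<lambda>n. F (r n) x) \<longlonglongrightarrow> f x"
  proof eventually_elim
    fix x assume "(\<lambda>n. (norm (F (r n) x - f x))\<^sup>2) \<longlonglongrightarrow> 0"
    then have "(\<lambda>n. sqrt ((norm (F (r n) x - f x))\<^sup>2)) \<longlonglongrightarrow> sqrt 0" by (intro tendsto_intros)
    then show "(\<lambda>n. F (r n) x) \<longlonglongrightarrow> f x" by (simp add: tendsto_norm_zero_iff LIM_zero_iff)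
  qed
  then show ?thesis using that r(1) by blast
qed

lemma l2_dominated_convergence:
  fixes F :: "nat \<Rightarrow> 'a \<Rightarrow> 'b::euclidean_space" and G :: "'a \<Rightarrow> 'c::euclidean_space"
  assumes "\<And>n. F n \<in> borel_measurable M" "f \<in> borel_measurable M" "square_integrable M G"
    and conv: "AE x in M. (\<lambda>n. F n x) \<longlonglongrightarrow> f x"
    and bd: "\<And>n. AE x in M. norm (F n x) \<le> norm (G x)"
  shows "square_integrable M f" "(\<lambda>n. l2norm M (\<lambda>x. F n x - f x)) \<longlonglongrightarrow> 0"
proof -
  have bdf: "AE x in M. norm (f x) \<le> norm (G x)"
  proof -
    have "AE x in M. \<forall>n. norm (F n x) \<le> norm (G x)" using bd by (simp add: AE_all_countable)
    with conv show ?thesis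
    proof eventually_elim
      fix x assume "(\<lambda>n. F n x) \<longlonglongrightarrow> f x" "\<forall>n. norm (F n x) \<le> norm (G x)"
      then show "norm (f x) \<le> norm (G x)" using LIMSEQ_le_const2[OF tendsto_norm] by blast
    qed
  qed
  then show "square_integrable M f"
    using square_integrable_bound(1)[OF assms(3,2), of 1] by simp
  have "(\<lambda>n. LINT x|M. (norm (F n x - f x))\<^sup>2) \<longlonglongrightarrow> (LINT x|M. 0)"
  proof (rule integral_dominated_convergence)
    show "integrable M (\<lambda>x. 4 * (norm (G x))\<^sup>2)" using assms(3) by auto
    show "(\<lambda>x. (norm (F n x - f x))\<^sup>2) \<in> borel_measurable M" for n
      using assms by (intro borel_measurable_power borel_measurable_norm borel_measurable_diff) auto
    show "AE x in M. (\<lambda>n. (norm (F n x - f x))\<^sup>2) \<longlonglongrightarrow> 0"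
      using conv
    proof eventually_elim
      fix x assume "(\<lambda>n. F n x) \<longlonglongrightarrow> f x"
      then have "(\<lambda>n. (norm (F n x - f x))\<^sup>2) \<longlonglongrightarrow> (norm (f x - f x))\<^sup>2" by (intro tendsto_intros)
      then show "(\<lambda>n. (norm (F n x - f x))\<^sup>2) \<longlonglongrightarrow> 0" by simp
    qed
    show "AE x in M. norm ((norm (F n x - f x))\<^sup>2) \<le> 4 * (norm (G x))\<^sup>2" for n
      using bd[of n] bdf
    proof eventually_elim
      fix x assume "norm (F n x) \<le> norm (G x)" "norm (f x) \<le> norm (G x)"
      then have "norm (F n x - f x) \<le> 2 * norm (G x)"
        using norm_triangle_ineq4[of "F n x" "f x"] by linarith
      from power_mono[OF this norm_ge_zero, of 2]
      show "norm ((norm (F n x - f x))\<^sup>2) \<le> 4 * (norm (G x))\<^sup>2" by (simp add: power_mult_distrib)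
    qed
  qed simp
  then have "(\<lambda>n. sqrt (LINT x|M. (norm (F n x - f x))\<^sup>2)) \<longlonglongrightarrow> sqrt 0" by (intro tendsto_intros) simp
  then show "(\<lambda>n. l2norm M (\<lambda>x. F n x - f x)) \<longlonglongrightarrow> 0" by (simp add: l2norm_def)
qed

text \<open>The Riesz-Fischer theorem. Along a subsequence with consecutive distances at most 2^-k
  the telescoping series converges absolutely almost everywhere, and Fatou's lemma turns the
  pointwise limit into a limit in norm.\<close>

lemma l2_complete:
  fixes F :: "nat \<Rightarrow> 'a \<Rightarrow> 'b::euclidean_space"
  assumes F: "\<And>n. square_integrable M (F n)"
    and Cauchy: "\<And>e. e > 0 \<Longrightarrow> \<exists>N. \<forall>m\<ge>N. \<forall>n\<ge>N. l2norm M (\<lambda>x. F m x - F n x) < e"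
  obtains f where "square_integrable M f" "(\<lambda>n. l2norm M (\<lambda>x. F n x - f x)) \<longlonglongrightarrow> 0"
proof -
  note [measurable] = square_integrableD(1)[OF F]
  have "\<forall>k. \<exists>N. \<forall>m\<ge>N. \<forall>n\<ge>N. l2norm M (\<lambda>x. F m x - F n x) < (1/2)^k" using Cauchy by simp
  then obtain N where N: "\<And>k m n. m \<ge> N k \<Longrightarrow> n \<ge> N k \<Longrightarrow> l2norm M (\<lambda>x. F m x - F n x) < (1/2)^k" by metis
  \<comment> \<open>The sum makes \<open>r\<close> monotone and at least \<open>N k\<close>; the
    summand \<open>k\<close> forces \<open>r k\<close> to be at least \<open>k\<close>, so that the
    subsequence enters every tail.\<close>
  define r where "r k = (\<Sum>i\<le>k. N i) + k" for k
  have rN: "N k \<le> r k" for k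
    using member_le_sum[of k "{..k}" N] by (simp add: r_def trans_le_add1)
  have rmono: "r k \<le> r (Suc k)" for k by (simp add: r_def)
  have kr: "k \<le> r k" for k by (simp add: r_def)
  define E where "E k x = F (r (Suc k)) x - F (r k) x" for k x
  have [measurable]: "E k \<in> borel_measurable M" for k unfolding E_def by measurable
  have Esq: "square_integrable M (E k)" for k unfolding E_def by (intro square_integrable_diff F)
  have Ebd: "l2norm M (E k) \<le> (1/2)^k" for k
    unfolding E_def using N[of k "r (Suc k)" "r k"] rN[of k] rmono[of k] by simp
  \<comment> \<open>The weight 2^k replaces a square root: t \<le> 2^k t^2 + 2^-k, so finiteness of
    the weighted sum of squares at x gives absolute convergence at x. The integral of the k-th
    summand is at most 2^k (2^-k)^2 = 2^-k.\<close>
  have "(\<integral>\<^sup>+x. (\<Sum>k. ennreal (2^k * (norm (E k x))\<^sup>2)) \<partial>M) = (\<Sum>k. \<integral>\<^sup>+x. ennreal (2^k * (norm (E k x))\<^sup>2) \<partial>M)"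
    by (rule nn_integral_suminf) measurable
  also have "\<dots> \<le> (\<Sum>k. ennreal ((1/2)^k))"
  proof (rule suminf_le)
    fix k
    have "(\<integral>\<^sup>+x. ennreal (2^k * (norm (E k x))\<^sup>2) \<partial>M) = ennreal (2^k) * ennreal ((l2norm M (E k))\<^sup>2)"
      unfolding l2norm_nn_integral[OF Esq, symmetric] by (subst nn_integral_cmult[symmetric]) (auto simp: ennreal_mult)
    also have "\<dots> = ennreal (2^k * (l2norm M (E k))\<^sup>2)" by (simp add: ennreal_mult)
    also have "\<dots> \<le> ennreal (2^k * ((1/2)^k)\<^sup>2)"
      using power_mono[OF Ebd, of k 2] by (intro ennreal_leI mult_left_mono) auto
    also have "2^k * ((1/2)^k)\<^sup>2 = (1/2::real)^k"
      by (simp add: power2_eq_square power_divide)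
    finally show "(\<integral>\<^sup>+x. ennreal (2^k * (norm (E k x))\<^sup>2) \<partial>M) \<le> ennreal ((1/2)^k)" .
  qed auto
  also have "\<dots> = ennreal (\<Sum>k. (1/2)^k)"
    by (intro suminf_ennreal2) (auto simp: summable_geometric)
  also have "\<dots> < \<infinity>" by simp
  finally have fin: "(\<integral>\<^sup>+x. (\<Sum>k. ennreal (2^k * (norm (E k x))\<^sup>2)) \<partial>M) \<noteq> \<infinity>" by simp
  have "AE x in M. (\<Sum>k. ennreal (2^k * (norm (E k x))\<^sup>2)) \<noteq> \<infinity>"
    by (rule nn_integral_noteq_infinite[OF _ fin]) measurable
  then have conv: "AE x in M. convergent (\<lambda>k. F (r k) x)"
  proof eventually_elim
    fix x assume "(\<Sum>k. ennreal (2^k * (norm (E k x))\<^sup>2)) \<noteq> \<infinity>"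
    then have s: "summable (\<lambda>k. 2^k * (norm (E k x))\<^sup>2)"
      by (intro summable_suminf_not_top) (auto simp: infinity_ennreal_def)
    have "summable (\<lambda>k. 2^k * (norm (E k x))\<^sup>2 + (1/2)^k)"
      by (intro summable_add s summable_geometric) simp
    then have "summable (\<lambda>k. E k x)"
    proof (rule summable_comparison_test')
      fix k
      have "2 ^ k * norm (E k x) * 1 \<le> ((2^k * norm (E k x))\<^sup>2 + 1\<^sup>2)"
      proof -
        have "0 \<le> 2^k * norm (E k x)" by simp
        then show ?thesis using sum_squares_bound[of "2^k * norm (E k x)" 1]
          by (simp only: one_power2 mult_1_right)
      qed
      then have "2^k * norm (E k x) \<le> 2^k * (2^k * (norm (E k x))\<^sup>2 + (1/2)^k)"
        by (simp add: power2_eq_square algebra_simps power_divide)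
      then show "norm (E k x) \<le> 2 ^ k * (norm (E k x))\<^sup>2 + (1 / 2) ^ k" by simp
    qed
    then have "summable (\<lambda>k. F (r (Suc k)) x - F (r k) x)" by (simp add: E_def)
    then have "convergent (\<lambda>n. \<Sum>k<n. F (r (Suc k)) x - F (r k) x)" by (simp add: summable_iff_convergent)
    then have "convergent (\<lambda>n. F (r n) x - F (r 0) x)" by (simp add: sum_lessThan_telescope[of "\<lambda>n. F (r n) x"])
    then show "convergent (\<lambda>n. F (r n) x)" by (simp add: convergent_diff_const_right_iff)
  qed
  define f where "f x = lim (\<lambda>k. F (r k) x)" for x
  have fm [measurable]: "f \<in> borel_measurable M" unfolding f_def by (rule borel_measurable_lim_metric) measurable
  have tof: "AE x in M. (\<lambda>k. F (r k) x) \<longlonglongrightarrow> f x"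
    using conv by eventually_elim (simp add: f_def convergent_LIMSEQ_iff)
  have main: "square_integrable M (\<lambda>x. F n x - f x) \<and> l2norm M (\<lambda>x. F n x - f x) \<le> e"
    if e: "e > 0" and n: "\<forall>m\<ge>K. \<forall>n\<ge>K. l2norm M (\<lambda>x. F m x - F n x) < e" "n \<ge> K" for e n K
  proof -
    have "(\<integral>\<^sup>+x. ennreal ((norm (F n x - f x))\<^sup>2) \<partial>M) = (\<integral>\<^sup>+x. liminf (\<lambda>k. ennreal ((norm (F n x - F (r k) x))\<^sup>2)) \<partial>M)"
    proof (rule nn_integral_cong_AE, use tof in eventually_elim)
      fix x assume "(\<lambda>k. F (r k) x) \<longlonglongrightarrow> f x"
      then have "(\<lambda>k. ennreal ((norm (F n x - F (r k) x))\<^sup>2)) \<longlonglongrightarrow> ennreal ((norm (F n x - f x))\<^sup>2)"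
        by (intro tendsto_ennrealI tendsto_intros)
      then show "ennreal ((norm (F n x - f x))\<^sup>2) = liminf (\<lambda>k. ennreal ((norm (F n x - F (r k) x))\<^sup>2))"
        by (intro lim_imp_Liminf[symmetric]) simp_all
    qed
    also have "\<dots> \<le> liminf (\<lambda>k. \<integral>\<^sup>+x. ennreal ((norm (F n x - F (r k) x))\<^sup>2) \<partial>M)"
      by (rule nn_integral_liminf) measurable
    also have "\<dots> \<le> ennreal (e\<^sup>2)"
    proof (rule Liminf_le)
      show "\<forall>\<^sub>F k in sequentially. (\<integral>\<^sup>+x. ennreal ((norm (F n x - F (r k) x))\<^sup>2) \<partial>M) \<le> ennreal (e\<^sup>2)"
        using eventually_ge_at_top[of K]
      proof eventually_elim
        fix k assume "K \<le> k"
        then have "l2norm M (\<lambda>x. F n x - F (r k) x) < e" using n kr[of k] by auto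
        then have "(l2norm M (\<lambda>x. F n x - F (r k) x))\<^sup>2 \<le> e\<^sup>2" by (intro power_mono) auto
        then show "(\<integral>\<^sup>+x. ennreal ((norm (F n x - F (r k) x))\<^sup>2) \<partial>M) \<le> ennreal (e\<^sup>2)"
          by (simp add: l2norm_nn_integral[OF square_integrable_diff[OF F F]])
      qed
    qed simp
    finally have le: "(\<integral>\<^sup>+x. ennreal ((norm (F n x - f x))\<^sup>2) \<partial>M) \<le> ennreal (e\<^sup>2)" .
    have m: "(\<lambda>x. F n x - f x) \<in> borel_measurable M" by measurable
    show ?thesis using square_integrable_nn_integralI[OF m le] e by simp
  qed
  have "\<exists>K. \<forall>m\<ge>K. \<forall>n\<ge>K. l2norm M (\<lambda>x. F m x - F n x) < 1" using Cauchy by simp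
  then obtain K where "\<forall>m\<ge>K. \<forall>n\<ge>K. l2norm M (\<lambda>x. F m x - F n x) < 1" by blast
  from main[OF _ this order_refl] have "square_integrable M (\<lambda>x. F K x - f x)" by simp
  from square_integrable_diff[OF F[of K] this] have "square_integrable M f" by simp
  moreover have "(\<lambda>n. l2norm M (\<lambda>x. F n x - f x)) \<longlonglongrightarrow> 0"
  proof (rule LIMSEQ_I)
    fix e :: real assume e: "0 < e"
    then obtain K where "\<forall>m\<ge>K. \<forall>n\<ge>K. l2norm M (\<lambda>x. F m x - F n x) < e/2" using Cauchy[of "e/2"] by auto
    from main[OF _ this] e show "\<exists>no. \<forall>n\<ge>no. norm (l2norm M (\<lambda>x. F n x - f x) - 0) < e"
      by (intro exI[of _ K]) fastforce
  qed
  ultimately show ?thesis using that by blast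
qed


section \<open>Uniqueness of weak gradients\<close>

text \<open>If b is the bump of the box, the test functions k b / (1 + k b) lie between 0 and 1 and
  tend to the indicator of the open box, so dominated convergence carries the vanishing over to it.
  The boundary of the box is a null set.\<close>

lemma integral_cbox_zero_of_tests:
  fixes h :: "real ^ 'd \<Rightarrow> real"
  assumes D: "open D" and cd: "cbox c d \<subseteq> D" and h: "h absolutely_integrable_on cbox c d"
    and zero: "\<And>f. f \<in> test_functions D \<Longrightarrow> (LINT x|lebesgue_on D. h x * f x) = 0"
  shows "integral (cbox c d) h = 0"
proof -
  have Ds: "D \<inter> space lebesgue \<in> sets lebesgue" using D by simp
  obtain b where b: "b \<in> test_functions D" "\<And>x. x \<in> box c d \<Longrightarrow> b x > 0"
    "\<And>x. x \<notin> box c d \<Longrightarrow> b x = 0" "\<And>x. b x \<ge> 0"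
    using test_bump_box[OF cd] by metis
  define \<phi> where "\<phi> k x = b x * (real k / (1 + real k * b x))" for k x
  have den: "1 + real k * b x > 0" for k x using b(4)[of x] by (simp add: add_pos_nonneg)
  have \<phi>: "\<phi> k \<in> test_functions D" for k
    unfolding \<phi>_def
    by (rule test_mult[OF b(1)], rule smooth_divide[OF smooth_const _ den], rule smooth_add[OF smooth_const],
        rule smooth_cmult, rule test_smooth[OF b(1)])
  have \<phi>_bd: "\<bar>\<phi> k x\<bar> \<le> 1" for k x
    using den[of k x] b(4)[of x] by (simp add: \<phi>_def abs_mult divide_le_eq)
  have \<phi>_lim: "(\<lambda>k. \<phi> k x) \<longlonglongrightarrow> indicator (box c d) x" for x
  proof (cases "x \<in> box c d")
    case True
    then have "(\<lambda>k. b x * (real k / (1 + real k * b x))) \<longlonglongrightarrow> 1" using b(2)[OF True] by real_asymp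
    then show ?thesis using True by (simp add: \<phi>_def)
  next
    case False
    then show ?thesis by (simp add: \<phi>_def b(3))
  qed
  define g where "g x = indicator (cbox c d) x * h x" for x
  have gi: "integrable (lebesgue_on D) g"
  proof -
    have "integrable lebesgue (\<lambda>x. indicator (cbox c d) x *\<^sub>R h x)" using h by (simp add: set_integrable_def)
    moreover have "(\<lambda>x. indicator D x *\<^sub>R g x) = (\<lambda>x. indicator (cbox c d) x *\<^sub>R h x)"
      using cd by (auto simp: g_def indicator_def fun_eq_iff)
    ultimately show ?thesis by (simp add: integrable_restrict_space[OF Ds])
  qed
  have eq: "h x * \<phi> k x = g x * \<phi> k x" for x k
    using box_subset_cbox[of c d] b(3)[of x] by (auto simp: g_def \<phi>_def indicator_def)
  have "(\<lambda>k. LINT x|lebesgue_on D. h x * \<phi> k x) \<longlonglongrightarrow> (LINT x|lebesgue_on D. g x * indicator (box c d) x)"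
    unfolding eq
  proof (rule integral_dominated_convergence)
    show "integrable (lebesgue_on D) (\<lambda>x. \<bar>g x\<bar>)" using gi by simp
    show "(\<lambda>x. g x * \<phi> k x) \<in> borel_measurable (lebesgue_on D)" for k
      using D by (intro borel_measurable_times borel_measurable_integrable[OF gi]
        continuous_imp_measurable_on_sets_lebesgue smooth_imp_continuous test_smooth[OF \<phi>]) simp
    show "(\<lambda>x. g x * indicator (box c d) x) \<in> borel_measurable (lebesgue_on D)"
    proof -
      have "box c d \<in> sets lebesgue" by simp
      then have "indicator (box c d) \<in> borel_measurable lebesgue" by (rule borel_measurable_indicator)
      then have "(indicator (box c d) :: _ \<Rightarrow> real) \<in> borel_measurable (lebesgue_on D)" by (rule measurable_restrict_space1)
      then show ?thesis using gi by (intro borel_measurable_times) auto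
    qed
    show "AE x in lebesgue_on D. (\<lambda>k. g x * \<phi> k x) \<longlonglongrightarrow> g x * indicator (box c d) x"
      by (intro AE_I2 tendsto_intros \<phi>_lim)
    show "AE x in lebesgue_on D. norm (g x * \<phi> k x) \<le> \<bar>g x\<bar>" for k
      using \<phi>_bd by (intro AE_I2) (simp add: abs_mult mult_left_le)
  qed
  then have "(LINT x|lebesgue_on D. g x * indicator (box c d) x) = 0"
    using zero[OF \<phi>] by (simp add: LIMSEQ_const_iff)
  moreover have "(LINT x|lebesgue_on D. g x * indicator (box c d) x) = (LINT x:box c d|lebesgue. h x)"
    unfolding integral_restrict_space[OF Ds] set_lebesgue_integral_def
    using cd box_subset_cbox[of c d] by (intro Bochner_Integration.integral_cong) (auto simp: g_def indicator_def)
  moreover have "set_integrable lebesgue (box c d) h"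
    using h by (rule set_integrable_subset) (auto simp: box_subset_cbox)
  then have "(LINT x:box c d|lebesgue. h x) = integral (box c d) h"
    by (rule set_lebesgue_integral_eq_integral)
  ultimately show ?thesis by (simp add: integral_open_interval)
qed

text \<open>Lebesgue differentiation along the cubes with lower corner x: for an interior x off the
  exceptional null set, the averages converge to h x, and they are all 0 once the cube fits into the
  box.\<close>

lemma negligible_nonzero_of_zero_integrals:
  fixes h :: "'a::euclidean_space \<Rightarrow> real"
  assumes h: "h absolutely_integrable_on cbox c d"
    and zero: "\<And>u v. cbox u v \<subseteq> cbox c d \<Longrightarrow> integral (cbox u v) h = 0"
  shows "negligible {x \<in> cbox c d. h x \<noteq> 0}"
proof -
  \<comment> \<open>Extension by zero, because the differentiation theorem asks for integrability on
    every box.\<close>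
  define k where "k x = (if x \<in> cbox c d then h x else 0)" for x
  have "h integrable_on cbox c d" using h by (rule set_lebesgue_integral_eq_integral(1))
  then have "k integrable_on UNIV" unfolding k_def by (simp add: integrable_restrict_UNIV)
  then have k: "k integrable_on cbox u v" for u v by (rule integrable_on_subcbox) simp
  obtain N where N: "negligible N" "\<And>x e. \<lbrakk>x \<notin> N; 0 < e\<rbrakk> \<Longrightarrow>
     \<exists>d>0. \<forall>h. 0 < h \<and> h < d \<longrightarrow> norm(integral (cbox x (x + h *\<^sub>R One)) k /\<^sub>R h ^ DIM('a) - k x) < e"
    using integrable_ccontinuous_explicit[OF k] by blast
  have "h x = 0" if x: "x \<in> box c d" "x \<notin> N" for x
  proof (rule ccontr)
    assume "h x \<noteq> 0"
    then obtain t where t: "t > 0" "\<And>s. 0 < s \<Longrightarrow> s < t \<Longrightarrow>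
        norm(integral (cbox x (x + s *\<^sub>R One)) k /\<^sub>R s ^ DIM('a) - k x) < \<bar>h x\<bar>"
      using N(2)[OF x(2), of "\<bar>h x\<bar>"] by auto
    have "\<exists>s>0. s < t \<and> cbox x (x + s *\<^sub>R One) \<subseteq> cbox c d"
    proof -
      obtain e where e: "e > 0" "ball x e \<subseteq> box c d"
        using x(1) open_box open_contains_ball by blast
      \<comment> \<open>\<open>t/2\<close> keeps the side below the differentiation threshold; the
        second term bounds the l^1 diameter of the cube by e/2, so the cube stays in the
        ball.\<close>
      define s where "s = min (t/2) (e / (2 * real DIM('a)))"
      have s: "0 < s" "s < t" "s * DIM('a) < e"
        using t(1) e(1) by (auto simp: s_def min_def field_simps split: if_splits)
      have "cbox x (x + s *\<^sub>R One) \<subseteq> ball x e"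
      proof
        fix y assume y: "y \<in> cbox x (x + s *\<^sub>R One)"
        have "norm (y - x) \<le> (\<Sum>b\<in>Basis. \<bar>(y - x) \<bullet> b\<bar>)" by (rule norm_le_l1)
        also have "\<dots> \<le> (\<Sum>b\<in>(Basis::'a set). s)"
          using y by (intro sum_mono) (auto simp: mem_box inner_diff_left inner_add_left)
        also have "\<dots> < e" using s by (simp add: mult.commute)
        finally show "y \<in> ball x e" by (simp add: dist_norm norm_minus_commute)
      qed
      then show ?thesis using s e(2) box_subset_cbox[of c d] by blast
    qed
    then obtain s where s: "0 < s" "s < t" "cbox x (x + s *\<^sub>R One) \<subseteq> cbox c d" by blast
    have "integral (cbox x (x + s *\<^sub>R One)) k = integral (cbox x (x + s *\<^sub>R One)) h"
      using s(3) by (intro integral_cong) (auto simp: k_def)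
    then have "norm (- k x) < \<bar>h x\<bar>" using t(2)[OF s(1,2)] zero[OF s(3)] by simp
    then show False using x(1) box_subset_cbox[of c d] by (auto simp: k_def)
  qed
  then have "{x \<in> cbox c d. h x \<noteq> 0} \<subseteq> N \<union> (cbox c d - box c d)" by blast
  moreover have "negligible (N \<union> (cbox c d - box c d))"
    using N(1) negligible_frontier_interval by (intro negligible_Un)
  ultimately show ?thesis by (rule negligible_subset[rotated])
qed

text \<open>The fundamental lemma of the calculus of variations. An open set is a countable union of
  compact boxes, and on each of them the function is negligible by the two preceding lemmas.\<close>

lemma AE_zero_of_tests:
  fixes h :: "real ^ 'd \<Rightarrow> real"
  assumes D: "open D" and h: "\<And>K. compact K \<Longrightarrow> K \<subseteq> D \<Longrightarrow> h absolutely_integrable_on K"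
    and zero: "\<And>f. f \<in> test_functions D \<Longrightarrow> (LINT x|lebesgue_on D. h x * f x) = 0"
  shows "AE x in lebesgue_on D. h x = 0"
proof -
  obtain \<D> where \<D>: "countable \<D>" "\<D> \<subseteq> Pow D" "\<And>X. X \<in> \<D> \<Longrightarrow> \<exists>a b. X = cbox a b" "\<Union>\<D> = D"
    by (rule open_countable_Union_open_cbox[OF D]) (rule that; assumption)
  have neg: "negligible {x \<in> X. h x \<noteq> 0}" if "X \<in> \<D>" for X
  proof -
    obtain c d where X: "X = cbox c d" using \<D>(3) \<open>X \<in> \<D>\<close> by blast
    then have cd: "cbox c d \<subseteq> D" using \<D>(2) that by blast
    show ?thesis unfolding X
    proof (rule negligible_nonzero_of_zero_integrals)
      show "h absolutely_integrable_on cbox c d" by (rule h[OF compact_cbox cd])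
      show "integral (cbox u v) h = 0" if "cbox u v \<subseteq> cbox c d" for u v
    proof -
        have uv: "cbox u v \<subseteq> D" using that cd by (rule subset_trans)
        show ?thesis by (rule integral_cbox_zero_of_tests[OF D uv h[OF compact_cbox uv] zero])
      qed
    qed
  qed
  have "{x \<in> D. h x \<noteq> 0} = (\<Union>X\<in>\<D>. {x \<in> X. h x \<noteq> 0})" using \<D>(4) by blast
  moreover have "negligible (\<Union>X\<in>\<D>. {x \<in> X. h x \<noteq> 0})"
  proof (rule negligible_countable_Union)
    show "countable ((\<lambda>X. {x \<in> X. h x \<noteq> 0}) ` \<D>)" using \<D>(1) by (rule countable_image)
    show "negligible S" if S: "S \<in> (\<lambda>X. {x \<in> X. h x \<noteq> 0}) ` \<D>" for S
      using S by (rule imageE) (simp only: neg)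
  qed
  ultimately have "{x \<in> D. h x \<noteq> 0} \<in> null_sets lebesgue" by (simp add: negligible_iff_null_sets)
  then have "AE x in lebesgue. x \<in> D \<longrightarrow> h x = 0" by (rule AE_I') blast
  then show ?thesis using D by (subst AE_restrict_space_iff) auto
qed

lemma locally_integrable_mult_test:
  fixes h :: "real ^ 'd \<Rightarrow> real"
  assumes D: "open D" and h: "\<And>K. compact K \<Longrightarrow> K \<subseteq> D \<Longrightarrow> h absolutely_integrable_on K"
    and f: "f \<in> test_functions D"
  shows "integrable (lebesgue_on D) (\<lambda>x. h x * f x)"
proof -
  have Ds: "D \<inter> space lebesgue \<in> sets lebesgue" using D by simp
  obtain K where K: "smooth f" "compact K" "K \<subseteq> D" "\<And>x. x \<notin> K \<Longrightarrow> f x = 0"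
    using f by (rule test_functionsE) blast
  obtain B where B: "\<And>x. \<bar>f x\<bar> \<le> B" using test_bounded[OF f] by metis
  have i: "integrable lebesgue (\<lambda>x. indicator K x *\<^sub>R h x)" using h[OF K(2,3)] by (simp add: set_integrable_def)
  have "integrable lebesgue (\<lambda>x. (indicator K x *\<^sub>R h x) * f x)"
  proof (rule Bochner_Integration.integrable_bound)
    show "integrable lebesgue (\<lambda>x. B * norm (indicator K x *\<^sub>R h x))" using i by simp
    show "(\<lambda>x. (indicator K x *\<^sub>R h x) * f x) \<in> borel_measurable lebesgue"
      using i continuous_imp_measurable_on_sets_lebesgue[OF smooth_imp_continuous[OF K(1)], of UNIV]
      by (intro borel_measurable_times) (auto simp: lebesgue_on_UNIV_eq)
    show "AE x in lebesgue. norm ((indicator K x *\<^sub>R h x) * f x) \<le> norm (B * norm (indicator K x *\<^sub>R h x))"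
    proof (intro AE_I2)
      fix x
      have "0 \<le> B" using B[of x] by linarith
      then show "norm ((indicator K x *\<^sub>R h x) * f x) \<le> norm (B * norm (indicator K x *\<^sub>R h x))"
        using B[of x] by (simp add: abs_mult mult.commute mult_right_mono mult_left_mono)
    qed
  qed
  moreover have "(\<lambda>x. (indicator K x *\<^sub>R h x) * f x) = (\<lambda>x. indicator D x *\<^sub>R (h x * f x))"
    using K(3,4) by (auto simp: indicator_def fun_eq_iff)
  ultimately show ?thesis by (simp add: integrable_restrict_space[OF Ds])
qed

lemma absolutely_integrable_component:
  fixes g :: "'a::euclidean_space \<Rightarrow> real ^ 'd"
  assumes "g absolutely_integrable_on K" shows "(\<lambda>x. g x $ i) absolutely_integrable_on K"
  using absolutely_integrable_linear[OF assms bounded_linear_vec_nth[of i]] by (simp add: o_def)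

text \<open>This is why the choice in \<open>wgrad\<close> is harmless: any weak gradient that is
  known explicitly may replace the chosen one almost everywhere.\<close>

lemma weak_gradient_unique:
  assumes D: "open D" and g: "has_weak_gradient D u g" and g': "has_weak_gradient D u g'"
  shows "AE x in lebesgue_on D. g x = g' x"
proof -
  have loc: "(\<lambda>x. g x $ i) absolutely_integrable_on K" "(\<lambda>x. g' x $ i) absolutely_integrable_on K"
    if "compact K" "K \<subseteq> D" for K i
    using g g' that by (auto intro: absolutely_integrable_component simp: has_weak_gradient_def)
  have "AE x in lebesgue_on D. g x $ i - g' x $ i = 0" for i
  proof (rule AE_zero_of_tests[OF D])
    show "(\<lambda>x. g x $ i - g' x $ i) absolutely_integrable_on K" if "compact K" "K \<subseteq> D" for K
      using loc[OF that] by (rule set_integral_diff(1))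
    fix f assume f: "f \<in> test_functions D"
    have "(LINT x|lebesgue_on D. u x * grad f x $ i) = - (LINT x|lebesgue_on D. g x $ i * f x)"
      "(LINT x|lebesgue_on D. u x * grad f x $ i) = - (LINT x|lebesgue_on D. g' x $ i * f x)"
      using g g' f by (auto simp: has_weak_gradient_def)
    then have "(LINT x|lebesgue_on D. g x $ i * f x) = (LINT x|lebesgue_on D. g' x $ i * f x)" by simp
    then show "(LINT x|lebesgue_on D. (g x $ i - g' x $ i) * f x) = 0"
      using locally_integrable_mult_test[OF D loc(1) f] locally_integrable_mult_test[OF D loc(2) f]
      by (simp add: left_diff_distrib)
  qed
  then have "AE x in lebesgue_on D. \<forall>i. g x $ i - g' x $ i = 0" by (simp add: AE_all_countable)
  then show ?thesis by eventually_elim (simp add: vec_eq_iff)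
qed

lemma has_weak_gradient_diff:
  assumes D: "open D" and u: "has_weak_gradient D u g" and v: "has_weak_gradient D v h"
  shows "has_weak_gradient D (\<lambda>x. u x - v x) (\<lambda>x. g x - h x)"
  unfolding has_weak_gradient_def
proof (intro conjI allI impI ballI)
  fix K assume K: "compact K \<and> K \<subseteq> D"
  then show "(\<lambda>x. u x - v x) absolutely_integrable_on K" "(\<lambda>x. g x - h x) absolutely_integrable_on K"
    using u v by (auto intro!: set_integral_diff(1) simp: has_weak_gradient_def)
next
  fix f i assume f: "f \<in> test_functions D"
  have loc: "u absolutely_integrable_on K" "v absolutely_integrable_on K"
    "(\<lambda>x. g x $ i) absolutely_integrable_on K" "(\<lambda>x. h x $ i) absolutely_integrable_on K"
    if "compact K" "K \<subseteq> D" for K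
    using u v that by (auto intro: absolutely_integrable_component simp: has_weak_gradient_def)
  \<comment> \<open>A partial derivative of a test function is again a test function, so the
    integrals on the left-hand side can be split by the same integrability lemma as those on the
    right.\<close>
  have df: "(\<lambda>x. grad f x $ i) \<in> test_functions D"
  proof -
    obtain K where K: "smooth f" "compact K" "K \<subseteq> D" "\<And>x. x \<notin> K \<Longrightarrow> grad f x = 0"
      using f by (rule test_functionsE) blast
    have "Ck (Suc k) f" for k using K(1) by (simp only: smooth_def)
    then have "smooth (\<lambda>x. grad f x $ i)" by (simp add: smooth_def)
    then show ?thesis by (rule test_functionsI[OF _ K(2,3)]) (simp add: K(4))
  qed
  note I = locally_integrable_mult_test[OF D loc(1) df] locally_integrable_mult_test[OF D loc(2) df]
    locally_integrable_mult_test[OF D loc(3) f] locally_integrable_mult_test[OF D loc(4) f]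
  have "(LINT x|lebesgue_on D. u x * grad f x $ i) = - (LINT x|lebesgue_on D. g x $ i * f x)"
    "(LINT x|lebesgue_on D. v x * grad f x $ i) = - (LINT x|lebesgue_on D. h x $ i * f x)"
    using u v f by (auto simp: has_weak_gradient_def)
  then show "(LINT x|lebesgue_on D. (u x - v x) * grad f x $ i) = - (LINT x|lebesgue_on D. (g x - h x) $ i * f x)"
    using I by (simp add: left_diff_distrib)
qed


section \<open>Integration by parts\<close>

text \<open>The integral of a partial derivative of a compactly supported function vanishes because the
  integrals of its difference quotients do, by translation invariance.\<close>

lemma integral_grad_zero:
  fixes f :: "real ^ 'd \<Rightarrow> real"
  assumes "f \<in> test_functions D"
  shows "(LINT x|lborel. grad f x $ i) = 0"
proof -
  obtain K where K: "smooth f" "compact K" "\<And>x. x \<notin> K \<Longrightarrow> f x = 0" "\<And>x. x \<notin> K \<Longrightarrow> grad f x = 0"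
    using assms by (rule test_functionsE) blast
  obtain B where B: "B > 0" "\<And>x. \<bar>f x\<bar> \<le> B" "\<And>x. norm (grad f x) \<le> B" using test_bounded[OF assms] by metis
  have diff: "f differentiable at x" for x by (rule smooth_imp_differentiable[OF K(1)])
  have fm [measurable]: "f \<in> borel_measurable borel"
    by (rule borel_measurable_continuous_onI[OF smooth_imp_continuous[OF K(1)]])
  have "bounded K" using K(2) by (rule compact_imp_bounded)
  then obtain R where R: "\<And>x. x \<in> K \<Longrightarrow> norm x \<le> R" by (auto simp: bounded_iff)
  define t where "t n = 1 / real (Suc n)" for n
  have t: "0 < t n" "t n \<le> 1" for n by (auto simp: t_def)
  have tlim: "t \<longlonglongrightarrow> 0" unfolding t_def by (rule LIMSEQ_Suc[OF lim_1_over_n])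
  define e where "e = (axis i 1 :: real ^ 'd)"
  have ne: "norm e = 1" by (simp add: e_def)
  define q where "q n x = (f (t n *\<^sub>R e + x) - f x) / t n" for n x
  \<comment> \<open>The Lipschitz bound is what dominates the difference quotients
    \<open>q n\<close>, uniformly in \<open>n\<close>.\<close>
  have lip: "\<bar>f x - f y\<bar> \<le> B * norm (x - y)" for x y
  proof -
    have "norm (f x - f y) \<le> B * norm (x - y)"
    proof (rule differentiable_bound[of UNIV f "\<lambda>x h. grad f x \<bullet> h"])
      show "(f has_derivative (\<lambda>h. grad f x \<bullet> h)) (at x within UNIV)" for x
        using has_derivative_grad[OF diff] by simp
      show "onorm (\<lambda>h. grad f x \<bullet> h) \<le> B" for x
      proof (rule onorm_le)
        fix y
        have "norm (grad f x \<bullet> y) \<le> norm (grad f x) * norm y" by (simp add: Cauchy_Schwarz_ineq2)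
        also have "\<dots> \<le> B * norm y" by (rule mult_right_mono[OF B(3)]) simp
        finally show "norm (grad f x \<bullet> y) \<le> B * norm y" .
      qed
    qed auto
    then show ?thesis by simp
  qed
  have fint: "integrable lborel f"
  proof (rule Bochner_Integration.integrable_bound)
    show "integrable lborel (\<lambda>x. B * indicator (cball 0 R) x :: real)"
      by (intro integrable_mult_right integrable_real_indicator) (simp_all add: emeasure_lborel_cball_finite[unfolded infinity_ennreal_def])
    show "AE x in lborel. norm (f x) \<le> norm (B * indicator (cball 0 R) x :: real)"
    proof (intro AE_I2)
      show "norm (f x) \<le> norm (B * indicator (cball 0 R) x :: real)" for x
        using B(1,2) K(3)[of x] R[of x] by (cases "x \<in> K") auto
    qed
  qed simp
  have fint': "integrable lborel (\<lambda>x. f (c + x))" for c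
  proof -
    have "integrable (distr lborel borel ((+) c)) f" using fint by (simp add: lborel_distr_plus)
    then show ?thesis by (rule integrable_distr[rotated]) simp
  qed
  have trans: "(LINT x|lborel. f (c + x)) = (LINT x|lborel. f x)" for c
    using integral_distr[of "(+) c" lborel borel f] by (simp add: lborel_distr_plus)
  have q0: "(LINT x|lborel. q n x) = 0" for n
    unfolding q_def using fint fint' by (simp add: trans)
  have "(\<lambda>n. LINT x|lborel. q n x) \<longlonglongrightarrow> (LINT x|lborel. grad f x $ i)"
  proof (rule integral_dominated_convergence)
    \<comment> \<open>The increments \<open>t n\<close> are at most 1, so every difference quotient
      vanishes outside the ball enlarged by 1.\<close>
    show "integrable lborel (\<lambda>x. B * indicator (cball 0 (R + 1)) x :: real)"
      by (intro integrable_mult_right integrable_real_indicator) (simp_all add: emeasure_lborel_cball_finite[unfolded infinity_ennreal_def])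
    show "(\<lambda>x. grad f x $ i) \<in> borel_measurable lborel"
      using smooth_imp_continuous_grad[OF K(1), of UNIV]
      by (simp, intro borel_measurable_continuous_onI continuous_intros)
    show "q n \<in> borel_measurable lborel" for n unfolding q_def by measurable
    show "AE x in lborel. (\<lambda>n. q n x) \<longlonglongrightarrow> grad f x $ i"
    proof (intro AE_I2)
      fix x
      have "((\<lambda>s. f (x + s *\<^sub>R e)) has_derivative (\<lambda>s. grad f (x + 0 *\<^sub>R e) \<bullet> (s *\<^sub>R e))) (at 0)"
        by (rule has_derivative_compose[OF _ has_derivative_grad[OF diff], where f = "\<lambda>s. x + s *\<^sub>R e"])
           (auto intro!: derivative_eq_intros)
      moreover have "(\<lambda>s. grad f (x + 0 *\<^sub>R e) \<bullet> (s *\<^sub>R e)) = (\<lambda>s. grad f x $ i * s)"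
        by (auto simp: e_def inner_axis)
      ultimately have "((\<lambda>s. f (x + s *\<^sub>R e)) has_real_derivative grad f x $ i) (at 0)"
        by (simp add: has_field_derivative_def)
      then have lim: "((\<lambda>s. (f (x + s *\<^sub>R e) - f x) / s) \<longlongrightarrow> grad f x $ i) (at 0)"
        by (simp add: DERIV_def)
      have "filterlim t (at 0) sequentially"
        using tlim t(1) by (auto simp: filterlim_at intro!: always_eventually) (metis less_irrefl)
      from filterlim_compose[OF lim this] show "(\<lambda>n. q n x) \<longlonglongrightarrow> grad f x $ i"
        by (simp add: q_def add.commute)
    qed
    show "AE x in lborel. norm (q n x) \<le> B * indicator (cball 0 (R + 1)) x" for n
    proof (intro AE_I2)
      fix x
      have "\<bar>f (t n *\<^sub>R e + x) - f x\<bar> \<le> B * t n" using lip[of "t n *\<^sub>R e + x" x] ne t(1)[of n] by simp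
      then have 1: "\<bar>q n x\<bar> \<le> B" using t(1)[of n] by (simp add: q_def divide_le_eq abs_divide)
      show "norm (q n x) \<le> B * indicator (cball 0 (R + 1)) x"
      proof (cases "x \<in> cball 0 (R + 1)")
        case True then show ?thesis using 1 by simp
      next
        case False
        then have nx: "norm x > R + 1" by simp
        have "norm x \<le> norm (t n *\<^sub>R e + x) + norm (t n *\<^sub>R e)"
          using norm_triangle_ineq4[of "t n *\<^sub>R e + x" "t n *\<^sub>R e"] by simp
        then have "norm x \<le> norm (t n *\<^sub>R e + x) + 1" using ne t[of n] by simp
        then have "x \<notin> K" "t n *\<^sub>R e + x \<notin> K" using nx R[of x] R[of "t n *\<^sub>R e + x"] by auto
        then show ?thesis using False by (simp add: q_def K(3))
      qed
    qed
  qed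
  then show ?thesis by (simp add: q0 LIMSEQ_const_iff)
qed

lemma integral_lebesgue_on_eq_lborel:
  fixes f :: "'a::euclidean_space \<Rightarrow> real"
  assumes "D \<in> sets lebesgue" "f \<in> borel_measurable borel" "\<And>x. x \<notin> D \<Longrightarrow> f x = 0"
  shows "(LINT x|lebesgue_on D. f x) = (LINT x|lborel. f x)"
proof -
  have "(LINT x|lebesgue_on D. f x) = (LINT x|lebesgue. indicator D x *\<^sub>R f x)"
    using assms(1) by (intro integral_restrict_space) simp
  also have "(\<lambda>x. indicator D x *\<^sub>R f x) = f" using assms(3) by (auto simp: indicator_def fun_eq_iff)
  also have "(LINT x|lebesgue. f x) = (LINT x|lborel. f x)" using assms(2) by (intro integral_completion) simp
  finally show ?thesis .
qed

text \<open>By the product rule the integrand is a partial derivative of the test function f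
  g.\<close>

lemma integral_by_parts_test:
  fixes f g :: "real ^ 'd \<Rightarrow> real"
  assumes D: "open D" and f: "f \<in> test_functions D" and g: "g \<in> test_functions D"
  shows "(LINT x|lebesgue_on D. f x * grad g x $ i + grad f x $ i * g x) = 0"
proof -
  have fg: "(\<lambda>x. f x * g x) \<in> test_functions D" by (rule test_mult[OF f test_smooth[OF g]])
  have "(\<lambda>x. f x * grad g x $ i + grad f x $ i * g x) = (\<lambda>x. grad (\<lambda>x. f x * g x) x $ i)"
    using f g by (auto simp: grad_mult smooth_imp_differentiable test_smooth)
  moreover have "(LINT x|lebesgue_on D. grad (\<lambda>x. f x * g x) x $ i) = (LINT x|lborel. grad (\<lambda>x. f x * g x) x $ i)"
  proof (rule integral_lebesgue_on_eq_lborel)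
    show "D \<in> sets lebesgue" using D by simp
    show "(\<lambda>x. grad (\<lambda>x. f x * g x) x $ i) \<in> borel_measurable borel"
      using smooth_imp_continuous_grad[OF test_smooth[OF fg], of UNIV]
      by (intro borel_measurable_continuous_onI continuous_intros)
    obtain K where "K \<subseteq> D" "\<And>x. x \<notin> K \<Longrightarrow> grad (\<lambda>x. f x * g x) x = 0" using fg by (rule test_functionsE) blast
    then show "grad (\<lambda>x. f x * g x) x $ i = 0" if "x \<notin> D" for x using that by (metis subsetD zero_index)
  qed
  ultimately show ?thesis using integral_grad_zero[OF fg] by simp
qed


section \<open>Jets of test functions\<close>

definition jet :: "(real ^ 'd \<Rightarrow> real) \<Rightarrow> real ^ 'd \<Rightarrow> real \<times> (real ^ 'd)" where
  "jet f x = (f x, grad f x)"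

text \<open>The pairs \<open>(u, \<nabla>u)\<close> with \<open>u\<close> in \<open>H\<^sup>1\<^sub>0\<close>.\<close>

definition jets0 :: "(real ^ 'd) set \<Rightarrow> (real ^ 'd \<Rightarrow> real \<times> (real ^ 'd)) set" where
  "jets0 D = {F. square_integrable (lebesgue_on D) F \<and>
     (\<forall>e>0. \<exists>f\<in>test_functions D. l2norm (lebesgue_on D) (\<lambda>x. F x - jet f x) < e)}"

text \<open>Holds because Lebesgue measure is complete. It gives measurability of
  \<open>wgrad\<close>, of which only almost everywhere equality with a known function is
  available.\<close>

lemma AE_lebesgue_on_measurable:
  fixes f g :: "'a::euclidean_space \<Rightarrow> 'b::euclidean_space"
  assumes D: "D \<in> sets lebesgue" and f: "f \<in> borel_measurable (lebesgue_on D)"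
    and ae: "AE x in lebesgue_on D. f x = g x"
  shows "g \<in> borel_measurable (lebesgue_on D)"
proof -
  have Ds: "D \<inter> space lebesgue \<in> sets lebesgue" using D by simp
  have "(\<lambda>x. indicator D x *\<^sub>R g x) \<in> borel_measurable lebesgue"
  proof (rule borel_measurable_AE)
    show "(\<lambda>x. indicator D x *\<^sub>R f x) \<in> borel_measurable lebesgue"
      using f borel_measurable_restrict_space_iff[OF Ds] by blast
    have "AE x in lebesgue. x \<in> D \<longrightarrow> f x = g x" using ae by (simp add: AE_restrict_space_iff[OF Ds])
    then show "AE x in lebesgue. indicator D x *\<^sub>R f x = indicator D x *\<^sub>R g x"
      by eventually_elim (auto simp: indicator_def)
  qed
  then show ?thesis using borel_measurable_restrict_space_iff[OF Ds] by blast
qed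

lemma square_integrable_bounded:
  assumes "finite_measure M" "f \<in> borel_measurable M" "AE x in M. norm (f x) \<le> B"
  shows "square_integrable M f"
proof -
  interpret finite_measure M by fact
  have "integrable M (\<lambda>x. (norm (f x))\<^sup>2)"
  proof (rule integrable_const_bound)
    show "AE x in M. norm ((norm (f x))\<^sup>2) \<le> B\<^sup>2"
      using assms(3) by eventually_elim (simp add: power_mono)
  qed (use assms(2) in measurable)
  then show ?thesis using assms(2) by (simp add: square_integrable_def)
qed

lemma square_integrable_fst_snd:
  assumes "square_integrable M F"
  shows "square_integrable M (\<lambda>x. fst (F x))" "square_integrable M (\<lambda>x. snd (F x))"
proof -
  note m [measurable] = square_integrableD(1)[OF assms]
  have "norm (fst (F x)) \<le> 1 * norm (F x)" "norm (snd (F x)) \<le> 1 * norm (F x)" for x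
    using norm_fst_le[of "fst (F x)" "snd (F x)"] norm_snd_le[of "snd (F x)" "fst (F x)"] by auto
  then show "square_integrable M (\<lambda>x. fst (F x))" "square_integrable M (\<lambda>x. snd (F x))"
    by (auto intro!: square_integrable_bound(1)[OF assms, of _ 1] measurable_compose[OF m]
        borel_measurable_continuous_onI continuous_intros)
qed

lemma square_integrable_Pair:
  assumes "square_integrable M f" "square_integrable M g"
  shows "square_integrable M (\<lambda>x. (f x, g x))"
proof -
  note m = square_integrableD[OF assms(1)] square_integrableD[OF assms(2)]
  have "(\<lambda>x. (norm (f x, g x))\<^sup>2) = (\<lambda>x. (norm (f x))\<^sup>2 + (norm (g x))\<^sup>2)" by (simp add: norm_Pair fun_eq_iff)
  then show ?thesis using m by (auto simp: square_integrable_def)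
qed

lemma l2norm_fst_snd_le:
  assumes "square_integrable M F"
  shows "l2norm M (\<lambda>x. fst (F x)) \<le> l2norm M F" "l2norm M (\<lambda>x. snd (F x)) \<le> l2norm M F"
proof -
  have "norm (fst (F x)) \<le> norm (F x)" "norm (snd (F x)) \<le> norm (F x)" for x
    using norm_fst_le[of "fst (F x)" "snd (F x)"] norm_snd_le[of "snd (F x)" "fst (F x)"] by auto
  then show "l2norm M (\<lambda>x. fst (F x)) \<le> l2norm M F" "l2norm M (\<lambda>x. snd (F x)) \<le> l2norm M F"
    using square_integrableD(1)[OF square_integrable_fst_snd(1)[OF assms]] square_integrableD(2)[OF assms]
      square_integrableD(1)[OF square_integrable_fst_snd(2)[OF assms]]
    by (auto intro!: l2norm_mono_AE)
qed

lemma integrable_inner_square: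
  fixes f g :: "'a \<Rightarrow> 'b::euclidean_space"
  assumes "square_integrable M f" "square_integrable M g"
  shows "integrable M (\<lambda>x. f x \<bullet> g x)" "\<bar>LINT x|M. f x \<bullet> g x\<bar> \<le> l2norm M f * l2norm M g"
proof -
  note m = square_integrableD(1)[OF assms(1)] square_integrableD(1)[OF assms(2)]
  show i: "integrable M (\<lambda>x. f x \<bullet> g x)"
    by (rule Bochner_Integration.integrable_bound[OF integrable_norm_mult[OF assms]])
       (use m in \<open>auto simp: Cauchy_Schwarz_ineq2\<close>)
  have "\<bar>LINT x|M. f x \<bullet> g x\<bar> \<le> (LINT x|M. \<bar>f x \<bullet> g x\<bar>)" using integral_norm_bound[of M "\<lambda>x. f x \<bullet> g x"] by simp
  also have "\<dots> \<le> (LINT x|M. norm (f x) * norm (g x))"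
    by (rule integral_mono) (use i integrable_norm_mult[OF assms] in \<open>auto simp: Cauchy_Schwarz_ineq2\<close>)
  also have "\<dots> \<le> l2norm M f * l2norm M g" by (rule l2norm_Cauchy_Schwarz[OF assms])
  finally show "\<bar>LINT x|M. f x \<bullet> g x\<bar> \<le> l2norm M f * l2norm M g" .
qed

lemma jet_add: "f \<in> test_functions D \<Longrightarrow> g \<in> test_functions D \<Longrightarrow> jet (\<lambda>x. f x + g x) x = jet f x + jet g x"
  by (simp add: jet_def grad_add smooth_imp_differentiable test_smooth)

lemma jet_cmult: "f \<in> test_functions D \<Longrightarrow> jet (\<lambda>x. c * f x) x = c *\<^sub>R jet f x"
  by (simp add: jet_def grad_mult smooth_imp_differentiable test_smooth smooth_const)

lemma jet_diff:
  assumes "f \<in> test_functions D" "g \<in> test_functions D"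
  shows "jet (\<lambda>x. f x - g x) x = jet f x - jet g x"
  using jet_add[OF assms(1) test_cmult[OF assms(2), of "-1"]] jet_cmult[OF assms(2), of "-1"] by simp

locale bounded_open =
  fixes D :: "(real ^ 'd) set"
  assumes open_D: "open D" and bounded_D: "bounded D"
begin

abbreviation "lD \<equiv> lebesgue_on D"

lemma D_sets [simp]: "D \<in> sets lebesgue" using open_D by simp

lemma finite_lD: "finite_measure lD"
  by (intro finite_measure_lebesgue_on lmeasurable_open open_D bounded_D)

lemma continuous_measurable_lD:
  "continuous_on UNIV f \<Longrightarrow> f \<in> borel_measurable lD"
  by (rule continuous_imp_measurable_on_sets_lebesgue[OF continuous_on_subset]) auto

lemma smooth_measurable_lD: "smooth f \<Longrightarrow> f \<in> borel_measurable lD"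
  and smooth_grad_measurable_lD: "smooth f \<Longrightarrow> grad f \<in> borel_measurable lD"
  by (auto intro: continuous_measurable_lD smooth_imp_continuous smooth_imp_continuous_grad)

lemma jet_square_integrable:
  assumes f: "f \<in> test_functions D" shows "square_integrable lD (jet f)"
proof -
  obtain B where B: "B > 0" "\<And>x. \<bar>f x\<bar> \<le> B" "\<And>x. norm (grad f x) \<le> B" using test_bounded[OF f] by metis
  have "square_integrable lD f" "square_integrable lD (grad f)"
    using B by (auto intro!: square_integrable_bounded[OF finite_lD, of _ B] smooth_measurable_lD
      smooth_grad_measurable_lD test_smooth[OF f])
  then show ?thesis using square_integrable_Pair[of lD f "grad f"] by (simp add: jet_def[abs_def])
qed

lemma jets0_square_integrable: "F \<in> jets0 D \<Longrightarrow> square_integrable lD F"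
  by (simp add: jets0_def)

lemma jets0_approx:
  assumes "F \<in> jets0 D" "e > 0"
  obtains f where "f \<in> test_functions D" "l2norm lD (\<lambda>x. F x - jet f x) < e"
  using assms by (auto simp: jets0_def)

lemma jets0_sequence:
  assumes "F \<in> jets0 D"
  obtains f where "\<And>n. f n \<in> test_functions D" "(\<lambda>n. l2norm lD (\<lambda>x. F x - jet (f n) x)) \<longlonglongrightarrow> 0"
proof -
  have "\<forall>n. \<exists>f. f \<in> test_functions D \<and> l2norm lD (\<lambda>x. F x - jet f x) < 1 / real (Suc n)"
  proof
    fix n
    have "1 / real (Suc n) > 0" by simp
    from jets0_approx[OF assms this]
    show "\<exists>f. f \<in> test_functions D \<and> l2norm lD (\<lambda>x. F x - jet f x) < 1 / real (Suc n)" by metis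
  qed
  then obtain f where f: "\<And>n. f n \<in> test_functions D" "\<And>n. l2norm lD (\<lambda>x. F x - jet (f n) x) < 1 / real (Suc n)"
    by metis
  have "(\<lambda>n. l2norm lD (\<lambda>x. F x - jet (f n) x)) \<longlonglongrightarrow> 0"
  proof (rule tendsto_sandwich[OF _ _ tendsto_const LIMSEQ_Suc[OF lim_1_over_n]])
    show "\<forall>\<^sub>F n in sequentially. l2norm lD (\<lambda>x. F x - jet (f n) x) \<le> 1 / real (Suc n)"
      using f(2) by (simp add: less_imp_le)
  qed simp
  then show ?thesis using that f(1) by blast
qed

section \<open>The pairs form a closed linear space\<close>

lemma jets0_jet: "f \<in> test_functions D \<Longrightarrow> jet f \<in> jets0 D"
  by (auto simp: jets0_def jet_square_integrable l2norm_def intro!: bexI[of _ f])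

lemma jets0_closed:
  assumes "square_integrable lD F" "\<And>e. e > 0 \<Longrightarrow> \<exists>G\<in>jets0 D. l2norm lD (\<lambda>x. F x - G x) < e"
  shows "F \<in> jets0 D"
  unfolding jets0_def
proof (intro CollectI conjI allI impI assms(1))
  fix e :: real assume e: "e > 0"
  obtain G where G: "G \<in> jets0 D" "l2norm lD (\<lambda>x. F x - G x) < e/2"
    using assms(2)[of "e/2"] e by auto
  obtain f where f: "f \<in> test_functions D" "l2norm lD (\<lambda>x. G x - jet f x) < e/2"
    using jets0_approx[OF G(1), of "e/2"] e by auto
  have "l2norm lD (\<lambda>x. F x - jet f x) < e"
    using l2norm_triangle_dist[OF assms(1) jets0_square_integrable[OF G(1)] jet_square_integrable[OF f(1)]] G(2) f(2)
    by simp
  then show "\<exists>f\<in>test_functions D. l2norm lD (\<lambda>x. F x - jet f x) < e" using f(1) by blast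
qed

lemma jets0_closed_sequence:
  assumes "square_integrable lD F" "\<And>n. G n \<in> jets0 D" "(\<lambda>n. l2norm lD (\<lambda>x. G n x - F x)) \<longlonglongrightarrow> 0"
  shows "F \<in> jets0 D"
proof (rule jets0_closed[OF assms(1)])
  fix e :: real assume "e > 0"
  then have "\<forall>\<^sub>F n in sequentially. l2norm lD (\<lambda>x. G n x - F x) < e" by (rule order_tendstoD(2)[OF assms(3)])
  then obtain n where "l2norm lD (\<lambda>x. G n x - F x) < e" by (auto simp: eventually_sequentially)
  then show "\<exists>G\<in>jets0 D. l2norm lD (\<lambda>x. F x - G x) < e"
    using assms(2) by (auto simp: l2norm_minus_commute[of lD F])
qed

lemma jets0_complete:
  assumes "\<And>n. F n \<in> jets0 D" "\<And>e. e > 0 \<Longrightarrow> \<exists>N. \<forall>m\<ge>N. \<forall>n\<ge>N. l2norm lD (\<lambda>x. F m x - F n x) < e"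
  obtains G where "G \<in> jets0 D" "(\<lambda>n. l2norm lD (\<lambda>x. F n x - G x)) \<longlonglongrightarrow> 0"
proof -
  obtain G where "square_integrable lD G" "(\<lambda>n. l2norm lD (\<lambda>x. F n x - G x)) \<longlonglongrightarrow> 0"
    by (rule l2_complete[OF jets0_square_integrable[OF assms(1)] assms(2)])
  then show ?thesis using that jets0_closed_sequence assms(1) by blast
qed

lemma jets0_add:
  assumes F: "F \<in> jets0 D" and G: "G \<in> jets0 D" shows "(\<lambda>x. F x + G x) \<in> jets0 D"
proof -
  note sq = jets0_square_integrable[OF F] jets0_square_integrable[OF G]
  have "\<exists>f\<in>test_functions D. l2norm lD (\<lambda>x. F x + G x - jet f x) < e" if e: "e > 0" for e
  proof -
    obtain f where f: "f \<in> test_functions D" "l2norm lD (\<lambda>x. F x - jet f x) < e/2"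
      using jets0_approx[OF F, of "e/2"] e by auto
    obtain g where g: "g \<in> test_functions D" "l2norm lD (\<lambda>x. G x - jet g x) < e/2"
      using jets0_approx[OF G, of "e/2"] e by auto
    have "l2norm lD (\<lambda>x. F x + G x - jet (\<lambda>x. f x + g x) x) = l2norm lD (\<lambda>x. (F x - jet f x) + (G x - jet g x))"
      by (simp add: jet_add[OF f(1) g(1)] algebra_simps)
    also have "\<dots> \<le> l2norm lD (\<lambda>x. F x - jet f x) + l2norm lD (\<lambda>x. G x - jet g x)"
      by (intro l2norm_triangle square_integrable_diff sq jet_square_integrable f g)
    also have "\<dots> < e" using f(2) g(2) by simp
    finally show ?thesis using test_add[OF f(1) g(1)] by blast
  qed
  then show ?thesis using square_integrable_add[OF sq] by (simp add: jets0_def)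
qed

lemma jets0_scaleR:
  assumes F: "F \<in> jets0 D" shows "(\<lambda>x. c *\<^sub>R F x) \<in> jets0 D"
proof -
  note sq = jets0_square_integrable[OF F]
  have "\<exists>f\<in>test_functions D. l2norm lD (\<lambda>x. c *\<^sub>R F x - jet f x) < e" if e: "e > 0" for e
  proof -
    obtain f where f: "f \<in> test_functions D" "l2norm lD (\<lambda>x. F x - jet f x) < e / (\<bar>c\<bar> + 1)"
      using jets0_approx[OF F, of "e / (\<bar>c\<bar> + 1)"] e by auto
    have "l2norm lD (\<lambda>x. c *\<^sub>R F x - jet (\<lambda>x. c * f x) x) = \<bar>c\<bar> * l2norm lD (\<lambda>x. F x - jet f x)"
      by (simp add: jet_cmult[OF f(1)] l2norm_scaleR flip: scaleR_diff_right)
    also have "\<dots> \<le> \<bar>c\<bar> * (e / (\<bar>c\<bar> + 1))" using f(2) by (intro mult_left_mono) auto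
    also have "\<dots> < e" using e by (simp add: field_simps)
    finally show ?thesis using test_cmult[OF f(1)] by blast
  qed
  then show ?thesis using square_integrable_scaleR[OF sq] by (simp add: jets0_def)
qed

section \<open>Jets and the Sobolev space\<close>

lemma square_integrable_integrable:
  fixes f :: "real ^ 'd \<Rightarrow> 'b::euclidean_space"
  assumes "square_integrable lD f" shows "integrable lD f"
proof -
  interpret finite_measure lD by (rule finite_lD)
  have "square_integrable lD (\<lambda>x. 1::real)" by (rule square_integrable_bounded[OF finite_lD, of _ 1]) auto
  from integrable_norm_mult[OF assms this] have "integrable lD (\<lambda>x. norm (f x))" by simp
  then show ?thesis using assms by (subst (asm) integrable_norm_iff) auto
qed

lemma square_integrable_absolutely_integrable_on:
  fixes f :: "real ^ 'd \<Rightarrow> 'b::euclidean_space"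
  assumes f: "square_integrable lD f" and K: "compact K" "K \<subseteq> D"
  shows "f absolutely_integrable_on K"
proof -
  have "D \<inter> space lebesgue \<in> sets lebesgue" by simp
  then have "integrable lebesgue (\<lambda>x. indicator D x *\<^sub>R f x)"
    using square_integrable_integrable[OF f] by (simp add: integrable_restrict_space)
  then have "f absolutely_integrable_on D" by (simp add: set_integrable_def)
  then show ?thesis by (rule set_integrable_subset) (use K in \<open>auto dest: compact_imp_closed\<close>)
qed

text \<open>The defining identity says that \<open>F\<close> is orthogonal in L^2 to the pair \<Psi>
  formed by the i-th derivative of \<phi> and \<phi> times the i-th unit vector. Jets of test
  functions are orthogonal to it by integration by parts, and orthogonality survives the closure by
  the Cauchy-Schwarz inequality.\<close>

lemma jets0_weak_gradient:
  assumes F: "F \<in> jets0 D"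
  shows "has_weak_gradient D (\<lambda>x. fst (F x)) (\<lambda>x. snd (F x))"
  unfolding has_weak_gradient_def
proof (intro conjI allI impI ballI)
  note sq = jets0_square_integrable[OF F]
  fix K assume "compact K \<and> K \<subseteq> D"
  then show "(\<lambda>x. fst (F x)) absolutely_integrable_on K" "(\<lambda>x. snd (F x)) absolutely_integrable_on K"
    using square_integrable_absolutely_integrable_on square_integrable_fst_snd[OF sq] by blast+
next
  fix \<phi> i assume \<phi>: "\<phi> \<in> test_functions D"
  note sq = jets0_square_integrable[OF F]
  define \<Psi> where "\<Psi> x = (grad \<phi> x $ i, \<phi> x *\<^sub>R axis i (1::real))" for x
  obtain B where B: "B > 0" "\<And>x. \<bar>\<phi> x\<bar> \<le> B" "\<And>x. norm (grad \<phi> x) \<le> B" using test_bounded[OF \<phi>] by metis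
  have s1: "square_integrable lD (\<lambda>x. grad \<phi> x $ i)"
  proof (rule square_integrable_bounded[OF finite_lD, of _ B])
    have "continuous_on UNIV (\<lambda>x. grad \<phi> x $ i)"
      by (intro continuous_intros smooth_imp_continuous_grad test_smooth[OF \<phi>])
    then show "(\<lambda>x. grad \<phi> x $ i) \<in> borel_measurable lD" by (rule continuous_measurable_lD)
    show "AE x in lD. norm (grad \<phi> x $ i) \<le> B"
    proof (intro AE_I2)
      show "norm (grad \<phi> x $ i) \<le> B" for x
        using B(3)[of x] component_le_norm_cart[of "grad \<phi> x" i] by simp
    qed
  qed
  have s2: "square_integrable lD (\<lambda>x. \<phi> x *\<^sub>R axis i (1::real))"
  proof (rule square_integrable_bounded[OF finite_lD, of _ B])
    show "(\<lambda>x. \<phi> x *\<^sub>R axis i (1::real)) \<in> borel_measurable lD"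
      by (intro continuous_measurable_lD continuous_intros smooth_imp_continuous test_smooth[OF \<phi>])
  qed (use B in auto)
  have \<Psi>: "square_integrable lD \<Psi>"
    using square_integrable_Pair[OF s1 s2] by (simp add: \<Psi>_def[abs_def])
  have inner: "G x \<bullet> \<Psi> x = fst (G x) * grad \<phi> x $ i + snd (G x) $ i * \<phi> x" for G :: "_ \<Rightarrow> real \<times> (real^'d)" and x
    by (simp add: \<Psi>_def inner_prod_def inner_axis mult.commute)
  have zero: "(LINT x|lD. jet f x \<bullet> \<Psi> x) = 0" if f: "f \<in> test_functions D" for f
    using integral_by_parts_test[OF open_D f \<phi>, of i] unfolding inner by (simp add: jet_def)
  have small: "\<bar>LINT x|lD. F x \<bullet> \<Psi> x\<bar> \<le> e * l2norm lD \<Psi>" if e: "e > 0" for e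
  proof -
    obtain f where f: "f \<in> test_functions D" "l2norm lD (\<lambda>x. F x - jet f x) < e"
      using jets0_approx[OF F e] by metis
    note sf = jet_square_integrable[OF f(1)]
    have "(LINT x|lD. F x \<bullet> \<Psi> x) = (LINT x|lD. (F x - jet f x) \<bullet> \<Psi> x)"
      using zero[OF f(1)] integrable_inner_square(1)[OF sq \<Psi>] integrable_inner_square(1)[OF sf \<Psi>]
      by (simp add: inner_diff_left)
    also have "\<bar>\<dots>\<bar> \<le> l2norm lD (\<lambda>x. F x - jet f x) * l2norm lD \<Psi>"
      by (rule integrable_inner_square(2)[OF square_integrable_diff[OF sq sf] \<Psi>])
    also have "\<dots> \<le> e * l2norm lD \<Psi>" using f(2) by (intro mult_right_mono) auto
    finally show ?thesis .
  qed
  have "\<bar>LINT x|lD. F x \<bullet> \<Psi> x\<bar> \<le> 0 + e" if e: "e > 0" for e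
  proof -
    \<comment> \<open>The summand 1 covers the case that \<Psi> has norm zero.\<close>
    have "e / (l2norm lD \<Psi> + 1) > 0" using e by (simp add: add_nonneg_pos)
    from small[OF this] have "\<bar>LINT x|lD. F x \<bullet> \<Psi> x\<bar> \<le> e * (l2norm lD \<Psi> / (l2norm lD \<Psi> + 1))" by simp
    also have "\<dots> \<le> e * 1" using e by (intro mult_left_mono) (auto simp: divide_le_eq add_nonneg_pos)
    finally show ?thesis by simp
  qed
  then have z: "(LINT x|lD. F x \<bullet> \<Psi> x) = 0" using field_le_epsilon[of "\<bar>LINT x|lD. F x \<bullet> \<Psi> x\<bar>" 0] by simp
  have i1: "integrable lD (\<lambda>x. fst (F x) * grad \<phi> x $ i)"
    using integrable_inner_square(1)[OF square_integrable_fst_snd(1)[OF sq] s1] by simp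
  have i2: "integrable lD (\<lambda>x. snd (F x) $ i * \<phi> x)"
    using integrable_inner_square(1)[OF square_integrable_fst_snd(2)[OF sq] s2] by (simp add: inner_axis mult.commute)
  show "(LINT x|lD. fst (F x) * grad \<phi> x $ i) = - (LINT x|lD. snd (F x) $ i * \<phi> x)"
    using z i1 i2 by (simp add: inner)
qed

lemma L2_iff: "f \<in> L2 D \<longleftrightarrow> square_integrable lD f"
  by (simp add: L2_def square_integrable_def)

lemma wgrad_eq:
  assumes "has_weak_gradient D u g"
  shows "has_weak_gradient D u (wgrad D u)" "AE x in lD. wgrad D u x = g x"
proof -
  show "has_weak_gradient D u (wgrad D u)" unfolding wgrad_def by (rule someI[of "has_weak_gradient D u", OF assms])
  from weak_gradient_unique[OF open_D this assms] show "AE x in lD. wgrad D u x = g x" .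
qed

lemma wgrad_square_integrable:
  assumes "has_weak_gradient D u g" "square_integrable lD g"
  shows "square_integrable lD (wgrad D u)"
proof -
  have gm: "g \<in> borel_measurable lD" using assms(2) by blast
  have ae: "AE x in lD. g x = wgrad D u x" using wgrad_eq(2)[OF assms(1)] by eventually_elim simp
  have "wgrad D u \<in> borel_measurable lD" by (rule AE_lebesgue_on_measurable[OF D_sets gm ae])
  then show ?thesis using square_integrable_cong_AE[OF gm _ ae] assms(2) by blast
qed

lemma H1_norm_eq:
  assumes "square_integrable lD u" "has_weak_gradient D u g" "square_integrable lD g"
  shows "H1_norm D u = l2norm lD (\<lambda>x. (u x, g x))"
proof -
  have gm: "g \<in> borel_measurable lD" "wgrad D u \<in> borel_measurable lD"
    using wgrad_square_integrable[OF assms(2,3)] assms(3) by blast+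
  have "(LINT x|lD. (norm (wgrad D u x))\<^sup>2) = (LINT x|lD. (norm (g x))\<^sup>2)"
    using gm wgrad_eq(2)[OF assms(2)] by (intro integral_cong_AE) auto
  moreover have "(norm (u x, g x))\<^sup>2 = (u x)\<^sup>2 + (norm (g x))\<^sup>2" for x by (simp add: norm_Pair)
  ultimately show ?thesis
    using square_integrableD(2)[OF assms(1)] square_integrableD(2)[OF assms(3)] by (simp add: H1_norm_def l2norm_def)
qed

text \<open>In \<open>H10\<close> the distance is measured with the chosen weak gradient of the
  difference, which agrees with the difference of the gradients only almost everywhere. With this
  lemma \<open>H10\<close> and \<open>jets0\<close> become closures in the same norm.\<close>

lemma H1_norm_diff_jet:
  assumes u: "square_integrable lD u" and g: "has_weak_gradient D u g" "square_integrable lD g" and f: "f \<in> test_functions D"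
  shows "H1_norm D (\<lambda>x. u x - f x) = l2norm lD (\<lambda>x. (u x, g x) - jet f x)"
proof -
  note sf = square_integrable_fst_snd[OF jet_square_integrable[OF f]]
  have sq: "square_integrable lD (\<lambda>x. u x - f x)" "square_integrable lD (\<lambda>x. g x - grad f x)"
    using square_integrable_diff[OF u sf(1)] square_integrable_diff[OF g(2) sf(2)] by (simp_all add: jet_def)
  have "has_weak_gradient D (\<lambda>x. u x - f x) (\<lambda>x. g x - grad f x)"
    using has_weak_gradient_diff[OF open_D g(1) jets0_weak_gradient[OF jets0_jet[OF f]]] by (simp add: jet_def)
  from H1_norm_eq[OF sq(1) this sq(2)] show ?thesis by (simp add: jet_def)
qed

lemma H10_imp_jets0:
  assumes "u \<in> H10 D" shows "(\<lambda>x. (u x, wgrad D u x)) \<in> jets0 D"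
proof -
  obtain f where u: "square_integrable lD u" "square_integrable lD (wgrad D u)" "\<exists>g. has_weak_gradient D u g"
    and f: "\<And>n. f n \<in> test_functions D" "(\<lambda>n. H1_norm D (\<lambda>x. u x - f n x)) \<longlonglongrightarrow> 0"
    using assms by (auto simp: H10_def H1_def L2_iff)
  have wg: "has_weak_gradient D u (wgrad D u)" using u(3) wgrad_eq(1) by blast
  have lim: "(\<lambda>n. l2norm lD (\<lambda>x. (u x, wgrad D u x) - jet (f n) x)) \<longlonglongrightarrow> 0"
    using f(2) H1_norm_diff_jet[OF u(1) wg u(2) f(1)] by simp
  show ?thesis
    by (rule jets0_closed_sequence[OF square_integrable_Pair[OF u(1,2)], of "\<lambda>n. jet (f n)"])
       (use jets0_jet[OF f(1)] lim in \<open>auto simp: l2norm_minus_commute[of lD "jet _"]\<close>)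
qed

lemma jets0_imp_H10:
  assumes F: "F \<in> jets0 D"
  shows "(\<lambda>x. fst (F x)) \<in> H10 D" "AE x in lD. wgrad D (\<lambda>x. fst (F x)) x = snd (F x)"
proof -
  note sq = square_integrable_fst_snd[OF jets0_square_integrable[OF F]]
  note wg = jets0_weak_gradient[OF F]
  show "AE x in lD. wgrad D (\<lambda>x. fst (F x)) x = snd (F x)" by (rule wgrad_eq(2)[OF wg])
  obtain f where f: "\<And>n. f n \<in> test_functions D" "(\<lambda>n. l2norm lD (\<lambda>x. F x - jet (f n) x)) \<longlonglongrightarrow> 0"
    by (rule jets0_sequence[OF F]) (rule that; assumption)
  have "(\<lambda>n. H1_norm D (\<lambda>x. fst (F x) - f n x)) \<longlonglongrightarrow> 0"
    using f(2) H1_norm_diff_jet[OF sq(1) wg sq(2) f(1)] by simp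
  moreover have "(\<lambda>x. fst (F x)) \<in> H1 D"
    unfolding H1_def L2_iff using sq(1) wg wgrad_square_integrable[OF wg sq(2)] by blast
  ultimately show "(\<lambda>x. fst (F x)) \<in> H10 D" unfolding H10_def using f(1) by blast
qed

end


section \<open>A Poincare inequality on compact convex sets\<close>

text \<open>The affine substitution has the Jacobian s to the power of the dimension, and 1 / s is
  at most 2. This is the origin of the factor \<open>2 ^ CARD('d)\<close> in the Poincare constants
  below.\<close>

lemma nn_integral_lborel_scale_le:
  fixes g :: "'a::euclidean_space \<Rightarrow> ennreal"
  assumes [measurable]: "g \<in> borel_measurable borel" and s: "1/2 \<le> s"
  shows "(\<integral>\<^sup>+y. g (t + s *\<^sub>R y) \<partial>lborel) \<le> 2 ^ DIM('a) * (\<integral>\<^sup>+y. g y \<partial>lborel)"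
proof -
  have "(\<integral>\<^sup>+y. g y \<partial>lborel) = (\<integral>\<^sup>+y. g y \<partial>density (distr lborel borel (\<lambda>x. t + s *\<^sub>R x)) (\<lambda>_. \<bar>s\<bar>^DIM('a)))"
    using s by (subst lborel_affine[of s t, symmetric]) auto
  also have "\<dots> = \<bar>s\<bar>^DIM('a) * (\<integral>\<^sup>+y. g (t + s *\<^sub>R y) \<partial>lborel)"
    by (subst nn_integral_density) (auto simp: nn_integral_cmult nn_integral_distr)
  finally have eq: "(\<integral>\<^sup>+y. g y \<partial>lborel) = ennreal (\<bar>s\<bar>^DIM('a)) * (\<integral>\<^sup>+y. g (t + s *\<^sub>R y) \<partial>lborel)" .
  have "(1/2) ^ DIM('a) \<le> s ^ DIM('a)" using s by (intro power_mono) auto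
  then have "1 \<le> 2 ^ DIM('a) * \<bar>s\<bar> ^ DIM('a)" using s by (simp add: power_divide divide_le_eq mult.commute)
  then have "1 \<le> 2 ^ DIM('a) * ennreal (\<bar>s\<bar> ^ DIM('a))"
    by (metis ennreal_1 ennreal_leI ennreal_mult ennreal_numeral ennreal_power zero_le_numeral zero_le_power abs_ge_zero)
  then have "1 * (\<integral>\<^sup>+y. g (t + s *\<^sub>R y) \<partial>lborel) \<le> 2 ^ DIM('a) * ennreal (\<bar>s\<bar> ^ DIM('a)) * (\<integral>\<^sup>+y. g (t + s *\<^sub>R y) \<partial>lborel)"
    by (rule mult_right_mono) simp
  then show ?thesis by (simp add: eq mult.assoc)
qed

text \<open>One of the two weights \<open>1 - s\<close> and \<open>s\<close> is at least \<open>1/2\<close>; integrate first over the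
  corresponding variable.\<close>

lemma nn_integral_segment_le:
  fixes w :: "'a::euclidean_space \<Rightarrow> ennreal"
  assumes [measurable]: "w \<in> borel_measurable borel" and K: "compact K" "convex K" and s: "0 \<le> s" "s \<le> 1"
  shows "(\<integral>\<^sup>+x. \<integral>\<^sup>+y. indicator K x * indicator K y * w ((1 - s) *\<^sub>R x + s *\<^sub>R y) \<partial>lborel \<partial>lborel)
    \<le> 2 ^ DIM('a) * emeasure lborel K * (\<integral>\<^sup>+x. indicator K x * w x \<partial>lborel)"
proof -
  have [measurable]: "K \<in> sets borel" using K(1) by (simp add: borel_compact)
  define G where "G = (\<integral>\<^sup>+x. indicator K x * w x \<partial>lborel)"
  have one: "(\<integral>\<^sup>+x. \<integral>\<^sup>+y. indicator K x * indicator K y * w ((1 - s) *\<^sub>R x + s *\<^sub>R y) \<partial>lborel \<partial>lborel)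
      \<le> 2 ^ DIM('a) * emeasure lborel K * G" if s: "1/2 \<le> s" "s \<le> 1" for s
  proof -
    have "(\<integral>\<^sup>+y. indicator K x * indicator K y * w ((1 - s) *\<^sub>R x + s *\<^sub>R y) \<partial>lborel)
      \<le> indicator K x * (2 ^ DIM('a) * G)" for x
    proof (cases "x \<in> K")
      case True
      have "(\<integral>\<^sup>+y. indicator K x * indicator K y * w ((1 - s) *\<^sub>R x + s *\<^sub>R y) \<partial>lborel)
        \<le> (\<integral>\<^sup>+y. indicator K ((1 - s) *\<^sub>R x + s *\<^sub>R y) * w ((1 - s) *\<^sub>R x + s *\<^sub>R y) \<partial>lborel)"
      proof (rule nn_integral_mono)
        fix y
        have "y \<in> K \<Longrightarrow> (1 - s) *\<^sub>R x + s *\<^sub>R y \<in> K" using True K(2) s by (auto simp: convex_alt)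
        then show "indicator K x * indicator K y * w ((1 - s) *\<^sub>R x + s *\<^sub>R y)
            \<le> indicator K ((1 - s) *\<^sub>R x + s *\<^sub>R y) * w ((1 - s) *\<^sub>R x + s *\<^sub>R y)"
          using True by (auto simp: indicator_def)
      qed
      also have "\<dots> \<le> 2 ^ DIM('a) * G"
        unfolding G_def using s(1)
        by (intro nn_integral_lborel_scale_le[where g = "\<lambda>z. indicator K z * w z"]) measurable
      finally show ?thesis using True by simp
    qed simp
    then have "(\<integral>\<^sup>+x. \<integral>\<^sup>+y. indicator K x * indicator K y * w ((1 - s) *\<^sub>R x + s *\<^sub>R y) \<partial>lborel \<partial>lborel)
      \<le> (\<integral>\<^sup>+x. indicator K x * (2 ^ DIM('a) * G) \<partial>lborel)" by (intro nn_integral_mono)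
    also have "\<dots> = 2 ^ DIM('a) * emeasure lborel K * G"
      by (subst nn_integral_multc) (auto simp: mult_ac)
    finally show ?thesis .
  qed
  show ?thesis
  proof (cases "1/2 \<le> s")
    case True then show ?thesis using one s unfolding G_def by blast
  next
    case False
    have "(\<integral>\<^sup>+x. \<integral>\<^sup>+y. indicator K x * indicator K y * w ((1 - s) *\<^sub>R x + s *\<^sub>R y) \<partial>lborel \<partial>lborel)
      = (\<integral>\<^sup>+y. \<integral>\<^sup>+x. indicator K x * indicator K y * w ((1 - s) *\<^sub>R x + s *\<^sub>R y) \<partial>lborel \<partial>lborel)"
      by (rule lborel_pair.Fubini'[symmetric]) measurable
    also have "\<dots> = (\<integral>\<^sup>+y. \<integral>\<^sup>+x. indicator K y * indicator K x * w ((1 - (1 - s)) *\<^sub>R y + (1 - s) *\<^sub>R x) \<partial>lborel \<partial>lborel)"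
      by (simp add: mult_ac add.commute)
    also have "\<dots> \<le> 2 ^ DIM('a) * emeasure lborel K * G" using False s by (intro one) auto
    finally show ?thesis unfolding G_def .
  qed
qed

text \<open>The fundamental theorem of calculus along the segment from x to y, followed by the
  Cauchy-Schwarz inequality in the segment parameter. The nonnegative integral prepares for Fubini's
  theorem.\<close>

lemma segment_difference_le:
  fixes h :: "real ^ 'd \<Rightarrow> real"
  assumes h: "\<And>x. h differentiable at x" "continuous_on UNIV (grad h)"
  shows "ennreal ((h x - h y)\<^sup>2) \<le> ennreal ((norm (x - y))\<^sup>2) *
    (\<integral>\<^sup>+s. indicator {0..1} s * ennreal ((norm (grad h ((1 - s) *\<^sub>R x + s *\<^sub>R y)))\<^sup>2) \<partial>lborel)"
proof -
  define p where "p s = (1 - s) *\<^sub>R x + s *\<^sub>R y" for s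
  define q where "q s = grad h (p s) \<bullet> (y - x)" for s
  have pc: "continuous_on UNIV p" unfolding p_def by (intro continuous_intros)
  have gc: "continuous_on UNIV (\<lambda>s. grad h (p s))"
    by (rule continuous_on_compose2[OF h(2) pc]) auto
  have qc: "continuous_on UNIV q" unfolding q_def by (intro continuous_intros gc)
  have [measurable]: "q \<in> borel_measurable borel" "(\<lambda>s. grad h (p s)) \<in> borel_measurable borel"
    by (auto intro!: borel_measurable_continuous_onI qc gc)
  have der: "((\<lambda>s. h (p s)) has_vector_derivative q s) (at s within {0..1})" for s
  proof -
    have "(p has_derivative (\<lambda>t. t *\<^sub>R (y - x))) (at s within {0..1})"
      unfolding p_def by (auto intro!: derivative_eq_intros simp: algebra_simps)
    from has_derivative_compose[OF this has_derivative_grad[OF h(1)]] show ?thesis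
      by (simp add: has_vector_derivative_def q_def)
  qed
  have bi: "has_bochner_integral lborel (\<lambda>s. indicator {0..1} s *\<^sub>R q s) (h (p 1) - h (p 0))"
    by (rule has_bochner_integral_FTC_Icc[OF _ der continuous_on_subset[OF qc]]) auto
  have int: "integrable lborel (\<lambda>s. indicator {0..1} s *\<^sub>R q s)" using bi by (simp add: has_bochner_integral_iff)
  have "ennreal \<bar>h x - h y\<bar> \<le> (\<integral>\<^sup>+s. ennreal (norm (indicator {0..1} s *\<^sub>R q s)) \<partial>lborel)"
    using integral_norm_bound_ennreal[OF int] has_bochner_integral_integral_eq[OF bi]
    by (simp add: p_def abs_minus_commute)
  \<comment> \<open>The indicator is doubled to exhibit a product: the first factor then has square
    integral 1 in the Cauchy-Schwarz inequality.\<close>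
  also have "\<dots> = (\<integral>\<^sup>+s. indicator {0..1} s * ennreal \<bar>indicator {0..1} s * q s\<bar> \<partial>lborel)"
    by (intro nn_integral_cong) (auto simp: indicator_def)
  finally have "(ennreal \<bar>h x - h y\<bar>)\<^sup>2 \<le> (\<integral>\<^sup>+s. indicator {0..1} s * ennreal \<bar>indicator {0..1} s * q s\<bar> \<partial>lborel)\<^sup>2"
    by (rule power_mono) simp
  also have "\<dots> \<le> (\<integral>\<^sup>+s. (indicator {0..1::real} s)\<^sup>2 \<partial>lborel) * (\<integral>\<^sup>+s. (ennreal \<bar>indicator {0..1} s * q s\<bar>)\<^sup>2 \<partial>lborel)"
    by (rule Cauchy_Schwarz_nn_integral) measurable
  also have "(\<integral>\<^sup>+s. (indicator {0..1::real} s)\<^sup>2 \<partial>lborel) = (1::ennreal)"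
  proof -
    have "(\<lambda>s. (indicator {0..1::real} s)\<^sup>2) = (indicator {0..1} :: real \<Rightarrow> ennreal)" by (auto simp: indicator_def fun_eq_iff)
    then show ?thesis by simp
  qed
  also have "(\<integral>\<^sup>+s. (ennreal \<bar>indicator {0..1} s * q s\<bar>)\<^sup>2 \<partial>lborel)
      \<le> (\<integral>\<^sup>+s. ennreal ((norm (x - y))\<^sup>2) * (indicator {0..1} s * ennreal ((norm (grad h (p s)))\<^sup>2)) \<partial>lborel)"
  proof (rule nn_integral_mono)
    fix s
    have "\<bar>q s\<bar> \<le> norm (grad h (p s)) * norm (y - x)" unfolding q_def by (rule Cauchy_Schwarz_ineq2)
    then have "\<bar>q s\<bar>\<^sup>2 \<le> (norm (grad h (p s)) * norm (y - x))\<^sup>2" by (rule power_mono) simp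
    then have "\<bar>q s\<bar>\<^sup>2 \<le> (norm (x - y))\<^sup>2 * (norm (grad h (p s)))\<^sup>2"
      by (simp add: power_mult_distrib norm_minus_commute mult.commute)
    then show "(ennreal \<bar>indicator {0..1} s * q s\<bar>)\<^sup>2
        \<le> ennreal ((norm (x - y))\<^sup>2) * (indicator {0..1} s * ennreal ((norm (grad h (p s)))\<^sup>2))"
      by (cases "s \<in> {0..1}") (simp_all add: ennreal_power flip: ennreal_mult)
  qed
  also have "\<dots> = ennreal ((norm (x - y))\<^sup>2) * (\<integral>\<^sup>+s. indicator {0..1} s * ennreal ((norm (grad h (p s)))\<^sup>2) \<partial>lborel)"
    by (rule nn_integral_cmult) measurable
  finally show ?thesis by (simp add: p_def ennreal_power)
qed

text \<open>Fubini's theorem moves the segment parameter s outside. For each fixed s the double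
  integral over x and y is bounded by \<open>nn_integral_segment_le\<close>, with a constant that
  does not depend on s.\<close>

lemma poincare_nn_integral:
  fixes h :: "real ^ 'd \<Rightarrow> real"
  assumes h: "\<And>x. h differentiable at x" "continuous_on UNIV (grad h)"
    and K: "compact K" "convex K" and R: "\<And>x y. x \<in> K \<Longrightarrow> y \<in> K \<Longrightarrow> norm (x - y) \<le> R"
  shows "(\<integral>\<^sup>+x. \<integral>\<^sup>+y. indicator K x * indicator K y * ennreal ((h x - h y)\<^sup>2) \<partial>lborel \<partial>lborel)
    \<le> ennreal (R\<^sup>2) * (2 ^ CARD('d) * emeasure lborel K * (\<integral>\<^sup>+x. indicator K x * ennreal ((norm (grad h x))\<^sup>2) \<partial>lborel))"
    (is "_ \<le> _ * ?C")
proof -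
  have [measurable]: "K \<in> sets borel" using K(1) by (simp add: borel_compact)
  have hc: "continuous_on UNIV h" using h(1) by (simp add: continuous_at_imp_continuous_on differentiable_imp_continuous_within)
  have [measurable]: "h \<in> borel_measurable borel" "grad h \<in> borel_measurable borel"
    by (auto intro!: borel_measurable_continuous_onI hc h(2))
  define w where "w x = ennreal ((norm (grad h x))\<^sup>2)" for x
  have [measurable]: "w \<in> borel_measurable borel" unfolding w_def by measurable
  define T where "T x y s = indicator K x * indicator K y * indicator {0..1} s * w ((1 - s) *\<^sub>R x + s *\<^sub>R y)" for x y :: "real^'d" and s :: real
  \<comment> \<open>Stated for arbitrary measurable arguments, so that the measurability prover
    handles \<open>T\<close> for each order of the three variables that Fubini's theorem
    produces.\<close>
  have [measurable (raw)]: "(\<lambda>z. T (f z) (g z) (s z)) \<in> borel_measurable N"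
    if [measurable]: "f \<in> N \<rightarrow>\<^sub>M borel" "g \<in> N \<rightarrow>\<^sub>M borel" "s \<in> N \<rightarrow>\<^sub>M borel"
    for f g s and N :: "'z measure"
    unfolding T_def by measurable
  have "indicator K x * indicator K y * ennreal ((h x - h y)\<^sup>2) \<le> ennreal (R\<^sup>2) * (\<integral>\<^sup>+s. T x y s \<partial>lborel)" for x y
  proof (cases "x \<in> K \<and> y \<in> K")
    case True
    have "ennreal ((h x - h y)\<^sup>2) \<le> ennreal ((norm (x - y))\<^sup>2) * (\<integral>\<^sup>+s. indicator {0..1} s * w ((1 - s) *\<^sub>R x + s *\<^sub>R y) \<partial>lborel)"
      unfolding w_def by (rule segment_difference_le[OF h])
    also have "\<dots> \<le> ennreal (R\<^sup>2) * (\<integral>\<^sup>+s. indicator {0..1} s * w ((1 - s) *\<^sub>R x + s *\<^sub>R y) \<partial>lborel)"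
      using R True by (intro mult_right_mono ennreal_leI power_mono) auto
    finally show ?thesis using True by (simp add: T_def)
  qed auto
  then have "(\<integral>\<^sup>+x. \<integral>\<^sup>+y. indicator K x * indicator K y * ennreal ((h x - h y)\<^sup>2) \<partial>lborel \<partial>lborel)
     \<le> (\<integral>\<^sup>+x. \<integral>\<^sup>+y. ennreal (R\<^sup>2) * (\<integral>\<^sup>+s. T x y s \<partial>lborel) \<partial>lborel \<partial>lborel)"
    by (intro nn_integral_mono)
  also have "\<dots> = ennreal (R\<^sup>2) * (\<integral>\<^sup>+x. \<integral>\<^sup>+y. \<integral>\<^sup>+s. T x y s \<partial>lborel \<partial>lborel \<partial>lborel)"
    by (simp add: nn_integral_cmult)
  also have "(\<integral>\<^sup>+x. \<integral>\<^sup>+y. \<integral>\<^sup>+s. T x y s \<partial>lborel \<partial>lborel \<partial>lborel)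
      = (\<integral>\<^sup>+x. \<integral>\<^sup>+s. \<integral>\<^sup>+y. T x y s \<partial>lborel \<partial>lborel \<partial>lborel)"
    by (intro nn_integral_cong lborel_pair.Fubini') measurable
  also have "\<dots> = (\<integral>\<^sup>+s. \<integral>\<^sup>+x. \<integral>\<^sup>+y. T x y s \<partial>lborel \<partial>lborel \<partial>lborel)"
    by (intro lborel_pair.Fubini') measurable
  also have "\<dots> \<le> (\<integral>\<^sup>+s. indicator {0..1::real} s * ?C \<partial>lborel)"
  proof (rule nn_integral_mono)
    fix s :: real
    show "(\<integral>\<^sup>+x. \<integral>\<^sup>+y. T x y s \<partial>lborel \<partial>lborel) \<le> indicator {0..1} s * ?C"
    proof (cases "s \<in> {0..1}")
      case True
      then have "(\<integral>\<^sup>+x. \<integral>\<^sup>+y. T x y s \<partial>lborel \<partial>lborel) = (\<integral>\<^sup>+x. \<integral>\<^sup>+y. indicator K x * indicator K y * w ((1 - s) *\<^sub>R x + s *\<^sub>R y) \<partial>lborel \<partial>lborel)"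
        by (simp add: T_def)
      also have "\<dots> \<le> ?C"
        using nn_integral_segment_le[of w K s] True K by (simp add: w_def[symmetric])
      finally show ?thesis using True by simp
    qed (simp add: T_def)
  qed
  also have "\<dots> = ?C" by (subst nn_integral_multc) auto
  finally show ?thesis by (simp add: mult_left_mono)
qed


text \<open>With m the measure of K, expanding the square shows that the double integral of (h x - h
  y)^2 is 2 m times the integral of h^2 minus twice the square of the integral of h. Multiplying by
  m, instead of subtracting a mean value, avoids dividing by m.\<close>

lemma poincare_compact_convex:
  fixes h :: "real ^ 'd \<Rightarrow> real"
  assumes h: "\<And>x. h differentiable at x" "continuous_on UNIV (grad h)"
    and K: "compact K" "convex K" and R: "\<And>x y. x \<in> K \<Longrightarrow> y \<in> K \<Longrightarrow> norm (x - y) \<le> R"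
  shows "measure lebesgue K * (LINT x|lebesgue_on K. (h x)\<^sup>2) \<le> (LINT x|lebesgue_on K. h x)\<^sup>2 +
    R\<^sup>2 * 2 ^ CARD('d) * measure lebesgue K * (LINT x|lebesgue_on K. (norm (grad h x))\<^sup>2)"
proof -
  define M where "M = lebesgue_on K"
  have Kl: "K \<in> lmeasurable" using K(1) by (rule lmeasurable_compact)
  then have Ks: "K \<inter> space lebesgue \<in> sets lebesgue" by (simp add: fmeasurableD)
  interpret finite_measure M unfolding M_def by (rule finite_measure_lebesgue_on[OF Kl])
  have [measurable]: "K \<in> sets borel" using K(1) by (simp add: borel_compact)
  have hc: "continuous_on UNIV h" using h(1) by (simp add: continuous_at_imp_continuous_on differentiable_imp_continuous_within)
  have [measurable]: "h \<in> borel_measurable borel" "grad h \<in> borel_measurable borel"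
    by (auto intro!: borel_measurable_continuous_onI hc h(2))
  have bounded_int: "integrable M f" if f: "continuous_on UNIV f" for f :: "real ^ 'd \<Rightarrow> real"
  proof -
    have "bounded (f ` K)"
      by (intro compact_imp_bounded compact_continuous_image K(1) continuous_on_subset[OF f] subset_UNIV)
    then obtain B where "\<forall>x\<in>K. norm (f x) \<le> B" by (auto simp: bounded_iff)
    then show ?thesis
      unfolding M_def using Kl
      by (intro finite_measure.integrable_const_bound[of _ _ B] finite_measure_lebesgue_on AE_I2
          continuous_imp_measurable_on_sets_lebesgue continuous_on_subset[OF f]) (auto simp: fmeasurableD)
  qed
  have space: "measure M (space M) = measure lebesgue K"
    using Ks by (simp add: M_def measure_restrict_space)
  have nn: "(\<integral>\<^sup>+x. f x \<partial>M) = (\<integral>\<^sup>+x. indicator K x * f x \<partial>lborel)" for f :: "real ^ 'd \<Rightarrow> ennreal"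
    unfolding M_def nn_integral_restrict_space[OF Ks] nn_integral_completion by (simp add: mult.commute)
  define A where "A = (LINT x|M. h x)"
  define B where "B = (LINT x|M. (h x)\<^sup>2)"
  define G where "G = (LINT x|M. (norm (grad h x))\<^sup>2)"
  define m where "m = measure lebesgue K"
  have ih: "integrable M h" by (rule bounded_int[OF hc])
  have ih2: "integrable M (\<lambda>x. (h x)\<^sup>2)" by (intro bounded_int continuous_intros hc)
  have ig: "integrable M (\<lambda>x. (norm (grad h x))\<^sup>2)" by (intro bounded_int continuous_intros h(2))
  have mx: "integrable M (\<lambda>y. (h x - h y)\<^sup>2)" "(LINT y|M. (h x - h y)\<^sup>2) = m * (h x)\<^sup>2 - 2 * h x * A + B" for x
  proof -
    have eq: "(\<lambda>y. (h x - h y)\<^sup>2) = (\<lambda>y. (h x)\<^sup>2 - 2 * h x * h y + (h y)\<^sup>2)" by (simp add: power2_diff fun_eq_iff)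
    show "integrable M (\<lambda>y. (h x - h y)\<^sup>2)" unfolding eq using ih ih2 by simp
    show "(LINT y|M. (h x - h y)\<^sup>2) = m * (h x)\<^sup>2 - 2 * h x * A + B"
      unfolding eq using ih ih2 by (simp add: A_def B_def m_def space)
  qed
  have outer: "(\<integral>\<^sup>+x. \<integral>\<^sup>+y. ennreal ((h x - h y)\<^sup>2) \<partial>M \<partial>M) = ennreal (2 * (m * B) - 2 * A\<^sup>2)"
  proof -
    have "(\<integral>\<^sup>+x. \<integral>\<^sup>+y. ennreal ((h x - h y)\<^sup>2) \<partial>M \<partial>M) = (\<integral>\<^sup>+x. ennreal (m * (h x)\<^sup>2 - 2 * h x * A + B) \<partial>M)"
      by (simp add: nn_integral_eq_integral[OF mx(1)] mx(2))
    also have "\<dots> = ennreal (LINT x|M. m * (h x)\<^sup>2 - 2 * h x * A + B)"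
    proof (rule nn_integral_eq_integral)
      show "integrable M (\<lambda>x. m * (h x)\<^sup>2 - 2 * h x * A + B)" using ih ih2 by simp
      show "AE x in M. 0 \<le> m * (h x)\<^sup>2 - 2 * h x * A + B"
        unfolding mx(2)[symmetric] by (simp add: integral_nonneg_AE)
    qed
    also have "(LINT x|M. m * (h x)\<^sup>2 - 2 * h x * A + B) = m * B - 2 * A * A + m * B"
      using ih ih2 by (simp add: A_def[symmetric] B_def[symmetric] m_def[symmetric] space)
    also have "\<dots> = 2 * (m * B) - 2 * A\<^sup>2" by (simp add: power2_eq_square)
    finally show ?thesis .
  qed
  have "(\<integral>\<^sup>+x. \<integral>\<^sup>+y. ennreal ((h x - h y)\<^sup>2) \<partial>M \<partial>M)
     = (\<integral>\<^sup>+x. \<integral>\<^sup>+y. indicator K x * indicator K y * ennreal ((h x - h y)\<^sup>2) \<partial>lborel \<partial>lborel)"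
    unfolding nn by (simp add: nn_integral_cmult[symmetric] mult.assoc)
  also have "\<dots> \<le> ennreal (R\<^sup>2) * (2 ^ CARD('d) * emeasure lborel K * (\<integral>\<^sup>+x. indicator K x * ennreal ((norm (grad h x))\<^sup>2) \<partial>lborel))"
    by (rule poincare_nn_integral[OF h K R])
  also have "(\<integral>\<^sup>+x. indicator K x * ennreal ((norm (grad h x))\<^sup>2) \<partial>lborel) = ennreal G"
    unfolding G_def nn[symmetric] by (rule nn_integral_eq_integral[OF ig]) simp
  also have "emeasure lborel K = ennreal m"
  proof -
    have "emeasure lebesgue K = ennreal m" using Kl unfolding m_def by (simp add: emeasure_eq_measure2 fmeasurableD2 emeasure_eq_ennreal_measure top.not_eq_extremum)
    then show ?thesis by simp
  qed
  also have "ennreal (R\<^sup>2) * (2 ^ CARD('d) * ennreal m * ennreal G) = ennreal (R\<^sup>2 * (2 ^ CARD('d) * m * G))"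
  proof -
    have "(2::ennreal) ^ CARD('d) = ennreal (2 ^ CARD('d))" by (simp add: ennreal_power[symmetric])
    moreover have "0 \<le> m" "0 \<le> G" by (auto simp: m_def G_def)
    ultimately show ?thesis by (simp add: ennreal_mult)
  qed
  finally have "ennreal (2 * (m * B) - 2 * A\<^sup>2) \<le> ennreal (R\<^sup>2 * (2 ^ CARD('d) * m * G))" unfolding outer .
  moreover have n: "0 \<le> R\<^sup>2 * (2 ^ CARD('d) * m * G)" by (simp add: m_def G_def)
  ultimately have "2 * (m * B) - 2 * A\<^sup>2 \<le> R\<^sup>2 * (2 ^ CARD('d) * m * G)" by simp
  \<comment> \<open>Division by 2 would even halve the gradient term; this gain is given
    away.\<close>
  then have "m * B \<le> A\<^sup>2 + R\<^sup>2 * (2 ^ CARD('d) * m * G)" using n by linarith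
  then show ?thesis by (simp add: A_def B_def m_def G_def M_def mult.assoc)
qed


section \<open>Compact embedding\<close>

context bounded_open
begin

text \<open>Cells may stick out of \<open>D\<close>, where the integrand is zero. Additivity over a
  division, whose cells share boundary points, is taken from the gauge integral.\<close>

lemma integral_test_cells:
  fixes g :: "real ^ 'd \<Rightarrow> real"
  assumes g: "continuous_on UNIV g" "\<And>x. x \<notin> D \<Longrightarrow> g x = 0" and D: "D \<subseteq> cbox a b"
    and p: "P division_of cbox a b"
  shows "(LINT x|lD. g x) = (\<Sum>K\<in>P. LINT x|lebesgue_on K. g x)"
proof -
  have gm: "g \<in> borel_measurable borel" using g(1) by (rule borel_measurable_continuous_onI)
  have int: "integrable (lebesgue_on (cbox u v)) g" for u v
    by (rule continuous_imp_integrable[OF continuous_on_subset[OF g(1)]]) simp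
  have "(LINT x|lD. g x) = (LINT x|lborel. g x)"
    by (rule integral_lebesgue_on_eq_lborel[OF D_sets gm g(2)])
  also have "\<dots> = (LINT x|lebesgue_on (cbox a b). g x)"
    by (rule integral_lebesgue_on_eq_lborel[symmetric]) (use gm g(2) D in auto)
  also have "\<dots> = integral (cbox a b) g" by (rule lebesgue_integral_eq_integral[OF int]) simp
  also have "\<dots> = (\<Sum>K\<in>P. integral K g)"
    by (rule integral_combine_division_topdown[OF _ p]) (rule integrable_continuous, rule continuous_on_subset[OF g(1)], simp)
  also have "\<dots> = (\<Sum>K\<in>P. LINT x|lebesgue_on K. g x)"
  proof (rule sum.cong[OF refl])
    fix K assume "K \<in> P"
    then obtain u v where "K = cbox u v" using division_ofD(4)[OF p] by blast
    then show "integral K g = (LINT x|lebesgue_on K. g x)"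
      using lebesgue_integral_eq_integral[OF int] by simp
  qed
  finally show ?thesis .
qed

text \<open>The Poincare inequality on every cell, summed up. Up to an error of the order of the
  squared mesh size R^2, the L^2 norm is thus controlled by finitely many numbers, the integrals
  over the cells; this is the source of compactness.\<close>

lemma test_l2norm_cells:
  assumes w: "w \<in> test_functions D" and D: "D \<subseteq> cbox a b" and P: "P division_of cbox a b"
    and R: "\<And>K x y. K \<in> P \<Longrightarrow> x \<in> K \<Longrightarrow> y \<in> K \<Longrightarrow> norm (x - y) \<le> R"
  shows "(l2norm lD w)\<^sup>2 \<le> (\<Sum>K\<in>P. (LINT x|lebesgue_on K. w x)\<^sup>2 / measure lebesgue K)
    + R\<^sup>2 * 2 ^ CARD('d) * (l2norm lD (grad w))\<^sup>2"
proof -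
  obtain L where L: "smooth w" "L \<subseteq> D" "\<And>x. x \<notin> L \<Longrightarrow> w x = 0" "\<And>x. x \<notin> L \<Longrightarrow> grad w x = 0"
    using w by (rule test_functionsE) blast
  note wc = smooth_imp_continuous[OF L(1), of UNIV] smooth_imp_continuous_grad[OF L(1), of UNIV]
  have cell: "(LINT x|lebesgue_on K. (w x)\<^sup>2) \<le> (LINT x|lebesgue_on K. w x)\<^sup>2 / measure lebesgue K
     + R\<^sup>2 * 2 ^ CARD('d) * (LINT x|lebesgue_on K. (norm (grad w x))\<^sup>2)" if K: "K \<in> P" for K
  proof -
    obtain u v where uv: "K = cbox u v" using division_ofD(4)[OF P K] by blast
    have le: "measure lebesgue K * (LINT x|lebesgue_on K. (w x)\<^sup>2) \<le> (LINT x|lebesgue_on K. w x)\<^sup>2 +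
       R\<^sup>2 * 2 ^ CARD('d) * measure lebesgue K * (LINT x|lebesgue_on K. (norm (grad w x))\<^sup>2)"
      using smooth_imp_differentiable[OF L(1)] wc R[OF K] uv
      by (intro poincare_compact_convex) (auto simp: convex_box)
    show ?thesis
    \<comment> \<open>A degenerate cell contributes nothing: all integrals over it vanish, and the
      quotient is 0 by the convention for division by zero.\<close>
    proof (cases "measure lebesgue K = 0")
      case True
      then have "negligible K" using uv by (simp add: negligible_iff_measure)
      then have "(LINT x|lebesgue_on K. f x) = 0" for f :: "real^'d \<Rightarrow> real"
      proof -
        have "(LINT x|lebesgue_on K. f x) = (LINT x|lebesgue. indicator K x *\<^sub>R f x)"
          using uv by (intro integral_restrict_space) simp
        also have "\<dots> = 0"
        proof (rule integral_eq_zero_AE)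
          have "K \<in> null_sets lebesgue" using \<open>negligible K\<close> by (simp add: negligible_iff_null_sets)
          then have "AE x in lebesgue. x \<notin> K" by (rule AE_not_in)
          then show "AE x in lebesgue. indicator K x *\<^sub>R f x = 0" by eventually_elim simp
        qed
        finally show ?thesis .
      qed
      then show ?thesis using True by simp
    next
      case False
      then have "measure lebesgue K > 0" by (simp add: zero_less_measure_iff)
      then show ?thesis using le by (simp add: field_simps)
    qed
  qed
  have "(l2norm lD w)\<^sup>2 = (\<Sum>K\<in>P. LINT x|lebesgue_on K. (w x)\<^sup>2)"
    unfolding l2norm_power2 real_norm_def power2_abs
    by (rule integral_test_cells[OF _ _ D P]) (use wc L in \<open>auto intro!: continuous_intros\<close>)
  also have "\<dots> \<le> (\<Sum>K\<in>P. (LINT x|lebesgue_on K. w x)\<^sup>2 / measure lebesgue K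
     + R\<^sup>2 * 2 ^ CARD('d) * (LINT x|lebesgue_on K. (norm (grad w x))\<^sup>2))"
    by (rule sum_mono[OF cell])
  also have "\<dots> = (\<Sum>K\<in>P. (LINT x|lebesgue_on K. w x)\<^sup>2 / measure lebesgue K)
     + R\<^sup>2 * 2 ^ CARD('d) * (\<Sum>K\<in>P. LINT x|lebesgue_on K. (norm (grad w x))\<^sup>2)"
    by (simp add: sum.distrib sum_distrib_left)
  also have "(\<Sum>K\<in>P. LINT x|lebesgue_on K. (norm (grad w x))\<^sup>2) = (l2norm lD (grad w))\<^sup>2"
    unfolding l2norm_power2
    by (rule integral_test_cells[OF _ _ D P, symmetric]) (use wc L in \<open>auto intro!: continuous_intros\<close>)
  finally show ?thesis .
qed

text \<open>The integrals of \<open>f n\<close> over the countably many cells of all partitions are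
  bounded, so a diagonal subsequence makes them converge simultaneously. Given e, a mesh so fine
  that the gradient term stays below e^2 / 2 is fixed first; after that only finitely many
  convergent cell integrals matter.\<close>

lemma rellich_test_functions:
  assumes f: "\<And>n. f n \<in> test_functions D" and C: "\<And>n. l2norm lD (jet (f n)) \<le> C"
  obtains r :: "nat \<Rightarrow> nat" where "strict_mono r"
    "\<And>e. e > 0 \<Longrightarrow> \<exists>N. \<forall>m\<ge>N. \<forall>n\<ge>N. l2norm lD (\<lambda>x. f (r m) x - f (r n) x) < e"
proof -
  interpret finite_measure lD by (rule finite_lD)
  obtain a b where ab: "D \<subseteq> cbox a b" using bounded_subset_cbox_symmetric[OF bounded_D] by blast
  \<comment> \<open>A tagged division that is fine for balls of radius 1 / (k + 1) has cells of
    diameter at most twice that radius.\<close>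
  have "\<exists>P. P division_of cbox a b \<and> (\<forall>K\<in>P. \<forall>x\<in>K. \<forall>y\<in>K. norm (x - y) \<le> 2 / real (Suc k))" for k
  proof -
    have "gauge (\<lambda>x::real^'d. ball x (1 / real (Suc k)))" by (intro gauge_ball) simp
    then obtain p where p: "p tagged_division_of (cbox a b)" "(\<lambda>x. ball x (1 / real (Suc k))) fine p"
      by (rule fine_division_exists)
    have "norm (x - y) \<le> 2 / real (Suc k)" if K: "K \<in> snd ` p" "x \<in> K" "y \<in> K" for K x y
    proof -
      obtain t where "(t, K) \<in> p" using K(1) by auto
      then have "K \<subseteq> ball t (1 / real (Suc k))" using p(2) by (auto simp: fine_def)
      then have "dist t x < 1 / real (Suc k)" "dist t y < 1 / real (Suc k)" using K by auto
      then have "dist x y < 1 / real (Suc k) + 1 / real (Suc k)"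
        using dist_triangle3[of x y t] by linarith
      then show ?thesis by (simp add: dist_norm)
    qed
    then show ?thesis using division_of_tagged_division[OF p(1)] by blast
  qed
  then obtain P where P: "\<And>k. P k division_of cbox a b"
    "\<And>k K x y. K \<in> P k \<Longrightarrow> x \<in> K \<Longrightarrow> y \<in> K \<Longrightarrow> norm (x - y) \<le> 2 / real (Suc k)"
    by metis
  have finP: "finite (P k)" for k using P(1) by (rule division_of_finite)
  define S where "S = (\<Union>k. P k)"
  have "countable S" unfolding S_def by (intro countable_UN countable_finite[OF finP]) simp
  note sq = square_integrable_fst_snd[OF jet_square_integrable[OF f], unfolded jet_def fst_conv snd_conv]
  have fbd: "l2norm lD (f n) \<le> C" "l2norm lD (grad (f n)) \<le> C" for n
    using l2norm_fst_snd_le[OF jet_square_integrable[OF f]] C[of n] order_trans unfolding jet_def fst_conv snd_conv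
    by blast+
  have one: "square_integrable lD (\<lambda>x. 1::real)" by (rule square_integrable_bounded[OF finite_lD, of _ 1]) auto
  \<comment> \<open>Since the cell may leave \<open>D\<close>, its integral is compared with the sum
    over the whole partition to which it belongs, which is an integral over
    \<open>D\<close>.\<close>
  have bd: "norm (LINT x|lebesgue_on K. f n x) \<le> C * l2norm lD (\<lambda>x. 1::real)" if KS: "K \<in> S" for K n
  proof -
    obtain k where k: "K \<in> P k" using KS unfolding S_def by blast
    obtain L where L: "smooth (f n)" "L \<subseteq> D" "\<And>x. x \<notin> L \<Longrightarrow> f n x = 0"
      using f by (rule test_functionsE) blast
    have c: "continuous_on UNIV (f n)" by (rule smooth_imp_continuous[OF L(1)])
    have "norm (LINT x|lebesgue_on K. f n x) \<le> (LINT x|lebesgue_on K. norm (f n x))" by (rule integral_norm_bound)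
    also have "\<dots> \<le> (\<Sum>K\<in>P k. LINT x|lebesgue_on K. norm (f n x))"
      by (rule member_le_sum[OF k _ finP]) simp
    also have "\<dots> = (LINT x|lD. norm (f n x))"
      by (rule integral_test_cells[OF _ _ ab P(1), symmetric]) (use c L in \<open>auto intro!: continuous_intros\<close>)
    also have "\<dots> \<le> l2norm lD (f n) * l2norm lD (\<lambda>x. 1::real)"
      using l2norm_Cauchy_Schwarz[OF sq(1)[of n] one] by simp
    also have "\<dots> \<le> C * l2norm lD (\<lambda>x. 1::real)" by (intro mult_right_mono fbd) simp
    finally show ?thesis .
  qed
  obtain r :: "nat \<Rightarrow> nat" where r: "strict_mono r" "\<And>K. K \<in> S \<Longrightarrow> \<exists>l. (\<lambda>n. LINT x|lebesgue_on K. f (r n) x) \<longlonglongrightarrow> l"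
    using function_convergent_subsequence[OF \<open>countable S\<close>, of "\<lambda>n K. LINT x|lebesgue_on K. f n x"] bd by blast
  show ?thesis
  proof (rule that[OF r(1)])
    fix e :: real assume e: "e > 0"
    \<comment> \<open>A difference of two members has gradient norm at most 2 C, so the mesh size
      squared times \<open>c\<close> bounds the gradient term of
      \<open>test_l2norm_cells\<close>.\<close>
    define c where "c = 2 ^ CARD('d) * (2 * C)\<^sup>2"
    have "(\<lambda>k. (2 / real (Suc k))\<^sup>2 * c) \<longlonglongrightarrow> 0" by real_asymp
    then have "\<forall>\<^sub>F k in sequentially. (2 / real (Suc k))\<^sup>2 * c < e\<^sup>2 / 2" using e by (intro order_tendstoD(2)) auto
    then obtain k where k: "(2 / real (Suc k))\<^sup>2 * c < e\<^sup>2 / 2" by (auto simp: eventually_sequentially)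
    define J where "J K n = (LINT x|lebesgue_on K. f (r n) x)" for K n
    have cau: "Cauchy (J K)" if "K \<in> P k" for K
      using r(2)[of K] that LIMSEQ_imp_Cauchy unfolding J_def S_def by blast
    \<comment> \<open>Each cell gets an equal share of e^2 / 2; the summand 1 in the denominator
      keeps it positive.\<close>
    have "\<exists>N. \<forall>K\<in>P k. \<forall>m\<ge>N. \<forall>n\<ge>N. (J K m - J K n)\<^sup>2 / measure lebesgue K < e\<^sup>2 / (2 * (real (card (P k)) + 1))"
    proof -
      define e' where "e' = e\<^sup>2 / (2 * (real (card (P k)) + 1))"
      have e': "e' > 0" using e by (simp add: e'_def add_nonneg_pos)
      have "\<exists>N. \<forall>m\<ge>N. \<forall>n\<ge>N. (J K m - J K n)\<^sup>2 / measure lebesgue K < e'" if K: "K \<in> P k" for K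
      proof (cases "measure lebesgue K = 0")
        case False
        then have pos: "measure lebesgue K > 0" by (simp add: zero_less_measure_iff)
        then have "sqrt (e' * measure lebesgue K) > 0" using e' by simp
        then obtain N where N: "\<forall>m\<ge>N. \<forall>n\<ge>N. norm (J K m - J K n) < sqrt (e' * measure lebesgue K)"
          using CauchyD[OF cau[OF K]] by blast
        have "(J K m - J K n)\<^sup>2 / measure lebesgue K < e'" if "m \<ge> N" "n \<ge> N" for m n
        proof -
          have "\<bar>J K m - J K n\<bar>\<^sup>2 < (sqrt (e' * measure lebesgue K))\<^sup>2"
            using N that by (intro power_strict_mono) auto
          then show ?thesis using pos e' by (simp add: divide_less_eq)
        qed
        then show ?thesis by blast
      qed (use e' in simp)
      then obtain N where N: "\<And>K m n. K \<in> P k \<Longrightarrow> m \<ge> N K \<Longrightarrow> n \<ge> N K \<Longrightarrow> (J K m - J K n)\<^sup>2 / measure lebesgue K < e'"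
        by metis
      have "N K \<le> (\<Sum>K\<in>P k. N K)" if "K \<in> P k" for K using that by (intro member_le_sum finP) auto
      then show ?thesis using N unfolding e'_def[symmetric] by (meson order_trans)
    qed
    then obtain N where N: "\<And>K m n. K \<in> P k \<Longrightarrow> m \<ge> N \<Longrightarrow> n \<ge> N \<Longrightarrow>
      (J K m - J K n)\<^sup>2 / measure lebesgue K < e\<^sup>2 / (2 * (real (card (P k)) + 1))" by blast
    have "l2norm lD (\<lambda>x. f (r m) x - f (r n) x) < e" if mn: "m \<ge> N" "n \<ge> N" for m n
    proof -
      define w where "w = (\<lambda>x. f (r m) x - f (r n) x)"
      have w: "w \<in> test_functions D" unfolding w_def by (intro test_diff f)
      have Jw: "(LINT x|lebesgue_on K. w x) = J K m - J K n" if K: "K \<in> P k" for K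
      proof -
        obtain u v where uv: "K = cbox u v" using division_ofD(4)[OF P(1) K] by blast
        have "integrable (lebesgue_on K) (f j)" for j
          unfolding uv by (intro continuous_imp_integrable smooth_imp_continuous test_smooth[OF f])
        then show ?thesis by (simp add: w_def J_def)
      qed
      have gw: "grad w x = grad (f (r m)) x - grad (f (r n)) x" for x
        using jet_diff[OF f f, of "r m" "r n" x] by (simp add: w_def jet_def)
      have gw2: "l2norm lD (grad w) \<le> 2 * C"
      proof -
        have "l2norm lD (grad w) = l2norm lD (\<lambda>x. grad (f (r m)) x + (-1) *\<^sub>R grad (f (r n)) x)"
          by (intro arg_cong[of _ _ "l2norm lD"]) (simp add: gw fun_eq_iff)
        also have "\<dots> \<le> l2norm lD (grad (f (r m))) + l2norm lD (\<lambda>x. (-1) *\<^sub>R grad (f (r n)) x)"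
          by (intro l2norm_triangle square_integrable_scaleR sq(2))
        also have "\<dots> \<le> 2 * C" using fbd(2)[of "r m"] fbd(2)[of "r n"] by (simp only: l2norm_scaleR)
        finally show ?thesis .
      qed
      have "(l2norm lD w)\<^sup>2 \<le> (\<Sum>K\<in>P k. (LINT x|lebesgue_on K. w x)\<^sup>2 / measure lebesgue K)
          + (2 / real (Suc k))\<^sup>2 * 2 ^ CARD('d) * (l2norm lD (grad w))\<^sup>2"
        by (rule test_l2norm_cells[OF w ab P])
      also have "(\<Sum>K\<in>P k. (LINT x|lebesgue_on K. w x)\<^sup>2 / measure lebesgue K)
          \<le> (\<Sum>K\<in>P k. e\<^sup>2 / (2 * (real (card (P k)) + 1)))"
        using N mn by (intro sum_mono) (auto simp: Jw less_imp_le)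
      also have "\<dots> \<le> e\<^sup>2 / 2" by (simp add: field_simps)
      also have "(2 / real (Suc k))\<^sup>2 * 2 ^ CARD('d) * (l2norm lD (grad w))\<^sup>2 \<le> (2 / real (Suc k))\<^sup>2 * c"
        unfolding c_def mult.assoc using gw2 by (intro mult_left_mono power_mono) auto
      also note k
      finally have "(l2norm lD w)\<^sup>2 < e\<^sup>2" by simp
      then show ?thesis using e unfolding w_def by (simp add: power_less_imp_less_base)
    qed
    then show "\<exists>N. \<forall>m\<ge>N. \<forall>n\<ge>N. l2norm lD (\<lambda>x. f (r m) x - f (r n) x) < e" by blast
  qed
qed

text \<open>Each \<open>F n\<close> is replaced by a test function at distance below 1 / (n + 1).
  Along a subsequence these errors still vanish because r n is at least n, and the triangle
  inequality splits e into e/4 + e/2 + e/4.\<close>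

lemma rellich_jets0:
  assumes F: "\<And>n. F n \<in> jets0 D" and C: "\<And>n. l2norm lD (F n) \<le> C"
  obtains r :: "nat \<Rightarrow> nat" where "strict_mono r"
    "\<And>e. e > 0 \<Longrightarrow> \<exists>N. \<forall>m\<ge>N. \<forall>n\<ge>N. l2norm lD (\<lambda>x. fst (F (r m) x) - fst (F (r n) x)) < e"
proof -
  have "\<exists>f. f \<in> test_functions D \<and> l2norm lD (\<lambda>x. F n x - jet f x) < 1 / real (Suc n)" for n
  proof -
    have "1 / real (Suc n) > 0" by simp
    from jets0_approx[OF F this] show ?thesis by metis
  qed
  then obtain f where f: "\<And>n. f n \<in> test_functions D" "\<And>n. l2norm lD (\<lambda>x. F n x - jet (f n) x) < 1 / real (Suc n)"
    by metis
  note sF = jets0_square_integrable[OF F] and sf = jet_square_integrable[OF f(1)]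
  have C1: "l2norm lD (jet (f n)) \<le> C + 1" for n
  proof -
    have "1 / real (Suc n) \<le> 1" by simp
    then show ?thesis using l2norm_diff_abs_le[OF sF sf, of n n] f(2)[of n] C[of n] by linarith
  qed
  obtain r :: "nat \<Rightarrow> nat" where r: "strict_mono r"
    "\<And>e. e > 0 \<Longrightarrow> \<exists>N. \<forall>m\<ge>N. \<forall>n\<ge>N. l2norm lD (\<lambda>x. f (r m) x - f (r n) x) < e"
    by (rule rellich_test_functions[of f, OF f(1) C1]) (rule that; assumption)
  show ?thesis
  proof (rule that[OF r(1)])
    fix e :: real assume e: "e > 0"
    obtain N where N: "\<forall>m\<ge>N. \<forall>n\<ge>N. l2norm lD (\<lambda>x. f (r m) x - f (r n) x) < e/2" using r(2)[of "e/2"] e by auto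
    obtain N' where N': "1 / real (Suc N') < e/4" using nat_approx_posE[of "e/4"] e by auto
    have close: "l2norm lD (\<lambda>x. fst (F (r n) x) - f (r n) x) < e/4" if "n \<ge> N'" for n
    proof -
      have "1 / real (Suc (r n)) \<le> 1 / real (Suc N')"
        using that seq_suble[OF r(1), of n] by (intro divide_left_mono) auto
      then have "l2norm lD (\<lambda>x. F (r n) x - jet (f (r n)) x) < e/4" using f(2)[of "r n"] N' by linarith
      then show ?thesis
        using l2norm_fst_snd_le(1)[OF square_integrable_diff[OF sF sf], of "r n" "r n"] by (simp add: jet_def)
    qed
    note s1 = square_integrable_fst_snd(1)[OF sF] and s2 = square_integrable_fst_snd(1)[OF sf, unfolded jet_def fst_conv]
    have "l2norm lD (\<lambda>x. fst (F (r m) x) - fst (F (r n) x)) < e" if mn: "m \<ge> max N N'" "n \<ge> max N N'" for m n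
    proof -
      have "l2norm lD (\<lambda>x. fst (F (r m) x) - fst (F (r n) x))
        \<le> l2norm lD (\<lambda>x. fst (F (r m) x) - f (r m) x) + l2norm lD (\<lambda>x. f (r m) x - fst (F (r n) x))"
        by (rule l2norm_triangle_dist[OF s1 s2 s1])
      also have "l2norm lD (\<lambda>x. f (r m) x - fst (F (r n) x))
        \<le> l2norm lD (\<lambda>x. f (r m) x - f (r n) x) + l2norm lD (\<lambda>x. f (r n) x - fst (F (r n) x))"
        by (rule l2norm_triangle_dist[OF s2 s2 s1])
      also have "l2norm lD (\<lambda>x. f (r n) x - fst (F (r n) x)) = l2norm lD (\<lambda>x. fst (F (r n) x) - f (r n) x)"
        by (rule l2norm_minus_commute)
      finally have "l2norm lD (\<lambda>x. fst (F (r m) x) - fst (F (r n) x)) \<le> l2norm lD (\<lambda>x. fst (F (r m) x) - f (r m) x)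
        + (l2norm lD (\<lambda>x. f (r m) x - f (r n) x) + l2norm lD (\<lambda>x. fst (F (r n) x) - f (r n) x))" by simp
      moreover have "l2norm lD (\<lambda>x. f (r m) x - f (r n) x) < e/2" using N mn by simp
      ultimately show ?thesis using close[of m] close[of n] mn by simp
    qed
    then show "\<exists>N. \<forall>m\<ge>N. \<forall>n\<ge>N. l2norm lD (\<lambda>x. fst (F (r m) x) - fst (F (r n) x)) < e" by blast
  qed
qed

end


section \<open>Weighted forms\<close>

context bounded_open
begin

definition ess_bounded :: "real \<Rightarrow> (real ^ 'd \<Rightarrow> real) \<Rightarrow> bool" where
  "ess_bounded B w \<longleftrightarrow> 0 \<le> B \<and> w \<in> borel_measurable lD \<and> (AE x in lD. \<bar>w x\<bar> \<le> B)"

text \<open>A common shape for both forms of the problem, on pairs: coefficients \<alpha>, \<beta>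
  give the energy form, and 0, \<gamma> give the mass form. Bilinearity, continuity and the
  parallelogram identity are then proved once for both.\<close>

definition wform :: "(real ^ 'd \<Rightarrow> real) \<Rightarrow> (real ^ 'd \<Rightarrow> real) \<Rightarrow>
    (real ^ 'd \<Rightarrow> real \<times> (real ^ 'd)) \<Rightarrow> (real ^ 'd \<Rightarrow> real \<times> (real ^ 'd)) \<Rightarrow> real" where
  "wform p q F G = (LINT x|lD. p x * (snd (F x) \<bullet> snd (G x)) + q x * (fst (F x) * fst (G x)))"

lemma ess_bounded_zero: "0 \<le> B \<Longrightarrow> ess_bounded B (\<lambda>x. 0)"
  by (simp add: ess_bounded_def)

text \<open>The form is the L^2 inner product of \<open>G\<close> with a pointwise linear image
  \<open>T\<close> of \<open>F\<close>, and \<open>T\<close> enlarges norms by at most the factor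
  \<open>B\<close>.\<close>

lemma wform_bounded:
  assumes p: "ess_bounded B p" and q: "ess_bounded B q"
    and F: "square_integrable lD F" and G: "square_integrable lD G"
  shows "integrable lD (\<lambda>x. p x * (snd (F x) \<bullet> snd (G x)) + q x * (fst (F x) * fst (G x)))"
    and "\<bar>wform p q F G\<bar> \<le> B * l2norm lD F * l2norm lD G"
proof -
  define T where "T x = (q x * fst (F x), p x *\<^sub>R snd (F x))" for x
  have Tm: "T \<in> borel_measurable lD"
  proof -
    have "p \<in> borel_measurable lD" "q \<in> borel_measurable lD" using p q by (auto simp: ess_bounded_def)
    then show ?thesis
      unfolding T_def using square_integrableD(1)[OF square_integrable_fst_snd(1)[OF F]]
        square_integrableD(1)[OF square_integrable_fst_snd(2)[OF F]]
      by (intro borel_measurable_Pair borel_measurable_times borel_measurable_scaleR)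
  qed
  have B: "0 \<le> B" using p by (simp add: ess_bounded_def)
  have "AE x in lD. \<bar>p x\<bar> \<le> B" "AE x in lD. \<bar>q x\<bar> \<le> B" using p q by (auto simp: ess_bounded_def)
  then have "AE x in lD. norm (T x) \<le> B * norm (F x)"
  proof eventually_elim
    fix x assume b: "\<bar>p x\<bar> \<le> B" "\<bar>q x\<bar> \<le> B"
    have "(norm (T x))\<^sup>2 = \<bar>q x\<bar>\<^sup>2 * (fst (F x))\<^sup>2 + \<bar>p x\<bar>\<^sup>2 * (norm (snd (F x)))\<^sup>2"
      by (simp add: T_def norm_Pair power_mult_distrib)
    also have "\<dots> \<le> B\<^sup>2 * (fst (F x))\<^sup>2 + B\<^sup>2 * (norm (snd (F x)))\<^sup>2"
      by (intro add_mono mult_right_mono power_mono b) simp_all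
    also have "\<dots> = (B * norm (F x))\<^sup>2"
      using norm_Pair[of "fst (F x)" "snd (F x)"] by (simp add: power_mult_distrib algebra_simps)
    finally show "norm (T x) \<le> B * norm (F x)" by (rule power2_le_imp_le) (simp add: B)
  qed
  note TB = square_integrable_bound[OF F Tm this B]
  have eq: "p x * (snd (F x) \<bullet> snd (G x)) + q x * (fst (F x) * fst (G x)) = T x \<bullet> G x" for x
    by (simp add: T_def inner_prod_def)
  show "integrable lD (\<lambda>x. p x * (snd (F x) \<bullet> snd (G x)) + q x * (fst (F x) * fst (G x)))"
    unfolding eq by (rule integrable_inner_square(1)[OF TB(1) G])
  have "\<bar>wform p q F G\<bar> \<le> l2norm lD T * l2norm lD G"
    unfolding wform_def eq by (rule integrable_inner_square(2)[OF TB(1) G])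
  also have "\<dots> \<le> B * l2norm lD F * l2norm lD G" by (rule mult_right_mono[OF TB(2)]) simp
  finally show "\<bar>wform p q F G\<bar> \<le> B * l2norm lD F * l2norm lD G" .
qed

lemma wform_commute: "wform p q F G = wform p q G F"
  by (simp add: wform_def inner_commute mult.commute)

lemma wform_add_left:
  assumes p: "ess_bounded B p" and q: "ess_bounded B q"
    and "square_integrable lD F" "square_integrable lD G" "square_integrable lD H"
  shows "wform p q (\<lambda>x. F x + G x) H = wform p q F H + wform p q G H"
  unfolding wform_def
  using wform_bounded(1)[OF p q assms(3,5)] wform_bounded(1)[OF p q assms(4,5)]
  by (simp add: Bochner_Integration.integral_add[symmetric] inner_add_left algebra_simps)

lemma wform_scaleR_left: "wform p q (\<lambda>x. c *\<^sub>R F x) H = c * wform p q F H"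
proof -
  have "wform p q (\<lambda>x. c *\<^sub>R F x) H = (LINT x|lD. c * (p x * (snd (F x) \<bullet> snd (H x)) + q x * (fst (F x) * fst (H x))))"
    unfolding wform_def by (intro Bochner_Integration.integral_cong) (simp_all add: algebra_simps)
  also have "\<dots> = c * wform p q F H" unfolding wform_def by (rule integral_mult_right_zero)
  finally show ?thesis .
qed

lemma wform_add_right:
  assumes "ess_bounded B p" "ess_bounded B q"
    and "square_integrable lD F" "square_integrable lD G" "square_integrable lD H"
  shows "wform p q H (\<lambda>x. F x + G x) = wform p q H F + wform p q H G"
  using wform_add_left[OF assms] by (simp add: wform_commute[of p q H])

lemma wform_scaleR_right: "wform p q H (\<lambda>x. c *\<^sub>R F x) = c * wform p q H F"
  using wform_scaleR_left[of p q c F H] by (simp add: wform_commute[of p q H])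

lemma wform_lincomb:
  assumes pq: "ess_bounded B p" "ess_bounded B q"
    and F: "square_integrable lD F" and G: "square_integrable lD G"
  shows "wform p q (\<lambda>x. F x + t *\<^sub>R G x) (\<lambda>x. F x + t *\<^sub>R G x)
    = wform p q F F + 2 * t * wform p q F G + t\<^sup>2 * wform p q G G"
proof -
  note tG = square_integrable_scaleR[OF G, of t]
  note S = square_integrable_add[OF F tG]
  have "wform p q (\<lambda>x. F x + t *\<^sub>R G x) (\<lambda>x. F x + t *\<^sub>R G x)
     = wform p q F (\<lambda>x. F x + t *\<^sub>R G x) + t * wform p q G (\<lambda>x. F x + t *\<^sub>R G x)"
    by (simp add: wform_add_left[OF pq F tG S] wform_scaleR_left)
  also have "\<dots> = wform p q F F + 2 * t * wform p q F G + t\<^sup>2 * wform p q G G"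
    by (simp add: wform_add_right[OF pq F tG F] wform_add_right[OF pq F tG G] wform_scaleR_right
        wform_commute[of p q G F] algebra_simps power2_eq_square)
  finally show ?thesis .
qed

lemma wform_parallelogram:
  assumes pq: "ess_bounded B p" "ess_bounded B q"
    and F: "square_integrable lD F" and G: "square_integrable lD G"
  shows "wform p q (\<lambda>x. F x - G x) (\<lambda>x. F x - G x) + wform p q (\<lambda>x. F x + G x) (\<lambda>x. F x + G x)
    = 2 * wform p q F F + 2 * wform p q G G"
  using wform_lincomb[OF assms, of "-1"] wform_lincomb[OF assms, of 1] by simp

lemma wform_tendsto:
  assumes pq: "ess_bounded B p" "ess_bounded B q"
    and F: "\<And>n. square_integrable lD (F n)" "square_integrable lD F'" "(\<lambda>n. l2norm lD (\<lambda>x. F n x - F' x)) \<longlonglongrightarrow> 0"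
    and G: "\<And>n. square_integrable lD (G n)" "square_integrable lD G'" "(\<lambda>n. l2norm lD (\<lambda>x. G n x - G' x)) \<longlonglongrightarrow> 0"
  shows "(\<lambda>n. wform p q (F n) (G n)) \<longlonglongrightarrow> wform p q F' G'"
proof -
  let ?d = "\<lambda>n. l2norm lD (\<lambda>x. F n x - F' x)" and ?e = "\<lambda>n. l2norm lD (\<lambda>x. G n x - G' x)"
  have B: "0 \<le> B" using pq(1) by (simp add: ess_bounded_def)
  have "norm (wform p q (F n) (G n) - wform p q F' G') \<le> B * ?d n * (?e n + l2norm lD G') + B * l2norm lD F' * ?e n" for n
  proof -
    note dF = square_integrable_diff[OF F(1)[of n] F(2)] and dG = square_integrable_diff[OF G(1)[of n] G(2)]
    have "wform p q (F n) (G n) = wform p q (\<lambda>x. (F n x - F' x) + F' x) (G n)" by simp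
    also have "\<dots> = wform p q (\<lambda>x. F n x - F' x) (G n) + wform p q F' (G n)"
      by (rule wform_add_left[OF pq dF F(2) G(1)])
    also have "wform p q F' (G n) = wform p q F' (\<lambda>x. (G n x - G' x) + G' x)" by simp
    also have "\<dots> = wform p q F' (\<lambda>x. G n x - G' x) + wform p q F' G'"
      by (rule wform_add_right[OF pq dG G(2) F(2)])
    finally have "norm (wform p q (F n) (G n) - wform p q F' G')
       \<le> \<bar>wform p q (\<lambda>x. F n x - F' x) (G n)\<bar> + \<bar>wform p q F' (\<lambda>x. G n x - G' x)\<bar>" by simp
    also have "\<dots> \<le> B * ?d n * l2norm lD (G n) + B * l2norm lD F' * ?e n"
      by (intro add_mono wform_bounded(2)[OF pq dF G(1)] wform_bounded(2)[OF pq F(2) dG])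
    also have "\<dots> \<le> B * ?d n * (?e n + l2norm lD G') + B * l2norm lD F' * ?e n"
    proof -
      have "l2norm lD (G n) \<le> ?e n + l2norm lD G'" using l2norm_diff_abs_le[OF G(1)[of n] G(2)] by linarith
      moreover have "0 \<le> B * ?d n" using B by simp
      ultimately show ?thesis by (intro add_right_mono mult_left_mono)
    qed
    finally show ?thesis .
  qed
  then have "\<forall>\<^sub>F n in sequentially. norm (wform p q (F n) (G n) - wform p q F' G')
      \<le> B * ?d n * (?e n + l2norm lD G') + B * l2norm lD F' * ?e n"
    by (intro always_eventually allI)
  moreover have "(\<lambda>n. B * ?d n * (?e n + l2norm lD G') + B * l2norm lD F' * ?e n)
     \<longlonglongrightarrow> B * 0 * (0 + l2norm lD G') + B * l2norm lD F' * 0"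
    by (intro tendsto_intros F(3) G(3))
  then have "(\<lambda>n. B * ?d n * (?e n + l2norm lD G') + B * l2norm lD F' * ?e n) \<longlonglongrightarrow> 0"
    by (simp only: mult_zero_right mult_zero_left add_0)
  ultimately have "(\<lambda>n. wform p q (F n) (G n) - wform p q F' G') \<longlonglongrightarrow> 0"
    by (rule Lim_null_comparison)
  then show ?thesis by (rule LIM_zero_cancel)
qed

lemma wform_cong_AE:
  assumes pq: "ess_bounded B p" "ess_bounded B q"
    and F: "square_integrable lD F" and G: "square_integrable lD G" "square_integrable lD H"
    and ae: "AE x in lD. G x = H x"
  shows "wform p q F G = wform p q F H"
  unfolding wform_def
proof (rule integral_cong_AE)
  show "AE x in lD. p x * (snd (F x) \<bullet> snd (G x)) + q x * (fst (F x) * fst (G x))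
     = p x * (snd (F x) \<bullet> snd (H x)) + q x * (fst (F x) * fst (H x))"
    using ae by eventually_elim simp
qed (use wform_bounded(1)[OF pq F G(1)] wform_bounded(1)[OF pq F G(2)] in auto)

text \<open>The minimization argument runs twice, on \<open>jets0 D\<close> itself and on the
  orthogonal complement of the first eigenjet, and this is what both have in common.\<close>

definition closed_subspace :: "(real ^ 'd \<Rightarrow> real \<times> (real ^ 'd)) set \<Rightarrow> bool" where
  "closed_subspace X \<longleftrightarrow> X \<subseteq> jets0 D \<and> (\<forall>F\<in>X. \<forall>G\<in>X. (\<lambda>x. F x + G x) \<in> X) \<and> (\<forall>F\<in>X. \<forall>c. (\<lambda>x. c *\<^sub>R F x) \<in> X) \<and>
    (\<forall>F G. (\<forall>n. F n \<in> X) \<and> G \<in> jets0 D \<and> (\<lambda>n. l2norm lD (\<lambda>x. F n x - G x)) \<longlonglongrightarrow> 0 \<longrightarrow> G \<in> X)"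

lemma closed_subspace_limit:
  assumes "closed_subspace X" "\<And>n. F n \<in> X" "G \<in> jets0 D" "(\<lambda>n. l2norm lD (\<lambda>x. F n x - G x)) \<longlonglongrightarrow> 0"
  shows "G \<in> X"
proof -
  have "(\<forall>n. F n \<in> X) \<and> G \<in> jets0 D \<and> (\<lambda>n. l2norm lD (\<lambda>x. F n x - G x)) \<longlonglongrightarrow> 0 \<longrightarrow> G \<in> X"
    using assms(1) unfolding closed_subspace_def by (elim conjE) (elim allE)
  then show ?thesis using assms(2-4) by simp
qed

lemma closed_subspace_jets0: "closed_subspace (jets0 D)"
  by (auto simp: closed_subspace_def jets0_add jets0_scaleR)

lemma AE_fst_zero_of_l2norm:
  assumes "square_integrable lD F" "l2norm lD (\<lambda>x. fst (F x)) = 0"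
  shows "AE x in lD. fst (F x) = 0"
proof -
  have "(LINT x|lD. (norm (fst (F x)))\<^sup>2) = 0" using assms(2) by (simp add: l2norm_def)
  then have "AE x in lD. (norm (fst (F x)))\<^sup>2 = 0"
    using square_integrableD(2)[OF square_integrable_fst_snd(1)[OF assms(1)]]
    by (subst (asm) integral_nonneg_eq_0_iff_AE) auto
  then show ?thesis by eventually_elim simp
qed

end


section \<open>Minimizers of the Rayleigh quotient\<close>

text \<open>The problem at one fixed parameter. The constants \<open>a0\<close> and \<open>B\<close>
  are locale parameters, so that all members of a family of problems can share them.\<close>

locale eigen_problem = bounded_open D for D :: "(real ^ 'd) set" +
  fixes \<alpha> \<beta> \<gamma> :: "real ^ 'd \<Rightarrow> real" and a0 B :: real
  assumes nonempty: "D \<noteq> {}"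
    and a0: "0 < a0"
    and bounded_\<alpha>: "ess_bounded B \<alpha>" and bounded_\<beta>: "ess_bounded B \<beta>" and bounded_\<gamma>: "ess_bounded B \<gamma>"
    and lower_\<alpha>: "AE x in lD. a0 \<le> \<alpha> x" and lower_\<beta>: "AE x in lD. 0 \<le> \<beta> x" and lower_\<gamma>: "AE x in lD. a0 \<le> \<gamma> x"
begin

abbreviation "\<A> \<equiv> wform \<alpha> \<beta>"
abbreviation "\<M> \<equiv> wform (\<lambda>x. 0) \<gamma>"

lemma B_nonneg: "0 \<le> B" using bounded_\<alpha> by (simp add: ess_bounded_def)

lemma bounded_zero: "ess_bounded B (\<lambda>x. 0)" by (rule ess_bounded_zero[OF B_nonneg])

lemmas A_bd = bounded_\<alpha> bounded_\<beta>
lemmas M_bd = bounded_zero bounded_\<gamma>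

lemma M_lower:
  assumes "square_integrable lD F"
  shows "a0 * (l2norm lD (\<lambda>x. fst (F x)))\<^sup>2 \<le> \<M> F F"
proof -
  have "a0 * (l2norm lD (\<lambda>x. fst (F x)))\<^sup>2 = (LINT x|lD. a0 * (norm (fst (F x)))\<^sup>2)" by (simp add: l2norm_power2)
  also have "\<dots> \<le> \<M> F F" unfolding wform_def
  proof (rule integral_mono_AE)
    show "integrable lD (\<lambda>x. a0 * (norm (fst (F x)))\<^sup>2)"
      using square_integrableD(2)[OF square_integrable_fst_snd(1)[OF assms]] by simp
    show "AE x in lD. a0 * (norm (fst (F x)))\<^sup>2 \<le> 0 * (snd (F x) \<bullet> snd (F x)) + \<gamma> x * (fst (F x) * fst (F x))"
      using lower_\<gamma> by eventually_elim (auto simp: power2_eq_square intro: mult_right_mono)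
  qed (rule wform_bounded(1)[OF M_bd assms assms])
  finally show ?thesis .
qed

lemma M_nonneg: "square_integrable lD F \<Longrightarrow> 0 \<le> \<M> F F"
  using M_lower[of F] a0 by (meson less_imp_le mult_nonneg_nonneg order_trans zero_le_power2)

lemma M_upper:
  assumes "square_integrable lD F"
  shows "\<M> F F \<le> B * (l2norm lD (\<lambda>x. fst (F x)))\<^sup>2"
proof -
  have "\<M> F F \<le> (LINT x|lD. B * (norm (fst (F x)))\<^sup>2)" unfolding wform_def
  proof (rule integral_mono_AE)
    show "integrable lD (\<lambda>x. B * (norm (fst (F x)))\<^sup>2)"
      using square_integrableD(2)[OF square_integrable_fst_snd(1)[OF assms]] by simp
    have "AE x in lD. \<bar>\<gamma> x\<bar> \<le> B" using bounded_\<gamma> by (simp add: ess_bounded_def)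
    then show "AE x in lD. 0 * (snd (F x) \<bullet> snd (F x)) + \<gamma> x * (fst (F x) * fst (F x)) \<le> B * (norm (fst (F x)))\<^sup>2"
      by eventually_elim (auto simp: power2_eq_square intro: mult_right_mono)
  qed (rule wform_bounded(1)[OF M_bd assms assms])
  then show ?thesis by (simp add: l2norm_power2)
qed

lemma A_lower:
  assumes "square_integrable lD F"
  shows "a0 * (l2norm lD (\<lambda>x. snd (F x)))\<^sup>2 \<le> \<A> F F"
proof -
  have "a0 * (l2norm lD (\<lambda>x. snd (F x)))\<^sup>2 = (LINT x|lD. a0 * (norm (snd (F x)))\<^sup>2)" by (simp add: l2norm_power2)
  also have "\<dots> \<le> \<A> F F" unfolding wform_def
  proof (rule integral_mono_AE)
    show "integrable lD (\<lambda>x. a0 * (norm (snd (F x)))\<^sup>2)"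
      using square_integrableD(2)[OF square_integrable_fst_snd(2)[OF assms]] by simp
    show "AE x in lD. a0 * (norm (snd (F x)))\<^sup>2 \<le> \<alpha> x * (snd (F x) \<bullet> snd (F x)) + \<beta> x * (fst (F x) * fst (F x))"
      using lower_\<alpha> lower_\<beta>
    proof eventually_elim
      fix x assume "a0 \<le> \<alpha> x" "0 \<le> \<beta> x"
      then have "a0 * (norm (snd (F x)))\<^sup>2 \<le> \<alpha> x * (norm (snd (F x)))\<^sup>2" "0 \<le> \<beta> x * (fst (F x) * fst (F x))"
        by (auto intro: mult_right_mono)
      then show "a0 * (norm (snd (F x)))\<^sup>2 \<le> \<alpha> x * (snd (F x) \<bullet> snd (F x)) + \<beta> x * (fst (F x) * fst (F x))"
        by (simp add: power2_norm_eq_inner)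
    qed
  qed (rule wform_bounded(1)[OF A_bd assms assms])
  finally show ?thesis .
qed

lemma A_nonneg: "square_integrable lD F \<Longrightarrow> 0 \<le> \<A> F F"
  using A_lower[of F] a0 by (meson less_imp_le mult_nonneg_nonneg order_trans zero_le_power2)

lemma l2norm_fst_snd_power2:
  assumes "square_integrable lD F"
  shows "(l2norm lD F)\<^sup>2 = (l2norm lD (\<lambda>x. fst (F x)))\<^sup>2 + (l2norm lD (\<lambda>x. snd (F x)))\<^sup>2"
proof -
  have "(norm (F x))\<^sup>2 = (norm (fst (F x)))\<^sup>2 + (norm (snd (F x)))\<^sup>2" for x
    using norm_Pair[of "fst (F x)" "snd (F x)"] by simp
  then show ?thesis
    using square_integrableD(2)[OF square_integrable_fst_snd(1)[OF assms]]
      square_integrableD(2)[OF square_integrable_fst_snd(2)[OF assms]]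
    by (simp add: l2norm_power2)
qed

text \<open>The energy controls the gradient and the mass controls the function, each with the same
  constant; hence the sum of the two forms.\<close>

lemma coercive:
  assumes "square_integrable lD F"
  shows "a0 * (l2norm lD F)\<^sup>2 \<le> \<A> F F + \<M> F F"
  using A_lower[OF assms] M_lower[OF assms] by (simp add: l2norm_fst_snd_power2[OF assms] algebra_simps)

lemma M_zero_AE:
  assumes F: "square_integrable lD F" and "\<M> F F = 0"
  shows "AE x in lD. fst (F x) = 0"
proof -
  have "a0 * (l2norm lD (\<lambda>x. fst (F x)))\<^sup>2 \<le> 0" using M_lower[OF F] assms(2) by simp
  then have "(l2norm lD (\<lambda>x. fst (F x)))\<^sup>2 \<le> 0" using a0 by (simp add: mult_le_0_iff)
  then show ?thesis using AE_fst_zero_of_l2norm[OF F] by simp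
qed

lemma M_AE_zero:
  assumes F: "square_integrable lD F" and "AE x in lD. fst (F x) = 0"
  shows "\<M> F G = 0"
  unfolding wform_def by (rule integral_eq_zero_AE) (use assms(2) in eventually_elim, simp)

lemma M_pos: "square_integrable lD F \<Longrightarrow> \<not> (AE x in lD. fst (F x) = 0) \<Longrightarrow> 0 < \<M> F F"
  using M_nonneg M_zero_AE by (metis order_le_less)

text \<open>The arithmetic of the parallelogram argument: \<open>aE\<close>, \<open>mE\<close> are
  energy and mass of the difference of two elements of mass 1, \<open>aS\<close>, \<open>mS\<close>
  those of their sum, \<open>am\<close>, \<open>an\<close> the energies of the two elements. A lower
  bound for the energy of the sum is an upper bound for that of the difference.\<close>

lemma almost_minimizer_energy:
  fixes aE aS am an mE mS \<mu> :: real
  assumes "aE + aS = 2 * am + 2 * an" "mE + mS = 4" "\<mu> * mS \<le> aS"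
  shows "aE + mE \<le> 2 * (am - \<mu>) + 2 * (an - \<mu>) + (\<mu> * mE + mE)"
proof -
  have "mS = 4 - mE" using assms(2) by simp
  then have "\<mu> * 4 - \<mu> * mE \<le> aS" using assms(3) by (simp add: right_diff_distrib)
  then show ?thesis using assms(1) by simp
qed

text \<open>By the parallelogram identity the energy of a difference of two almost minimizers is controlled
  by their \<open>L\<^sup>2\<close> distance, which Rellich's theorem makes small.\<close>

lemma minimizing_sequence_converges:
  assumes X: "closed_subspace X" and lb: "\<And>F. F \<in> X \<Longrightarrow> \<mu> * \<M> F F \<le> \<A> F F"
    and F: "\<And>n. F n \<in> X" and M1: "\<And>n. \<M> (F n) (F n) = 1" and lim: "(\<lambda>n. \<A> (F n) (F n)) \<longlonglongrightarrow> \<mu>"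
  obtains r :: "nat \<Rightarrow> nat" and G where "strict_mono r" "G \<in> X" "(\<lambda>n. l2norm lD (\<lambda>x. F (r n) x - G x)) \<longlonglongrightarrow> 0"
    "\<M> G G = 1" "\<A> G G = \<mu>"
proof -
  have XJ: "X \<subseteq> jets0 D" using X by (simp add: closed_subspace_def)
  have FJ: "F n \<in> jets0 D" for n using F XJ by blast
  note sq = jets0_square_integrable[OF FJ]
  obtain C where C: "C > 0" "\<And>n. \<bar>\<A> (F n) (F n)\<bar> \<le> C"
    using convergent_imp_Bseq[OF convergentI[OF lim]] unfolding Bseq_def real_norm_def by blast
  have "l2norm lD (F n) \<le> sqrt ((C + 1) / a0)" for n
  proof -
    have "a0 * (l2norm lD (F n))\<^sup>2 \<le> C + 1" using coercive[OF sq, of n] C(2)[of n] M1[of n] by linarith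
    then have "(l2norm lD (F n))\<^sup>2 \<le> (C + 1) / a0" using a0 by (simp add: field_simps)
    then show ?thesis using real_le_rsqrt by blast
  qed
  then obtain r :: "nat \<Rightarrow> nat" where r: "strict_mono r"
    "\<And>e. e > 0 \<Longrightarrow> \<exists>N. \<forall>m\<ge>N. \<forall>n\<ge>N. l2norm lD (\<lambda>x. fst (F (r m) x) - fst (F (r n) x)) < e"
    by (rule rellich_jets0[of F, OF FJ]) (rule that; assumption)
  define d where "d n = \<A> (F (r n)) (F (r n)) - \<mu>" for n
  have limr: "(\<lambda>n. \<A> (F (r n)) (F (r n))) \<longlonglongrightarrow> \<mu>" using LIMSEQ_subseq_LIMSEQ[OF lim r(1)] by (simp add: o_def)
  have d0: "d \<longlonglongrightarrow> 0" unfolding d_def using tendsto_diff[OF limr tendsto_const[of \<mu>]] by simp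
  have main: "a0 * (l2norm lD (\<lambda>x. F (r m) x - F (r n) x))\<^sup>2 \<le> 2 * d m + 2 * d n
      + (\<bar>\<mu>\<bar> + 1) * B * (l2norm lD (\<lambda>x. fst (F (r m) x) - fst (F (r n) x)))\<^sup>2" for m n
  proof -
    define E where "E = (\<lambda>x. F (r m) x - F (r n) x)"
    define S where "S = (\<lambda>x. F (r m) x + F (r n) x)"
    have E: "square_integrable lD E" unfolding E_def by (intro square_integrable_diff sq)
    have S: "S \<in> X" unfolding S_def using X F by (simp add: closed_subspace_def)
    have 1: "\<A> E E + \<A> S S = 2 * \<A> (F (r m)) (F (r m)) + 2 * \<A> (F (r n)) (F (r n))"
      unfolding E_def S_def by (rule wform_parallelogram[OF A_bd sq sq])
    have 2: "\<M> E E + \<M> S S = 4"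
      unfolding E_def S_def wform_parallelogram[OF M_bd sq sq] M1 by simp
    have "a0 * (l2norm lD E)\<^sup>2 \<le> \<A> E E + \<M> E E" by (rule coercive[OF E])
    also have "\<dots> \<le> 2 * d m + 2 * d n + (\<mu> * \<M> E E + \<M> E E)"
      unfolding d_def by (rule almost_minimizer_energy[OF 1 2 lb[OF S]])
    also have "\<mu> * \<M> E E + \<M> E E \<le> (\<bar>\<mu>\<bar> + 1) * \<M> E E"
      using M_nonneg[OF E] by (simp add: distrib_right mult_right_mono)
    also have "(\<bar>\<mu>\<bar> + 1) * \<M> E E \<le> (\<bar>\<mu>\<bar> + 1) * (B * (l2norm lD (\<lambda>x. fst (E x)))\<^sup>2)"
      by (rule mult_left_mono[OF M_upper[OF E]]) simp
    finally show ?thesis by (simp add: E_def mult.assoc)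
  qed
  have Cauchy: "\<exists>N. \<forall>m\<ge>N. \<forall>n\<ge>N. l2norm lD (\<lambda>x. F (r m) x - F (r n) x) < e" if e: "e > 0" for e
  proof -
    define c where "c = (\<bar>\<mu>\<bar> + 1) * B + 1"
    have c: "c > 0" using B_nonneg by (simp add: c_def add_nonneg_pos)
    \<comment> \<open>With these thresholds each of the three terms on the right of
      \<open>main\<close> stays below a quarter of a0 e^2. The summand 1 in \<open>c\<close> keeps
      the second threshold meaningful if \<open>B\<close> is 0.\<close>
    have pos: "a0 * e\<^sup>2 / 8 > 0" "sqrt (a0 * e\<^sup>2 / (4 * c)) > 0" using a0 e c by auto
    have "\<forall>\<^sub>F n in sequentially. d n < a0 * e\<^sup>2 / 8" by (rule order_tendstoD(2)[OF d0 pos(1)])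
    then obtain N1 where N1: "\<And>n. n \<ge> N1 \<Longrightarrow> d n < a0 * e\<^sup>2 / 8" by (auto simp: eventually_sequentially)
    obtain N2 where N2: "\<forall>m\<ge>N2. \<forall>n\<ge>N2. l2norm lD (\<lambda>x. fst (F (r m) x) - fst (F (r n) x)) < sqrt (a0 * e\<^sup>2 / (4 * c))"
      using r(2)[OF pos(2)] by blast
    have "l2norm lD (\<lambda>x. F (r m) x - F (r n) x) < e" if mn: "m \<ge> max N1 N2" "n \<ge> max N1 N2" for m n
    proof -
      let ?f = "l2norm lD (\<lambda>x. fst (F (r m) x) - fst (F (r n) x))"
      have "?f < sqrt (a0 * e\<^sup>2 / (4 * c))" using N2 mn by simp
      then have "?f\<^sup>2 < (sqrt (a0 * e\<^sup>2 / (4 * c)))\<^sup>2" by (rule power_strict_mono) auto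
      also have "\<dots> = a0 * e\<^sup>2 / (4 * c)" using a0 c by simp
      finally have "c * ?f\<^sup>2 < a0 * e\<^sup>2 / 4" using c by (simp add: field_simps)
      moreover have "(\<bar>\<mu>\<bar> + 1) * B * ?f\<^sup>2 \<le> c * ?f\<^sup>2" by (rule mult_right_mono) (simp_all add: c_def)
      moreover have "d m < a0 * e\<^sup>2 / 8" "d n < a0 * e\<^sup>2 / 8" using N1 mn by auto
      moreover have "a0 * e\<^sup>2 > 0" using a0 e by simp
      ultimately have "a0 * (l2norm lD (\<lambda>x. F (r m) x - F (r n) x))\<^sup>2 < a0 * e\<^sup>2" using main[of m n] by linarith
      then have "(l2norm lD (\<lambda>x. F (r m) x - F (r n) x))\<^sup>2 < e\<^sup>2" using a0 by simp
      then show ?thesis using e by (simp add: power_less_imp_less_base)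
    qed
    then show ?thesis by blast
  qed
  obtain G where G: "G \<in> jets0 D" "(\<lambda>n. l2norm lD (\<lambda>x. F (r n) x - G x)) \<longlonglongrightarrow> 0"
  proof (rule jets0_complete[of "\<lambda>n. F (r n)", OF FJ])
    show "\<exists>N. \<forall>m\<ge>N. \<forall>n\<ge>N. l2norm lD (\<lambda>x. F (r m) x - F (r n) x) < e" if "e > 0" for e
      using that by (rule Cauchy)
  qed (rule that; assumption)
  have GX: "G \<in> X" by (rule closed_subspace_limit[OF X F G])
  note sG = jets0_square_integrable[OF G(1)]
  have "(\<lambda>n. \<M> (F (r n)) (F (r n))) \<longlonglongrightarrow> \<M> G G" by (rule wform_tendsto[OF M_bd sq sG G(2) sq sG G(2)])
  then have "\<M> G G = 1" by (simp add: M1 LIMSEQ_const_iff)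
  moreover have "(\<lambda>n. \<A> (F (r n)) (F (r n))) \<longlonglongrightarrow> \<A> G G" by (rule wform_tendsto[OF A_bd sq sG G(2) sq sG G(2)])
  then have "\<A> G G = \<mu>" using limr LIMSEQ_unique by blast
  ultimately show ?thesis by (intro that[OF r(1) GX G(2)])
qed

text \<open>Along the line G + t H the excess of energy over \<mu> times mass is the quadratic
  polynomial 2 t b + t^2 c. It has no constant term and is nonnegative for all t, so its linear
  coefficient vanishes.\<close>

lemma minimizer_euler_lagrange:
  assumes X: "closed_subspace X" and lb: "\<And>F. F \<in> X \<Longrightarrow> \<mu> * \<M> F F \<le> \<A> F F"
    and G: "G \<in> X" "\<A> G G = \<mu> * \<M> G G" and H: "H \<in> X"
  shows "\<A> G H = \<mu> * \<M> G H"
proof -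
  have XJ: "X \<subseteq> jets0 D" using X by (simp add: closed_subspace_def)
  have sG: "square_integrable lD G" and sH: "square_integrable lD H"
    using G(1) H XJ jets0_square_integrable by blast+
  define b where "b = \<A> G H - \<mu> * \<M> G H"
  define c where "c = \<A> H H - \<mu> * \<M> H H"
  have q: "0 \<le> 2 * t * b + t\<^sup>2 * c" for t
  proof -
    have "(\<lambda>x. G x + t *\<^sub>R H x) \<in> X" using X G(1) H by (simp add: closed_subspace_def)
    from lb[OF this] show ?thesis
      unfolding wform_lincomb[OF A_bd sG sH] wform_lincomb[OF M_bd sG sH] b_def c_def
      using G(2) by (simp add: algebra_simps)
  qed
  have c: "0 \<le> c" unfolding c_def using lb[OF H] by simp
  \<comment> \<open>The minimum of the polynomial would be at - b / c; the denominator c + 1 allows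
    c = 0 and still gives a negative value unless b = 0.\<close>
  have "0 \<le> 2 * (- b / (c + 1)) * b + (- b / (c + 1))\<^sup>2 * c" by (rule q)
  also have "\<dots> = - (b\<^sup>2 * (c + 2)) / (c + 1)\<^sup>2"
  proof -
    have "c + 1 \<noteq> 0" using c by simp
    then show ?thesis by (simp add: divide_simps power2_eq_square) (simp add: algebra_simps)
  qed
  finally have "0 \<le> - (b\<^sup>2 * (c + 2))" using c by (simp only: zero_le_divide_iff) auto
  then have "b\<^sup>2 * (c + 2) \<le> 0" by simp
  then have "b = 0" using c by (simp add: mult_le_0_iff)
  then show ?thesis by (simp add: b_def)
qed

text \<open>The direct method: an infimum over elements of mass 1 is attained by
  \<open>minimizing_sequence_converges\<close>. Homogeneity extends the lower bound to all elements
  of positive mass, and elements of mass 0 satisfy it because the energy is nonnegative.\<close>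

lemma minimizer_exists:
  assumes X: "closed_subspace X" and ne: "F0 \<in> X" "\<M> F0 F0 > 0"
  obtains \<mu> G where "G \<in> X" "\<M> G G = 1" "\<A> G G = \<mu>" "\<And>F. F \<in> X \<Longrightarrow> \<mu> * \<M> F F \<le> \<A> F F"
    "\<And>H. H \<in> X \<Longrightarrow> \<A> G H = \<mu> * \<M> G H"
proof -
  have XJ: "X \<subseteq> jets0 D" using X by (simp add: closed_subspace_def)
  have sq: "square_integrable lD F" if "F \<in> X" for F using that XJ jets0_square_integrable by blast
  define V where "V = {\<A> F F |F. F \<in> X \<and> \<M> F F = 1}"
  define \<mu> where "\<mu> = Inf V"
  have normalize: "\<exists>F'\<in>X. \<M> F' F' = 1 \<and> \<A> F F = \<M> F F * \<A> F' F'" if F: "F \<in> X" "\<M> F F > 0" for F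
  proof -
    define s where "s = 1 / sqrt (\<M> F F)"
    have s: "s * (s * \<M> F F) = 1" using F(2) by (simp add: s_def field_simps)
    have "(\<lambda>x. s *\<^sub>R F x) \<in> X" using X F by (simp add: closed_subspace_def)
    moreover have "\<M> (\<lambda>x. s *\<^sub>R F x) (\<lambda>x. s *\<^sub>R F x) = 1"
      using s by (simp add: wform_scaleR_left wform_scaleR_right)
    moreover have "\<A> F F = \<M> F F * \<A> (\<lambda>x. s *\<^sub>R F x) (\<lambda>x. s *\<^sub>R F x)"
      using s by (simp add: wform_scaleR_left wform_scaleR_right) (metis mult.assoc mult.commute mult_1)
    ultimately show ?thesis by (intro bexI[of _ "\<lambda>x. s *\<^sub>R F x"]) auto
  qed
  have Vne: "V \<noteq> {}" using normalize[OF ne] by (auto simp: V_def)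
  have "0 \<le> v" if "v \<in> V" for v using that A_nonneg sq by (auto simp: V_def)
  then have Vbd: "bdd_below V" by (rule bdd_belowI)
  have lb: "\<mu> * \<M> F F \<le> \<A> F F" if F: "F \<in> X" for F
  proof (cases "\<M> F F > 0")
    case True
    then obtain F' where F': "F' \<in> X" "\<M> F' F' = 1" "\<A> F F = \<M> F F * \<A> F' F'" using normalize[OF F] by blast
    then have "\<mu> \<le> \<A> F' F'" unfolding \<mu>_def by (intro cInf_lower Vbd) (auto simp: V_def)
    then show ?thesis using True F'(3) by (simp add: mult.commute)
  next
    case False
    then have "\<M> F F = 0" using M_nonneg[OF sq[OF F]] by simp
    then show ?thesis using A_nonneg[OF sq[OF F]] by simp
  qed
  have "\<exists>F. F \<in> X \<and> \<M> F F = 1 \<and> \<A> F F < \<mu> + 1 / real (Suc n)" for n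
  proof -
    have "\<mu> < \<mu> + 1 / real (Suc n)" by simp
    then have "\<exists>v\<in>V. v < \<mu> + 1 / real (Suc n)" unfolding \<mu>_def using cInf_less_iff[OF Vne Vbd] by blast
    then show ?thesis by (auto simp: V_def)
  qed
  then obtain F where F: "\<And>n. F n \<in> X" "\<And>n. \<M> (F n) (F n) = 1" "\<And>n. \<A> (F n) (F n) < \<mu> + 1 / real (Suc n)" by metis
  have lim: "(\<lambda>n. \<A> (F n) (F n)) \<longlonglongrightarrow> \<mu>"
  proof (rule tendsto_sandwich[of "\<lambda>n. \<mu>" _ _ "\<lambda>n. \<mu> + 1 / real (Suc n)"])
    show "\<forall>\<^sub>F n in sequentially. \<mu> \<le> \<A> (F n) (F n)" using lb[OF F(1)] F(2) by simp
    show "\<forall>\<^sub>F n in sequentially. \<A> (F n) (F n) \<le> \<mu> + 1 / real (Suc n)" using F(3) by (simp add: less_imp_le)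
    show "(\<lambda>n. \<mu> + 1 / real (Suc n)) \<longlonglongrightarrow> \<mu>"
      using tendsto_add[OF tendsto_const[of \<mu>] LIMSEQ_Suc[OF lim_1_over_n]] by simp
  qed simp
  obtain G where G: "G \<in> X" "\<M> G G = 1" "\<A> G G = \<mu>"
  proof (rule minimizing_sequence_converges[OF X lb F(1,2) lim])
    show "F \<in> X" if "F \<in> X" for F using that .
  qed (rule that; assumption)
  have "\<A> G H = \<mu> * \<M> G H" if "H \<in> X" for H
    by (rule minimizer_euler_lagrange[OF X lb G(1) _ that]) (simp_all add: G)
  then show ?thesis using that[OF G lb] by blast
qed

end


section \<open>The two lowest eigenvalues\<close>

lemma positive_on_open_not_AE_zero:
  fixes f :: "'a::euclidean_space \<Rightarrow> real"
  assumes "open D" "open U" "U \<subseteq> D" "U \<noteq> {}" "\<And>x. x \<in> U \<Longrightarrow> f x > 0"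
  shows "\<not> (AE x in lebesgue_on D. f x = 0)"
proof
  assume "AE x in lebesgue_on D. f x = 0"
  then have "AE x in lebesgue. x \<in> D \<longrightarrow> f x = 0" using assms(1) by (subst (asm) AE_restrict_space_iff) auto
  then have "AE x in lebesgue. x \<notin> U"
  proof eventually_elim
    fix x assume "x \<in> D \<longrightarrow> f x = 0"
    then show "x \<notin> U" using assms(3) assms(5)[of x] by auto
  qed
  then have "U \<in> null_sets lebesgue" by (simp add: completion.null_sets_iff_AE)
  then show False using open_not_negligible[OF assms(2,4)] by (simp add: negligible_iff_null_sets)
qed

text \<open>Two linearly independent directions, which ensure that the orthogonal complement of the
  first eigenjet contains an element of positive mass. Disjoint supports make their mass product
  vanish.\<close>

lemma disjoint_test_functions:
  fixes D :: "(real ^ 'd) set"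
  assumes "open D" "D \<noteq> {}"
  obtains f g where "f \<in> test_functions D" "g \<in> test_functions D" "\<And>x. f x * g x = 0"
    "\<not> (AE x in lebesgue_on D. f x = 0)" "\<not> (AE x in lebesgue_on D. g x = 0)"
proof -
  have "\<exists>x\<in>D. \<exists>y\<in>D. x \<noteq> y"
  proof (rule ccontr)
    assume "\<not> ?thesis"
    then obtain x where "D = {x}" using assms(2) by blast
    then show False using assms(1) not_open_singleton[of x] by simp
  qed
  then obtain x y where xy: "x \<in> D" "y \<in> D" "x \<noteq> y" by blast
  obtain U V where UV: "open U" "open V" "x \<in> U" "y \<in> V" "U \<inter> V = {}" using hausdorff[OF xy(3)] by blast
  have bump: "\<exists>f U'. f \<in> test_functions D \<and> open U' \<and> U' \<subseteq> D \<inter> W \<and> U' \<noteq> {} \<and> (\<forall>x\<in>U'. f x > 0) \<and> (\<forall>x. x \<notin> U' \<longrightarrow> f x = 0)"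
    if W: "open W" "z \<in> W" "z \<in> D" for W z
  proof -
    have "open (D \<inter> W)" "z \<in> D \<inter> W" using assms(1) W by auto
    then obtain c d where cd: "cbox c d \<subseteq> D \<inter> W" "z \<in> box c d"
      by (rule open_contains_cbox) (rule that; assumption)
    then have cD: "cbox c d \<subseteq> D" by blast
    obtain b where b: "b \<in> test_functions D" "\<And>x. x \<in> box c d \<Longrightarrow> b x > 0" "\<And>x. x \<notin> box c d \<Longrightarrow> b x = 0"
      by (rule test_bump_box[OF cD]) (rule that; assumption)
    have "box c d \<subseteq> D \<inter> W" using cd(1) box_subset_cbox[of c d] by blast
    then show ?thesis using b cd(2) open_box[of c d]
      by (intro exI[of _ b] exI[of _ "box c d"] conjI) auto
  qed
  obtain f O1 where f: "f \<in> test_functions D" "open O1" "O1 \<subseteq> D \<inter> U" "O1 \<noteq> {}" "\<forall>x\<in>O1. f x > 0" "\<forall>x. x \<notin> O1 \<longrightarrow> f x = 0"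
    using bump[OF UV(1,3) xy(1)] by blast
  obtain g O2 where g: "g \<in> test_functions D" "open O2" "O2 \<subseteq> D \<inter> V" "O2 \<noteq> {}" "\<forall>x\<in>O2. g x > 0" "\<forall>x. x \<notin> O2 \<longrightarrow> g x = 0"
    using bump[OF UV(2,4) xy(2)] by blast
  show ?thesis
  proof (rule that[OF f(1) g(1)])
    show "f x * g x = 0" for x
    proof -
      have "x \<notin> O1 \<or> x \<notin> O2" using f(3) g(3) UV(5) by blast
      then show ?thesis using f(6) g(6) by auto
    qed
    show "\<not> (AE x in lebesgue_on D. f x = 0)"
      by (rule positive_on_open_not_AE_zero[OF assms(1) f(2) _ f(4)]) (use f(3,5) in auto)
    show "\<not> (AE x in lebesgue_on D. g x = 0)"
      by (rule positive_on_open_not_AE_zero[OF assms(1) g(2) _ g(4)]) (use g(3,5) in auto)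
  qed
qed

context eigen_problem
begin

text \<open>The eigenspace on the level of pairs: the weak equation is tested with pairs, so that
  \<open>wgrad\<close> does not occur in it.\<close>

definition eigenjets :: "real \<Rightarrow> (real ^ 'd \<Rightarrow> real \<times> (real ^ 'd)) set" where
  "eigenjets \<mu> = {F \<in> jets0 D. \<forall>H\<in>jets0 D. \<A> F H = \<mu> * \<M> F H}"

lemma eigenjetsD:
  assumes "F \<in> eigenjets \<mu>"
  shows "F \<in> jets0 D" "square_integrable lD F" "\<And>H. H \<in> jets0 D \<Longrightarrow> \<A> F H = \<mu> * \<M> F H"
  using assms jets0_square_integrable by (auto simp: eigenjets_def)

lemma eigenjets_add:
  assumes F: "F \<in> eigenjets \<mu>" and G: "G \<in> eigenjets \<mu>"
  shows "(\<lambda>x. F x + G x) \<in> eigenjets \<mu>"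
proof -
  note F' = eigenjetsD[OF F] and G' = eigenjetsD[OF G]
  have "\<A> (\<lambda>x. F x + G x) H = \<mu> * \<M> (\<lambda>x. F x + G x) H" if H: "H \<in> jets0 D" for H
    unfolding wform_add_left[OF A_bd F'(2) G'(2) jets0_square_integrable[OF H]]
      wform_add_left[OF M_bd F'(2) G'(2) jets0_square_integrable[OF H]] F'(3)[OF H] G'(3)[OF H]
    by (simp add: distrib_left)
  then show ?thesis using jets0_add[OF F'(1) G'(1)] by (simp add: eigenjets_def)
qed

lemma eigenjets_scaleR: "F \<in> eigenjets \<mu> \<Longrightarrow> (\<lambda>x. c *\<^sub>R F x) \<in> eigenjets \<mu>"
  by (auto simp: eigenjets_def jets0_scaleR wform_scaleR_left)

section \<open>Translation between eigenfunctions and eigenjets\<close>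

lemma A_form_eq_wform:
  assumes u: "u \<in> H10 D" and v: "v \<in> H10 D"
  shows "A_form D \<alpha> \<beta> u v = \<A> (\<lambda>x. (u x, wgrad D u x)) (\<lambda>x. (v x, wgrad D v x))"
    and "M_form D \<gamma> u v = \<M> (\<lambda>x. (u x, wgrad D u x)) (\<lambda>x. (v x, wgrad D v x))"
proof -
  note su = jets0_square_integrable[OF H10_imp_jets0[OF u]] and sv = jets0_square_integrable[OF H10_imp_jets0[OF v]]
  \<comment> \<open>Each half of the energy is itself a \<open>wform\<close> with the other
    coefficient 0, hence integrable, and the two integrals of \<open>A_form\<close> merge into
    one.\<close>
  have i: "integrable lD (\<lambda>x. \<alpha> x * (wgrad D u x \<bullet> wgrad D v x))"
    "integrable lD (\<lambda>x. \<beta> x * u x * v x)"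
    using wform_bounded(1)[OF bounded_\<alpha> bounded_zero su sv] wform_bounded(1)[OF bounded_zero bounded_\<beta> su sv]
    by (simp_all add: mult.assoc)
  show "A_form D \<alpha> \<beta> u v = \<A> (\<lambda>x. (u x, wgrad D u x)) (\<lambda>x. (v x, wgrad D v x))"
    unfolding A_form_def wform_def using Bochner_Integration.integral_add[OF i] by (simp add: mult.assoc)
  show "M_form D \<gamma> u v = \<M> (\<lambda>x. (u x, wgrad D u x)) (\<lambda>x. (v x, wgrad D v x))"
    unfolding M_form_def wform_def by (simp add: mult.assoc)
qed

text \<open>The second component of a pair is a weak gradient of the first, but in general not
  literally the chosen one. Replacing it by the chosen one changes the pair on a null set
  only.\<close>

lemma jet_of_jets0:
  assumes F: "F \<in> jets0 D"
  shows "(\<lambda>x. (fst (F x), wgrad D (\<lambda>x. fst (F x)) x)) \<in> jets0 D"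
    "AE x in lD. F x = (fst (F x), wgrad D (\<lambda>x. fst (F x)) x)"
proof -
  show "(\<lambda>x. (fst (F x), wgrad D (\<lambda>x. fst (F x)) x)) \<in> jets0 D"
    by (rule H10_imp_jets0[OF jets0_imp_H10(1)[OF F]])
  show "AE x in lD. F x = (fst (F x), wgrad D (\<lambda>x. fst (F x)) x)"
    using jets0_imp_H10(2)[OF F] by eventually_elim (simp add: prod_eq_iff)
qed

lemma wform_jet_of_jets0:
  assumes pq: "ess_bounded B p" "ess_bounded B q" and F: "F \<in> jets0 D" and G: "square_integrable lD G"
  shows "wform p q G (\<lambda>x. (fst (F x), wgrad D (\<lambda>x. fst (F x)) x)) = wform p q G F"
  by (rule wform_cong_AE[OF pq G jets0_square_integrable[OF F] jets0_square_integrable[OF jet_of_jets0(1)[OF F]]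
        jet_of_jets0(2)[OF F], symmetric])

lemma eigenspace_imp_eigenjets:
  assumes "u \<in> eigenspace D \<alpha> \<beta> \<gamma> \<mu>"
  shows "(\<lambda>x. (u x, wgrad D u x)) \<in> eigenjets \<mu>"
proof -
  have u: "u \<in> H10 D" "\<And>v. v \<in> H10 D \<Longrightarrow> A_form D \<alpha> \<beta> u v = \<mu> * M_form D \<gamma> u v"
    using assms by (auto simp: eigenspace_def)
  note J = H10_imp_jets0[OF u(1)]
  have "\<A> (\<lambda>x. (u x, wgrad D u x)) H = \<mu> * \<M> (\<lambda>x. (u x, wgrad D u x)) H" if H: "H \<in> jets0 D" for H
    using u(2)[OF jets0_imp_H10(1)[OF H]]
    unfolding A_form_eq_wform[OF u(1) jets0_imp_H10(1)[OF H]]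
      wform_jet_of_jets0[OF A_bd H jets0_square_integrable[OF J]]
      wform_jet_of_jets0[OF M_bd H jets0_square_integrable[OF J]] .
  then show ?thesis using J by (simp add: eigenjets_def)
qed

lemma eigenjets_imp_eigenspace:
  assumes "F \<in> eigenjets \<mu>"
  shows "(\<lambda>x. fst (F x)) \<in> eigenspace D \<alpha> \<beta> \<gamma> \<mu>"
proof -
  note F = eigenjetsD[OF assms]
  have "A_form D \<alpha> \<beta> (\<lambda>x. fst (F x)) v = \<mu> * M_form D \<gamma> (\<lambda>x. fst (F x)) v" if v: "v \<in> H10 D" for v
  proof -
    note Jv = H10_imp_jets0[OF v]
    note sv = jets0_square_integrable[OF Jv]
    show ?thesis
      unfolding A_form_eq_wform[OF jets0_imp_H10(1)[OF F(1)] v]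
      unfolding wform_commute[of _ _ "\<lambda>x. (fst (F x), wgrad D (\<lambda>x. fst (F x)) x)"]
        wform_jet_of_jets0[OF A_bd F(1) sv] wform_jet_of_jets0[OF M_bd F(1) sv]
      using F(3)[OF Jv] by (simp add: wform_commute)
  qed
  then show ?thesis using jets0_imp_H10(1)[OF F(1)] by (simp add: eigenspace_def)
qed

text \<open>Positive mass expresses that the function is not zero almost everywhere, since the
  weight is bounded below by \<open>a0\<close>.\<close>

lemma is_eigenvalue_iff:
  "is_eigenvalue D \<alpha> \<beta> \<gamma> \<mu> \<longleftrightarrow> (\<exists>F\<in>eigenjets \<mu>. \<M> F F > 0)"
proof
  assume "is_eigenvalue D \<alpha> \<beta> \<gamma> \<mu>"
  then obtain u where u: "u \<in> eigenspace D \<alpha> \<beta> \<gamma> \<mu>" "\<not> (AE x in lD. u x = 0)" by (auto simp: is_eigenvalue_def)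
  note J = eigenspace_imp_eigenjets[OF u(1)]
  have "\<M> (\<lambda>x. (u x, wgrad D u x)) (\<lambda>x. (u x, wgrad D u x)) > 0"
    by (rule M_pos[OF eigenjetsD(2)[OF J]]) (simp add: u(2))
  then show "\<exists>F\<in>eigenjets \<mu>. \<M> F F > 0" using J by blast
next
  assume "\<exists>F\<in>eigenjets \<mu>. \<M> F F > 0"
  then obtain F where F: "F \<in> eigenjets \<mu>" "\<M> F F > 0" by blast
  have "\<not> (AE x in lD. fst (F x) = 0)" using M_AE_zero[OF eigenjetsD(2)[OF F(1)], of F] F(2) by auto
  then show "is_eigenvalue D \<alpha> \<beta> \<gamma> \<mu>"
    unfolding is_eigenvalue_def using eigenjets_imp_eigenspace[OF F(1)] by (intro bexI)
qed

section \<open>Multiplicities and linear independence\<close>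

lemma multiplicity_of_ge:
  assumes "\<And>i. i < n \<Longrightarrow> u i \<in> eigenspace D \<alpha> \<beta> \<gamma> \<mu>" "ae_independent D n u"
  shows "enat n \<le> multiplicity_of D \<alpha> \<beta> \<gamma> \<mu>"
  unfolding multiplicity_of_def by (rule Sup_upper) (use assms in blast)

lemma multiplicity_of_ge_1:
  assumes "is_eigenvalue D \<alpha> \<beta> \<gamma> \<mu>"
  shows "enat 1 \<le> multiplicity_of D \<alpha> \<beta> \<gamma> \<mu>"
proof -
  obtain u where u: "u \<in> eigenspace D \<alpha> \<beta> \<gamma> \<mu>" "\<not> (AE x in lD. u x = 0)" using assms by (auto simp: is_eigenvalue_def)
  have "ae_independent D 1 (\<lambda>i. u)"
    unfolding ae_independent_def
  proof (intro allI impI)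
    fix s :: "nat \<Rightarrow> real" and i
    assume ae: "AE x in lD. (\<Sum>i<1. s i * u x) = 0" and i: "i < (1::nat)"
    show "s i = 0"
    proof (rule ccontr)
      assume "s i \<noteq> 0"
      then have "s 0 \<noteq> 0" using i by simp
      then have "AE x in lD. u x = 0" using ae by (auto elim: eventually_mono)
      then show False using u(2) by simp
    qed
  qed
  then show ?thesis using multiplicity_of_ge[of 1 "\<lambda>i. u"] u(1) by simp
qed

lemma ae_independent_orthonormal:
  assumes F: "square_integrable lD F" and G: "square_integrable lD G"
    and M: "\<M> F F = 1" "\<M> G G = 1" "\<M> F G = 0"
  shows "ae_independent D 2 (\<lambda>i x. if i = 0 then fst (F x) else fst (G x))"
  unfolding ae_independent_def
proof (intro allI impI)
  fix s :: "nat \<Rightarrow> real" and i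
  assume ae: "AE x in lD. (\<Sum>i<2. s i * (if i = 0 then fst (F x) else fst (G x))) = 0" and i: "i < (2::nat)"
  define C where "C = (\<lambda>x. s 0 *\<^sub>R F x + s 1 *\<^sub>R G x)"
  note sF = square_integrable_scaleR[OF F, of "s 0"] and sG = square_integrable_scaleR[OF G, of "s 1"]
  have C: "square_integrable lD C" unfolding C_def by (intro square_integrable_add sF sG)
  have "AE x in lD. fst (C x) = 0" using ae by (simp add: C_def numeral_2_eq_2)
  from M_AE_zero[OF C this] have z: "\<M> C H = 0" for H .
  have "\<M> C H = s 0 * \<M> F H + s 1 * \<M> G H" if "square_integrable lD H" for H
    unfolding C_def wform_add_left[OF M_bd sF sG that] wform_scaleR_left ..
  from this[OF F] this[OF G] z have "s 0 = 0" "s 1 = 0" using M by (simp_all add: wform_commute[of _ _ G F])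
  then show "s i = 0" using i by (cases "i = 0") (auto simp: less_2_cases_iff)
qed

text \<open>Two independent eigenfunctions span a plane, and orthogonality to \<open>F1\<close> is
  one linear condition on it. With b and a the mass products of \<open>F1\<close> with the two
  eigenjets, the coefficients a and -b solve it; if both products vanish, the first eigenjet will
  do.\<close>

lemma eigenvector_orthogonal_to:
  assumes mult: "enat 2 \<le> multiplicity_of D \<alpha> \<beta> \<gamma> \<mu>" and F1: "square_integrable lD F1"
  obtains F where "F \<in> eigenjets \<mu>" "\<M> F F > 0" "\<M> F1 F = 0"
proof -
  note result = that
  let ?S = "{enat n |n. \<exists>u. (\<forall>i<n. u i \<in> eigenspace D \<alpha> \<beta> \<gamma> \<mu>) \<and> ae_independent D n u}"
  have "\<exists>n\<ge>2. \<exists>u. (\<forall>i<n. u i \<in> eigenspace D \<alpha> \<beta> \<gamma> \<mu>) \<and> ae_independent D n u"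
  \<comment> \<open>The multiplicity is a supremum, so a family of size at least 2 has to be
    extracted: if all sizes were at most 1, so would be the supremum.\<close>
  proof (rule ccontr)
    assume no: "\<not> ?thesis"
    have "s \<le> enat 1" if s: "s \<in> ?S" for s
      using s
    proof (elim CollectE exE conjE)
      fix n u assume n: "s = enat n" "\<forall>i<n. u i \<in> eigenspace D \<alpha> \<beta> \<gamma> \<mu>" "ae_independent D n u"
      have "\<not> n \<ge> 2"
      proof
        assume "n \<ge> 2"
        then have "\<exists>n\<ge>2. \<exists>u. (\<forall>i<n. u i \<in> eigenspace D \<alpha> \<beta> \<gamma> \<mu>) \<and> ae_independent D n u"
          using n(2,3) by (intro exI[of _ n] conjI exI[of _ u])
        with no show False by (rule notE)
      qed
      then show ?thesis using n(1) by simp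
    qed
    then have "Sup ?S \<le> enat 1" by (rule Sup_least)
    then have "enat 2 \<le> enat 1" using mult unfolding multiplicity_of_def by (rule order_trans[rotated])
    then show False by simp
  qed
  then obtain n u where n: "n \<ge> 2" and u': "\<forall>i<n. u i \<in> eigenspace D \<alpha> \<beta> \<gamma> \<mu>" and ind: "ae_independent D n u"
    by (elim exE conjE)
  have u: "u i \<in> eigenspace D \<alpha> \<beta> \<gamma> \<mu>" if "i < n" for i using u' that by simp
  define J where "J i x = (u i x, wgrad D (u i) x)" for i x
  have J: "J i \<in> eigenjets \<mu>" if "i < n" for i using eigenspace_imp_eigenjets[OF u[OF that]] by (simp add: J_def[abs_def])
  have J01: "J 0 \<in> eigenjets \<mu>" "J 1 \<in> eigenjets \<mu>" using J n by auto
  have nz: "s0 = 0 \<and> s1 = 0" if ae: "AE x in lD. s0 * u 0 x + s1 * u 1 x = 0" for s0 s1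
  proof -
    \<comment> \<open>The family may have more than two members; the remaining coefficients are
      filled with zeros.\<close>
    define s where "s i = (if i = 0 then s0 else if i = 1 then s1 else 0)" for i :: nat
    have "(\<Sum>i<n. s i * u i x) = (\<Sum>i<2. s i * u i x)" for x
      using n by (intro sum.mono_neutral_right) (auto simp: s_def)
    then have "AE x in lD. (\<Sum>i<n. s i * u i x) = 0" using ae by (simp add: numeral_2_eq_2 s_def)
    then have "\<forall>i<n. s i = 0" using ind by (simp add: ae_independent_def)
    then have "s 0 = 0" "s 1 = 0" using n by auto
    then show ?thesis by (simp add: s_def)
  qed
  define a where "a = \<M> F1 (J 1)"
  define b where "b = \<M> F1 (J 0)"
  have mk: thesis if ab: "s0 \<noteq> 0 \<or> s1 \<noteq> 0" "s0 * b + s1 * a = 0" for s0 s1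
  proof (rule result)
    let ?C = "\<lambda>x. s0 *\<^sub>R J 0 x + s1 *\<^sub>R J 1 x"
    show C: "?C \<in> eigenjets \<mu>" by (intro eigenjets_add eigenjets_scaleR J01)
    have "\<not> (AE x in lD. fst (?C x) = 0)"
    proof
      assume "AE x in lD. fst (?C x) = 0"
      then have "AE x in lD. s0 * u 0 x + s1 * u 1 x = 0" by (simp add: J_def)
      from nz[OF this] ab(1) show False by simp
    qed
    then show "\<M> ?C ?C > 0" by (rule M_pos[OF eigenjetsD(2)[OF C]])
    show "\<M> F1 ?C = 0"
      unfolding wform_add_right[OF M_bd square_integrable_scaleR[OF eigenjetsD(2)[OF J01(1)]]
          square_integrable_scaleR[OF eigenjetsD(2)[OF J01(2)]] F1] wform_scaleR_right
      using ab(2) by (simp add: a_def b_def)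
  qed
  show thesis
  proof (cases "a = 0 \<and> b = 0")
    case True then show ?thesis by (intro mk[of 1 0]) auto
  next
    case False then show ?thesis by (intro mk[of a "- b"]) auto
  qed
qed

lemma orthogonal_closed_subspace:
  assumes F1: "square_integrable lD F1"
  shows "closed_subspace {F \<in> jets0 D. \<M> F1 F = 0}"
  unfolding closed_subspace_def
proof (intro conjI allI impI ballI)
  fix F G assume "F \<in> {F \<in> jets0 D. \<M> F1 F = 0}" "G \<in> {F \<in> jets0 D. \<M> F1 F = 0}"
  then show "(\<lambda>x. F x + G x) \<in> {F \<in> jets0 D. \<M> F1 F = 0}"
    using wform_add_right[OF M_bd jets0_square_integrable jets0_square_integrable F1] by (simp add: jets0_add)
next
  fix F c assume "F \<in> {F \<in> jets0 D. \<M> F1 F = 0}"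
  then show "(\<lambda>x. c *\<^sub>R F x) \<in> {F \<in> jets0 D. \<M> F1 F = 0}" by (simp add: jets0_scaleR wform_scaleR_right)
next
  fix F :: "nat \<Rightarrow> _" and G
  assume a: "(\<forall>n. F n \<in> {F \<in> jets0 D. \<M> F1 F = 0}) \<and> G \<in> jets0 D \<and> (\<lambda>n. l2norm lD (\<lambda>x. F n x - G x)) \<longlonglongrightarrow> 0"
  then have F: "\<And>n. F n \<in> jets0 D" "\<And>n. \<M> F1 (F n) = 0" and G: "G \<in> jets0 D" "(\<lambda>n. l2norm lD (\<lambda>x. F n x - G x)) \<longlonglongrightarrow> 0"
    by auto
  have c: "(\<lambda>n. l2norm lD (\<lambda>x. F1 x - F1 x)) \<longlonglongrightarrow> 0" by (simp add: l2norm_def)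
  have "(\<lambda>n. \<M> F1 (F n)) \<longlonglongrightarrow> \<M> F1 G"
    by (rule wform_tendsto[OF M_bd F1 F1 c jets0_square_integrable[OF F(1)] jets0_square_integrable[OF G(1)] G(2)])
  then show "G \<in> {F \<in> jets0 D. \<M> F1 F = 0}" using G(1) F(2) by (simp add: LIMSEQ_const_iff)
qed auto

text \<open>\<open>F1\<close> minimizes the Rayleigh quotient over all pairs, \<open>F2\<close> over
  the pairs orthogonal to \<open>F1\<close>. It remains to match the two minima with the counting
  definition of \<open>eigval\<close>, for which the multiplicities need only be compared with 1 and
  2.\<close>

lemma two_lowest_eigenvalues:
  obtains \<mu>1 \<mu>2 F1 F2 where "F1 \<in> eigenjets \<mu>1" "F2 \<in> eigenjets \<mu>2" "\<M> F1 F1 = 1" "\<M> F2 F2 = 1" "\<M> F1 F2 = 0"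
    "\<mu>1 \<le> \<mu>2" "\<And>F. F \<in> jets0 D \<Longrightarrow> \<mu>1 * \<M> F F \<le> \<A> F F"
    "eigval D \<alpha> \<beta> \<gamma> 1 = \<mu>1" "eigval D \<alpha> \<beta> \<gamma> 2 = \<mu>2"
proof -
  obtain f g where fg: "f \<in> test_functions D" "g \<in> test_functions D" "\<And>x. f x * g x = 0"
    "\<not> (AE x in lD. f x = 0)" "\<not> (AE x in lD. g x = 0)"
    by (rule disjoint_test_functions[OF open_D nonempty]) (rule that; assumption)
  note Jf = jets0_jet[OF fg(1)] and Jg = jets0_jet[OF fg(2)]
  note sf = jets0_square_integrable[OF Jf] and sg = jets0_square_integrable[OF Jg]
  have Mf: "\<M> (jet f) (jet f) > 0" by (rule M_pos[OF sf]) (simp add: jet_def fg(4))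
  have Mg: "\<M> (jet g) (jet g) > 0" by (rule M_pos[OF sg]) (simp add: jet_def fg(5))
  have Mfg: "\<M> (jet f) (jet g) = 0" by (simp add: wform_def jet_def fg(3))
  obtain F1 \<mu>1 where F1: "F1 \<in> jets0 D" "\<M> F1 F1 = 1" "\<And>F. F \<in> jets0 D \<Longrightarrow> \<mu>1 * \<M> F F \<le> \<A> F F"
    "\<And>H. H \<in> jets0 D \<Longrightarrow> \<A> F1 H = \<mu>1 * \<M> F1 H"
    by (rule minimizer_exists[OF closed_subspace_jets0 Jf Mf]) (rule that; assumption)
  note s1 = jets0_square_integrable[OF F1(1)]
  have E1: "F1 \<in> eigenjets \<mu>1" using F1 by (simp add: eigenjets_def)
  define X where "X = {F \<in> jets0 D. \<M> F1 F = 0}"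
  have X: "closed_subspace X" unfolding X_def by (rule orthogonal_closed_subspace[OF s1])
  \<comment> \<open>Either \<open>jet f\<close> is orthogonal to \<open>F1\<close>, or
    \<open>jet g\<close> becomes so after adding a multiple of \<open>jet f\<close>. The supports
    are disjoint, so the mass of this combination has no cross term and is at least that of
    \<open>jet g\<close>.\<close>
  have "\<exists>F0\<in>X. \<M> F0 F0 > 0"
  proof (cases "\<M> F1 (jet f) = 0")
    case True
    then have "jet f \<in> X" using Jf by (simp add: X_def)
    then show ?thesis using Mf by (intro bexI[of _ "jet f"])
  next
    case False
    define c where "c = - \<M> F1 (jet g) / \<M> F1 (jet f)"
    have c: "\<M> F1 (jet g) + c * \<M> F1 (jet f) = 0" using False by (simp add: c_def)
    let ?C = "\<lambda>x. jet g x + c *\<^sub>R jet f x"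
    have "\<M> F1 ?C = 0"
      unfolding wform_add_right[OF M_bd sg square_integrable_scaleR[OF sf] s1] wform_scaleR_right by (rule c)
    then have "?C \<in> X" unfolding X_def using jets0_add[OF Jg jets0_scaleR[OF Jf, of c]] by (intro CollectI conjI)
    moreover have "\<M> ?C ?C > 0"
    proof -
      have "\<M> (jet g) (jet f) = 0" using Mfg by (subst wform_commute)
      then have "\<M> ?C ?C = \<M> (jet g) (jet g) + c\<^sup>2 * \<M> (jet f) (jet f)"
        unfolding wform_lincomb[OF M_bd sg sf] by simp
      then show ?thesis using Mf Mg by (simp add: add_pos_nonneg)
    qed
    ultimately show ?thesis by (intro bexI[of _ ?C])
  qed
  then obtain F0 where F0: "F0 \<in> X" "\<M> F0 F0 > 0" by (elim bexE)
  obtain F2 \<mu>2 where F2: "F2 \<in> X" "\<M> F2 F2 = 1" "\<A> F2 F2 = \<mu>2" "\<And>F. F \<in> X \<Longrightarrow> \<mu>2 * \<M> F F \<le> \<A> F F"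
    "\<And>H. H \<in> X \<Longrightarrow> \<A> F2 H = \<mu>2 * \<M> F2 H"
    by (rule minimizer_exists[OF X F0]) (rule that; assumption)
  have J2: "F2 \<in> jets0 D" "\<M> F1 F2 = 0" using F2(1) by (auto simp: X_def)
  note s2 = jets0_square_integrable[OF J2(1)]
  have le: "\<mu>1 \<le> \<mu>2" using F1(3)[OF J2(1)] F2(2,3) by simp
  have A12: "\<A> F2 F1 = 0" using F1(4)[OF J2(1)] J2(2) by (simp add: wform_commute[of _ _ F2])
  \<comment> \<open>The second minimization yields the equation for test pairs in \<open>X\<close>
    only. A general \<open>H\<close> is projected to \<open>X\<close>; the part along
    \<open>F1\<close> that is removed contributes 0 to both sides.\<close>
  have "\<A> F2 H = \<mu>2 * \<M> F2 H" if H: "H \<in> jets0 D" for H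
  proof -
    note sH = jets0_square_integrable[OF H]
    let ?H = "\<lambda>x. H x + (- \<M> F1 H) *\<^sub>R F1 x"
    note sF = square_integrable_scaleR[OF s1, of "- \<M> F1 H"]
    have "?H \<in> X" unfolding X_def
      using jets0_add[OF H jets0_scaleR[OF F1(1)]] wform_add_right[OF M_bd sH sF s1] F1(2)
      by (simp add: wform_scaleR_right del: scaleR_minus_left)
    from F2(5)[OF this] show ?thesis
      unfolding wform_add_right[OF M_bd sH sF s2] wform_add_right[OF A_bd sH sF s2] wform_scaleR_right
      using A12 J2(2) by (simp add: wform_commute[of _ _ F2 F1])
  qed
  then have E2: "F2 \<in> eigenjets \<mu>2" using J2(1) by (simp add: eigenjets_def)
  have ev1: "is_eigenvalue D \<alpha> \<beta> \<gamma> \<mu>1" unfolding is_eigenvalue_iff using E1 F1(2) by (intro bexI[of _ F1]) auto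
  have ev2: "is_eigenvalue D \<alpha> \<beta> \<gamma> \<mu>2" unfolding is_eigenvalue_iff using E2 F2(2) by (intro bexI[of _ F2]) auto
  \<comment> \<open>Such an \<open>F\<close> competes in the second minimization.\<close>
  have low2: "\<mu>2 \<le> \<mu>" if F: "F \<in> eigenjets \<mu>" "\<M> F F > 0" "\<M> F1 F = 0" for \<mu> F
  proof -
    have "F \<in> X" using F eigenjetsD(1)[OF F(1)] by (simp add: X_def)
    from F2(4)[OF this] show ?thesis using eigenjetsD(3)[OF F(1) eigenjetsD(1)[OF F(1)]] F(2) by simp
  qed
  have low1: "\<mu>1 \<le> \<mu>" if ev: "is_eigenvalue D \<alpha> \<beta> \<gamma> \<mu>" for \<mu>
  proof -
    obtain F where F: "F \<in> eigenjets \<mu>" "\<M> F F > 0" using ev unfolding is_eigenvalue_iff by (elim bexE)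
    from F1(3)[OF eigenjetsD(1)[OF F(1)]] show ?thesis
      using eigenjetsD(3)[OF F(1) eigenjetsD(1)[OF F(1)]] F(2) by simp
  qed
  have low2': "\<mu>2 \<le> \<mu>" if ev: "is_eigenvalue D \<alpha> \<beta> \<gamma> \<mu>" and ne: "\<mu> \<noteq> \<mu>1" for \<mu>
  proof -
    obtain F where F: "F \<in> eigenjets \<mu>" "\<M> F F > 0" using ev unfolding is_eigenvalue_iff by (elim bexE)
    \<comment> \<open>Symmetry of both forms makes eigenjets of different eigenvalues
      orthogonal.\<close>
    have "\<mu>1 * \<M> F1 F = \<mu> * \<M> F F1"
      using F1(4)[OF eigenjetsD(1)[OF F(1)]] eigenjetsD(3)[OF F(1) F1(1)] by (simp add: wform_commute[of _ _ F F1])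
    then have "(\<mu>1 - \<mu>) * \<M> F1 F = 0" by (simp add: wform_commute[of _ _ F F1] left_diff_distrib)
    then have "\<M> F1 F = 0" using ne by simp
    then show ?thesis by (rule low2[OF F])
  qed
  have "eigval D \<alpha> \<beta> \<gamma> 1 = \<mu>1"
    unfolding eigval_def
  proof (rule Least_equality)
    show "\<exists>S. finite S \<and> (\<forall>\<mu>\<in>S. is_eigenvalue D \<alpha> \<beta> \<gamma> \<mu> \<and> \<mu> \<le> \<mu>1) \<and> enat 1 \<le> (\<Sum>\<mu>\<in>S. multiplicity_of D \<alpha> \<beta> \<gamma> \<mu>)"
      using ev1 multiplicity_of_ge_1[OF ev1] by (intro exI[of _ "{\<mu>1}"]) simp
  next
    fix t assume "\<exists>S. finite S \<and> (\<forall>\<mu>\<in>S. is_eigenvalue D \<alpha> \<beta> \<gamma> \<mu> \<and> \<mu> \<le> t) \<and> enat 1 \<le> (\<Sum>\<mu>\<in>S. multiplicity_of D \<alpha> \<beta> \<gamma> \<mu>)"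
    then obtain S where S: "\<forall>\<mu>\<in>S. is_eigenvalue D \<alpha> \<beta> \<gamma> \<mu> \<and> \<mu> \<le> t" "enat 1 \<le> (\<Sum>\<mu>\<in>S. multiplicity_of D \<alpha> \<beta> \<gamma> \<mu>)" by (elim exE conjE)
    have "S \<noteq> {}" using S(2) by (auto simp: zero_enat_def)
    then obtain \<mu> where "\<mu> \<in> S" by blast
    then have "is_eigenvalue D \<alpha> \<beta> \<gamma> \<mu>" "\<mu> \<le> t" using S(1) by auto
    with low1[of \<mu>] show "\<mu>1 \<le> t" by simp
  qed
  moreover have "eigval D \<alpha> \<beta> \<gamma> 2 = \<mu>2"
    unfolding eigval_def
  proof (rule Least_equality)
    show "\<exists>S. finite S \<and> (\<forall>\<mu>\<in>S. is_eigenvalue D \<alpha> \<beta> \<gamma> \<mu> \<and> \<mu> \<le> \<mu>2) \<and> enat 2 \<le> (\<Sum>\<mu>\<in>S. multiplicity_of D \<alpha> \<beta> \<gamma> \<mu>)"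
    \<comment> \<open>A coinciding value is one element of \<open>S\<close> of multiplicity at least
      2, because \<open>F1\<close> and \<open>F2\<close> are independent; otherwise two elements
      contribute at least 1 each.\<close>
    proof (cases "\<mu>1 = \<mu>2")
      case True
      have "enat 2 \<le> multiplicity_of D \<alpha> \<beta> \<gamma> \<mu>2"
      proof (rule multiplicity_of_ge[OF _ ae_independent_orthonormal[OF s1 s2 F1(2) F2(2) J2(2)]])
        show "(\<lambda>x. if i = 0 then fst (F1 x) else fst (F2 x)) \<in> eigenspace D \<alpha> \<beta> \<gamma> \<mu>2" if "i < 2" for i :: nat
          using eigenjets_imp_eigenspace[OF E1] eigenjets_imp_eigenspace[OF E2] True by (cases "i = 0") auto
      qed
      then show ?thesis using ev2 by (intro exI[of _ "{\<mu>2}"]) simp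
    next
      case False
      have "enat 1 + enat 1 \<le> multiplicity_of D \<alpha> \<beta> \<gamma> \<mu>1 + multiplicity_of D \<alpha> \<beta> \<gamma> \<mu>2"
        by (intro add_mono multiplicity_of_ge_1 ev1 ev2)
      then show ?thesis using ev1 ev2 le False by (intro exI[of _ "{\<mu>1, \<mu>2}"]) (simp add: numeral_2_eq_2)
    qed
  next
    fix t assume "\<exists>S. finite S \<and> (\<forall>\<mu>\<in>S. is_eigenvalue D \<alpha> \<beta> \<gamma> \<mu> \<and> \<mu> \<le> t) \<and> enat 2 \<le> (\<Sum>\<mu>\<in>S. multiplicity_of D \<alpha> \<beta> \<gamma> \<mu>)"
    then obtain S where S: "\<forall>\<mu>\<in>S. is_eigenvalue D \<alpha> \<beta> \<gamma> \<mu> \<and> \<mu> \<le> t" "enat 2 \<le> (\<Sum>\<mu>\<in>S. multiplicity_of D \<alpha> \<beta> \<gamma> \<mu>)" by (elim exE conjE)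
    show "\<mu>2 \<le> t"
    \<comment> \<open>Either \<mu>1 alone reaches the count 2, and its eigenspace contains a vector
      orthogonal to \<open>F1\<close>, or another eigenvalue is counted, which is at least
      \<mu>2.\<close>
    proof (cases "S \<subseteq> {\<mu>1}")
      case True
      have "S \<noteq> {}" using S(2) by (auto simp: zero_enat_def)
      then have S1: "S = {\<mu>1}" using True by blast
      then have "enat 2 \<le> multiplicity_of D \<alpha> \<beta> \<gamma> \<mu>1" using S(2) by simp
      then obtain F where "F \<in> eigenjets \<mu>1" "\<M> F F > 0" "\<M> F1 F = 0"
        by (rule eigenvector_orthogonal_to[OF _ s1])
      then have "\<mu>2 \<le> \<mu>1" by (rule low2)
      then show ?thesis using S(1) S1 by auto
    next
      case False
      then obtain \<mu> where \<mu>: "\<mu> \<in> S" "\<mu> \<noteq> \<mu>1" by blast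
      then have "is_eigenvalue D \<alpha> \<beta> \<gamma> \<mu>" "\<mu> \<le> t" using S(1) by auto
      with low2'[of \<mu>] \<mu>(2) show ?thesis by simp
    qed
  qed
  ultimately show ?thesis
  proof (rule that[OF E1 E2 F1(2) F2(2) J2(2) le, rotated])
    show "\<mu>1 * \<M> F F \<le> \<A> F F" if "F \<in> jets0 D" for F using that by (rule F1(3))
  qed
qed

end


section \<open>Chain rules\<close>

lemma l2norm_Pair_le:
  assumes "square_integrable M f" "square_integrable M g"
  shows "l2norm M (\<lambda>x. (f x, g x)) \<le> l2norm M f + l2norm M g"
proof (rule power2_le_imp_le)
  have "(l2norm M (\<lambda>x. (f x, g x)))\<^sup>2 = (l2norm M f)\<^sup>2 + (l2norm M g)\<^sup>2"
    using square_integrableD(2)[OF assms(1)] square_integrableD(2)[OF assms(2)]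
    by (simp add: l2norm_power2 norm_Pair)
  also have "\<dots> \<le> (l2norm M f + l2norm M g)\<^sup>2" by (simp add: power2_sum)
  finally show "(l2norm M (\<lambda>x. (f x, g x)))\<^sup>2 \<le> (l2norm M f + l2norm M g)\<^sup>2" .
qed simp

lemma l2norm_tendsto_zero:
  assumes "\<And>n. l2norm M (f n) \<le> b n" "b \<longlonglongrightarrow> 0"
  shows "(\<lambda>n. l2norm M (f n)) \<longlonglongrightarrow> 0"
  by (rule tendsto_sandwich[OF _ _ tendsto_const assms(2)]) (simp_all add: assms(1))

lemma lipschitz_of_derivative_bound:
  fixes G :: "real \<Rightarrow> real"
  assumes "\<And>t. (G has_real_derivative G' t) (at t)" "\<And>t. \<bar>G' t\<bar> \<le> C"
  shows "\<bar>G s - G t\<bar> \<le> C * \<bar>s - t\<bar>"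
proof -
  have "norm (G s - G t) \<le> C * norm (s - t)"
    by (rule field_differentiable_bound[of UNIV G G']) (use assms in auto)
  then show ?thesis by simp
qed

context bounded_open
begin

lemma continuous_comp_measurable_lD:
  fixes h :: "real \<Rightarrow> real"
  assumes "continuous_on UNIV h" "u \<in> borel_measurable lD"
  shows "(\<lambda>x. h (u x)) \<in> borel_measurable lD"
  by (rule measurable_compose[OF assms(2) borel_measurable_continuous_onI[OF assms(1)]])

lemma chain_square_integrable:
  assumes F: "square_integrable lD F"
    and der: "\<And>t. (G has_real_derivative G' t) (at t)" and cont: "continuous_on UNIV G'" and bd: "\<And>t. \<bar>G' t\<bar> \<le> C"
  shows "square_integrable lD (\<lambda>x. G (fst (F x)))" "square_integrable lD (\<lambda>x. G' (fst (F x)) *\<^sub>R snd (F x))"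
    "square_integrable lD (\<lambda>x. (G (fst (F x)), G' (fst (F x)) *\<^sub>R snd (F x)))"
proof -
  note s = square_integrable_fst_snd[OF F]
  have C: "0 \<le> C" using bd[of 0] by linarith
  have Gc: "continuous_on UNIV G" using der DERIV_isCont by (intro continuous_at_imp_continuous_on) blast
  have 1: "square_integrable lD (\<lambda>x. G (fst (F x)) - G 0)"
  proof (rule square_integrable_bound(1)[OF s(1) _ _ C])
    show "(\<lambda>x. G (fst (F x)) - G 0) \<in> borel_measurable lD"
      using continuous_comp_measurable_lD[OF Gc square_integrableD(1)[OF s(1)]] by simp
    show "AE x in lD. norm (G (fst (F x)) - G 0) \<le> C * norm (fst (F x))"
      using lipschitz_of_derivative_bound[OF der bd, of _ 0] by (intro AE_I2) simp
  qed
  have "square_integrable lD (\<lambda>x. G 0)" by (rule square_integrable_bounded[OF finite_lD, of _ "\<bar>G 0\<bar>"]) auto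
  from square_integrable_add[OF 1 this] show a: "square_integrable lD (\<lambda>x. G (fst (F x)))" by simp
  show b: "square_integrable lD (\<lambda>x. G' (fst (F x)) *\<^sub>R snd (F x))"
    by (rule square_integrable_bounded_mult(1)[OF s(2) continuous_comp_measurable_lD[OF cont square_integrableD(1)[OF s(1)]] _ C])
       (simp add: bd)
  show "square_integrable lD (\<lambda>x. (G (fst (F x)), G' (fst (F x)) *\<^sub>R snd (F x)))"
    by (rule square_integrable_Pair[OF a b])
qed

text \<open>The factor \<open>G' (f n x)\<close> converges only pointwise, whence the passage to an
  almost everywhere convergent subsequence and dominated convergence with majorant C times the
  gradient. Everything else is a Lipschitz estimate. The limit is stated for the composed functions
  themselves, so that it can be used under a cut-off or on a compact subset.\<close>

lemma chain_convergence:
  assumes F: "F \<in> jets0 D"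
    and der: "\<And>t. (G has_real_derivative G' t) (at t)" and cont: "continuous_on UNIV G'" and bd: "\<And>t. \<bar>G' t\<bar> \<le> C"
  obtains f where "\<And>n. f n \<in> test_functions D"
    "(\<lambda>n. l2norm lD (\<lambda>x. (G (f n x), G' (f n x) *\<^sub>R grad (f n) x) - (G (fst (F x)), G' (fst (F x)) *\<^sub>R snd (F x)))) \<longlonglongrightarrow> 0"
proof -
  note sF = jets0_square_integrable[OF F]
  have C: "0 \<le> C" using bd[of 0] by linarith
  obtain f0 where f0: "\<And>n. f0 n \<in> test_functions D" "(\<lambda>n. l2norm lD (\<lambda>x. F x - jet (f0 n) x)) \<longlonglongrightarrow> 0"
    by (rule jets0_sequence[OF F]) (rule that; assumption)
  have lim0: "(\<lambda>n. l2norm lD (\<lambda>x. jet (f0 n) x - F x)) \<longlonglongrightarrow> 0" using f0(2) by (simp add: l2norm_minus_commute[of lD F])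
  obtain r :: "nat \<Rightarrow> nat" where r: "strict_mono r" "AE x in lD. (\<lambda>n. jet (f0 (r n)) x) \<longlonglongrightarrow> F x"
    by (rule l2_conv_AE_subseq[OF jet_square_integrable[OF f0(1)] sF lim0]) (rule that; assumption)
  define f where "f n = f0 (r n)" for n
  have f: "f n \<in> test_functions D" for n by (simp add: f_def f0(1))
  have lim: "(\<lambda>n. l2norm lD (\<lambda>x. jet (f n) x - F x)) \<longlonglongrightarrow> 0"
    using LIMSEQ_subseq_LIMSEQ[OF lim0 r(1)] by (simp add: o_def f_def)
  note sf = jet_square_integrable[OF f]
  note s = square_integrable_fst_snd[OF sF] and t = square_integrable_fst_snd[OF sf, unfolded jet_def fst_conv snd_conv]
  note cF = chain_square_integrable[OF sF der cont bd]
  note cf = chain_square_integrable[OF sf der cont bd, unfolded jet_def fst_conv snd_conv]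
  let ?e = "\<lambda>n. l2norm lD (\<lambda>x. jet (f n) x - F x)"
  let ?d = "\<lambda>n. l2norm lD (\<lambda>x. G' (f n x) *\<^sub>R snd (F x) - G' (fst (F x)) *\<^sub>R snd (F x))"
  have m: "(\<lambda>x. G' (f n x)) \<in> borel_measurable lD" "(\<lambda>x. G' (fst (F x))) \<in> borel_measurable lD" for n
    by (intro continuous_comp_measurable_lD[OF cont] square_integrableD(1)[OF t(1)] square_integrableD(1)[OF s(1)])+
  have sd: "square_integrable lD (\<lambda>x. G' (f n x) *\<^sub>R snd (F x))" for n
    by (rule square_integrable_bounded_mult(1)[OF s(2) m(1) _ C]) (simp add: bd)
  have d0: "?d \<longlonglongrightarrow> 0"
  proof (rule l2_dominated_convergence(2)[where G = "\<lambda>x. C *\<^sub>R snd (F x)"])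
    show "(\<lambda>x. G' (f n x) *\<^sub>R snd (F x)) \<in> borel_measurable lD" for n using sd by blast
    show "(\<lambda>x. G' (fst (F x)) *\<^sub>R snd (F x)) \<in> borel_measurable lD" using cF(2) by blast
    show "square_integrable lD (\<lambda>x. C *\<^sub>R snd (F x))" by (rule square_integrable_scaleR[OF s(2)])
    show "AE x in lD. norm (G' (f n x) *\<^sub>R snd (F x)) \<le> norm (C *\<^sub>R snd (F x))" for n
      using bd C by (intro AE_I2) (simp add: mult_right_mono)
    show "AE x in lD. (\<lambda>n. G' (f n x) *\<^sub>R snd (F x)) \<longlonglongrightarrow> G' (fst (F x)) *\<^sub>R snd (F x)"
      using r(2)
    proof eventually_elim
      fix x assume "(\<lambda>n. jet (f0 (r n)) x) \<longlonglongrightarrow> F x"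
      then have "(\<lambda>n. fst (jet (f0 (r n)) x)) \<longlonglongrightarrow> fst (F x)" by (rule tendsto_fst)
      then have l: "(\<lambda>n. f n x) \<longlonglongrightarrow> fst (F x)" by (simp add: f_def jet_def)
      have "isCont G' (fst (F x))" using cont by (simp add: continuous_on_eq_continuous_at)
      from isCont_tendsto_compose[OF this l]
      show "(\<lambda>n. G' (f n x) *\<^sub>R snd (F x)) \<longlonglongrightarrow> G' (fst (F x)) *\<^sub>R snd (F x)" by (intro tendsto_intros)
    qed
  qed
  have bound: "l2norm lD (\<lambda>x. (G (f n x), G' (f n x) *\<^sub>R grad (f n) x) - (G (fst (F x)), G' (fst (F x)) *\<^sub>R snd (F x)))
    \<le> 2 * C * ?e n + ?d n" for n
  proof -
    have e: "square_integrable lD (\<lambda>x. f n x - fst (F x))" "square_integrable lD (\<lambda>x. grad (f n) x - snd (F x))"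
      by (intro square_integrable_diff t s)+
    have en: "l2norm lD (\<lambda>x. f n x - fst (F x)) \<le> ?e n" "l2norm lD (\<lambda>x. grad (f n) x - snd (F x)) \<le> ?e n"
      using l2norm_fst_snd_le[OF square_integrable_diff[OF sf sF], of n] by (simp_all add: jet_def)
    have a: "l2norm lD (\<lambda>x. G (f n x) - G (fst (F x))) \<le> C * l2norm lD (\<lambda>x. f n x - fst (F x))"
    proof (rule square_integrable_bound(2)[OF e(1) _ _ C])
      show "(\<lambda>x. G (f n x) - G (fst (F x))) \<in> borel_measurable lD"
        using square_integrable_diff[OF cf(1) cF(1), of n] by blast
      show "AE x in lD. norm (G (f n x) - G (fst (F x))) \<le> C * norm (f n x - fst (F x))"
        using lipschitz_of_derivative_bound[OF der bd] by (intro AE_I2) simp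
    qed
    \<comment> \<open>The gradient error is split by inserting the new factor times the old
      gradient: the first part is small by boundedness of \<open>G'\<close>, the second is
      \<open>?d n\<close>.\<close>
    have "l2norm lD (\<lambda>x. G' (f n x) *\<^sub>R grad (f n) x - G' (fst (F x)) *\<^sub>R snd (F x))
      \<le> l2norm lD (\<lambda>x. G' (f n x) *\<^sub>R grad (f n) x - G' (f n x) *\<^sub>R snd (F x)) + ?d n"
      by (rule l2norm_triangle_dist[OF cf(2) sd cF(2)])
    also have "l2norm lD (\<lambda>x. G' (f n x) *\<^sub>R grad (f n) x - G' (f n x) *\<^sub>R snd (F x))
      = l2norm lD (\<lambda>x. G' (f n x) *\<^sub>R (grad (f n) x - snd (F x)))" by (simp add: scaleR_diff_right)
    also have "\<dots> \<le> C * l2norm lD (\<lambda>x. grad (f n) x - snd (F x))"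
      by (rule square_integrable_bounded_mult(2)[OF e(2) m(1) _ C]) (simp add: bd)
    finally have b: "l2norm lD (\<lambda>x. G' (f n x) *\<^sub>R grad (f n) x - G' (fst (F x)) *\<^sub>R snd (F x))
      \<le> C * l2norm lD (\<lambda>x. grad (f n) x - snd (F x)) + ?d n" by simp
    have "l2norm lD (\<lambda>x. (G (f n x), G' (f n x) *\<^sub>R grad (f n) x) - (G (fst (F x)), G' (fst (F x)) *\<^sub>R snd (F x)))
      \<le> l2norm lD (\<lambda>x. G (f n x) - G (fst (F x))) + l2norm lD (\<lambda>x. G' (f n x) *\<^sub>R grad (f n) x - G' (fst (F x)) *\<^sub>R snd (F x))"
      using l2norm_Pair_le[OF square_integrable_diff[OF cf(1) cF(1)] square_integrable_diff[OF cf(2) cF(2)], of n n] by simp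
    moreover have "C * l2norm lD (\<lambda>x. f n x - fst (F x)) \<le> C * ?e n" "C * l2norm lD (\<lambda>x. grad (f n) x - snd (F x)) \<le> C * ?e n"
      by (rule mult_left_mono[OF en(1) C], rule mult_left_mono[OF en(2) C])
    ultimately show ?thesis using a b by linarith
  qed
  have "(\<lambda>n. 2 * C * ?e n + ?d n) \<longlonglongrightarrow> 2 * C * 0 + 0" by (intro tendsto_intros lim d0)
  then have "(\<lambda>n. 2 * C * ?e n + ?d n) \<longlonglongrightarrow> 0" by simp
  then have "(\<lambda>n. l2norm lD (\<lambda>x. (G (f n x), G' (f n x) *\<^sub>R grad (f n) x) - (G (fst (F x)), G' (fst (F x)) *\<^sub>R snd (F x)))) \<longlonglongrightarrow> 0"
    by (rule l2norm_tendsto_zero[OF bound])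
  then show ?thesis using that[of f] f by blast
qed

text \<open>The condition \<open>G 0 = 0\<close> keeps the supports of the composed test functions
  compact.\<close>

lemma jets0_chain:
  assumes F: "F \<in> jets0 D"
    and der: "\<And>t. (G has_real_derivative G' t) (at t)" and cont: "continuous_on UNIV G'" and bd: "\<And>t. \<bar>G' t\<bar> \<le> C"
    and G0: "G 0 = 0" and sm: "\<And>f :: real ^ 'd \<Rightarrow> real. smooth f \<Longrightarrow> smooth (\<lambda>x. G (f x))"
  shows "(\<lambda>x. (G (fst (F x)), G' (fst (F x)) *\<^sub>R snd (F x))) \<in> jets0 D"
proof -
  obtain f where f: "\<And>n. f n \<in> test_functions D"
    "(\<lambda>n. l2norm lD (\<lambda>x. (G (f n x), G' (f n x) *\<^sub>R grad (f n) x) - (G (fst (F x)), G' (fst (F x)) *\<^sub>R snd (F x)))) \<longlonglongrightarrow> 0"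
    by (rule chain_convergence[OF F der cont bd]) (rule that; assumption)
  have "(\<lambda>x. (G (f n x), G' (f n x) *\<^sub>R grad (f n) x)) \<in> jets0 D" for n
  proof -
    have "jet (\<lambda>x. G (f n x)) = (\<lambda>x. (G (f n x), G' (f n x) *\<^sub>R grad (f n) x))"
      using grad_chain(2)[OF smooth_imp_differentiable[OF test_smooth[OF f(1)]] der] by (simp add: jet_def[abs_def])
    moreover have "(\<lambda>x. G (f n x)) \<in> test_functions D" by (rule test_comp[OF f(1) sm[OF test_smooth[OF f(1)]] G0])
    ultimately show ?thesis using jets0_jet by metis
  qed
  then show ?thesis
    by (rule jets0_closed_sequence[OF chain_square_integrable(3)[OF jets0_square_integrable[OF F] der cont bd] _ f(2)])
qed

text \<open>Here the factor \<phi> keeps the supports compact. This serves functions such as (sqrt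
  (t^2 + \<epsilon>^2) - t) / \<epsilon>^2, whose value at 0 is 1 / \<epsilon>.\<close>

lemma jets0_cutoff_chain:
  assumes F: "F \<in> jets0 D" and \<phi>: "\<phi> \<in> test_functions D"
    and der: "\<And>t. (G has_real_derivative G' t) (at t)" and cont: "continuous_on UNIV G'" and bd: "\<And>t. \<bar>G' t\<bar> \<le> C"
    and sm: "\<And>f :: real ^ 'd \<Rightarrow> real. smooth f \<Longrightarrow> smooth (\<lambda>x. G (f x))"
  shows "(\<lambda>x. (\<phi> x * G (fst (F x)), \<phi> x *\<^sub>R (G' (fst (F x)) *\<^sub>R snd (F x)) + G (fst (F x)) *\<^sub>R grad \<phi> x)) \<in> jets0 D"
proof -
  obtain f where f: "\<And>n. f n \<in> test_functions D"
    "(\<lambda>n. l2norm lD (\<lambda>x. (G (f n x), G' (f n x) *\<^sub>R grad (f n) x) - (G (fst (F x)), G' (fst (F x)) *\<^sub>R snd (F x)))) \<longlonglongrightarrow> 0"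
    by (rule chain_convergence[OF F der cont bd]) (rule that; assumption)
  note sF = jets0_square_integrable[OF F]
  note cF = chain_square_integrable[OF sF der cont bd]
  note cf = chain_square_integrable[OF jet_square_integrable[OF f(1)] der cont bd, unfolded jet_def fst_conv snd_conv]
  obtain B where B: "B > 0" "\<And>x. \<bar>\<phi> x\<bar> \<le> B" "\<And>x. norm (grad \<phi> x) \<le> B"
    by (rule test_bounded[OF \<phi>]) (rule that; assumption)
  \<comment> \<open>The pointwise linear map that turns the jet of a function into the jet of its
    product with \<phi>. It is bounded by 3 B, so it respects limits in L^2.\<close>
  define P where "P q x = (\<phi> x * fst q, \<phi> x *\<^sub>R snd q + fst q *\<^sub>R grad \<phi> x)" for q :: "real \<times> (real^'d)" and x
  have Pm: "(\<lambda>x. P (q x) x) \<in> borel_measurable lD" if "square_integrable lD q" for q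
  proof -
    note m = square_integrableD(1)[OF square_integrable_fst_snd(1)[OF that]] square_integrableD(1)[OF square_integrable_fst_snd(2)[OF that]]
    note p = smooth_measurable_lD[OF test_smooth[OF \<phi>]] smooth_grad_measurable_lD[OF test_smooth[OF \<phi>]]
    show ?thesis unfolding P_def
      by (intro borel_measurable_Pair borel_measurable_times borel_measurable_add borel_measurable_scaleR m p)
  qed
  have Pn: "norm (P q x) \<le> 3 * B * norm q" for q x
  proof -
    have "norm (P q x) \<le> norm (\<phi> x * fst q) + norm (\<phi> x *\<^sub>R snd q + fst q *\<^sub>R grad \<phi> x)"
      unfolding P_def by (rule norm_Pair_le)
    also have "\<dots> \<le> \<bar>\<phi> x\<bar> * \<bar>fst q\<bar> + (\<bar>\<phi> x\<bar> * norm (snd q) + \<bar>fst q\<bar> * norm (grad \<phi> x))"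
      using norm_triangle_ineq[of "\<phi> x *\<^sub>R snd q" "fst q *\<^sub>R grad \<phi> x"] by (simp add: abs_mult)
    also have "\<dots> \<le> B * norm q + (B * norm q + norm q * B)"
      using B norm_fst_le[of "fst q" "snd q"] norm_snd_le[of "snd q" "fst q"]
      by (intro add_mono mult_mono) auto
    finally show ?thesis by simp
  qed
  have Psq: "square_integrable lD (\<lambda>x. P (q x) x)" "l2norm lD (\<lambda>x. P (q x) x) \<le> 3 * B * l2norm lD q"
    if q: "square_integrable lD q" for q
  proof -
    have "AE x in lD. norm (P (q x) x) \<le> 3 * B * norm (q x)" using Pn by (intro AE_I2)
    moreover have "0 \<le> 3 * B" using B(1) by simp
    ultimately show "square_integrable lD (\<lambda>x. P (q x) x)" "l2norm lD (\<lambda>x. P (q x) x) \<le> 3 * B * l2norm lD q"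
      by (rule square_integrable_bound[OF q Pm[OF q]])+
  qed
  have diff: "P a x - P b x = P (a - b) x" for a b x
    by (simp add: P_def algebra_simps)
  let ?q = "\<lambda>x. (G (fst (F x)), G' (fst (F x)) *\<^sub>R snd (F x))"
  let ?p = "\<lambda>n x. (G (f n x), G' (f n x) *\<^sub>R grad (f n) x)"
  have J: "(\<lambda>x. P (?p n x) x) \<in> jets0 D" for n
  proof -
    note df = smooth_imp_differentiable[OF test_smooth[OF f(1)]] and d\<phi> = smooth_imp_differentiable[OF test_smooth[OF \<phi>]]
    have "jet (\<lambda>x. \<phi> x * G (f n x)) x = P (?p n x) x" for x
      unfolding jet_def grad_mult[OF d\<phi> grad_chain(1)[OF df der]] grad_chain(2)[OF df der] by (simp add: P_def)
    then have eq: "jet (\<lambda>x. \<phi> x * G (f n x)) = (\<lambda>x. P (?p n x) x)" by (rule ext)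
    have "(\<lambda>x. \<phi> x * G (f n x)) \<in> test_functions D" by (rule test_mult[OF \<phi> sm[OF test_smooth[OF f(1)]]])
    from jets0_jet[OF this] show ?thesis unfolding eq .
  qed
  have "(\<lambda>x. P (?q x) x) \<in> jets0 D"
  proof (rule jets0_closed_sequence[OF Psq(1)[OF cF(3)] J])
    have le: "l2norm lD (\<lambda>x. P (?p n x) x - P (?q x) x) \<le> 3 * B * l2norm lD (\<lambda>x. ?p n x - ?q x)" for n
      unfolding diff by (rule Psq(2)[OF square_integrable_diff[OF cf(3) cF(3)]])
    have "(\<lambda>n. 3 * B * l2norm lD (\<lambda>x. ?p n x - ?q x)) \<longlonglongrightarrow> 3 * B * 0" by (intro tendsto_mult tendsto_const f(2))
    then have "(\<lambda>n. 3 * B * l2norm lD (\<lambda>x. ?p n x - ?q x)) \<longlonglongrightarrow> 0" by simp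
    then show "(\<lambda>n. l2norm lD (\<lambda>x. P (?p n x) x - P (?q x) x)) \<longlonglongrightarrow> 0"
      by (rule l2norm_tendsto_zero[OF le])
  qed
  then show ?thesis by (simp add: P_def)
qed

text \<open>The absolute value is approximated by sqrt (t^2 + \<eta>^2) - \<eta>, which is smooth,
  vanishes at 0, stays below the absolute value of t and has slope at most 1. The slopes tend to
  \<open>sgn t\<close> at every t, including the value 0 at t = 0.\<close>

lemma jets0_abs:
  assumes F: "F \<in> jets0 D"
  shows "(\<lambda>x. (\<bar>fst (F x)\<bar>, sgn (fst (F x)) *\<^sub>R snd (F x))) \<in> jets0 D"
proof -
  note sF = jets0_square_integrable[OF F]
  note s = square_integrable_fst_snd[OF sF]
  define \<eta> where "\<eta> n = 1 / real (Suc n)" for n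
  have \<eta>: "\<eta> n > 0" for n by (simp add: \<eta>_def)
  have \<eta>0: "\<eta> \<longlonglongrightarrow> 0" unfolding \<eta>_def by (rule LIMSEQ_Suc[OF lim_1_over_n])
  define G where "G n t = sqrt (t\<^sup>2 + (\<eta> n)\<^sup>2) - \<eta> n" for n t
  define G' where "G' n t = t / sqrt (t\<^sup>2 + (\<eta> n)\<^sup>2)" for n t
  have pos: "t\<^sup>2 + (\<eta> n)\<^sup>2 > 0" for t n using \<eta>[of n] by (simp add: add_nonneg_pos)
  have der: "(G n has_real_derivative G' n t) (at t)" for n t
    unfolding G_def G'_def using pos[of t n] by (auto intro!: derivative_eq_intros simp: field_simps)
  have cont: "continuous_on UNIV (G' n)" for n
    unfolding G'_def using pos[of _ n] by (intro continuous_intros) (auto simp: less_le)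
  have root: "\<bar>t\<bar> \<le> sqrt (t\<^sup>2 + (\<eta> n)\<^sup>2)" for n t by (rule real_le_rsqrt) simp
  have bd: "\<bar>G' n t\<bar> \<le> 1" for n t
    using root[of t n] pos[of t n] by (simp add: G'_def abs_divide divide_le_eq)
  have Gle: "\<bar>G n t\<bar> \<le> \<bar>t\<bar>" for n t
  proof -
    have "sqrt (t\<^sup>2 + (\<eta> n)\<^sup>2) \<le> \<bar>t\<bar> + \<eta> n"
      using sqrt_add_le_add_sqrt[of "t\<^sup>2" "(\<eta> n)\<^sup>2"] \<eta>[of n] by simp
    moreover have "\<eta> n \<le> sqrt (t\<^sup>2 + (\<eta> n)\<^sup>2)" by (rule real_le_rsqrt) simp
    ultimately show ?thesis by (simp add: G_def)
  qed
  have G0: "G n 0 = 0" for n using \<eta>[of n] by (simp add: G_def)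
  have sm: "smooth (\<lambda>x. G n (f x))" if f: "smooth f" for n and f :: "real ^ 'd \<Rightarrow> real"
  proof -
    have "smooth (\<lambda>x. f x * f x + (\<eta> n)\<^sup>2)" by (rule smooth_add[OF smooth_mult[OF f f] smooth_const])
    then have "smooth (\<lambda>x. sqrt (f x * f x + (\<eta> n)\<^sup>2))"
      by (rule smooth_sqrt) (use pos in \<open>simp add: power2_eq_square\<close>)
    from smooth_diff[OF this smooth_const] show ?thesis by (simp add: G_def power2_eq_square)
  qed
  have J: "(\<lambda>x. (G n (fst (F x)), G' n (fst (F x)) *\<^sub>R snd (F x))) \<in> jets0 D" for n
    by (rule jets0_chain[OF F der cont bd G0 sm])
  have m: "(\<lambda>x. (\<bar>fst (F x)\<bar>, sgn (fst (F x)) *\<^sub>R snd (F x))) \<in> borel_measurable lD"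
  proof -
    note [measurable] = square_integrableD(1)[OF s(1)] square_integrableD(1)[OF s(2)]
    show ?thesis by measurable
  qed
  have lim: "(\<lambda>n. (G n t, G' n t *\<^sub>R v)) \<longlonglongrightarrow> (\<bar>t\<bar>, sgn t *\<^sub>R v)" for t and v :: "real^'d"
  proof (rule tendsto_Pair)
    have root_lim: "(\<lambda>n. sqrt (t\<^sup>2 + (\<eta> n)\<^sup>2)) \<longlonglongrightarrow> \<bar>t\<bar>"
      using tendsto_real_sqrt[OF tendsto_add[OF tendsto_const tendsto_power[OF \<eta>0, of 2]], of "t\<^sup>2"] by simp
    from tendsto_diff[OF this \<eta>0] show "(\<lambda>n. G n t) \<longlonglongrightarrow> \<bar>t\<bar>" by (simp add: G_def)
    show "(\<lambda>n. G' n t *\<^sub>R v) \<longlonglongrightarrow> sgn t *\<^sub>R v"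
    proof (cases "t = 0")
      case False
      then have "(\<lambda>n. t / sqrt (t\<^sup>2 + (\<eta> n)\<^sup>2)) \<longlonglongrightarrow> t / \<bar>t\<bar>" by (intro tendsto_divide tendsto_const root_lim) simp
      then have "(\<lambda>n. G' n t) \<longlonglongrightarrow> sgn t" by (simp add: G'_def real_sgn_eq)
      then show ?thesis by (intro tendsto_intros)
    qed (simp add: G'_def)
  qed
  have dom: "norm (G n t, G' n t *\<^sub>R v) \<le> norm (t, v)" for n t and v :: "real^'d"
  proof -
    have "\<bar>G n t\<bar>\<^sup>2 + (\<bar>G' n t\<bar> * norm v)\<^sup>2 \<le> \<bar>t\<bar>\<^sup>2 + (1 * norm v)\<^sup>2"
      by (intro add_mono power_mono mult_right_mono Gle bd) auto
    then show ?thesis by (simp add: norm_Pair)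
  qed
  have "AE x in lD. norm (G n (fst (F x)), G' n (fst (F x)) *\<^sub>R snd (F x)) \<le> norm (F x)" for n
  proof (intro AE_I2)
    show "norm (G n (fst (F x)), G' n (fst (F x)) *\<^sub>R snd (F x)) \<le> norm (F x)" for x
      using dom[of n "fst (F x)" "snd (F x)"] by simp
  qed
  note L = l2_dominated_convergence[OF square_integrableD(1)[OF jets0_square_integrable[OF J]] m sF AE_I2[OF lim] this]
  show ?thesis by (rule jets0_closed_sequence[OF L(1) J L(2)])
qed

end


section \<open>Positivity of the first eigenfunction\<close>

text \<open>Inner regularity, with an error smaller than the measure of \<open>S\<close>.
  Compactness is wanted because convex hulls of compact sets are compact, so that a cut-off function
  can be bounded below on them.\<close>

lemma inner_compact_positive:
  fixes S :: "'a::euclidean_space set"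
  assumes S: "S \<in> sets lebesgue" "bounded S" "S \<notin> null_sets lebesgue"
  obtains T where "compact T" "T \<subseteq> S" "measure lebesgue T > 0"
proof -
  have Sl: "S \<in> lmeasurable" using S(1,2) by (simp add: bounded_set_imp_lmeasurable)
  have eS: "emeasure lebesgue S = ennreal (measure lebesgue S)"
    using Sl by (intro emeasure_eq_ennreal_measure) (auto simp: fmeasurable_def)
  have mS: "measure lebesgue S > 0"
  proof (rule ccontr)
    assume "\<not> ?thesis"
    then have "measure lebesgue S = 0" by (simp add: zero_less_measure_iff)
    then have "S \<in> null_sets lebesgue" using eS S(1) by (intro null_setsI) simp_all
    then show False using S(3) by blast
  qed
  obtain T where T: "closed T" "T \<subseteq> S" "S - T \<in> lmeasurable" "emeasure lebesgue (S - T) < ennreal (measure lebesgue S)"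
    by (rule sets_lebesgue_inner_closed[OF S(1) mS]) (rule that; assumption)
  have cT: "compact T" using T(1,2) S(2) by (meson bounded_subset compact_eq_bounded_closed)
  have "measure lebesgue T > 0"
  proof (rule ccontr)
    assume "\<not> ?thesis"
    then have "measure lebesgue T = 0" by (simp add: zero_less_measure_iff)
    then have "negligible T" using lmeasurable_compact[OF cT] by (simp add: negligible_iff_measure)
    then have "T \<in> null_sets lebesgue" by (simp add: negligible_iff_null_sets)
    then have "emeasure lebesgue (S - T) = emeasure lebesgue S" using S(1) by (rule emeasure_Diff_null_set)
    then show False using T(4) eS by simp
  qed
  then show ?thesis using that cT T(2) by blast
qed

lemma square_integrable_restrict:
  assumes A: "A \<in> sets M" and f: "square_integrable M f"
  shows "square_integrable (restrict_space M A) f" "l2norm (restrict_space M A) f \<le> l2norm M f"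
proof -
  have As: "A \<inter> space M \<in> sets M" using A by simp
  have i: "integrable M (\<lambda>x. indicator A x *\<^sub>R (norm (f x))\<^sup>2)"
    by (rule integrable_mult_indicator[OF A square_integrableD(2)[OF f]])
  have "f \<in> borel_measurable (restrict_space M A)" by (rule measurable_restrict_space1[OF square_integrableD(1)[OF f]])
  then show "square_integrable (restrict_space M A) f"
    using i by (simp add: square_integrable_def integrable_restrict_space[OF As])
  show "l2norm (restrict_space M A) f \<le> l2norm M f"
    unfolding l2norm_def integral_restrict_space[OF As]
    by (intro real_sqrt_le_mono integral_mono i square_integrableD(2)[OF f]) (simp add: indicator_def)
qed

text \<open>Poincare's inequality for the composed test functions, passed to the limit. Restriction
  to K does not increase L^2 norms, so convergence on \<open>D\<close> gives convergence of all
  three terms.\<close>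

lemma poincare_chain:
  fixes D :: "(real ^ 'd) set"
  assumes "bounded_open D" and F: "F \<in> jets0 D"
    and der: "\<And>t. (G has_real_derivative G' t) (at t)" and cont: "continuous_on UNIV G'" and bd: "\<And>t. \<bar>G' t\<bar> \<le> C"
    and K: "compact K" "convex K" "K \<subseteq> D" and R: "\<And>x y. x \<in> K \<Longrightarrow> y \<in> K \<Longrightarrow> norm (x - y) \<le> R"
  shows "square_integrable (lebesgue_on K) (\<lambda>x. G (fst (F x)))"
    "measure lebesgue K * (l2norm (lebesgue_on K) (\<lambda>x. G (fst (F x))))\<^sup>2 \<le> (LINT x|lebesgue_on K. G (fst (F x)))\<^sup>2 +
      R\<^sup>2 * 2 ^ CARD('d) * measure lebesgue K * (l2norm (lebesgue_on K) (\<lambda>x. G' (fst (F x)) *\<^sub>R snd (F x)))\<^sup>2"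
proof -
  interpret bounded_open D by fact
  obtain f where f: "\<And>n. f n \<in> test_functions D"
    "(\<lambda>n. l2norm lD (\<lambda>x. (G (f n x), G' (f n x) *\<^sub>R grad (f n) x) - (G (fst (F x)), G' (fst (F x)) *\<^sub>R snd (F x)))) \<longlonglongrightarrow> 0"
    by (rule chain_convergence[OF F der cont bd]) (rule that; assumption)
  note cF = chain_square_integrable[OF jets0_square_integrable[OF F] der cont bd]
  note cf = chain_square_integrable[OF jet_square_integrable[OF f(1)] der cont bd, unfolded jet_def fst_conv snd_conv]
  have Ks: "K \<in> sets lebesgue" using K(1) by (simp add: lmeasurable_compact fmeasurableD)
  have KD: "K \<in> sets lD" using Ks K(3) by (simp add: sets_restrict_space_iff)
  have lK: "restrict_space lD K = lebesgue_on K"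
    using restrict_restrict_space[of D lebesgue K] Ks K(3) by (simp add: Int_absorb1 Int_absorb2)
  note res = square_integrable_restrict[OF KD, unfolded lK]
  have fin: "finite_measure (lebesgue_on K)" by (rule finite_measure_lebesgue_on[OF lmeasurable_compact[OF K(1)]])
  have one: "square_integrable (lebesgue_on K) (\<lambda>x. 1::real)" by (rule square_integrable_bounded[OF fin, of _ 1]) auto
  define p where "p n = (\<lambda>x. G (f n x))" for n
  define q where "q n = (\<lambda>x. G' (f n x) *\<^sub>R grad (f n) x)" for n
  define p' where "p' = (\<lambda>x. G (fst (F x)))"
  define q' where "q' = (\<lambda>x. G' (fst (F x)) *\<^sub>R snd (F x))"
  have sp: "square_integrable lD (p n)" and sq: "square_integrable lD (q n)" for n unfolding p_def q_def by (rule cf)+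
  have sp': "square_integrable lD p'" and sq': "square_integrable lD q'" unfolding p'_def q'_def by (rule cF)+
  let ?e = "\<lambda>n. l2norm lD (\<lambda>x. (G (f n x), G' (f n x) *\<^sub>R grad (f n) x) - (G (fst (F x)), G' (fst (F x)) *\<^sub>R snd (F x)))"
  have e: "l2norm lD (\<lambda>x. p n x - p' x) \<le> ?e n" "l2norm lD (\<lambda>x. q n x - q' x) \<le> ?e n" for n
    using l2norm_fst_snd_le[OF square_integrable_diff[OF cf(3)[of n] cF(3)]]
    by (simp_all add: p_def p'_def q_def q'_def)
  have lim_p: "(\<lambda>n. l2norm (lebesgue_on K) (p n)) \<longlonglongrightarrow> l2norm (lebesgue_on K) p'"
  proof (rule LIM_zero_cancel, rule Lim_null_comparison[OF always_eventually[OF allI] f(2)])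
    fix n
    show "norm (l2norm (lebesgue_on K) (p n) - l2norm (lebesgue_on K) p') \<le> ?e n"
      using l2norm_diff_abs_le[OF res(1)[OF sp] res(1)[OF sp'], of n] res(2)[OF square_integrable_diff[OF sp sp'], of n] e(1)[of n]
      by simp
  qed
  have lim_q: "(\<lambda>n. l2norm (lebesgue_on K) (q n)) \<longlonglongrightarrow> l2norm (lebesgue_on K) q'"
  proof (rule LIM_zero_cancel, rule Lim_null_comparison[OF always_eventually[OF allI] f(2)])
    fix n
    show "norm (l2norm (lebesgue_on K) (q n) - l2norm (lebesgue_on K) q') \<le> ?e n"
      using l2norm_diff_abs_le[OF res(1)[OF sq] res(1)[OF sq'], of n] res(2)[OF square_integrable_diff[OF sq sq'], of n] e(2)[of n]
      by simp
  qed
  have lim_i: "(\<lambda>n. LINT x|lebesgue_on K. p n x) \<longlonglongrightarrow> (LINT x|lebesgue_on K. p' x)"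
  proof (rule LIM_zero_cancel, rule Lim_null_comparison[OF always_eventually[OF allI]])
    fix n
    have i: "integrable (lebesgue_on K) (p n)" "integrable (lebesgue_on K) p'"
      using integrable_inner_square(1)[OF res(1)[OF sp] one] integrable_inner_square(1)[OF res(1)[OF sp'] one] by simp_all
    have "\<bar>LINT x|lebesgue_on K. p n x - p' x\<bar> \<le> l2norm (lebesgue_on K) (\<lambda>x. p n x - p' x) * l2norm (lebesgue_on K) (\<lambda>x. 1::real)"
      using integrable_inner_square(2)[OF res(1)[OF square_integrable_diff[OF sp sp']] one] by simp
    also have "\<dots> \<le> ?e n * l2norm (lebesgue_on K) (\<lambda>x. 1::real)"
      using res(2)[OF square_integrable_diff[OF sp sp'], of n] e(1)[of n] by (intro mult_right_mono) auto
    finally show "norm ((LINT x|lebesgue_on K. p n x) - (LINT x|lebesgue_on K. p' x)) \<le> ?e n * l2norm (lebesgue_on K) (\<lambda>x. 1::real)"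
      using i by simp
  next
    show "(\<lambda>n. ?e n * l2norm (lebesgue_on K) (\<lambda>x. 1::real)) \<longlonglongrightarrow> 0" by (rule tendsto_mult_left_zero[OF f(2)])
  qed
  have each: "measure lebesgue K * (l2norm (lebesgue_on K) (p n))\<^sup>2 \<le> (LINT x|lebesgue_on K. p n x)\<^sup>2 +
      R\<^sup>2 * 2 ^ CARD('d) * measure lebesgue K * (l2norm (lebesgue_on K) (q n))\<^sup>2" for n
  proof -
    note df = smooth_imp_differentiable[OF test_smooth[OF f(1)]]
    have g: "grad (p n) = q n" unfolding p_def q_def by (rule ext, rule grad_chain(2)[OF df der])
    have fc: "continuous_on UNIV (f n)" by (rule smooth_imp_continuous[OF test_smooth[OF f(1)]])
    have "continuous_on UNIV (\<lambda>x. G' (f n x))" by (rule continuous_on_compose2[OF cont fc]) simp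
    then have "continuous_on UNIV (q n)" unfolding q_def
      by (intro continuous_on_scaleR smooth_imp_continuous_grad test_smooth[OF f(1)])
    then have gc: "continuous_on UNIV (grad (p n))" unfolding g .
    have "p n differentiable at x" for x unfolding p_def by (rule grad_chain(1)[OF df der])
    from poincare_compact_convex[OF this gc K(1,2) R] show ?thesis unfolding g l2norm_power2 by simp
  qed
  show "square_integrable (lebesgue_on K) (\<lambda>x. G (fst (F x)))" using res(1)[OF sp'] by (simp add: p'_def)
  have "measure lebesgue K * (l2norm (lebesgue_on K) p')\<^sup>2 \<le> (LINT x|lebesgue_on K. p' x)\<^sup>2 +
      R\<^sup>2 * 2 ^ CARD('d) * measure lebesgue K * (l2norm (lebesgue_on K) q')\<^sup>2"
  proof (rule LIMSEQ_le)
    show "(\<lambda>n. measure lebesgue K * (l2norm (lebesgue_on K) (p n))\<^sup>2) \<longlonglongrightarrow> measure lebesgue K * (l2norm (lebesgue_on K) p')\<^sup>2"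
      by (intro tendsto_intros lim_p)
    show "(\<lambda>n. (LINT x|lebesgue_on K. p n x)\<^sup>2 + R\<^sup>2 * 2 ^ CARD('d) * measure lebesgue K * (l2norm (lebesgue_on K) (q n))\<^sup>2)
      \<longlonglongrightarrow> (LINT x|lebesgue_on K. p' x)\<^sup>2 + R\<^sup>2 * 2 ^ CARD('d) * measure lebesgue K * (l2norm (lebesgue_on K) q')\<^sup>2"
      by (intro tendsto_intros lim_i lim_q)
  qed (use each in blast)
  then show "measure lebesgue K * (l2norm (lebesgue_on K) (\<lambda>x. G (fst (F x))))\<^sup>2 \<le> (LINT x|lebesgue_on K. G (fst (F x)))\<^sup>2 +
      R\<^sup>2 * 2 ^ CARD('d) * measure lebesgue K * (l2norm (lebesgue_on K) (\<lambda>x. G' (fst (F x)) *\<^sub>R snd (F x)))\<^sup>2"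
    unfolding p'_def q'_def .
qed

text \<open>The integrand of the tested equation at one point: v is the value, n and d are the norms
  of the gradients of v and \<phi>, x is their inner product. The test function is \<phi>^2 g with g
  = (s - v) / \<epsilon>^2 = 1 / (s + v). Its derivative is at most -1 / (2 s^2), which yields a
  good term with factor a0 / 2; half of it absorbs the mixed term. The zero order terms are bounded
  because v g is at most 1.\<close>

lemma log_test_pointwise:
  fixes v \<epsilon> \<phi> n d x \<alpha> \<beta> \<gamma> \<mu> a0 B :: real
  assumes \<epsilon>: "0 < \<epsilon>" and v: "0 \<le> v" and a0: "0 < a0" "a0 \<le> \<alpha>" and bd: "\<bar>\<alpha>\<bar> \<le> B" "\<bar>\<beta>\<bar> \<le> B" "\<bar>\<gamma>\<bar> \<le> B"
    and x: "\<bar>x\<bar> \<le> n * d" "0 \<le> n" "0 \<le> d"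
  defines "s \<equiv> sqrt (v\<^sup>2 + \<epsilon>\<^sup>2)"
  shows "\<alpha> * (\<phi>\<^sup>2 * ((v / s - 1) / \<epsilon>\<^sup>2) * n\<^sup>2 + 2 * \<phi> * ((s - v) / \<epsilon>\<^sup>2) * x) + \<beta> * (v * (\<phi>\<^sup>2 * ((s - v) / \<epsilon>\<^sup>2)))
      - \<mu> * (\<gamma> * (v * (\<phi>\<^sup>2 * ((s - v) / \<epsilon>\<^sup>2))))
    \<le> - (a0 / 4) * (\<phi> * n / s)\<^sup>2 + 4 * B\<^sup>2 / a0 * d\<^sup>2 + (B + \<bar>\<mu>\<bar> * B) * \<phi>\<^sup>2"
proof -
  have s2: "s\<^sup>2 = v\<^sup>2 + \<epsilon>\<^sup>2" by (simp add: s_def)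
  have s: "0 < s" using \<epsilon> by (simp add: s_def add_nonneg_pos)
  have vs: "v \<le> s" unfolding s_def by (rule real_le_rsqrt) simp
  define g where "g = (s - v) / \<epsilon>\<^sup>2"
  have gs: "g = 1 / (s + v)"
  proof -
    have "(s - v) * (s + v) = \<epsilon>\<^sup>2" using s2 by (simp add: algebra_simps power2_eq_square)
    then show ?thesis using s v \<epsilon> by (simp add: g_def field_simps)
  qed
  have g0: "0 \<le> g" using s v by (simp add: gs)
  have g1: "g \<le> 1 / s" using s v unfolding gs by (intro divide_left_mono) auto
  have vg: "0 \<le> v * g" "v * g \<le> 1" using s v by (auto simp: gs divide_le_eq)
  \<comment> \<open>The left-hand side, which is the derivative of g with respect to v, equals - g /
    s, and g is at least 1 / (2 s) because v is at most s.\<close>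
  have g': "(v / s - 1) / \<epsilon>\<^sup>2 \<le> - (1 / (2 * s\<^sup>2))"
  proof -
    have "v / s - 1 = - ((s - v) / s)" using s by (simp add: field_simps)
    then have "(v / s - 1) / \<epsilon>\<^sup>2 = - (g / s)" by (simp add: g_def mult.commute)
    moreover have "1 / (2 * s) \<le> g" unfolding gs using s v vs by (intro divide_left_mono) auto
    then have "1 / (2 * s) / s \<le> g / s" using s by (intro divide_right_mono) auto
    ultimately show ?thesis by (simp add: power2_eq_square)
  qed
  have B: "0 \<le> B" using bd(1) by linarith
  have T1: "\<alpha> * (\<phi>\<^sup>2 * ((v / s - 1) / \<epsilon>\<^sup>2) * n\<^sup>2) \<le> - (a0 / 2) * (\<phi> * n / s)\<^sup>2"
  proof -
    have h: "\<phi>\<^sup>2 * n\<^sup>2 * ((v / s - 1) / \<epsilon>\<^sup>2) \<le> \<phi>\<^sup>2 * n\<^sup>2 * - (1 / (2 * s\<^sup>2))" by (intro mult_left_mono g') simp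
    have "\<alpha> * (\<phi>\<^sup>2 * n\<^sup>2 * ((v / s - 1) / \<epsilon>\<^sup>2)) \<le> \<alpha> * (\<phi>\<^sup>2 * n\<^sup>2 * - (1 / (2 * s\<^sup>2)))"
      by (rule mult_left_mono[OF h]) (use a0 in simp)
    also have "\<dots> = - (\<alpha> * (\<phi>\<^sup>2 * n\<^sup>2 * (1 / (2 * s\<^sup>2))))" by simp
    also have "\<dots> \<le> - (a0 * (\<phi>\<^sup>2 * n\<^sup>2 * (1 / (2 * s\<^sup>2))))"
      using a0(2) by (simp only: neg_le_iff_le, intro mult_right_mono) simp_all
    finally show ?thesis by (simp add: power_mult_distrib power_divide mult_ac)
  qed
  have T2: "\<alpha> * (2 * \<phi> * g * x) \<le> (a0 / 4) * (\<phi> * n / s)\<^sup>2 + 4 * B\<^sup>2 / a0 * d\<^sup>2"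
  proof -
    define A where "A = \<bar>\<phi>\<bar> * n / s"
    have "\<alpha> * (2 * \<phi> * g * x) \<le> \<bar>\<alpha> * (2 * \<phi> * g * x)\<bar>" by simp
    also have "\<dots> = \<bar>\<alpha>\<bar> * (2 * \<bar>\<phi>\<bar> * g * \<bar>x\<bar>)" using g0 by (simp add: abs_mult)
    also have "\<dots> \<le> B * (2 * \<bar>\<phi>\<bar> * (1 / s) * (n * d))"
      using bd(1) B g0 g1 x s by (intro mult_mono) auto
    also have "\<dots> = 2 * A * (B * d)" by (simp add: A_def)
    also have "\<dots> \<le> (a0 / 4) * A\<^sup>2 + 4 / a0 * (B * d)\<^sup>2"
    proof -
      \<comment> \<open>Young's inequality, weighted so that exactly half of the good term is
        spent.\<close>
      have "0 \<le> (a0 * A - 4 * (B * d))\<^sup>2 / (4 * a0)" using a0 by simp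
      also have "\<dots> = (a0 / 4) * A\<^sup>2 + 4 / a0 * (B * d)\<^sup>2 - 2 * A * (B * d)"
        using a0(1) by (simp add: power2_eq_square field_simps)
      finally show ?thesis by simp
    qed
    finally show ?thesis by (simp add: A_def power_mult_distrib power_divide)
  qed
  have T3: "\<beta> * (v * (\<phi>\<^sup>2 * g)) \<le> B * \<phi>\<^sup>2" "- (\<mu> * (\<gamma> * (v * (\<phi>\<^sup>2 * g)))) \<le> \<bar>\<mu>\<bar> * B * \<phi>\<^sup>2"
  proof -
    have w: "0 \<le> v * (\<phi>\<^sup>2 * g)" "v * (\<phi>\<^sup>2 * g) \<le> \<phi>\<^sup>2"
      using vg mult_right_mono[OF vg(2), of "\<phi>\<^sup>2"] mult_nonneg_nonneg[OF vg(1), of "\<phi>\<^sup>2"] by (simp_all add: mult_ac)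
    have "\<beta> * (v * (\<phi>\<^sup>2 * g)) \<le> B * (v * (\<phi>\<^sup>2 * g))" using bd(2) w by (intro mult_right_mono) auto
    also have "\<dots> \<le> B * \<phi>\<^sup>2" by (rule mult_left_mono[OF w(2) B])
    finally show "\<beta> * (v * (\<phi>\<^sup>2 * g)) \<le> B * \<phi>\<^sup>2" .
    have "- (\<mu> * (\<gamma> * (v * (\<phi>\<^sup>2 * g)))) \<le> \<bar>\<mu> * (\<gamma> * (v * (\<phi>\<^sup>2 * g)))\<bar>" by linarith
    also have "\<dots> = \<bar>\<mu>\<bar> * (\<bar>\<gamma>\<bar> * (v * (\<phi>\<^sup>2 * g)))" by (simp only: abs_mult[of \<mu>] abs_mult[of \<gamma>] abs_of_nonneg[OF w(1)])
    also have "\<dots> \<le> \<bar>\<mu>\<bar> * (B * \<phi>\<^sup>2)" using bd(3) w B by (intro mult_left_mono mult_mono) auto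
    finally show "- (\<mu> * (\<gamma> * (v * (\<phi>\<^sup>2 * g)))) \<le> \<bar>\<mu>\<bar> * B * \<phi>\<^sup>2" by (simp add: mult.assoc)
  qed
  have T4: "- (a0 / 2) * (\<phi> * n / s)\<^sup>2 = - (a0 / 4) * (\<phi> * n / s)\<^sup>2 - (a0 / 4) * (\<phi> * n / s)\<^sup>2" by (simp add: field_simps)
  show ?thesis
    unfolding g_def[symmetric] distrib_left[of \<alpha>] distrib_right[of B] using T1 T2 T3 T4 by linarith
qed

context eigen_problem
begin

text \<open>Testing with \<open>\<phi>\<^sup>2 / s(v)\<close>, where \<open>s(v) = v + sqrt (v\<^sup>2 + \<epsilon>\<^sup>2)\<close>, bounds the gradient of
  \<open>log (s v)\<close> uniformly in \<open>\<epsilon>\<close>.\<close>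

lemma log_gradient_bound:
  assumes V: "V \<in> eigenjets \<mu>" and nn: "AE x in lD. 0 \<le> fst (V x)" and \<epsilon>: "0 < \<epsilon>"
    and \<phi>: "\<phi> \<in> test_functions D" and b: "\<And>x. \<bar>\<phi> x\<bar> \<le> b" "\<And>x. norm (grad \<phi> x) \<le> b"
  shows "(l2norm lD (\<lambda>x. (\<phi> x / sqrt ((fst (V x))\<^sup>2 + \<epsilon>\<^sup>2)) *\<^sub>R snd (V x)))\<^sup>2
    \<le> 4 / a0 * ((4 * B\<^sup>2 / a0 + (B + \<bar>\<mu>\<bar> * B)) * b\<^sup>2 * measure lebesgue D)"
proof -
  interpret fin: finite_measure lD by (rule finite_lD)
  \<comment> \<open>Here \<open>s\<close> is the square root alone. The function \<open>G\<close>
    below equals 1 / (t + s t), rationalized, so that its derivative and its smoothness follow from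
    those of \<open>s\<close> by linearity.\<close>
  define s where "s t = sqrt (t\<^sup>2 + \<epsilon>\<^sup>2)" for t
  define G where "G t = (s t - t) / \<epsilon>\<^sup>2" for t
  define G' where "G' t = (t / s t - 1) / \<epsilon>\<^sup>2" for t
  have pos: "t\<^sup>2 + \<epsilon>\<^sup>2 > 0" for t using \<epsilon> by (simp add: add_nonneg_pos)
  have spos: "s t > 0" for t by (simp add: s_def pos)
  have root: "\<bar>t\<bar> \<le> s t" for t unfolding s_def by (rule real_le_rsqrt) simp
  have der: "(G has_real_derivative G' t) (at t)" for t
  proof -
    have "(s has_real_derivative t / s t) (at t)"
      unfolding s_def using pos[of t] by (auto intro!: derivative_eq_intros simp: field_simps)
    then show ?thesis unfolding G_def G'_def by (intro DERIV_cdivide DERIV_diff DERIV_ident)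
  qed
  have sc: "continuous_on UNIV s" unfolding s_def by (intro continuous_intros)
  have cont: "continuous_on UNIV G'"
    unfolding G'_def using spos \<epsilon> by (intro continuous_intros sc) (auto simp: less_le)
  have bdG: "\<bar>G' t\<bar> \<le> 2 / \<epsilon>\<^sup>2" for t
  proof -
    have "\<bar>t / s t\<bar> \<le> 1" using root[of t] spos[of t] by (simp add: abs_divide divide_le_eq)
    then have "\<bar>t / s t - 1\<bar> \<le> 2" by linarith
    then show ?thesis unfolding G'_def by (simp add: abs_divide divide_right_mono)
  qed
  have sm: "smooth (\<lambda>x. G (f x))" if f: "smooth f" for f :: "real ^ 'd \<Rightarrow> real"
  proof -
    have "smooth (\<lambda>x. f x * f x + \<epsilon>\<^sup>2)" by (rule smooth_add[OF smooth_mult[OF f f] smooth_const])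
    then have "smooth (\<lambda>x. sqrt (f x * f x + \<epsilon>\<^sup>2))"
      by (rule smooth_sqrt) (use pos in \<open>simp add: power2_eq_square\<close>)
    from smooth_cmult[OF smooth_diff[OF this f], of "1 / \<epsilon>\<^sup>2"] show ?thesis by (simp add: G_def s_def power2_eq_square)
  qed
  have \<phi>2: "(\<lambda>x. \<phi> x * \<phi> x) \<in> test_functions D" by (rule test_mult[OF \<phi> test_smooth[OF \<phi>]])
  have g\<phi>2: "grad (\<lambda>x. \<phi> x * \<phi> x) x = (2 * \<phi> x) *\<^sub>R grad \<phi> x" for x
    using grad_mult[OF smooth_imp_differentiable[OF test_smooth[OF \<phi>]] smooth_imp_differentiable[OF test_smooth[OF \<phi>]]]
    by (simp add: scaleR_add_left[symmetric])
  \<comment> \<open>The pair of the test function \<phi>^2 G(v) and its gradient.\<close>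
  define H where "H x = (\<phi> x * \<phi> x * G (fst (V x)), (\<phi> x * \<phi> x) *\<^sub>R (G' (fst (V x)) *\<^sub>R snd (V x)) + G (fst (V x)) *\<^sub>R ((2 * \<phi> x) *\<^sub>R grad \<phi> x))" for x
  have H: "H \<in> jets0 D"
    unfolding H_def[abs_def] using jets0_cutoff_chain[OF eigenjetsD(1)[OF V] \<phi>2 der cont bdG sm] unfolding g\<phi>2 .
  note sV = eigenjetsD(2)[OF V] and sH = jets0_square_integrable[OF H]
  \<comment> \<open>The integrand of energy minus \<mu> times mass, tested with \<open>H\<close>;
    its integral vanishes by the eigenvalue equation. The term with factor 0 mirrors the first
    coefficient of the mass form.\<close>
  define I where "I x = (\<alpha> x * (snd (V x) \<bullet> snd (H x)) + \<beta> x * (fst (V x) * fst (H x))) - \<mu> * (0 * (snd (V x) \<bullet> snd (H x)) + \<gamma> x * (fst (V x) * fst (H x)))" for x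
  have iI: "integrable lD I"
    unfolding I_def by (intro Bochner_Integration.integrable_diff integrable_mult_right wform_bounded(1)[OF A_bd sV sH] wform_bounded(1)[OF M_bd sV sH])
  have "(LINT x|lD. I x) = \<A> V H - \<mu> * \<M> V H"
    unfolding I_def wform_def
    by (subst Bochner_Integration.integral_diff)
       (intro integrable_mult_right wform_bounded(1)[OF A_bd sV sH] wform_bounded(1)[OF M_bd sV sH] | simp)+
  then have I0: "(LINT x|lD. I x) = 0" using eigenjetsD(3)[OF V H] by simp
  define Q where "Q x = (\<phi> x / sqrt ((fst (V x))\<^sup>2 + \<epsilon>\<^sup>2)) *\<^sub>R snd (V x)" for x
  define c where "c = (4 * B\<^sup>2 / a0 + (B + \<bar>\<mu>\<bar> * B)) * b\<^sup>2"
  have Qs: "square_integrable lD Q"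
  proof -
    note m = square_integrableD(1)[OF square_integrable_fst_snd(1)[OF sV]]
    have "continuous_on UNIV (\<lambda>t. 1 / s t)" using spos by (intro continuous_intros sc) (auto simp: less_le)
    from continuous_comp_measurable_lD[OF this m] smooth_measurable_lD[OF test_smooth[OF \<phi>]]
    have "(\<lambda>x. \<phi> x * (1 / s (fst (V x)))) \<in> borel_measurable lD" by (intro borel_measurable_times)
    then have "(\<lambda>x. \<phi> x / sqrt ((fst (V x))\<^sup>2 + \<epsilon>\<^sup>2)) \<in> borel_measurable lD" by (simp add: s_def)
    moreover have "\<bar>\<phi> x / sqrt ((fst (V x))\<^sup>2 + \<epsilon>\<^sup>2)\<bar> \<le> b / \<epsilon>" for x
    proof -
      have "\<epsilon> \<le> sqrt ((fst (V x))\<^sup>2 + \<epsilon>\<^sup>2)" by (rule real_le_rsqrt) simp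
      then show ?thesis using \<epsilon> b(1)[of x] pos[of "fst (V x)"] by (auto simp: abs_divide intro!: frac_le)
    qed
    moreover have "0 \<le> b / \<epsilon>" using b(1)[of undefined] \<epsilon> by simp
    ultimately show ?thesis unfolding Q_def
      by (intro square_integrable_bounded_mult(1)[OF square_integrable_fst_snd(2)[OF sV]] AE_I2) auto
  qed
  have "AE x in lD. I x \<le> - (a0 / 4) * (norm (Q x))\<^sup>2 + c"
  proof -
    have "AE x in lD. \<bar>\<alpha> x\<bar> \<le> B" "AE x in lD. \<bar>\<beta> x\<bar> \<le> B" "AE x in lD. \<bar>\<gamma> x\<bar> \<le> B"
      using A_bd M_bd by (auto simp: ess_bounded_def)
    then show ?thesis using nn lower_\<alpha>
    proof eventually_elim
      fix x assume as: "\<bar>\<alpha> x\<bar> \<le> B" "\<bar>\<beta> x\<bar> \<le> B" "\<bar>\<gamma> x\<bar> \<le> B" "0 \<le> fst (V x)" "a0 \<le> \<alpha> x"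
      let ?v = "fst (V x)" and ?g = "snd (V x)"
      have "\<bar>?g \<bullet> grad \<phi> x\<bar> \<le> norm ?g * norm (grad \<phi> x)" by (rule Cauchy_Schwarz_ineq2)
      note P = log_test_pointwise[OF \<epsilon> as(4) a0 as(5,1-3) this norm_ge_zero norm_ge_zero, of "\<phi> x" \<mu>]
      have "I x = \<alpha> x * ((\<phi> x)\<^sup>2 * ((?v / s ?v - 1) / \<epsilon>\<^sup>2) * (norm ?g)\<^sup>2 + 2 * \<phi> x * ((s ?v - ?v) / \<epsilon>\<^sup>2) * (?g \<bullet> grad \<phi> x))
          + \<beta> x * (?v * ((\<phi> x)\<^sup>2 * ((s ?v - ?v) / \<epsilon>\<^sup>2))) - \<mu> * (\<gamma> x * (?v * ((\<phi> x)\<^sup>2 * ((s ?v - ?v) / \<epsilon>\<^sup>2))))"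
        by (simp add: I_def H_def G_def G'_def inner_add_right dot_square_norm power2_eq_square[of "\<phi> x"] mult_ac)
      also have "\<dots> \<le> - (a0 / 4) * (\<phi> x * norm ?g / s ?v)\<^sup>2 + 4 * B\<^sup>2 / a0 * (norm (grad \<phi> x))\<^sup>2 + (B + \<bar>\<mu>\<bar> * B) * (\<phi> x)\<^sup>2"
        using P unfolding s_def .
      also have "(\<phi> x * norm ?g / s ?v)\<^sup>2 = (norm (Q x))\<^sup>2"
        by (simp add: Q_def s_def power_mult_distrib power_divide)
      also have "4 * B\<^sup>2 / a0 * (norm (grad \<phi> x))\<^sup>2 \<le> 4 * B\<^sup>2 / a0 * b\<^sup>2"
        using a0 b(2)[of x] by (intro mult_left_mono power_mono) auto
      also have "(B + \<bar>\<mu>\<bar> * B) * (\<phi> x)\<^sup>2 \<le> (B + \<bar>\<mu>\<bar> * B) * b\<^sup>2"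
        using B_nonneg power_mono[OF b(1)[of x] abs_ge_zero, of 2] by (intro mult_left_mono) auto
      finally show "I x \<le> - (a0 / 4) * (norm (Q x))\<^sup>2 + c" by (simp add: c_def distrib_right)
    qed
  qed
  then have "(LINT x|lD. I x) \<le> (LINT x|lD. - (a0 / 4) * (norm (Q x))\<^sup>2 + c)"
    using iI square_integrableD(2)[OF Qs] by (intro integral_mono_AE) auto
  also have "\<dots> = - (a0 / 4) * (l2norm lD Q)\<^sup>2 + c * measure lebesgue D"
  proof -
    have "measure lD (space lD) = measure lebesgue D" by (simp add: measure_restrict_space)
    then show ?thesis using square_integrableD(2)[OF Qs] by (simp add: l2norm_power2 mult.commute)
  qed
  finally have "(a0 / 4) * (l2norm lD Q)\<^sup>2 \<le> c * measure lebesgue D" using I0 by simp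
  then have "(l2norm lD Q)\<^sup>2 \<le> 4 / a0 * (c * measure lebesgue D)" using a0 by (simp add: field_simps)
  then show ?thesis unfolding Q_def c_def .
qed

end


context eigen_problem
begin

lemma null_sets_imp_AE_lD:
  assumes "{x \<in> D. \<not> P x} \<in> null_sets lebesgue" shows "AE x in lD. P x"
proof -
  have "AE x in lebesgue. x \<in> D \<longrightarrow> P x" by (rule AE_I'[OF assms]) auto
  then show ?thesis by (subst AE_restrict_space_iff) auto
qed

text \<open>Otherwise v = 0 almost everywhere on a compact set Z and v \<ge> \<delta> on a compact
  set P, both of positive measure. The function arsinh (v / \<epsilon>) is 0 almost everywhere on Z
  and at least arsinh (\<delta> / \<epsilon>) on P, while the Poincare inequality on the convex hull
  of both bounds its L^2 norm independently of \<epsilon>. Small \<epsilon> gives the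
  contradiction.\<close>

lemma eigenjet_positive:
  assumes conv: "convex D" and V: "V \<in> eigenjets \<mu>" and nn: "AE x in lD. 0 \<le> fst (V x)"
    and nz: "\<not> (AE x in lD. fst (V x) = 0)"
  shows "AE x in lD. 0 < fst (V x)"
proof (rule ccontr)
  assume np: "\<not> (AE x in lD. 0 < fst (V x))"
  define v where "v = (\<lambda>x. fst (V x))"
  note sV = eigenjetsD(2)[OF V]
  have vm [measurable]: "v \<in> borel_measurable lD"
    unfolding v_def by (rule square_integrableD(1)[OF square_integrable_fst_snd(1)[OF sV]])
  have sets: "{x \<in> D. v x \<in> T} \<in> sets lebesgue" if "T \<in> sets borel" for T
  proof -
    have "v -` T \<inter> space lD \<in> sets lD" by (rule measurable_sets[OF vm that])
    then have "v -` T \<inter> D \<in> sets lebesgue" by (simp add: sets_restrict_space_iff)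
    moreover have "v -` T \<inter> D = {x \<in> D. v x \<in> T}" by blast
    ultimately show ?thesis by simp
  qed
  have bdd: "bounded {x \<in> D. v x \<in> T}" for T by (rule bounded_subset[OF bounded_D]) blast
  have Z0: "{x \<in> D. v x \<in> {..0}} \<notin> null_sets lebesgue"
  proof
    assume "{x \<in> D. v x \<in> {..0}} \<in> null_sets lebesgue"
    moreover have "{x \<in> D. v x \<in> {..0}} = {x \<in> D. \<not> 0 < fst (V x)}" by (auto simp: v_def)
    ultimately show False using np null_sets_imp_AE_lD by simp
  qed
  have "{x \<in> D. v x \<in> {..0}} \<in> sets lebesgue" by (rule sets) simp
  then obtain Z where Z: "compact Z" "Z \<subseteq> {x \<in> D. v x \<in> {..0}}" "measure lebesgue Z > 0"
    by (rule inner_compact_positive[OF _ bdd Z0]) (rule that; assumption)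
  \<comment> \<open>The countably many sets where v is at least 1 / (k + 1) exhaust the set v > 0,
    so not all of them are null sets.\<close>
  have "\<exists>k. {x \<in> D. v x \<in> {1 / real (Suc k)..}} \<notin> null_sets lebesgue"
  proof (rule ccontr)
    assume "\<not> ?thesis"
    then have n: "{x \<in> D. v x \<in> {1 / real (Suc k)..}} \<in> null_sets lebesgue" for k by blast
    have "AE x in lD. v x < 1 / real (Suc k)" for k
    proof (rule null_sets_imp_AE_lD)
      have "{x \<in> D. \<not> v x < 1 / real (Suc k)} = {x \<in> D. v x \<in> {1 / real (Suc k)..}}" by (simp add: not_less)
      then show "{x \<in> D. \<not> v x < 1 / real (Suc k)} \<in> null_sets lebesgue" using n by simp
    qed
    then have "AE x in lD. \<forall>k. v x < 1 / real (Suc k)" by (simp add: AE_all_countable)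
    then have "AE x in lD. fst (V x) = 0" using nn
    proof eventually_elim
      fix x assume a: "\<forall>k. v x < 1 / real (Suc k)" "0 \<le> fst (V x)"
      have "v x \<le> 0"
      proof (rule ccontr)
        assume "\<not> v x \<le> 0"
        then obtain k where "1 / real (Suc k) < v x" using nat_approx_posE[of "v x"] by auto
        then show False using a(1) by (meson less_asym)
      qed
      then show "fst (V x) = 0" using a(2) by (simp add: v_def)
    qed
    then show False using nz by simp
  qed
  then obtain k where k: "{x \<in> D. v x \<in> {1 / real (Suc k)..}} \<notin> null_sets lebesgue" by blast
  define \<delta> where "\<delta> = 1 / real (Suc k)"
  have \<delta>: "\<delta> > 0" by (simp add: \<delta>_def)
  obtain P where P: "compact P" "P \<subseteq> {x \<in> D. v x \<in> {\<delta>..}}" "measure lebesgue P > 0"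
    by (rule inner_compact_positive[OF sets bdd, of "{\<delta>..}"]) (use k in \<open>auto simp: \<delta>_def intro: that\<close>)
  \<comment> \<open>Convexity of \<open>D\<close> keeps the hull inside \<open>D\<close>, where a
    cut-off function is available.\<close>
  define K where "K = convex hull (Z \<union> P)"
  have K: "compact K" "convex K" "K \<subseteq> D"
  proof -
    show "compact K" unfolding K_def by (intro compact_convex_hull compact_Un Z P)
    show "convex K" unfolding K_def by (rule convex_convex_hull)
    show "K \<subseteq> D" unfolding K_def by (rule hull_minimal) (use Z P conv in auto)
  qed
  have ZK: "Z \<subseteq> K" and PK: "P \<subseteq> K" unfolding K_def using hull_subset[of "Z \<union> P" convex] by auto
  obtain b0 where b0: "\<And>x. x \<in> K \<Longrightarrow> norm x \<le> b0" using compact_imp_bounded[OF K(1)] by (auto simp: bounded_iff)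
  define R where "R = 2 * b0"
  have R: "norm (x - y) \<le> R" if "x \<in> K" "y \<in> K" for x y
    using b0[OF that(1)] b0[OF that(2)] norm_triangle_ineq4[of x y] by (simp add: R_def)
  obtain \<phi> m where \<phi>: "\<phi> \<in> test_functions D" and m: "m > 0" "\<And>x. x \<in> K \<Longrightarrow> \<phi> x \<ge> m"
    by (rule test_cutoff[OF open_D K(1,3)]) (rule that; assumption)
  obtain b where b: "\<And>x. \<bar>\<phi> x\<bar> \<le> b" "\<And>x. norm (grad \<phi> x) \<le> b"
    by (rule test_bounded[OF \<phi>]) (rule that; assumption)
  \<comment> \<open>The constant of \<open>log_gradient_bound\<close>. Like \<open>C2\<close> it is
    fixed before \<epsilon>, which is the point of the argument.\<close>
  define C1 where "C1 = 4 / a0 * ((4 * B\<^sup>2 / a0 + (B + \<bar>\<mu>\<bar> * B)) * b\<^sup>2 * measure lebesgue D)"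
  define mK where "mK = measure lebesgue K"
  define C2 where "C2 = R\<^sup>2 * 2 ^ CARD('d) * mK * (C1 / m\<^sup>2)"
  have Ks: "K \<in> sets lebesgue" "K \<in> lmeasurable" using K(1) by (simp_all add: lmeasurable_compact fmeasurableD)
  have KD: "K \<in> sets lD" using Ks K(3) by (simp add: sets_restrict_space_iff)
  have lK: "restrict_space lD K = lebesgue_on K"
    using restrict_restrict_space[of D lebesgue K] Ks K(3) by (simp add: Int_absorb1 Int_absorb2)
  note res = square_integrable_restrict[OF KD, unfolded lK]
  interpret fK: finite_measure "lebesgue_on K" by (rule finite_measure_lebesgue_on[OF Ks(2)])
  have mspace: "measure (lebesgue_on K) (space (lebesgue_on K)) = mK" using Ks by (simp add: mK_def measure_restrict_space)
  have mSub: "measure (lebesgue_on K) T = measure lebesgue T" "T \<in> sets (lebesgue_on K)"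
    if "compact T" "T \<subseteq> K" for T
    using that Ks by (auto simp: measure_restrict_space sets_restrict_space_iff lmeasurable_compact fmeasurableD)
  have iK: "integrable (lebesgue_on K) (indicator T :: _ \<Rightarrow> real)" if "T \<in> sets (lebesgue_on K)" for T
    by (rule fK.integrable_const_bound[of _ 1]) (use that in auto)
  have main: "measure lebesgue Z * (measure lebesgue P * (arsinh (\<delta> / \<epsilon>))\<^sup>2) \<le> C2" if \<epsilon>: "0 < \<epsilon>" for \<epsilon>
  proof -
    \<comment> \<open>For \<epsilon> > 0, arsinh (t / \<epsilon>) is log (t + sqrt (t^2 +
      \<epsilon>^2)) - log \<epsilon>: the logarithm normalized to vanish at 0, with derivative 1 /
      sqrt (t^2 + \<epsilon>^2).\<close>
    define G where "G t = arsinh (t / \<epsilon>)" for t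
    define G' where "G' t = 1 / sqrt (t\<^sup>2 + \<epsilon>\<^sup>2)" for t
    have pos: "t\<^sup>2 + \<epsilon>\<^sup>2 > 0" for t using \<epsilon> by (simp add: add_nonneg_pos)
    have sq: "sqrt (t\<^sup>2 + \<epsilon>\<^sup>2) = \<epsilon> * sqrt ((t / \<epsilon>)\<^sup>2 + 1)" for t
    proof -
      have "t\<^sup>2 + \<epsilon>\<^sup>2 = \<epsilon>\<^sup>2 * ((t / \<epsilon>)\<^sup>2 + 1)" using \<epsilon> by (simp add: power_divide distrib_left)
      then show ?thesis using \<epsilon> by (simp add: real_sqrt_mult)
    qed
    have der: "(G has_real_derivative G' t) (at t)" for t
    proof -
      have "((\<lambda>t. arsinh (t / \<epsilon>)) has_real_derivative (1 / sqrt ((t / \<epsilon>)\<^sup>2 + 1)) * (1 / \<epsilon>)) (at t)"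
        by (rule DERIV_chain2[OF arsinh_real_has_field_derivative DERIV_cdivide[OF DERIV_ident]])
      then show ?thesis unfolding G_def G'_def sq by (simp add: mult.commute)
    qed
    have cont: "continuous_on UNIV G'" unfolding G'_def using pos by (intro continuous_intros) (auto simp: less_le)
    have bdG: "\<bar>G' t\<bar> \<le> 1 / \<epsilon>" for t
    proof -
      have "\<epsilon> \<le> sqrt (t\<^sup>2 + \<epsilon>\<^sup>2)" by (rule real_le_rsqrt) simp
      then show ?thesis using \<epsilon> by (simp add: G'_def abs_divide frac_le)
    qed
    note pc = poincare_chain[OF bounded_open_axioms eigenjetsD(1)[OF V] der cont bdG K R]
    define N where "N = l2norm (lebesgue_on K) (\<lambda>x. G (v x))"
    define A where "A = (LINT x|lebesgue_on K. G (v x))"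
    define X where "X = (l2norm (lebesgue_on K) (\<lambda>x. G' (v x) *\<^sub>R snd (V x)))\<^sup>2"
    have sG: "square_integrable (lebesgue_on K) (\<lambda>x. G (v x))" using pc(1) by (simp add: v_def)
    have 1: "mK * N\<^sup>2 \<le> A\<^sup>2 + R\<^sup>2 * 2 ^ CARD('d) * mK * X"
      using pc(2) by (simp add: v_def N_def A_def X_def mK_def)
    have 2: "X \<le> C1 / m\<^sup>2"
    proof -
      define Q where "Q x = (\<phi> x / sqrt ((fst (V x))\<^sup>2 + \<epsilon>\<^sup>2)) *\<^sub>R snd (V x)" for x
      have Qb: "(l2norm lD Q)\<^sup>2 \<le> C1"
        unfolding Q_def C1_def by (rule log_gradient_bound[OF V nn \<epsilon> \<phi> b])
      have G'm: "(\<lambda>x. G' (v x) *\<^sub>R snd (V x)) \<in> borel_measurable lD"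
        unfolding v_def using chain_square_integrable(2)[OF sV der cont bdG] by blast
      have Qs: "square_integrable lD Q"
      proof (rule square_integrable_bound(1)[OF chain_square_integrable(2)[OF sV der cont bdG], of _ b])
        have "Q = (\<lambda>x. \<phi> x *\<^sub>R (G' (v x) *\<^sub>R snd (V x)))" by (simp add: Q_def G'_def v_def fun_eq_iff)
        then show "Q \<in> borel_measurable lD"
          using borel_measurable_scaleR[OF smooth_measurable_lD[OF test_smooth[OF \<phi>]] G'm] by simp
        show "AE x in lD. norm (Q x) \<le> b * norm (G' (fst (V x)) *\<^sub>R snd (V x))"
        proof (intro AE_I2)
          fix x
          have "norm (Q x) = \<bar>\<phi> x\<bar> * norm (G' (fst (V x)) *\<^sub>R snd (V x))" by (simp add: Q_def G'_def abs_divide)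
          also have "\<dots> \<le> b * norm (G' (fst (V x)) *\<^sub>R snd (V x))" by (intro mult_right_mono b(1)) simp
          finally show "norm (Q x) \<le> b * norm (G' (fst (V x)) *\<^sub>R snd (V x))" .
        qed
        show "0 \<le> b" using b(1)[of undefined] by simp
      qed
      \<comment> \<open>On \<open>K\<close> the cut-off is at least \<open>m\<close>, so removing it
        from \<open>Q\<close> costs the factor 1 / m.\<close>
      have "l2norm (lebesgue_on K) (\<lambda>x. G' (v x) *\<^sub>R snd (V x)) \<le> (1 / m) * l2norm (lebesgue_on K) Q"
      proof (rule square_integrable_bound(2)[OF res(1)[OF Qs]])
        show "(\<lambda>x. G' (v x) *\<^sub>R snd (V x)) \<in> borel_measurable (lebesgue_on K)"
          using measurable_restrict_space1[OF G'm, of K] by (simp add: lK)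
        show "AE x in lebesgue_on K. norm (G' (v x) *\<^sub>R snd (V x)) \<le> 1 / m * norm (Q x)"
        proof (intro AE_I2)
          fix x assume "x \<in> space (lebesgue_on K)"
          then have p: "m \<le> \<phi> x" using m(2) by simp
          have "norm (Q x) = \<bar>\<phi> x\<bar> * norm (G' (v x) *\<^sub>R snd (V x))" by (simp add: Q_def G'_def abs_divide v_def)
          moreover have "m * norm (G' (v x) *\<^sub>R snd (V x)) \<le> \<bar>\<phi> x\<bar> * norm (G' (v x) *\<^sub>R snd (V x))"
            using p by (intro mult_right_mono) auto
          ultimately have "m * norm (G' (v x) *\<^sub>R snd (V x)) \<le> norm (Q x)" by simp
          then show "norm (G' (v x) *\<^sub>R snd (V x)) \<le> 1 / m * norm (Q x)"
            using m(1) by (simp add: pos_le_divide_eq mult.commute del: norm_scaleR)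
        qed
      qed (use m(1) in simp)
      also have "\<dots> \<le> (1 / m) * l2norm lD Q" using m(1) by (intro mult_left_mono res(2)[OF Qs]) simp
      finally have "X \<le> ((1 / m) * l2norm lD Q)\<^sup>2" unfolding X_def by (rule power_mono) simp
      also have "\<dots> = (l2norm lD Q)\<^sup>2 / m\<^sup>2" by (simp add: power_divide)
      also have "\<dots> \<le> C1 / m\<^sup>2" by (rule divide_right_mono[OF Qb]) simp
      finally show ?thesis .
    qed
    \<comment> \<open>The integral of G(v) runs effectively over K without Z, so the Cauchy-Schwarz
      inequality gains the measure of Z. In the Poincare inequality \<open>1\<close> the terms with
      \<open>mK\<close> then cancel, and the measure of Z times N^2 remains on the left.\<close>
    have 3: "A\<^sup>2 \<le> (mK - measure lebesgue Z) * N\<^sup>2"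
    proof -
      let ?J = "\<lambda>x. indicator (- Z) x :: real"
      have Zs: "Z \<in> sets (lebesgue_on K)" by (rule mSub(2)[OF Z(1) ZK])
      have J: "?J x = 1 - indicator Z x" for x by (simp add: indicator_def)
      have Jm: "?J \<in> borel_measurable (lebesgue_on K)" unfolding J using Zs by (intro borel_measurable_diff borel_measurable_const borel_measurable_indicator)
      have Js: "square_integrable (lebesgue_on K) ?J"
        by (rule square_integrable_bounded[OF fK.finite_measure_axioms Jm, of 1]) (simp add: indicator_def)
      have "(l2norm (lebesgue_on K) ?J)\<^sup>2 = (LINT x|lebesgue_on K. 1 - indicator Z x)"
        unfolding l2norm_power2 by (intro Bochner_Integration.integral_cong) (auto simp: indicator_def)
      also have "\<dots> = mK - measure lebesgue Z"
        using iK[OF Zs] mSub(1)[OF Z(1) ZK] mspace by (simp add: inf.absorb1[OF ZK])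
      finally have J2: "(l2norm (lebesgue_on K) ?J)\<^sup>2 = mK - measure lebesgue Z" .
      have "A = (LINT x|lebesgue_on K. ?J x \<bullet> G (v x))"
        unfolding A_def
      proof (rule integral_cong_AE)
        show "(\<lambda>x. G (v x)) \<in> borel_measurable (lebesgue_on K)" using sG by blast
        then show "(\<lambda>x. ?J x \<bullet> G (v x)) \<in> borel_measurable (lebesgue_on K)" using Jm by (simp add: borel_measurable_times)
        \<comment> \<open>On \<open>Z\<close> the function is at most 0 by construction and at least
          0 almost everywhere.\<close>
        have "AE x in lebesgue. x \<in> D \<longrightarrow> 0 \<le> fst (V x)" using nn by (subst (asm) AE_restrict_space_iff) auto
        then have "AE x in lebesgue. x \<in> K \<longrightarrow> G (v x) = ?J x \<bullet> G (v x)"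
        proof eventually_elim
          fix x assume a: "x \<in> D \<longrightarrow> 0 \<le> fst (V x)"
          show "x \<in> K \<longrightarrow> G (v x) = ?J x \<bullet> G (v x)"
          proof (cases "x \<in> Z")
            case True
            then have "v x = 0" using Z(2) a by (auto simp: v_def)
            then show ?thesis by (simp add: G_def)
          qed simp
        qed
        then show "AE x in lebesgue_on K. G (v x) = ?J x \<bullet> G (v x)" using Ks(1) by (subst AE_restrict_space_iff) auto
      qed
      then have "\<bar>A\<bar> \<le> l2norm (lebesgue_on K) ?J * N"
        unfolding N_def using integrable_inner_square(2)[OF Js sG] by simp
      then have "\<bar>A\<bar>\<^sup>2 \<le> (l2norm (lebesgue_on K) ?J * N)\<^sup>2" by (rule power_mono) simp
      then show ?thesis by (simp add: power_mult_distrib J2)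
    qed
    have 4: "measure lebesgue P * (arsinh (\<delta> / \<epsilon>))\<^sup>2 \<le> N\<^sup>2"
    proof -
      have Ps: "P \<in> sets (lebesgue_on K)" by (rule mSub(2)[OF P(1) PK])
      have "measure lebesgue P * (arsinh (\<delta> / \<epsilon>))\<^sup>2 = (LINT x|lebesgue_on K. indicator P x * (arsinh (\<delta> / \<epsilon>))\<^sup>2)"
        using iK[OF Ps] mSub(1)[OF P(1) PK] by (simp add: inf.absorb1[OF PK])
      also have "\<dots> \<le> (LINT x|lebesgue_on K. (norm (G (v x)))\<^sup>2)"
      proof (rule integral_mono)
        show "integrable (lebesgue_on K) (\<lambda>x. indicator P x * (arsinh (\<delta> / \<epsilon>))\<^sup>2)"
          using iK[OF Ps] by simp
        show "integrable (lebesgue_on K) (\<lambda>x. (norm (G (v x)))\<^sup>2)" by (rule square_integrableD(2)[OF sG])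
        show "indicator P x * (arsinh (\<delta> / \<epsilon>))\<^sup>2 \<le> (norm (G (v x)))\<^sup>2" for x
        proof (cases "x \<in> P")
          case True
          then have "\<delta> \<le> v x" using P(2) by auto
          then have "\<delta> / \<epsilon> \<le> v x / \<epsilon>" using \<epsilon> by (intro divide_right_mono) auto
          then have "arsinh (\<delta> / \<epsilon>) \<le> G (v x)" unfolding G_def by (metis arsinh_less_iff_real not_le)
          moreover have "0 \<le> arsinh (\<delta> / \<epsilon>)" using \<delta> \<epsilon> by (simp add: less_imp_le)
          ultimately show ?thesis using True by (simp add: power_mono)
        qed simp
      qed
      finally show ?thesis by (simp add: N_def l2norm_power2)
    qed
    have "measure lebesgue Z * N\<^sup>2 \<le> R\<^sup>2 * 2 ^ CARD('d) * mK * X"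
      using 1 3 by (simp add: left_diff_distrib)
    also have "\<dots> \<le> C2" unfolding C2_def by (rule mult_left_mono[OF 2]) (simp add: mK_def)
    finally have "measure lebesgue Z * N\<^sup>2 \<le> C2" .
    moreover have "measure lebesgue Z * (measure lebesgue P * (arsinh (\<delta> / \<epsilon>))\<^sup>2) \<le> measure lebesgue Z * N\<^sup>2"
      by (rule mult_left_mono[OF 4]) simp
    ultimately show ?thesis by linarith
  qed
  define c where "c = measure lebesgue Z * measure lebesgue P"
  have c: "c > 0" using Z(3) P(3) by (simp add: c_def)
  \<comment> \<open>Chosen so that c \<tau> = \<open>\<bar>C2\<bar> + c\<close> exceeds
    \<open>C2\<close>. The matching \<epsilon> is \<delta> / sinh \<tau>, for which arsinh (\<delta>
    / \<epsilon>) = \<tau>; and \<tau> \<ge> 1 gives c \<tau> \<le> c \<tau>^2.\<close>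
  define \<tau> where "\<tau> = \<bar>C2\<bar> / c + 1"
  have \<tau>: "\<tau> \<ge> 1" using c by (simp add: \<tau>_def)
  have sh: "sinh \<tau> > 0" using \<tau> by simp
  have "\<delta> / (\<delta> / sinh \<tau>) = sinh \<tau>" using \<delta> sh by simp
  then have "c * \<tau>\<^sup>2 \<le> C2"
    using main[of "\<delta> / sinh \<tau>"] \<delta> sh by (simp add: c_def arsinh_sinh_real mult.assoc)
  moreover have "c * \<tau> \<le> c * \<tau>\<^sup>2" using c \<tau> by (intro mult_left_mono) (auto simp: power2_eq_square mult_le_cancel_left1)
  moreover have "c * \<tau> = \<bar>C2\<bar> + c" using c by (simp add: \<tau>_def distrib_left)
  ultimately show False using c by linarith
qed


section \<open>Simplicity of the first eigenvalue\<close>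

text \<open>The absolute value has the same mass and no more energy, the square of a sign being at
  most 1. So it also attains the minimum, and minimizers satisfy the eigenvalue equation.\<close>

lemma eigenjets_abs:
  assumes F: "F \<in> eigenjets \<mu>" and lb: "\<And>F. F \<in> jets0 D \<Longrightarrow> \<mu> * \<M> F F \<le> \<A> F F"
  shows "(\<lambda>x. (\<bar>fst (F x)\<bar>, sgn (fst (F x)) *\<^sub>R snd (F x))) \<in> eigenjets \<mu>" (is "?G \<in> _")
proof -
  note sF = eigenjetsD(2)[OF F]
  have G: "?G \<in> jets0 D" by (rule jets0_abs[OF eigenjetsD(1)[OF F]])
  note sG = jets0_square_integrable[OF G]
  have M: "\<M> ?G ?G = \<M> F F" by (simp add: wform_def)
  have "\<A> ?G ?G \<le> \<A> F F" unfolding wform_def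
  proof (rule integral_mono_AE[OF wform_bounded(1)[OF A_bd sG sG] wform_bounded(1)[OF A_bd sF sF]])
    show "AE x in lD. \<alpha> x * (snd (?G x) \<bullet> snd (?G x)) + \<beta> x * (fst (?G x) * fst (?G x))
       \<le> \<alpha> x * (snd (F x) \<bullet> snd (F x)) + \<beta> x * (fst (F x) * fst (F x))"
      using lower_\<alpha>
    proof eventually_elim
      fix x assume a: "a0 \<le> \<alpha> x"
      have "snd (?G x) \<bullet> snd (?G x) \<le> snd (F x) \<bullet> snd (F x)" by (simp add: sgn_real_def)
      then have "\<alpha> x * (snd (?G x) \<bullet> snd (?G x)) \<le> \<alpha> x * (snd (F x) \<bullet> snd (F x))"
        using a a0 by (intro mult_left_mono) auto
      then show "\<alpha> x * (snd (?G x) \<bullet> snd (?G x)) + \<beta> x * (fst (?G x) * fst (?G x))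
         \<le> \<alpha> x * (snd (F x) \<bullet> snd (F x)) + \<beta> x * (fst (F x) * fst (F x))" by simp
    qed
  qed
  also have "\<dots> = \<mu> * \<M> ?G ?G" using eigenjetsD(3)[OF F eigenjetsD(1)[OF F]] M by simp
  finally have eq: "\<A> ?G ?G = \<mu> * \<M> ?G ?G" using lb[OF G] by simp
  have "\<A> ?G H = \<mu> * \<M> ?G H" if H: "H \<in> jets0 D" for H
    by (rule minimizer_euler_lagrange[OF closed_subspace_jets0 _ G eq H]) (rule lb)
  then show ?thesis using G by (simp add: eigenjets_def)
qed

text \<open>The sum of \<open>\<bar>u\<bar>\<close> and u is twice the positive part of u. As a
  nonnegative eigenfunction it is either zero almost everywhere or positive almost
  everywhere.\<close>

lemma eigenjet_nonpos_or_pos: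
  assumes conv: "convex D" and F: "F \<in> eigenjets \<mu>" and lb: "\<And>F. F \<in> jets0 D \<Longrightarrow> \<mu> * \<M> F F \<le> \<A> F F"
  shows "(AE x in lD. fst (F x) \<le> 0) \<or> (AE x in lD. 0 < fst (F x))"
proof -
  define G where "G x = (\<bar>fst (F x)\<bar>, sgn (fst (F x)) *\<^sub>R snd (F x))" for x
  have G: "G \<in> eigenjets \<mu>" unfolding G_def[abs_def] by (rule eigenjets_abs[OF F]) (rule lb)
  define V where "V = (\<lambda>x. G x + F x)"
  have V: "V \<in> eigenjets \<mu>" unfolding V_def by (rule eigenjets_add[OF G F])
  have fV: "fst (V x) = \<bar>fst (F x)\<bar> + fst (F x)" for x by (simp add: V_def G_def)
  show ?thesis
  proof (cases "AE x in lD. fst (V x) = 0")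
    case True
    then have "AE x in lD. fst (F x) \<le> 0" by eventually_elim (simp add: fV)
    then show ?thesis ..
  next
    case False
    have "AE x in lD. 0 \<le> fst (V x)" by (simp add: fV)
    from eigenjet_positive[OF conv V this False] have "AE x in lD. 0 < fst (F x)"
      by eventually_elim (simp add: fV)
    then show ?thesis ..
  qed
qed

text \<open>Two first eigenfunctions have strict signs almost everywhere, so their product weighted
  with \<gamma> has a strict sign, and its integral cannot vanish.\<close>

lemma first_eigenvalue_simple:
  assumes conv: "convex D" and lb: "\<And>F. F \<in> jets0 D \<Longrightarrow> \<mu> * \<M> F F \<le> \<A> F F"
    and F: "F \<in> eigenjets \<mu>" "\<M> F F = 1" and G: "G \<in> eigenjets \<mu>" "\<M> G G = 1" and FG: "\<M> F G = 0"
  shows False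
proof -
  \<comment> \<open>The dichotomy is applied to \<open>H\<close> and to its negative; mass 1
    excludes that both are nonpositive.\<close>
  have sign: "(AE x in lD. 0 < fst (H x)) \<or> (AE x in lD. fst (H x) < 0)" if H: "H \<in> eigenjets \<mu>" "\<M> H H = 1" for H
  proof -
    have "(\<lambda>x. (-1) *\<^sub>R H x) \<in> eigenjets \<mu>" by (rule eigenjets_scaleR[OF H(1)])
    from eigenjet_nonpos_or_pos[OF conv this lb]
    have neg: "(AE x in lD. 0 \<le> fst (H x)) \<or> (AE x in lD. fst (H x) < 0)" by simp
    have "\<not> ((AE x in lD. fst (H x) \<le> 0) \<and> (AE x in lD. 0 \<le> fst (H x)))"
    proof
      assume a: "(AE x in lD. fst (H x) \<le> 0) \<and> (AE x in lD. 0 \<le> fst (H x))"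
      have "AE x in lD. fst (H x) = 0" using conjunct1[OF a] conjunct2[OF a] by eventually_elim simp
      from M_AE_zero[OF eigenjetsD(2)[OF H(1)] this, of H] show False using H(2) by simp
    qed
    then show ?thesis using neg eigenjet_nonpos_or_pos[OF conv H(1) lb] by blast
  qed
  note sF = eigenjetsD(2)[OF F(1)] and sG = eigenjetsD(2)[OF G(1)]
  have "\<exists>s::real. s \<noteq> 0 \<and> (AE x in lD. 0 < s * (fst (F x) * fst (G x)))"
  proof -
    consider "AE x in lD. 0 < fst (F x)" "AE x in lD. 0 < fst (G x)" | "AE x in lD. 0 < fst (F x)" "AE x in lD. fst (G x) < 0"
      | "AE x in lD. fst (F x) < 0" "AE x in lD. 0 < fst (G x)" | "AE x in lD. fst (F x) < 0" "AE x in lD. fst (G x) < 0"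
      using sign[OF F] sign[OF G] by blast
    then show ?thesis
    proof cases
      case 1
      then have "AE x in lD. 0 < 1 * (fst (F x) * fst (G x))" by eventually_elim simp
      then show ?thesis by (intro exI[of _ 1]) simp
    next
      case 2
      then have "AE x in lD. 0 < (-1) * (fst (F x) * fst (G x))" by eventually_elim (simp add: mult_pos_neg)
      then show ?thesis by (intro exI[of _ "-1"]) simp
    next
      case 3
      then have "AE x in lD. 0 < (-1) * (fst (F x) * fst (G x))" by eventually_elim (simp add: mult_neg_pos)
      then show ?thesis by (intro exI[of _ "-1"]) simp
    next
      case 4
      then have "AE x in lD. 0 < 1 * (fst (F x) * fst (G x))" by eventually_elim (simp add: mult_neg_neg)
      then show ?thesis by (intro exI[of _ 1]) simp
    qed
  qed
  then obtain s :: real where s: "s \<noteq> 0" "AE x in lD. 0 < s * (fst (F x) * fst (G x))" by blast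
  define w where "w x = s * (0 * (snd (F x) \<bullet> snd (G x)) + \<gamma> x * (fst (F x) * fst (G x)))" for x
  have iw: "integrable lD w" unfolding w_def by (intro integrable_mult_right wform_bounded(1)[OF M_bd sF sG])
  have w0: "(LINT x|lD. w x) = 0" using FG by (simp add: w_def wform_def)
  have wpos: "AE x in lD. 0 < w x"
    using s(2) lower_\<gamma>
  proof eventually_elim
    fix x assume "0 < s * (fst (F x) * fst (G x))" "a0 \<le> \<gamma> x"
    then have "0 < \<gamma> x * (s * (fst (F x) * fst (G x)))" using a0 mult_pos_pos[of "\<gamma> x" "s * (fst (F x) * fst (G x))"] by simp
    then show "0 < w x" by (simp add: w_def mult_ac)
  qed
  then have wnn: "AE x in lD. 0 \<le> w x" by eventually_elim simp
  have "AE x in lD. w x = 0" using w0 integral_nonneg_eq_0_iff_AE[OF iw wnn] by simp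
  \<comment> \<open>Vacuous: w is both zero and positive almost everywhere, which would make
    \<open>D\<close> a null set; the contradiction is drawn from the mass of
    \<open>F\<close>.\<close>
  then have "AE x in lD. fst (F x) = 0" using wpos by eventually_elim simp
  from M_AE_zero[OF sF this, of F] show False using F(2) by simp
qed

end


section \<open>Affine coefficients\<close>

text \<open>The essential supremum is nonnegative because a nonempty open set is not a null set;
  together with finiteness this makes the conversion to a real number faithful.\<close>

lemma Linf_AE_bound:
  fixes f :: "'a::euclidean_space \<Rightarrow> real"
  assumes D: "open D" "D \<noteq> {}" and f: "f \<in> Linf D"
  shows "f \<in> borel_measurable (lebesgue_on D)" "AE x in lebesgue_on D. \<bar>f x\<bar> \<le> Linf_norm D f" "0 \<le> Linf_norm D f"
proof -
  define e where "e = esssup (lebesgue_on D) (\<lambda>x. ereal (norm (f x)))"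
  show "f \<in> borel_measurable (lebesgue_on D)" using f by (simp add: Linf_def)
  have lt: "e < \<infinity>" using f by (simp add: Linf_def e_def)
  have ae: "AE x in lebesgue_on D. ereal (norm (f x)) \<le> e" unfolding e_def by (rule esssup_AE)
  have e0: "0 \<le> e"
  proof (rule ccontr)
    assume "\<not> 0 \<le> e"
    have "AE x in lebesgue_on D. (1::real) = 0"
      using ae
    proof eventually_elim
      fix x assume "ereal (norm (f x)) \<le> e"
      moreover have "0 \<le> ereal (norm (f x))" by simp
      ultimately have "0 \<le> e" by (rule order_trans[rotated])
      then show "(1::real) = 0" using \<open>\<not> 0 \<le> e\<close> by simp
    qed
    moreover have "\<not> (AE x in lebesgue_on D. (1::real) = 0)"
      by (rule positive_on_open_not_AE_zero[OF D(1) D(1) subset_refl D(2)]) simp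
    ultimately show False by simp
  qed
  have eq: "e = ereal (Linf_norm D f)"
    using e0 lt unfolding Linf_norm_def e_def[symmetric] by (cases e) auto
  show "0 \<le> Linf_norm D f" using e0 eq by simp
  show "AE x in lebesgue_on D. \<bar>f x\<bar> \<le> Linf_norm D f" using ae unfolding eq by simp
qed

text \<open>The terms are eventually at most 1, where t \<le> t^p because p < 1.\<close>

lemma summable_of_summable_powr:
  fixes n :: "nat \<Rightarrow> real"
  assumes n: "\<And>j. 0 \<le> n j" and p: "0 < p" "p < 1" and s: "summable (\<lambda>j. n j powr p)"
  shows "summable n"
proof (rule summable_comparison_test_ev[OF _ s])
  have "(\<lambda>j. n j powr p) \<longlonglongrightarrow> 0" by (rule summable_LIMSEQ_zero[OF s])
  then have "\<forall>\<^sub>F j in sequentially. n j powr p < 1" by (rule order_tendstoD(2)) simp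
  then show "\<forall>\<^sub>F j in sequentially. norm (n j) \<le> n j powr p"
  proof eventually_elim
    fix j assume a: "n j powr p < 1"
    have "n j \<le> 1"
    proof (rule ccontr)
      assume "\<not> n j \<le> 1"
      then have "1 \<le> n j powr p" using p by (simp add: ge_one_powr_ge_zero)
      then show False using a by simp
    qed
    then have "n j powr 1 \<le> n j powr p" using n[of j] p by (intro powr_mono') auto
    then show "norm (n j) \<le> n j powr p" using n[of j] by simp
  qed
qed

locale affine_family =
  fixes D :: "'a::euclidean_space set" and a :: "nat \<Rightarrow> 'a \<Rightarrow> real"
  assumes D: "open D" "D \<noteq> {}" and Linf: "\<And>j. a j \<in> Linf D"
    and summable_norm: "summable (\<lambda>j. Linf_norm D (a (Suc j)))"
begin

abbreviation "N j \<equiv> Linf_norm D (a j)"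

lemmas a_measurable = Linf_AE_bound(1)[OF D Linf] and a_bound = Linf_AE_bound(2)[OF D Linf]
  and N_nonneg = Linf_AE_bound(3)[OF D Linf]

lemma AE_bounds: "AE x in lebesgue_on D. \<forall>j. \<bar>a j x\<bar> \<le> N j"
  using a_bound by (simp add: AE_all_countable)

lemma affine_measurable: "affine_coeff a y \<in> borel_measurable (lebesgue_on D)"
proof -
  note [measurable] = a_measurable
  show ?thesis unfolding affine_coeff_def[abs_def] by measurable
qed

lemma affine_bound:
  assumes y: "\<And>j. \<bar>y (Suc j)\<bar> \<le> 1"
  shows "AE x in lebesgue_on D. \<bar>affine_coeff a y x\<bar> \<le> N 0 + (\<Sum>j. N (Suc j))"
  using AE_bounds
proof eventually_elim
  fix x assume b: "\<forall>j. \<bar>a j x\<bar> \<le> N j"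
  have le: "norm (y (Suc j) * a (Suc j) x) \<le> N (Suc j)" for j
  proof -
    have "\<bar>y (Suc j)\<bar> * \<bar>a (Suc j) x\<bar> \<le> 1 * N (Suc j)" using y b by (intro mult_mono) auto
    then show ?thesis by (simp add: abs_mult)
  qed
  have "norm (\<Sum>j. y (Suc j) * a (Suc j) x) \<le> (\<Sum>j. N (Suc j))" by (rule norm_suminf_le[OF le summable_norm])
  then show "\<bar>affine_coeff a y x\<bar> \<le> N 0 + (\<Sum>j. N (Suc j))"
    using b[rule_format, of 0] unfolding affine_coeff_def by (simp only: real_norm_def)
qed

text \<open>The right-hand side depends on the parameters only, so it bounds the distance of the two
  coefficients in the supremum norm up to a null set.\<close>

lemma affine_difference_bound:
  assumes y: "\<And>j. \<bar>y (Suc j)\<bar> \<le> 1" and z: "\<And>j. \<bar>z (Suc j)\<bar> \<le> 1"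
  shows "AE x in lebesgue_on D. \<bar>affine_coeff a y x - affine_coeff a z x\<bar> \<le> (\<Sum>j. \<bar>y (Suc j) - z (Suc j)\<bar> * N (Suc j))"
  using AE_bounds
proof eventually_elim
  fix x assume b: "\<forall>j. \<bar>a j x\<bar> \<le> N j"
  have s: "summable (\<lambda>j. t (Suc j) * a (Suc j) x)" if t: "\<And>j. \<bar>t (Suc j)\<bar> \<le> 1" for t
  proof (rule summable_comparison_test'[OF summable_norm])
    fix j
    have "\<bar>t (Suc j)\<bar> * \<bar>a (Suc j) x\<bar> \<le> 1 * N (Suc j)" using t b by (intro mult_mono) auto
    then show "norm (t (Suc j) * a (Suc j) x) \<le> N (Suc j)" by (simp add: abs_mult)
  qed
  have "affine_coeff a y x - affine_coeff a z x = (\<Sum>j. (y (Suc j) - z (Suc j)) * a (Suc j) x)"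
    using suminf_diff[OF s[of y, OF y] s[of z, OF z]] by (simp add: affine_coeff_def left_diff_distrib)
  also have "norm \<dots> \<le> (\<Sum>j. \<bar>y (Suc j) - z (Suc j)\<bar> * N (Suc j))"
  proof (rule norm_suminf_le)
    show "norm ((y (Suc j) - z (Suc j)) * a (Suc j) x) \<le> \<bar>y (Suc j) - z (Suc j)\<bar> * N (Suc j)" for j
      using b by (simp add: abs_mult mult_left_mono)
    show "summable (\<lambda>j. \<bar>y (Suc j) - z (Suc j)\<bar> * N (Suc j))"
    proof (rule summable_comparison_test'[OF summable_mult[OF summable_norm, of 2]])
      fix j
      have "\<bar>y (Suc j) - z (Suc j)\<bar> \<le> 2" using y[of j] z[of j] by linarith
      then show "norm (\<bar>y (Suc j) - z (Suc j)\<bar> * N (Suc j)) \<le> 2 * N (Suc j)"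
        using N_nonneg by (simp add: abs_mult mult_right_mono)
    qed
  qed
  finally show "\<bar>affine_coeff a y x - affine_coeff a z x\<bar> \<le> (\<Sum>j. \<bar>y (Suc j) - z (Suc j)\<bar> * N (Suc j))" by simp
qed

text \<open>Tannery's theorem, that is dominated convergence for series, with majorant 2 N.
  Coordinatewise convergence of the parameters thus gives convergence of the coefficients in the
  supremum norm.\<close>

lemma weighted_distance_tendsto_zero:
  assumes y: "\<And>n j. \<bar>y n (Suc j)\<bar> \<le> 1" and z: "\<And>j. \<bar>z (Suc j)\<bar> \<le> 1"
    and lim: "\<And>j. (\<lambda>n. y n (Suc j)) \<longlonglongrightarrow> z (Suc j)"
  shows "(\<lambda>n. \<Sum>j. \<bar>y n (Suc j) - z (Suc j)\<bar> * N (Suc j)) \<longlonglongrightarrow> 0"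
proof -
  have "(\<lambda>n. \<Sum>j. \<bar>y n (Suc j) - z (Suc j)\<bar> * N (Suc j)) \<longlonglongrightarrow> (\<Sum>j. 0 * N (Suc j))"
  proof (rule tannerys_theorem[where M = "\<lambda>j. 2 * N (Suc j)", THEN conjunct2, THEN conjunct2])
    show "(\<lambda>n. \<bar>y n (Suc j) - z (Suc j)\<bar> * N (Suc j)) \<longlonglongrightarrow> 0 * N (Suc j)" for j
    proof (intro tendsto_mult tendsto_const)
      show "(\<lambda>n. \<bar>y n (Suc j) - z (Suc j)\<bar>) \<longlonglongrightarrow> 0"
        using tendsto_rabs[OF LIM_zero[OF lim[of j]]] by simp
    qed
    have "norm (\<bar>y n (Suc j) - z (Suc j)\<bar> * N (Suc j)) \<le> 2 * N (Suc j)" for j n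
    proof -
      have "\<bar>y n (Suc j) - z (Suc j)\<bar> \<le> 2" using y[of n j] z[of j] by linarith
      then show ?thesis using N_nonneg by (simp add: abs_mult mult_right_mono)
    qed
    then show "\<forall>\<^sub>F (j, n) in sequentially \<times>\<^sub>F sequentially. norm (\<bar>y n (Suc j) - z (Suc j)\<bar> * N (Suc j)) \<le> 2 * N (Suc j)"
      by (intro always_eventually) auto
    show "summable (\<lambda>j. 2 * N (Suc j))" by (rule summable_mult[OF summable_norm])
  qed simp
  then show ?thesis by simp
qed

end

section \<open>Sequential compactness of the parameter set\<close>

lemma params_bound:
  assumes "y \<in> params" shows "\<bar>y (Suc j)\<bar> \<le> 1"
proof -
  have "y (Suc j) \<in> {-1/2..1/2}" using assms unfolding params_def by (rule PiE_mem) simp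
  then show ?thesis by auto
qed

lemma params_convergent_subsequence:
  assumes y: "\<And>n. y n \<in> params"
  obtains r :: "nat \<Rightarrow> nat" and z where "strict_mono r" "z \<in> params" "\<And>j. (\<lambda>n. y (r n) (Suc j)) \<longlonglongrightarrow> z (Suc j)"
proof -
  obtain r :: "nat \<Rightarrow> nat" where r: "strict_mono r" "\<And>j. j \<in> UNIV \<Longrightarrow> \<exists>l. (\<lambda>n. y (r n) (Suc j)) \<longlonglongrightarrow> l"
  proof (rule function_convergent_subsequence[of UNIV "\<lambda>n j. y n (Suc j)" 1])
    show "norm (y n (Suc j)) \<le> 1" for n j using params_bound[OF y] by simp
    show "countable (UNIV :: nat set)" by simp
  qed (rule that; assumption)
  then have "\<exists>l. (\<lambda>n. y (r n) (Suc j)) \<longlonglongrightarrow> l" for j by simp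
  then obtain l where l: "\<And>j. (\<lambda>n. y (r n) (Suc j)) \<longlonglongrightarrow> l j" by metis
  \<comment> \<open>Elements of \<open>params\<close> are extensional on the indices from 1, hence
    the restricted abstraction; \<open>j - 1\<close> undoes the shift by \<open>Suc\<close>.\<close>
  define z where "z = (\<lambda>j\<in>{1..}. l (j - 1))"
  have zS: "z (Suc j) = l j" for j by (simp add: z_def)
  have "z \<in> params" unfolding params_def
  proof (rule PiE_I)
    fix j :: nat assume "j \<in> {1..}"
    then obtain i where i: "j = Suc i" by (cases j) auto
    have "y (r n) (Suc i) \<in> {-1/2..1/2}" for n using y unfolding params_def by (rule PiE_mem) simp
    then have "\<forall>n. y (r n) (Suc i) \<in> {-1/2..1/2}" by blast
    from closed_sequentially[OF closed_atLeastAtMost _ l[of i], of "-1/2" "1/2"] this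
    show "z j \<in> {-1/2..1/2}" unfolding i zS by blast
  qed (simp add: z_def)
  then show ?thesis using that[OF r(1)] l unfolding zS[symmetric] by blast
qed


section \<open>Uniform gap\<close>

text \<open>The difference is the form of the difference coefficients, so convergence of the
  coefficients in the supremum norm gives convergence of the energies, uniformly on bounded sets of
  pairs.\<close>

lemma (in bounded_open) wform_difference_bound:
  assumes p: "ess_bounded B p" "ess_bounded B p'" and q: "ess_bounded B q" "ess_bounded B q'"
    and d: "ess_bounded \<eta> (\<lambda>x. p x - p' x)" "ess_bounded \<eta> (\<lambda>x. q x - q' x)" and F: "square_integrable lD F"
  shows "\<bar>wform p q F F - wform p' q' F F\<bar> \<le> \<eta> * (l2norm lD F)\<^sup>2"
proof -
  have "wform p q F F - wform p' q' F F = wform (\<lambda>x. p x - p' x) (\<lambda>x. q x - q' x) F F"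
    unfolding wform_def
    by (subst Bochner_Integration.integral_diff[OF wform_bounded(1)[OF p(1) q(1) F F] wform_bounded(1)[OF p(2) q(2) F F], symmetric])
       (simp add: algebra_simps)
  then show ?thesis using wform_bounded(2)[OF d F F] by (simp add: power2_eq_square mult.assoc)
qed

theorem proposition2p4:
  fixes D :: "(real ^ 'd) set"
    and a b :: "nat \<Rightarrow> real ^ 'd \<Rightarrow> real"
    and c :: "real ^ 'd \<Rightarrow> real"
    and a_min p :: real
  assumes dim: "CARD('d) \<in> {1, 2, 3}"
    and domain: "open D" "D \<noteq> {}" "connected D" "bounded D" "convex D" "lipschitz_boundary D"
    and bounded_coeffs: "\<forall>j. a j \<in> Linf D" "\<forall>j. b j \<in> Linf D" "c \<in> Linf D"
    and a_min: "a_min > 0"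
    and a_lower: "\<forall>y\<in>params. AE x in lebesgue_on D. affine_coeff a y x \<ge> a_min"
    and b_lower: "\<forall>y\<in>params. AE x in lebesgue_on D. affine_coeff b y x \<ge> 0"
    and c_lower: "AE x in lebesgue_on D. c x \<ge> a_min"
    and p: "0 < p" "p < 1"
    and summable_a: "summable (\<lambda>j. Linf_norm D (a (Suc j)) powr p)"
    and summable_b: "summable (\<lambda>j. Linf_norm D (b (Suc j)) powr p)"
    and W1inf_a: "\<forall>j. a j \<in> W1inf D"
    and summable_W1inf_a: "summable (\<lambda>j. W1inf_norm D (a (Suc j)))"
  shows "\<exists>\<delta>>0. \<forall>y\<in>params.
           eigval D (affine_coeff a y) (affine_coeff b y) c 2 -
           eigval D (affine_coeff a y) (affine_coeff b y) c 1 \<ge> \<delta>"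
proof (rule ccontr)
  assume no_gap: "\<not> ?thesis"
  interpret bounded_open D by standard (rule domain)+
  interpret A: affine_family D a
    by standard (use domain bounded_coeffs summable_of_summable_powr[OF Linf_AE_bound(3) p summable_a] in auto)
  interpret B: affine_family D b
    by standard (use domain bounded_coeffs summable_of_summable_powr[OF Linf_AE_bound(3) p summable_b] in auto)
  \<comment> \<open>One bound for the three coefficients at all parameters, so that every y yields
    an instance of \<open>eigen_problem\<close> with the same constants \<open>a_min\<close> and
    \<open>B0\<close>.\<close>
  define B0 where "B0 = max (max (A.N 0 + (\<Sum>j. A.N (Suc j))) (B.N 0 + (\<Sum>j. B.N (Suc j)))) (Linf_norm D c)"
  note c_Linf = Linf_AE_bound[OF domain(1,2) bounded_coeffs(3)]
  have B0: "0 \<le> B0" using c_Linf(3) by (simp add: B0_def)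
  have bd_a: "ess_bounded B0 (affine_coeff a y)" if y: "y \<in> params" for y
    unfolding ess_bounded_def using B0 A.affine_measurable A.affine_bound[of y, OF params_bound[OF y]]
    by (auto simp: B0_def elim!: eventually_mono)
  have bd_b: "ess_bounded B0 (affine_coeff b y)" if y: "y \<in> params" for y
    unfolding ess_bounded_def using B0 B.affine_measurable B.affine_bound[of y, OF params_bound[OF y]]
    by (auto simp: B0_def elim!: eventually_mono)
  have bd_c: "ess_bounded B0 c"
    unfolding ess_bounded_def using B0 c_Linf(1,2) by (auto simp: B0_def elim!: eventually_mono)
  have problem: "eigen_problem D (affine_coeff a y) (affine_coeff b y) c a_min B0" if y: "y \<in> params" for y
  proof unfold_locales
    show "AE x in lD. a_min \<le> affine_coeff a y x" "AE x in lD. 0 \<le> affine_coeff b y x"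
      using a_lower b_lower y by auto
  qed (use domain a_min bd_a[OF y] bd_b[OF y] bd_c c_lower in auto)
  let ?A = "\<lambda>y. wform (affine_coeff a y) (affine_coeff b y)"
  let ?M = "wform (\<lambda>x. 0) c"
  let ?gap = "\<lambda>y. eigval D (affine_coeff a y) (affine_coeff b y) c 2 - eigval D (affine_coeff a y) (affine_coeff b y) c 1"
  \<comment> \<open>The facts about the two lowest eigenjets, packed without reference to the locale
    of the fixed parameter, so that they can be chosen simultaneously for a whole sequence.\<close>
  have two: "\<exists>\<mu>1 \<mu>2 F1 F2. F1 \<in> jets0 D \<and> F2 \<in> jets0 D \<and> ?A y F1 F1 = \<mu>1 \<and> ?A y F2 F2 = \<mu>2 \<and>
     ?M F1 F1 = 1 \<and> ?M F2 F2 = 1 \<and> ?M F1 F2 = 0 \<and> \<mu>1 \<le> \<mu>2 \<and> (\<forall>F\<in>jets0 D. \<mu>1 * ?M F F \<le> ?A y F F) \<and> ?gap y = \<mu>2 - \<mu>1"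
    if y: "y \<in> params" for y
  proof -
    interpret eigen_problem D "affine_coeff a y" "affine_coeff b y" c a_min B0 by (rule problem[OF y])
    obtain \<mu>1 \<mu>2 F1 F2 where F: "F1 \<in> eigenjets \<mu>1" "F2 \<in> eigenjets \<mu>2" "?M F1 F1 = 1" "?M F2 F2 = 1" "?M F1 F2 = 0"
      "\<mu>1 \<le> \<mu>2" "\<And>F. F \<in> jets0 D \<Longrightarrow> \<mu>1 * ?M F F \<le> ?A y F F"
      "eigval D (affine_coeff a y) (affine_coeff b y) c 1 = \<mu>1" "eigval D (affine_coeff a y) (affine_coeff b y) c 2 = \<mu>2"
      by (rule two_lowest_eigenvalues) (rule that; assumption)
    have "?A y F1 F1 = \<mu>1" "?A y F2 F2 = \<mu>2"
      using eigenjetsD(3)[OF F(1) eigenjetsD(1)[OF F(1)]] eigenjetsD(3)[OF F(2) eigenjetsD(1)[OF F(2)]] F(3,4) by simp_all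
    then show ?thesis
      using F eigenjetsD(1)[OF F(1)] eigenjetsD(1)[OF F(2)]
      by (intro exI[of _ \<mu>1] exI[of _ \<mu>2] exI[of _ F1] exI[of _ F2] conjI ballI) simp_all
  qed
  have "\<exists>y. y \<in> params \<and> ?gap y < 1 / real (Suc n)" for n
  proof -
    have "1 / real (Suc n) > 0" by simp
    then have "\<not> (\<forall>y\<in>params. ?gap y \<ge> 1 / real (Suc n))" using no_gap by blast
    then show ?thesis by (auto simp: not_le)
  qed
  then obtain y0 where y0: "\<And>n. y0 n \<in> params" "\<And>n. ?gap (y0 n) < 1 / real (Suc n)" by metis
  obtain r0 :: "nat \<Rightarrow> nat" and z where r0: "strict_mono r0" and z: "z \<in> params"
    and lim0: "\<And>j. (\<lambda>n. y0 (r0 n) (Suc j)) \<longlonglongrightarrow> z (Suc j)"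
    by (rule params_convergent_subsequence[OF y0(1)]) (rule that; assumption)
  define y where "y n = y0 (r0 n)" for n
  have y: "y n \<in> params" for n by (simp add: y_def y0(1))
  have limy: "(\<lambda>n. y n (Suc j)) \<longlonglongrightarrow> z (Suc j)" for j using lim0 by (simp add: y_def)
  have gap: "?gap (y n) < 1 / real (Suc n)" for n
  proof -
    have "?gap (y n) < 1 / real (Suc (r0 n))" unfolding y_def by (rule y0(2))
    also have "\<dots> \<le> 1 / real (Suc n)" using seq_suble[OF r0, of n] by (intro divide_left_mono) auto
    finally show ?thesis .
  qed
  \<comment> \<open>A bound for the distance of both coefficients at \<open>y n\<close> to those at
    the limit \<open>z\<close>; adding the two series gives one number for the whole energy
    form.\<close>
  define \<eta> where "\<eta> n = (\<Sum>j. \<bar>y n (Suc j) - z (Suc j)\<bar> * A.N (Suc j)) + (\<Sum>j. \<bar>y n (Suc j) - z (Suc j)\<bar> * B.N (Suc j))" for n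
  have \<eta>0: "\<eta> \<longlonglongrightarrow> 0"
    using tendsto_add[OF A.weighted_distance_tendsto_zero[of y z, OF params_bound[OF y] params_bound[OF z] limy]
        B.weighted_distance_tendsto_zero[of y z, OF params_bound[OF y] params_bound[OF z] limy]]
    by (simp add: \<eta>_def[abs_def])
  have form_diff: "\<bar>?A (y n) F F - ?A z F F\<bar> \<le> \<eta> n * (l2norm lD F)\<^sup>2" if F: "square_integrable lD F" for n F
  proof (rule wform_difference_bound[OF bd_a[OF y] bd_a[OF z] bd_b[OF y] bd_b[OF z] _ _ F])
    note da = A.affine_difference_bound[of "y n" z, OF params_bound[OF y] params_bound[OF z]]
    note db = B.affine_difference_bound[of "y n" z, OF params_bound[OF y] params_bound[OF z]]
    let ?a = "\<Sum>j. \<bar>y n (Suc j) - z (Suc j)\<bar> * A.N (Suc j)" and ?b = "\<Sum>j. \<bar>y n (Suc j) - z (Suc j)\<bar> * B.N (Suc j)"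
    have nonneg: "0 \<le> t" if "AE x in lD. \<bar>f x\<bar> \<le> t" for f :: "_ \<Rightarrow> real" and t
    proof (rule ccontr)
      assume "\<not> 0 \<le> t"
      have "AE x in lD. (1::real) = 0" using that
        by eventually_elim (use \<open>\<not> 0 \<le> t\<close> in linarith)
      then show False using positive_on_open_not_AE_zero[OF domain(1) domain(1) subset_refl domain(2), of "\<lambda>x. 1"] by simp
    qed
    have n: "0 \<le> ?a" "0 \<le> ?b" by (rule nonneg[OF da], rule nonneg[OF db])
    show "ess_bounded (\<eta> n) (\<lambda>x. affine_coeff a (y n) x - affine_coeff a z x)"
      unfolding ess_bounded_def \<eta>_def using n da A.affine_measurable by (auto elim!: eventually_mono)
    show "ess_bounded (\<eta> n) (\<lambda>x. affine_coeff b (y n) x - affine_coeff b z x)"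
      unfolding ess_bounded_def \<eta>_def using n db B.affine_measurable by (auto elim!: eventually_mono)
  qed
  obtain \<mu>1 \<mu>2 F1 F2 where J: "\<And>n. F1 n \<in> jets0 D" "\<And>n. F2 n \<in> jets0 D"
    and E12: "\<And>n. ?A (y n) (F1 n) (F1 n) = \<mu>1 n" "\<And>n. ?A (y n) (F2 n) (F2 n) = \<mu>2 n"
    and M: "\<And>n. ?M (F1 n) (F1 n) = 1" "\<And>n. ?M (F2 n) (F2 n) = 1" "\<And>n. ?M (F1 n) (F2 n) = 0"
    and le: "\<And>n. \<mu>1 n \<le> \<mu>2 n" and lb: "\<And>n F. F \<in> jets0 D \<Longrightarrow> \<mu>1 n * ?M F F \<le> ?A (y n) F F"
    and gap': "\<And>n. ?gap (y n) = \<mu>2 n - \<mu>1 n"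
    using two[OF y] by metis
  interpret Z: eigen_problem D "affine_coeff a z" "affine_coeff b z" c a_min B0 by (rule problem[OF z])
  note sq1 = jets0_square_integrable[OF J(1)] and sq2 = jets0_square_integrable[OF J(2)]
  have \<mu>1_nonneg: "0 \<le> \<mu>1 n" for n
    using eigen_problem.A_nonneg[OF problem[OF y] sq1] E12(1) by metis
  \<comment> \<open>The eigenjet \<open>F1 0\<close> serves as trial element for every n. It keeps
    mass 1 because the mass form does not depend on the parameter, and its energies are bounded by
    \<open>B0\<close>.\<close>
  obtain C where C: "\<And>n. \<mu>1 n \<le> C"
  proof -
    note s0 = sq1[of 0]
    have "\<mu>1 n \<le> B0 * l2norm lD (F1 0) * l2norm lD (F1 0)" for n
    proof -
      have "\<mu>1 n \<le> ?A (y n) (F1 0) (F1 0)" using lb[OF J(1)[of 0], of n] M(1)[of 0] by simp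
      also have "\<dots> \<le> \<bar>?A (y n) (F1 0) (F1 0)\<bar>" by simp
      also have "\<dots> \<le> B0 * l2norm lD (F1 0) * l2norm lD (F1 0)"
        by (rule wform_bounded(2)[OF bd_a[OF y] bd_b[OF y] s0 s0])
      finally show ?thesis .
    qed
    then show ?thesis by (rule that)
  qed
  have gap_le: "\<mu>2 n - \<mu>1 n \<le> 1 / real (Suc n)" for n using gap[of n] unfolding gap' by simp
  have \<mu>2C: "\<mu>2 n \<le> C + 1" for n
  proof -
    have "1 / real (Suc n) \<le> 1" by simp
    then show ?thesis using gap_le[of n] C[of n] by linarith
  qed
  have norm_bound: "(l2norm lD F)\<^sup>2 \<le> (C + 2) / a_min"
    if F: "square_integrable lD F" "?A (y n) F F \<le> C + 1" "?M F F = 1" for n F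
  proof -
    have "a_min * (l2norm lD F)\<^sup>2 \<le> ?A (y n) F F + ?M F F"
      by (rule eigen_problem.coercive[OF problem[OF y] F(1)])
    then have "a_min * (l2norm lD F)\<^sup>2 \<le> C + 2" using F(2,3) by simp
    then show ?thesis using a_min by (simp add: field_simps)
  qed
  have "bounded (range \<mu>1)"
    unfolding bounded_iff using \<mu>1_nonneg C by (intro exI[of _ C]) auto
  then obtain \<mu> and s :: "nat \<Rightarrow> nat" where s: "strict_mono s" and \<mu>1_lim: "(\<mu>1 \<circ> s) \<longlonglongrightarrow> \<mu>"
    using bounded_imp_convergent_subsequence by blast
  have sub: "(\<lambda>n. f (s n)) \<longlonglongrightarrow> l" if "f \<longlonglongrightarrow> l" for f :: "nat \<Rightarrow> real" and l
    using LIMSEQ_subseq_LIMSEQ[OF that s] by (simp add: o_def)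
  have lim1: "(\<lambda>n. \<mu>1 (s n)) \<longlonglongrightarrow> \<mu>" using \<mu>1_lim by (simp add: o_def)
  have lim2: "(\<lambda>n. \<mu>2 (s n)) \<longlonglongrightarrow> \<mu>"
  proof (rule tendsto_sandwich[OF _ _ lim1])
    show "\<forall>\<^sub>F n in sequentially. \<mu>1 (s n) \<le> \<mu>2 (s n)" using le by simp
    show "\<forall>\<^sub>F n in sequentially. \<mu>2 (s n) \<le> \<mu>1 (s n) + 1 / real (Suc (s n))"
    proof (intro always_eventually allI)
      show "\<mu>2 (s n) \<le> \<mu>1 (s n) + 1 / real (Suc (s n))" for n using gap_le[of "s n"] by linarith
    qed
    have "(\<lambda>n. \<mu>1 (s n) + 1 / real (Suc (s n))) \<longlonglongrightarrow> \<mu> + 0"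
      by (intro tendsto_add lim1 sub LIMSEQ_Suc[OF lim_1_over_n])
    then show "(\<lambda>n. \<mu>1 (s n) + 1 / real (Suc (s n))) \<longlonglongrightarrow> \<mu>" by simp
  qed
  \<comment> \<open>The lower bounds pass to the limit: \<mu> is a lower bound of the Rayleigh
    quotient at \<open>z\<close>, so sequences of mass 1 with energies tending to \<mu> are
    minimizing sequences there.\<close>
  have lbz: "\<mu> * ?M F F \<le> ?A z F F" if F: "F \<in> jets0 D" for F
  proof (rule LIMSEQ_le)
    show "(\<lambda>n. \<mu>1 (s n) * ?M F F) \<longlonglongrightarrow> \<mu> * ?M F F" by (intro tendsto_intros lim1)
    have "(\<lambda>n. ?A z F F + \<eta> (s n) * (l2norm lD F)\<^sup>2) \<longlonglongrightarrow> ?A z F F + 0 * (l2norm lD F)\<^sup>2"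
      by (intro tendsto_intros sub \<eta>0)
    then show "(\<lambda>n. ?A z F F + \<eta> (s n) * (l2norm lD F)\<^sup>2) \<longlonglongrightarrow> ?A z F F" by simp
    have "\<mu>1 n * ?M F F \<le> ?A z F F + \<eta> n * (l2norm lD F)\<^sup>2" for n
      using lb[OF F, of n] form_diff[OF jets0_square_integrable[OF F], of n] by linarith
    then show "\<exists>N. \<forall>n\<ge>N. \<mu>1 (s n) * ?M F F \<le> ?A z F F + \<eta> (s n) * (l2norm lD F)\<^sup>2" by blast
  qed
  \<comment> \<open>The eigenjets have mass 1 and bounded energy, hence bounded norm by coercivity,
    so replacing the parameter \<open>y n\<close> by \<open>z\<close> changes their energies by a
    vanishing amount.\<close>
  have energy: "(\<lambda>n. ?A z (F (s n)) (F (s n))) \<longlonglongrightarrow> \<mu>"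
    if F: "\<And>n. F n \<in> jets0 D" "\<And>n. ?A (y n) (F n) (F n) = \<nu> n" "\<And>n. \<nu> n \<le> C + 1" "\<And>n. ?M (F n) (F n) = 1"
      and \<nu>: "(\<lambda>n. \<nu> (s n)) \<longlonglongrightarrow> \<mu>" for F \<nu>
  proof -
    have bound: "norm (?A z (F n) (F n) - \<nu> n) \<le> \<eta> n * ((C + 2) / a_min)" for n
    proof -
      note sF = jets0_square_integrable[OF F(1)[of n]]
      have d: "\<bar>\<nu> n - ?A z (F n) (F n)\<bar> \<le> \<eta> n * (l2norm lD (F n))\<^sup>2" using form_diff[OF sF, of n] F(2) by simp
      \<comment> \<open>A negative value would, by the difference estimate, force \<open>F n\<close>
        to have norm 0, against mass 1.\<close>
      have \<eta>n: "0 \<le> \<eta> n"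
      proof (rule ccontr)
        assume neg: "\<not> 0 \<le> \<eta> n"
        have "0 \<le> \<eta> n * (l2norm lD (F n))\<^sup>2" using d by linarith
        then have "(l2norm lD (F n))\<^sup>2 = 0" using neg by (simp add: zero_le_mult_iff)
        then have "l2norm lD (F n) = 0" by simp
        then show False using wform_bounded(2)[OF Z.M_bd sF sF] F(4)[of n] by simp
      qed
      have "\<eta> n * (l2norm lD (F n))\<^sup>2 \<le> \<eta> n * ((C + 2) / a_min)"
        by (rule mult_left_mono[OF norm_bound[OF sF, of n] \<eta>n]) (simp_all add: F)
      then show ?thesis using d by simp
    qed
    have "(\<lambda>n. \<eta> (s n) * ((C + 2) / a_min)) \<longlonglongrightarrow> 0 * ((C + 2) / a_min)" by (intro tendsto_intros sub \<eta>0)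
    then have "(\<lambda>n. \<eta> (s n) * ((C + 2) / a_min)) \<longlonglongrightarrow> 0" by simp
    then have "(\<lambda>n. ?A z (F (s n)) (F (s n)) - \<nu> (s n)) \<longlonglongrightarrow> 0"
      by (rule Lim_null_comparison[OF always_eventually[OF allI[OF bound]]])
    from tendsto_add[OF this \<nu>] show ?thesis by simp
  qed
  have \<mu>1C: "\<mu>1 n \<le> C + 1" for n using C[of n] by simp
  note en1 = energy[OF J(1) E12(1) \<mu>1C M(1) lim1] and en2 = energy[OF J(2) E12(2) \<mu>2C M(2) lim2]
  obtain r1 :: "nat \<Rightarrow> nat" and G1 where r1: "strict_mono r1" and G1: "G1 \<in> jets0 D"
    "(\<lambda>n. l2norm lD (\<lambda>x. F1 (s (r1 n)) x - G1 x)) \<longlonglongrightarrow> 0" "?M G1 G1 = 1" "?A z G1 G1 = \<mu>"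
  proof (rule Z.minimizing_sequence_converges[OF closed_subspace_jets0, of \<mu> "\<lambda>n. F1 (s n)"])
    show "\<mu> * ?M F F \<le> ?A z F F" if "F \<in> jets0 D" for F using that by (rule lbz)
  qed (rule J M en1 | (rule that; assumption))+
  \<comment> \<open>The second extraction starts from the first subsequence, so that in the end both
    sequences converge along the same indices.\<close>
  have en2': "(\<lambda>n. ?A z (F2 (s (r1 n))) (F2 (s (r1 n)))) \<longlonglongrightarrow> \<mu>"
    using LIMSEQ_subseq_LIMSEQ[OF en2 r1] by (simp add: o_def)
  obtain r2 :: "nat \<Rightarrow> nat" and G2 where r2: "strict_mono r2" and G2: "G2 \<in> jets0 D"
    "(\<lambda>n. l2norm lD (\<lambda>x. F2 (s (r1 (r2 n))) x - G2 x)) \<longlonglongrightarrow> 0" "?M G2 G2 = 1" "?A z G2 G2 = \<mu>"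
  proof (rule Z.minimizing_sequence_converges[OF closed_subspace_jets0, of \<mu> "\<lambda>n. F2 (s (r1 n))"])
    show "\<mu> * ?M F F \<le> ?A z F F" if "F \<in> jets0 D" for F using that by (rule lbz)
  qed (rule J M en2' | (rule that; assumption))+
  have G1': "(\<lambda>n. l2norm lD (\<lambda>x. F1 (s (r1 (r2 n))) x - G1 x)) \<longlonglongrightarrow> 0"
    using LIMSEQ_subseq_LIMSEQ[OF G1(2) r2] by (simp add: o_def)
  \<comment> \<open>Orthogonality survives the limit because the mass form is the same for all
    parameters and is continuous in the norm of pairs.\<close>
  have "(\<lambda>n. ?M (F1 (s (r1 (r2 n)))) (F2 (s (r1 (r2 n))))) \<longlonglongrightarrow> ?M G1 G2"
    by (rule wform_tendsto[OF Z.M_bd sq1 jets0_square_integrable[OF G1(1)] G1' sq2 jets0_square_integrable[OF G2(1)] G2(2)])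
  then have orth: "?M G1 G2 = 0" by (simp add: M(3) LIMSEQ_const_iff)
  \<comment> \<open>Both limits attain the lower bound \<mu> at \<open>z\<close>, so the
    Euler-Lagrange equation makes them eigenjets for \<mu>.\<close>
  have eig: "G \<in> Z.eigenjets \<mu>" if G: "G \<in> jets0 D" "?M G G = 1" "?A z G G = \<mu>" for G
  proof -
    have "?A z G H = \<mu> * ?M G H" if H: "H \<in> jets0 D" for H
      by (rule Z.minimizer_euler_lagrange[OF closed_subspace_jets0 _ G(1) _ H]) (use lbz G in auto)
    then show ?thesis using G(1) by (simp add: Z.eigenjets_def)
  qed
  show False
    by (rule Z.first_eigenvalue_simple[OF domain(5) lbz eig[OF G1(1,3,4)] G1(3) eig[OF G2(1,3,4)] G2(3) orth])
qed

end
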